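(* Let $D\subset\mathbb{R}^2$ be a centrosymmetric convex domain, and let a packing of translates of $D$ be given whose corresponding subdivision of the plane is a subdivision into convex polygons with at most six sides each. Let $\lambda$ be the average number of neighbours (in a large circle) and $d'$ the density of the packing in the large circle. Then asymptotically the following lower bounds hold: $$d'\ \ge\ \frac34\cdot\frac{2}{-\frac13\lambda+4}\quad\text{if } 4\tfrac45\le\lambda\le 6,$$ $$d'\ \ge\ \frac{2}{8-\lambda}\quad\text{if } 4\le\lambda\le4\tfrac45,$$ $$d'\ \ge\ \frac12\quad\text{if } 3\le\lambda\le4.$$ Equality is attained for any $4\frac45\le\lambda\le6$ for $D$ a regular hexagon, and for any $3\le\lambda\le4\frac45$ for $D$ a square.
   Context: A convex domain is a compact convex set in $\mathbb{R}^2$ with nonempty interior. A packing of translates of $D$ is a family $\{D+x:x\in X\}$ with pairwise disjoint interiors; two different members are neighbours if they touch (have a common point). The corresponding subdivision of the plane has vertex set $X$, and its edges are the segments $[x,y]$ for which $D+x$ and $D+y$ are neighbours (segments connecting homologous points of touching translates); the hypothesis includes that these segments do form the edges of a subdivision of $\mathbb{R}^2$ into convex polygons. The number of sides of a polygon of the subdivision is the number of edges of the subdivision on its boundary (angles equal to $\pi$ at vertices are allowed). Meaning of "in a large circle" and "asymptotically": let $B_R$ be the Euclidean disc of radius $R$ about the origin, $N(R)=|X\cap B_R|$, $\lambda(R)$ the average number of neighbours of the translates $D+x$, $x\in X\cap B_R$, and $d'(R)=N(R)\,\mathrm{area}(D)/(\pi R^2)$. A lower bound $d'\ge f(\lambda)$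 holding asymptotically means: whenever $R_j\to\infty$ and $\lambda(R_j)\to\lambda$ (with $\lambda$ in the indicated range), then $\liminf_j d'(R_j)\ge f(\lambda)$. Equality being attained for a given $\lambda$ and $D$ means that there is a packing of translates of $D$ satisfying the hypotheses with $\lambda(R)\to\lambda$ and $d'(R)\to f(\lambda)$ as $R\to\infty$. $4\frac45$ denotes the number $24/5$. *)

theory Defs
  imports "HOL-Analysis.Analysis"
begin

definition convex_domain :: "(real^2) set \<Rightarrow> bool" where
  "convex_domain D \<longleftrightarrow> compact D \<and> convex D \<and> interior D \<noteq> {}"

definition centrosymmetric :: "(real^2) set \<Rightarrow> bool" where
  "centrosymmetric D \<longleftrightarrow> (\<exists>c. \<forall>x\<in>D. 2 *\<^sub>R c - x \<in> D)"

definition translate_packing :: "(real^2) set \<Rightarrow> (real^2) set \<Rightarrow> bool" where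
  "translate_packing D X \<longleftrightarrow>
     pairwise (\<lambda>x y. interior ((+) x ` D) \<inter> interior ((+) y ` D) = {}) X"

definition neighbours :: "(real^2) set \<Rightarrow> (real^2) set \<Rightarrow> real^2 \<Rightarrow> (real^2) set" where
  "neighbours D X x = {y \<in> X. y \<noteq> x \<and> ((+) x ` D) \<inter> ((+) y ` D) \<noteq> {}}"

definition touching_segments :: "(real^2) set \<Rightarrow> (real^2) set \<Rightarrow> (real^2) set set" where
  "touching_segments D X = {closed_segment x y | x y. x \<in> X \<and> y \<in> neighbours D X x}"

definition convex_polygon :: "(real^2) set \<Rightarrow> bool" where
  "convex_polygon P \<longleftrightarrow> polytope P \<and> interior P \<noteq> {}"

text \<open>
  A subdivision of the plane into the convex polygons \<open>F\<close>, with vertex set \<open>V\<close> and set of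
  edges \<open>E\<close>. Edges may meet only in vertices, and no vertex lies inside an edge. A vertex on the
  boundary of a polygon need not be an extreme point of it: angles equal to \<open>\<pi>\<close> are allowed.
\<close>

definition polygonal_subdivision ::
    "(real^2) set \<Rightarrow> (real^2) set set \<Rightarrow> (real^2) set set \<Rightarrow> bool" where
  "polygonal_subdivision V E F \<longleftrightarrow>
     (\<forall>f\<in>F. convex_polygon f) \<and>
     \<Union>F = UNIV \<and>
     pairwise (\<lambda>f g. interior f \<inter> interior g = {}) F \<and>
     locally_finite_in euclidean F \<and>
     (\<forall>e\<in>E. \<exists>x y. x \<noteq> y \<and> e = closed_segment x y \<and> e \<inter> V = {x, y}) \<and>
     pairwise (\<lambda>e e'. e \<inter> e' \<subseteq> V) E \<and>
     V \<subseteq> \<Union>E \<and>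
     \<Union>E = (\<Union>f\<in>F. frontier f)"

definition sides :: "(real^2) set set \<Rightarrow> (real^2) set \<Rightarrow> (real^2) set set" where
  "sides E f = {e \<in> E. e \<subseteq> frontier f}"

definition admissible_packing :: "(real^2) set \<Rightarrow> (real^2) set \<Rightarrow> bool" where
  "admissible_packing D X \<longleftrightarrow>
     translate_packing D X \<and>
     (\<exists>F. polygonal_subdivision X (touching_segments D X) F \<and>
          (\<forall>f\<in>F. finite (sides (touching_segments D X) f) \<and>
                 card (sides (touching_segments D X) f) \<le> 6))"

definition average_neighbours :: "(real^2) set \<Rightarrow> (real^2) set \<Rightarrow> real \<Rightarrow> real" where
  "average_neighbours D X R =
     (\<Sum>x \<in> X \<inter> cball 0 R. real (card (neighbours D X x))) / real (card (X \<inter> cball 0 R))"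

definition packing_density :: "(real^2) set \<Rightarrow> (real^2) set \<Rightarrow> real \<Rightarrow> real" where
  "packing_density D X R = real (card (X \<inter> cball 0 R)) * measure lebesgue D / (pi * R\<^sup>2)"

definition asymptotic_lower_bound ::
    "(real^2) set \<Rightarrow> (real^2) set \<Rightarrow> real \<Rightarrow> real \<Rightarrow> bool" where
  "asymptotic_lower_bound D X l b \<longleftrightarrow>
     (\<forall>R :: nat \<Rightarrow> real.
        filterlim R at_top sequentially \<longrightarrow>
        (\<lambda>j. average_neighbours D X (R j)) \<longlonglongrightarrow> l \<longrightarrow>
        ereal b \<le> liminf (\<lambda>j. ereal (packing_density D X (R j))))"

definition equality_attained :: "(real^2) set \<Rightarrow> real \<Rightarrow> real \<Rightarrow> bool" where
  "equality_attained D l b \<longleftrightarrow>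
     (\<exists>X. admissible_packing D X \<and>
          (average_neighbours D X \<longlongrightarrow> l) at_top \<and>
          (packing_density D X \<longlongrightarrow> b) at_top)"

definition regular_polygon :: "nat \<Rightarrow> (real^2) set \<Rightarrow> bool" where
  "regular_polygon n D \<longleftrightarrow>
     (\<exists>c r t. r > 0 \<and>
        D = convex hull ((\<lambda>k. c + r *\<^sub>R vector [cos (t + 2 * pi * real k / real n),
                                              sin (t + 2 * pi * real k / real n)]) ` {..<n}))"

end

theory Submission
  imports Defs
begin

text \<open>
  Lower bounds. Centre \<open>D\<close> at the origin and call it \<open>K\<close>. An edge \<open>[x, y]\<close> of the subdivision has
  half-length \<open>1\<close> in the norm with unit ball \<open>K\<close>, so a face with \<open>k \<le> 6\<close> sides is cut by diagonals into
  pieces whose areas are sums of cross products of boundary vectors of \<open>K\<close>. Comparing with symmetric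
  polygons inscribed in \<open>K\<close> gives \<open>area f \<le> (k - 2) * area K\<close>. The sharper bounds on triangles and
  on pairs \<open>a, b \<in> K\<close> trade off against each other, as a large triangle forces small parallelograms. They
  can be combined into \<open>area f \<le> area K * (8/7 + s * (k - 24/7))\<close> with some \<open>s \<in> [10/9, 3/2]\<close> that depends
  only on \<open>K\<close>. Summing such affine bounds over the faces in a large disc, where \<open>\<Sum> k\<close> is \<open>\<lambda> N\<close> and
  \<open>\<Sum> (k - 2)\<close> is \<open>2 N\<close> (by the angle sum) up to boundary terms, bounds the area \<open>\<pi> R\<^sup>2\<close> by
  \<open>N * area K\<close> times a function of \<open>\<lambda>\<close>. All \<open>s\<close> agree at \<open>\<lambda> = 24/5\<close>; the extreme slopes give the two bounds
  on either side.

  Equality. Up to an affine map the packings live on \<open>\<int>\<^sup>2\<close>: a hexagon lattice in which every second point of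
  some rows is removed, and a checkerboard of squares in which some rows are completely filled, or in which
  some pairs of consecutive rows are aligned. The affected rows have any prescribed frequency.
\<close>

section \<open>Areas of polygons in a symmetric convex domain\<close>

text \<open>The sharp bounds on the faces conflict: relative to the area of \<open>K\<close> a
  triangle can reach 2/3 (regular hexagon) and a quadrilateral 2 (square), but not for the same
  \<open>K\<close>. If \<tau> and q bound triangles and quadrilaterals, the trade-off reads 4 \<tau>
  + 3 q \<le> 8. One seventh of the left side is the value at k = 24/7 of the line through (3,
  \<tau>) and (4, q), so the lines can all be taken through (24/7, 8/7); and 24/7 is the mean number
  of sides 2 \<lambda> / (\<lambda> - 2) for \<lambda> = 24/5. Pentagons and hexagons, bounded by 2
  + q/2 and 4, lie below the line exactly if s \<ge> 10/9, that is \<tau> \<le> 2/3. A face is given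
  only as a point set, possibly with straight angles, so the cyclic order of its sides has to be
  recovered from the topology of its frontier. Cones from an interior point do this and treat
  straight angles like all others. Angles themselves are never defined: the area cut out of a small
  disc takes their place.\<close>

definition cross2 :: "real^2 \<Rightarrow> real^2 \<Rightarrow> real" where
  "cross2 a b = a $ 1 * b $ 2 - a $ 2 * b $ 1"

lemma vec2_eq_iff: "(p :: real^2) = q \<longleftrightarrow> p $ 1 = q $ 1 \<and> p $ 2 = q $ 2"
  by (simp add: vec_eq_iff forall_2)

lemma cross2_simps [simp]:
  "cross2 0 a = 0" "cross2 a 0 = 0" "cross2 a a = 0"
  "cross2 (- a) b = - cross2 a b" "cross2 a (- b) = - cross2 a b"
  "cross2 (r *\<^sub>R a) b = r * cross2 a b" "cross2 a (r *\<^sub>R b) = r * cross2 a b"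
  by (simp_all add: cross2_def algebra_simps)

lemma cross2_add:
  "cross2 (a + b) c = cross2 a c + cross2 b c" "cross2 c (a + b) = cross2 c a + cross2 c b"
  "cross2 (a - b) c = cross2 a c - cross2 b c" "cross2 c (a - b) = cross2 c a - cross2 c b"
  by (simp_all add: cross2_def algebra_simps)

lemma cross2_commute: "cross2 a b = - cross2 b a"
  by (simp add: cross2_def)

text \<open>Cramer's rule without division: if \<open>cross2 a b\<close> is not 0, the coordinates
  of \<open>q\<close> in the basis \<open>a\<close>, \<open>b\<close> can be read off.\<close>

lemma cross2_expansion: "cross2 a b *\<^sub>R q = cross2 q b *\<^sub>R a + cross2 a q *\<^sub>R b"
  unfolding vec2_eq_iff cross2_def by (auto; algebra)

lemma cross2_eq_0_imp_parallel:
  assumes "cross2 a q = 0" "a \<noteq> 0"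
  obtains t where "q = t *\<^sub>R a"
proof -
  have n: "a $ 1 \<noteq> 0 \<or> a $ 2 \<noteq> 0"
    using assms(2) by (simp add: vec2_eq_iff)
  have e: "a $ 1 * q $ 2 = a $ 2 * q $ 1"
    using assms(1) by (simp add: cross2_def)
  show ?thesis
  proof (cases "a $ 1 = 0")
    case True
    then have "q $ 1 = 0" "a $ 2 \<noteq> 0" using n e by auto
    then show ?thesis using True that[of "q $ 2 / a $ 2"] by (simp add: vec2_eq_iff)
  next
    case False
    then have "q $ 2 = a $ 2 * q $ 1 / a $ 1" using e by (simp add: field_simps)
    then show ?thesis using False that[of "q $ 1 / a $ 1"] by (simp add: vec2_eq_iff)
  qed
qed

text \<open>The normal of the line is \<open>p\<close> after a quarter turn. Overlaps of adjacent
  pieces are shown to be null sets by confining them to such lines.\<close>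

lemma negligible_cross2:
  assumes "p \<noteq> 0"
  shows "negligible {q. cross2 p (q - c) = 0}"
proof -
  define a :: "real^2" where "a = vector [- p $ 2, p $ 1]"
  have "a \<noteq> 0" using assms by (auto simp: a_def vec2_eq_iff)
  moreover have "{q. cross2 p (q - c) = 0} = {q. a \<bullet> q = a \<bullet> c}"
    by (auto simp: a_def cross2_def inner_vec_def sum_2 algebra_simps)
  ultimately show ?thesis
    using negligible_hyperplane[of a] by simp
qed

lemma in_triangle:
  fixes c :: "'a :: euclidean_space"
  shows "q \<in> convex hull {c, x, y} \<longleftrightarrow>
    (\<exists>\<alpha> \<beta>. 0 \<le> \<alpha> \<and> 0 \<le> \<beta> \<and> \<alpha> + \<beta> \<le> 1 \<and> q = c + \<alpha> *\<^sub>R (x - c) + \<beta> *\<^sub>R (y - c))"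
  unfolding convex_hull_3_alt by auto

lemma measure_triangle:
  "measure lebesgue (convex hull {a, b, c}) = \<bar>cross2 (b - a) (c - a)\<bar> / 2"
proof -
  have "closed (convex hull {a, b, c})"
    by (intro compact_imp_closed finite_imp_compact_convex_hull) simp
  then have "measure lebesgue (convex hull {a, b, c}) = measure lborel (convex hull {a, b, c})"
    by (simp add: measure_completion)
  then show ?thesis
    by (simp add: content_triangle cross2_def abs_minus_commute mult.commute)
qed

lemma lmeasurable_convex_hull: "finite S \<Longrightarrow> convex hull S \<in> lmeasurable"
  by (simp add: finite_imp_compact_convex_hull lmeasurable_compact)

definition sector :: "real^2 \<Rightarrow> real^2 \<Rightarrow> (real^2) set" where
  "sector v w = {\<alpha> *\<^sub>R v + \<beta> *\<^sub>R w | \<alpha> \<beta>. 0 \<le> \<alpha> \<and> 0 \<le> \<beta>}"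

lemma sector_minus: "a \<in> sector v w \<Longrightarrow> - a \<in> sector (- v) (- w)"
  unfolding sector_def by clarify (metis minus_add_distrib scaleR_minus_right)

text \<open>The sign \<open>s\<close> pairs every triangle with its reflection in the origin, so
  that half of the vertices of a centrally symmetric polygon suffice.\<close>

definition star_triangle :: "(nat \<Rightarrow> real^2) \<Rightarrow> nat \<times> real \<Rightarrow> (real^2) set" where
  "star_triangle p = (\<lambda>(i, s). convex hull {0, s *\<^sub>R p i, s *\<^sub>R p (Suc i)})"

text \<open>The weak counterclockwise order keeps any two triangles on opposite sides of a line
  through 0 and some \<open>p k\<close>, so they overlap in null sets. Being an identity, the
  formula serves both for estimates with inscribed polygons and for the areas of the model hexagon
  and square.\<close>

lemma measure_star:
  fixes p :: "nat \<Rightarrow> real^2"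
  assumes nz: "\<And>i. i < m \<Longrightarrow> p i \<noteq> 0"
    and pos: "\<And>i j. i < j \<Longrightarrow> j < m \<Longrightarrow> 0 \<le> cross2 (p i) (p j)"
    and pm: "p m = - p 0"
  shows "measure lebesgue (\<Union>(star_triangle p ` ({..<m} \<times> {1, -1}))) = (\<Sum>i<m. cross2 (p i) (p (Suc i)))"
proof -
  \<comment> \<open>The order extends to the index \<open>m\<close>, because
    \<open>cross2 (p i) (- p 0) = cross2 (p 0) (p i)\<close>.\<close>
  have pos': "0 \<le> cross2 (p i) (p j)" if "i \<le> j" "j \<le> m" "i < m" for i j
  proof (cases "j = m")
    case True
    show ?thesis
    proof (cases "i = 0")
      case False
      then show ?thesis using pos[of 0 i] that True pm cross2_commute[of "p i" "p 0"] by simp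
    qed (use pm True in simp)
  next
    case False
    then show ?thesis using pos[of i j] that by (cases "i = j") auto
  qed
  have cone: "\<exists>\<alpha> \<beta>. 0 \<le> \<alpha> \<and> 0 \<le> \<beta> \<and> s *\<^sub>R q = \<alpha> *\<^sub>R p i + \<beta> *\<^sub>R p (Suc i)"
    if t: "q \<in> star_triangle p (i, s)" "s = 1 \<or> s = -1" for q i s
  proof -
    have "q \<in> convex hull {0, s *\<^sub>R p i, s *\<^sub>R p (Suc i)}"
      using that(1) by (simp add: star_triangle_def)
    then obtain \<alpha> \<beta> where *: "0 \<le> \<alpha>" "0 \<le> \<beta>" "q = 0 + \<alpha> *\<^sub>R (s *\<^sub>R p i - 0) + \<beta> *\<^sub>R (s *\<^sub>R p (Suc i) - 0)"
      by (subst (asm) in_triangle) (elim exE conjE)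
    then have "q = s *\<^sub>R (\<alpha> *\<^sub>R p i + \<beta> *\<^sub>R p (Suc i))"
      by (simp add: scaleR_right_distrib mult.commute)
    moreover have "s * s = 1" using that(2) by auto
    ultimately have "s *\<^sub>R q = \<alpha> *\<^sub>R p i + \<beta> *\<^sub>R p (Suc i)" by simp
    then show ?thesis using * by blast
  qed
  \<comment> \<open>The line through \<open>p 0\<close> separates the triangles from the reflected
    ones (\<open>c0\<close>); the line through \<open>p j\<close> separates triangle
    \<open>j\<close> from the earlier ones (\<open>c1\<close>, \<open>c2\<close>).\<close>
  have c0: "0 \<le> s * cross2 (p 0) q" if t: "q \<in> star_triangle p (i, s)" "s = 1 \<or> s = -1" "i < m" for q i s
  proof -
    obtain \<alpha> \<beta> where *: "0 \<le> \<alpha>" "0 \<le> \<beta>" "s *\<^sub>R q = \<alpha> *\<^sub>R p i + \<beta> *\<^sub>R p (Suc i)"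
      using cone[OF t(1,2)] by blast
    have "s * cross2 (p 0) q = \<alpha> * cross2 (p 0) (p i) + \<beta> * cross2 (p 0) (p (Suc i))"
      using arg_cong[OF *(3), of "cross2 (p 0)"] by (simp add: cross2_add)
    then show ?thesis using * pos'[of 0 i] pos'[of 0 "Suc i"] that by simp
  qed
  have c1: "0 \<le> s * cross2 q (p j)"
    if t: "q \<in> star_triangle p (i, s)" "s = 1 \<or> s = -1" "i < j" "j < m" for q i s j
  proof -
    obtain \<alpha> \<beta> where *: "0 \<le> \<alpha>" "0 \<le> \<beta>" "s *\<^sub>R q = \<alpha> *\<^sub>R p i + \<beta> *\<^sub>R p (Suc i)"
      using cone[OF t(1,2)] by blast
    have "s * cross2 q (p j) = \<alpha> * cross2 (p i) (p j) + \<beta> * cross2 (p (Suc i)) (p j)"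
      using arg_cong[OF *(3), of "\<lambda>x. cross2 x (p j)"] by (simp add: cross2_add)
    then show ?thesis using * pos'[of i j] pos'[of "Suc i" j] that by simp
  qed
  have c2: "0 \<le> s * cross2 (p j) q"
    if t: "q \<in> star_triangle p (j, s)" "s = 1 \<or> s = -1" "j < m" for q s j
  proof -
    obtain \<alpha> \<beta> where *: "0 \<le> \<alpha>" "0 \<le> \<beta>" "s *\<^sub>R q = \<alpha> *\<^sub>R p j + \<beta> *\<^sub>R p (Suc j)"
      using cone[OF t(1,2)] by blast
    have "s * cross2 (p j) q = \<beta> * cross2 (p j) (p (Suc j))"
      using arg_cong[OF *(3), of "cross2 (p j)"] by (simp add: cross2_add)
    then show ?thesis using * pos'[of j "Suc j"] that by simp
  qed
  have line: "negligible (star_triangle p a \<inter> star_triangle p b)"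
    if *: "\<And>q. q \<in> star_triangle p a \<Longrightarrow> q \<in> star_triangle p b \<Longrightarrow> cross2 (p k) q = 0" and "k < m" for a b k
  proof (rule negligible_subset)
    show "negligible {q. cross2 (p k) (q - 0) = 0}" by (rule negligible_cross2) (use nz that in auto)
  qed (use * in auto)
  have same: "negligible (star_triangle p (i, s) \<inter> star_triangle p (j, s))"
    if "i < j" "j < m" "s = 1 \<or> s = -1" for i j s
  proof (rule line[of _ _ j])
    fix q assume q: "q \<in> star_triangle p (i, s)" "q \<in> star_triangle p (j, s)"
    have "0 \<le> s * cross2 q (p j)" "0 \<le> s * cross2 (p j) q"
      using c1[OF q(1) that(3,1,2)] c2[OF q(2) that(3,2)] by auto
    then show "cross2 (p j) q = 0"
      using that(3) cross2_commute[of q "p j"] by auto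
  qed (use that in auto)
  have opp: "negligible (star_triangle p (i, s) \<inter> star_triangle p (j, t))"
    if "i < m" "j < m" "s = 1 \<or> s = -1" "t = - s" for i j s t
  proof (rule line[of _ _ 0])
    fix q assume q: "q \<in> star_triangle p (i, s)" "q \<in> star_triangle p (j, t)"
    have "t = 1 \<or> t = -1" using that by auto
    then show "cross2 (p 0) q = 0"
      using c0[OF q(1) that(3,1)] c0[OF q(2) _ that(2)] that(3,4) by auto
  qed (use that in auto)
  have meas: "measure lebesgue (star_triangle p x) = cross2 (p (fst x)) (p (Suc (fst x))) / 2"
    if "x \<in> {..<m} \<times> {1, -1}" for x
  proof -
    obtain i s where x: "x = (i, s)" "i < m" "s = 1 \<or> s = -1" using \<open>x \<in> _\<close> by auto
    then show ?thesis using pos'[of i "Suc i"] by (auto simp: star_triangle_def measure_triangle)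
  qed
  have "measure lebesgue (\<Union>(star_triangle p ` ({..<m} \<times> {1, -1})))
      = (\<Sum>x\<in>{..<m} \<times> {1, -1}. measure lebesgue (star_triangle p x))"
  proof (rule measure_negligible_finite_Union_image)
    show "pairwise (\<lambda>x y. negligible (star_triangle p x \<inter> star_triangle p y)) ({..<m} \<times> {1, -1})"
    proof (rule pairwiseI)
      fix x y assume xy: "x \<in> {..<m} \<times> {1, - 1 :: real}" "y \<in> {..<m} \<times> {1, - 1 :: real}" "x \<noteq> y"
      obtain i s j t where e: "x = (i, s)" "y = (j, t)" by (metis surj_pair)
      have ij: "i < m" "j < m" and st: "s \<in> {1, - 1 :: real}" "t \<in> {1, -1 :: real}"
        and ne: "(i, s) \<noteq> (j, t)" using xy e by auto
      consider "t = - s" | "t = s" "i < j" | "t = s" "j < i"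
        using st ne by (cases "i < j"; cases "j < i") auto
      then have "negligible (star_triangle p (i, s) \<inter> star_triangle p (j, t))"
      proof cases
        case 1
        then show ?thesis using opp ij st by auto
      next
        case 2
        then show ?thesis using same ij st by auto
      next
        case 3
        then show ?thesis using same[of j i s] ij st by (auto simp: Int_commute)
      qed
      then show "negligible (star_triangle p x \<inter> star_triangle p y)" unfolding e .
    qed
  qed (auto simp: star_triangle_def lmeasurable_convex_hull)
  also have "\<dots> = (\<Sum>x\<in>{..<m} \<times> {1, -1 :: real}. cross2 (p (fst x)) (p (Suc (fst x))) / 2)"
    by (rule sum.cong) (simp_all add: meas)
  also have "\<dots> = (\<Sum>(i, s)\<in>{..<m} \<times> {1, -1 :: real}. cross2 (p i) (p (Suc i)) / 2)"
    by (rule sum.cong) auto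
  also have "\<dots> = (\<Sum>i<m. \<Sum>s\<in>{1, -1 :: real}. cross2 (p i) (p (Suc i)) / 2)"
    by (rule sum.cartesian_product[symmetric])
  also have "\<dots> = (\<Sum>i<m. cross2 (p i) (p (Suc i)))"
    by (simp add: field_simps)
  finally show ?thesis .
qed

section \<open>Polygons inscribed in a symmetric convex domain\<close>

locale symmetric_domain =
  fixes K :: "(real^2) set"
  assumes compact: "compact K" and convex: "convex K" and sym: "\<And>x. x \<in> K \<Longrightarrow> - x \<in> K"
    and interior_ne: "interior K \<noteq> {}"
begin

abbreviation area :: real where "area \<equiv> measure lebesgue K"

lemma zero_in_interior: "0 \<in> interior K"
proof -
  obtain x where x: "x \<in> interior K" using interior_ne by blast
  then have "- x \<in> K" using sym interior_subset by blast
  have "0 = - x - (1/2) *\<^sub>R (- x - x)" by (simp add: vec2_eq_iff)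
  then show ?thesis
    using mem_interior_convex_shrink[OF convex x \<open>- x \<in> K\<close>, of "1/2"] by simp
qed

lemma zero_in: "0 \<in> K"
  using zero_in_interior interior_subset by blast

lemma lmeasurable: "K \<in> lmeasurable"
  by (simp add: compact lmeasurable_compact)

lemma area_pos: "0 < area"
proof -
  have "\<not> negligible K"
    using open_not_negligible[of "interior K"] interior_ne negligible_subset[OF _ interior_subset] by auto
  then have "area \<noteq> 0"
    using lmeasurable by (simp add: negligible_iff_measure)
  then show ?thesis using measure_nonneg[of lebesgue K] by linarith
qed

lemma star_area_le:
  fixes p :: "nat \<Rightarrow> real^2"
  assumes nz: "\<And>i. i < m \<Longrightarrow> p i \<noteq> 0"
    and pos: "\<And>i j. i < j \<Longrightarrow> j < m \<Longrightarrow> 0 \<le> cross2 (p i) (p j)"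
    and pm: "p m = - p 0" and K: "\<And>i. i < m \<Longrightarrow> p i \<in> K" and "0 < m"
  shows "(\<Sum>i<m. cross2 (p i) (p (Suc i))) \<le> area"
proof -
  have K': "p i \<in> K" if "i \<le> m" for i
    using K[of i] K[of 0] sym pm that \<open>0 < m\<close> by (cases "i = m") auto
  have sub: "star_triangle p x \<subseteq> K" if x: "x \<in> {..<m} \<times> {1, -1}" for x
  proof -
    obtain i s where x: "x = (i, s)" "i < m" "s = 1 \<or> s = -1" using x by (cases x) auto
    have "s *\<^sub>R p i \<in> K" "s *\<^sub>R p (Suc i) \<in> K"
      using x(3) K'[of i] K'[of "Suc i"] sym[of "p i"] sym[of "p (Suc i)"] x(2) by (elim disjE; simp)+
    then show ?thesis unfolding x star_triangle_def prod.case
      using zero_in by (intro hull_minimal convex) auto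
  qed
  have "measure lebesgue (\<Union>(star_triangle p ` ({..<m} \<times> {1, -1}))) \<le> area"
  proof (rule measure_mono_fmeasurable)
    show "\<Union> (star_triangle p ` ({..<m} \<times> {1, -1})) \<in> sets lebesgue"
      by (intro sets.finite_UN) (auto simp: star_triangle_def fmeasurableD lmeasurable_convex_hull)
  qed (use sub lmeasurable in blast)+
  then show ?thesis using measure_star[of m p] nz pos pm by simp
qed

text \<open>Inscribed parallelograms, hexagons and decagons are obtained by evaluating this on a
  concrete list of half of their vertices; \<open>- hd ps\<close> closes the half turn.\<close>

lemma star_list_area_le:
  assumes "\<forall>p\<in>set ps. p \<noteq> 0 \<and> p \<in> K" "sorted_wrt (\<lambda>a b. 0 \<le> cross2 a b) ps" "ps \<noteq> []"
  shows "(\<Sum>i<length ps. cross2 ((ps @ [- hd ps]) ! i) ((ps @ [- hd ps]) ! Suc i)) \<le> area"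
proof (rule star_area_le)
  show "0 \<le> cross2 ((ps @ [- hd ps]) ! i) ((ps @ [- hd ps]) ! j)" if "i < j" "j < length ps" for i j
    using assms(2) that by (simp add: nth_append sorted_wrt_iff_nth_less)
  show "(ps @ [- hd ps]) ! length ps = - (ps @ [- hd ps]) ! 0"
    using assms(3) by (simp add: nth_append hd_conv_nth)
qed (use assms in \<open>simp_all add: nth_append\<close>)

text \<open>The parallelogram with vertices \<plusminus> a, \<plusminus> b lies in \<open>K\<close>,
  and its area is \<open>2 * cross2 a b\<close> when this is positive.\<close>

lemma cross2_le_half_area:
  assumes "a \<in> K" "b \<in> K"
  shows "2 * cross2 a b \<le> area"
proof (cases "cross2 a b \<le> 0")
  case True
  then show ?thesis using area_pos by simp
next
  case False
  then have "a \<noteq> 0" "b \<noteq> 0" by auto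
  then show ?thesis
    using star_list_area_le[of "[a, b]"] False assms
    by (simp add: cross2_commute[of b a] lessThan_Suc)
qed

text \<open>For a positively oriented triple the sum is the area of the hexagon with vertices
  \<plusminus> a, \<plusminus> b, \<plusminus> c. Otherwise one term is at most 0 and each of the
  other two is at most half the area.\<close>

lemma chain_cross2_le_area:
  assumes "a \<in> K" "b \<in> K" "c \<in> K"
  shows "cross2 a b + cross2 b c + cross2 a c \<le> area"
proof -
  consider "cross2 a b \<le> 0" | "cross2 b c \<le> 0" | "cross2 a c \<le> 0"
    | "0 < cross2 a b" "0 < cross2 b c" "0 < cross2 a c" by linarith
  then show ?thesis
  proof cases
    case 4
    then have "a \<noteq> 0" "b \<noteq> 0" "c \<noteq> 0" by auto
    then show ?thesis
      using star_list_area_le[of "[a, b, c]"] 4 assms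
      by (simp add: cross2_commute[of c a] lessThan_Suc)
  qed (use cross2_le_half_area[OF assms(1,2)] cross2_le_half_area[OF assms(2,3)]
        cross2_le_half_area[OF assms(1,3)] in linarith)+
qed

text \<open>The sum is the area of the inscribed decagon with vertices \<open>w1\<close>,
  \<open>a\<close>, \<open>w2\<close>, \<open>b\<close>, \<open>w3\<close> and their
  negatives.\<close>

lemma five_cross2_le_area:
  assumes "w1 \<in> K" "a \<in> K" "w2 \<in> K" "b \<in> K" "w3 \<in> K"
    and "w1 \<noteq> 0" "a \<noteq> 0" "w2 \<noteq> 0" "b \<noteq> 0" "w3 \<noteq> 0"
    and "0 \<le> cross2 w1 a" "0 \<le> cross2 w1 w2" "0 \<le> cross2 w1 b" "0 \<le> cross2 w1 w3"
      "0 \<le> cross2 a w2" "0 \<le> cross2 a b" "0 \<le> cross2 a w3"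
      "0 \<le> cross2 w2 b" "0 \<le> cross2 w2 w3" "0 \<le> cross2 b w3"
  shows "cross2 w1 a + cross2 a w2 + cross2 w2 b + cross2 b w3 + cross2 w1 w3 \<le> area"
  using star_list_area_le[of "[w1, a, w2, b, w3]"] assms
  by (simp add: cross2_commute[of w3 w1] lessThan_Suc)

text \<open>The triangle inequality of the norm with unit ball \<open>K\<close>, without introducing
  that norm: \<open>w\<close> has norm at least 1, \<open>p\<close> and \<open>q\<close> have norm
  at most 1.\<close>

lemma unit_le:
  assumes "w \<notin> interior K" "p \<in> K" "q \<in> K" "0 \<le> s" "0 \<le> t" "r *\<^sub>R w = s *\<^sub>R p + t *\<^sub>R q"
  shows "r \<le> s + t"
proof (cases "s + t = 0")
  case True
  then have "s = 0" "t = 0" using assms by auto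
  moreover have "w \<noteq> 0" using assms(1) zero_in_interior by auto
  ultimately show ?thesis using assms(6) by simp
next
  case False
  then have pos: "0 < s + t" using assms by linarith
  show ?thesis
  proof (rule ccontr)
    assume "\<not> r \<le> s + t"
    then have r: "s + t < r" by simp
    \<comment> \<open>If \<open>r\<close> were larger than \<open>s + t\<close>, then
      \<open>w\<close> would be the point \<open>v\<close> of \<open>K\<close> shrunk towards 0,
      hence interior.\<close>
    define v where "v = (s / (s + t)) *\<^sub>R p + (t / (s + t)) *\<^sub>R q"
    have "v \<in> K"
      unfolding v_def by (rule convexD[OF convex assms(2,3)])
        (use pos assms in \<open>auto simp flip: add_divide_distrib\<close>)
    have "(s + t) *\<^sub>R v = r *\<^sub>R w"
      using pos by (simp add: v_def assms(6) scaleR_right_distrib)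
    then have "w = (1 / r) *\<^sub>R (s + t) *\<^sub>R v" using r pos by simp
    also have "\<dots> = v - (1 - (s + t) / r) *\<^sub>R (v - 0)" by (simp add: scaleR_left_diff_distrib)
    also have "\<dots> \<in> interior K"
      using r pos by (intro mem_interior_convex_shrink[OF convex zero_in_interior \<open>v \<in> K\<close>]) (auto simp: field_simps)
    finally show False using assms(1) by simp
  qed
qed

text \<open>The unit sphere of the norm of \<open>K\<close>. Half the difference vector of two
  touching translates lies on it.\<close>

definition unit :: "(real^2) set" where "unit = K - interior K"

lemma unit_minus: "w \<in> unit \<Longrightarrow> - w \<in> unit"
proof -
  assume w: "w \<in> unit"
  have "- w \<notin> interior K"
  proof
    assume *: "- w \<in> interior K"
    have "K = uminus ` K" using sym by (force simp: image_iff)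
    then have "interior K = uminus ` interior K" by (metis interior_negations)
    then have "w \<in> interior K" using * by (metis add.inverse_inverse image_eqI)
    then show False using w by (simp add: unit_def)
  qed
  then show ?thesis using w sym by (auto simp: unit_def)
qed

lemma unit_nonzero: "w \<in> unit \<Longrightarrow> w \<noteq> 0"
  using zero_in_interior by (auto simp: unit_def)

text \<open>In the chain \<open>w1\<close>, \<open>w1 + w3\<close>, \<open>w3\<close> all three
  cross products coincide: the inscribed hexagon is affinely regular.\<close>

lemma hexagon_area_le:
  assumes "w1 \<in> K" "w3 \<in> K" "w1 + w3 \<in> K"
  shows "3 * cross2 w1 w3 \<le> area"
  using chain_cross2_le_area[OF assms(1,3,2)] by (simp add: cross2_add)

text \<open>Since \<open>w2 = w1 + w3\<close>, both (\<alpha> + \<beta>) w1 = a - \<beta> w3 and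
  (\<alpha> + \<beta>) w2 = a + \<alpha> w3 hold, and \<open>unit_le\<close> applies to
  each.\<close>

lemma sector_coeff_le:
  assumes u: "w1 \<in> unit" "w2 \<in> unit" "w3 \<in> K" "w2 = w1 + w3"
    and a: "a = \<alpha> *\<^sub>R w1 + \<beta> *\<^sub>R w2" "a \<in> K" "0 \<le> \<alpha>" "0 \<le> \<beta>"
  shows "\<alpha> \<le> 1" "\<beta> \<le> 1"
proof -
  have "\<alpha> + \<beta> \<le> 1 + \<beta>"
    by (rule unit_le[of w1 a "- w3"]) (use u a sym in \<open>auto simp: unit_def algebra_simps\<close>)
  then show "\<alpha> \<le> 1" by simp
  have "\<alpha> + \<beta> \<le> 1 + \<alpha>"
    by (rule unit_le[of w2 a w3]) (use u a in \<open>auto simp: unit_def algebra_simps\<close>)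
  then show "\<beta> \<le> 1" by simp
qed

text \<open>Both points have coordinates in [0, 1] with respect to \<open>w1\<close>,
  \<open>w2\<close>, so the determinant of the coordinates is at most 1 in absolute value.\<close>

lemma same_sector:
  assumes u: "w1 \<in> unit" "w2 \<in> unit" "w3 \<in> K" "w2 = w1 + w3" "0 \<le> cross2 w1 w3"
    and "a \<in> K" "b \<in> K" "a \<in> sector w1 w2" "b \<in> sector w1 w2"
  shows "\<bar>cross2 a b\<bar> \<le> cross2 w1 w3"
proof -
  obtain \<alpha> \<beta> where a: "a = \<alpha> *\<^sub>R w1 + \<beta> *\<^sub>R w2" "0 \<le> \<alpha>" "0 \<le> \<beta>"
    using assms(8) by (auto simp: sector_def)
  obtain \<gamma> \<zeta> where b: "b = \<gamma> *\<^sub>R w1 + \<zeta> *\<^sub>R w2" "0 \<le> \<gamma>" "0 \<le> \<zeta>"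
    using assms(9) by (auto simp: sector_def)
  have le: "\<alpha> \<le> 1" "\<beta> \<le> 1" "\<gamma> \<le> 1" "\<zeta> \<le> 1"
    using sector_coeff_le[OF u(1-4) a(1) assms(6) a(2,3)] sector_coeff_le[OF u(1-4) b(1) assms(7) b(2,3)] by auto
  have c: "cross2 a b = (\<alpha> * \<zeta> - \<beta> * \<gamma>) * cross2 w1 w3"
    by (simp add: a b u cross2_add cross2_commute[of w3 w1] algebra_simps)
  have "0 \<le> \<alpha> * \<zeta>" "\<alpha> * \<zeta> \<le> 1" "0 \<le> \<beta> * \<gamma>" "\<beta> * \<gamma> \<le> 1"
    using a b le by (auto intro: mult_le_one)
  then have "\<bar>\<alpha> * \<zeta> - \<beta> * \<gamma>\<bar> \<le> 1" by linarith
  then show ?thesis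
    unfolding c abs_mult using u(5) by (simp add: mult_left_le_one_le)
qed

text \<open>The decagon through \<open>w1\<close>, \<open>a\<close>, \<open>w2\<close>,
  \<open>b\<close>, \<open>w3\<close> has area (1 + \<alpha> + \<beta> + \<gamma> + \<zeta>) times
  \<open>cross2 w1 w3\<close>. It then remains to bound the factor \<mu> of
  \<open>cross2 a b\<close> by two thirds of the sum of the coordinates.\<close>

lemma adjacent_sectors:
  assumes u: "w1 \<in> unit" "w2 \<in> unit" "w3 \<in> unit" "w2 = w1 + w3" "0 < cross2 w1 w3"
    and ab: "a \<in> K" "b \<in> K" "a \<in> sector w1 w2" "b \<in> sector w2 w3"
  shows "cross2 w1 w3 + 3 / 2 * \<bar>cross2 a b\<bar> \<le> area"
proof -
  have uK: "w1 \<in> K" "w2 \<in> K" "w3 \<in> K" using u by (auto simp: unit_def)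
  obtain \<alpha> \<beta> where a: "a = \<alpha> *\<^sub>R w1 + \<beta> *\<^sub>R w2" "0 \<le> \<alpha>" "0 \<le> \<beta>"
    using ab by (auto simp: sector_def)
  obtain \<gamma> \<zeta> where b: "b = \<gamma> *\<^sub>R w2 + \<zeta> *\<^sub>R w3" "0 \<le> \<gamma>" "0 \<le> \<zeta>"
    using ab by (auto simp: sector_def)
  have le: "\<alpha> \<le> 1" "\<beta> \<le> 1"
    using sector_coeff_le[OF u(1,2) uK(3) u(4) a(1) ab(1) a(2,3)] by auto
  have le': "\<zeta> \<le> 1" "\<gamma> \<le> 1"
    using sector_coeff_le[OF u(3,2) uK(1), of b \<zeta> \<gamma>] u(4) b ab by (auto simp: add.commute)
  define \<mu> where "\<mu> = \<alpha> * \<gamma> + \<alpha> * \<zeta> + \<beta> * \<zeta>"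
  have c: "cross2 a b = \<mu> * cross2 w1 w3"
    by (simp add: a b u \<mu>_def cross2_add cross2_commute[of w3 w1] algebra_simps)
  \<comment> \<open>Because of \<open>w1 + w3 = w2\<close> the combination \<zeta> a + \<alpha> b is
    \<mu> w2.\<close>
  have mu: "\<mu> \<le> \<zeta> + \<alpha>"
    by (rule unit_le[of w2 a b]) (use u ab a b in \<open>auto simp: unit_def \<mu>_def algebra_simps\<close>)
  have mu0: "0 \<le> \<mu>" using a b by (simp add: \<mu>_def)
  show ?thesis
  proof (cases "a = 0 \<or> b = 0")
    case True
    then show ?thesis using hexagon_area_le[OF uK(1,3)] uK u by auto
  next
    case False
    have d0: "0 \<le> cross2 w1 w3" using u by simp
    have "cross2 w1 a + cross2 a w2 + cross2 w2 b + cross2 b w3 + cross2 w1 w3 \<le> area"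
    proof (rule five_cross2_le_area)
      show "0 \<le> cross2 a b" using c mu0 d0 by simp
    qed (use False ab uK u(1-3)[THEN unit_nonzero] d0 a(2,3) b(2,3) in
         \<open>auto simp: a(1) b(1) u(4) cross2_add cross2_commute[of w3 w1] algebra_simps\<close>)
    then have A: "(1 + \<alpha> + \<beta> + \<gamma> + \<zeta>) * cross2 w1 w3 \<le> area"
      by (simp add: a b u cross2_add cross2_commute[of w3 w1] algebra_simps)
    have prods: "\<alpha> * \<gamma> \<le> \<gamma>" "\<beta> * \<zeta> \<le> \<beta>" "\<alpha> * \<zeta> \<le> \<alpha>" "\<alpha> * \<zeta> \<le> \<zeta>"
      using a b le le' by (auto intro: mult_left_le_one_le mult_right_le_one_le)
    \<comment> \<open>Add \<mu> \<le> \<alpha> + \<zeta> to twice \<mu> \<le> \<gamma> + \<alpha>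
      \<zeta> + \<beta>, where 2 \<alpha> \<zeta> \<le> \<alpha> + \<zeta>. The products are
      abstracted to \<open>x\<close>, \<open>y\<close>, \<open>z\<close>, which makes the problem
      linear.\<close>
    have key: "3 * \<mu> \<le> 2 * (\<alpha> + \<beta> + \<gamma> + \<zeta>)"
      if "x \<le> \<gamma>" "y \<le> \<beta>" "z \<le> \<alpha>" "z \<le> \<zeta>" "\<mu> = x + z + y" for x y z
      using that mu by argo
    have "3 * \<mu> \<le> 2 * (\<alpha> + \<beta> + \<gamma> + \<zeta>)"
      by (rule key[OF prods \<mu>_def])
    then have "(1 + 3 / 2 * \<mu>) * cross2 w1 w3 \<le> (1 + \<alpha> + \<beta> + \<gamma> + \<zeta>) * cross2 w1 w3"
      by (intro mult_right_mono d0) argo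
    then show ?thesis using A c mu0 d0 by (simp add: algebra_simps)
  qed
qed

text \<open>Consecutive vertices of the hexagon \<plusminus> w1, \<plusminus> w2, \<plusminus> w3
  span six sectors that cover the plane; up to sign three remain.\<close>

lemma sector_cases:
  assumes "w2 = w1 + w3" "0 < cross2 w1 w3"
  obtains s where "s = 1 \<or> s = (-1 :: real)"
    "s *\<^sub>R a \<in> sector w1 w2 \<or> s *\<^sub>R a \<in> sector w2 w3 \<or> s *\<^sub>R a \<in> sector w3 (- w1)"
proof -
  define x where "x = cross2 a w3 / cross2 w1 w3"
  define y where "y = cross2 w1 a / cross2 w1 w3"
  have "cross2 w1 w3 *\<^sub>R a = cross2 w1 w3 *\<^sub>R (x *\<^sub>R w1 + y *\<^sub>R w3)"
    using assms(2) cross2_expansion[of w1 w3 a] by (simp add: x_def y_def scaleR_right_distrib)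
  then have a: "a = x *\<^sub>R w1 + y *\<^sub>R w3" using assms(2) by simp
  have 1: "s *\<^sub>R a \<in> sector w1 w2" if "0 \<le> s * (x - y)" "0 \<le> s * y" for s
    unfolding sector_def using that
    by (intro CollectI exI[of _ "s * (x - y)"] exI[of _ "s * y"]) (simp add: a assms algebra_simps)
  have 2: "s *\<^sub>R a \<in> sector w2 w3" if "0 \<le> s * (y - x)" "0 \<le> s * x" for s
    unfolding sector_def using that
    by (intro CollectI exI[of _ "s * x"] exI[of _ "s * (y - x)"]) (simp add: a assms algebra_simps)
  have 3: "s *\<^sub>R a \<in> sector w3 (- w1)" if "0 \<le> s * y" "s * x \<le> 0" for s
    unfolding sector_def using that
    by (intro CollectI exI[of _ "s * y"] exI[of _ "- (s * x)"]) (simp add: a algebra_simps)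
  consider "0 \<le> y" "y \<le> x" | "0 \<le> x" "x \<le> y" | "x \<le> 0" "0 \<le> y" | "y \<le> 0" "x \<le> y" | "x \<le> 0" "y \<le> x" | "0 \<le> x" "y \<le> 0"
    by linarith
  then show ?thesis
    by cases (use that[of 1] that[of "-1"] 1[of 1] 1[of "-1"] 2[of 1] 2[of "-1"] 3[of 1] 3[of "-1"] in auto)
qed

text \<open>Signs of \<open>a\<close> and \<open>b\<close> do not matter for the absolute value of
  \<open>cross2 a b\<close>, so both may be taken from three sectors. In a common sector the cross
  product is at most \<open>cross2 w1 w3\<close>, and \<open>3 * cross2 w1 w3 \<le> area\<close> is
  enough. Two different sectors are adjacent, the third one being next to the reflected
  first.\<close>

lemma triangle_parallelogram_tradeoff:
  assumes u: "w1 \<in> unit" "w3 \<in> unit" "w1 + w3 \<in> unit" and pos: "0 < cross2 w1 w3"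
    and ab: "a \<in> K" "b \<in> K"
  shows "cross2 w1 w3 + 3 / 2 * cross2 a b \<le> area"
proof -
  define w2 where "w2 = w1 + w3"
  note un = unit_minus[OF u(1)] unit_minus[OF u(2)] unit_minus[OF u(3), folded w2_def] u(3)[folded w2_def]
  have K: "w1 \<in> K" "w3 \<in> K" "w2 \<in> K" "- w1 \<in> K" using u un by (auto simp: unit_def w2_def)
  have c: "cross2 w2 (- w1) = cross2 w1 w3" "cross2 w3 (- w2) = cross2 w1 w3"
    by (simp_all add: w2_def cross2_add cross2_commute[of w3 w1])
  have three: "3 * cross2 w1 w3 \<le> area" using hexagon_area_le K by (simp add: w2_def)
  obtain s where s: "s = 1 \<or> s = (-1 :: real)"
    "s *\<^sub>R a \<in> sector w1 w2 \<or> s *\<^sub>R a \<in> sector w2 w3 \<or> s *\<^sub>R a \<in> sector w3 (- w1)"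
    using sector_cases[OF w2_def pos] .
  obtain t where t: "t = 1 \<or> t = (-1 :: real)"
    "t *\<^sub>R b \<in> sector w1 w2 \<or> t *\<^sub>R b \<in> sector w2 w3 \<or> t *\<^sub>R b \<in> sector w3 (- w1)"
    using sector_cases[OF w2_def pos] .
  define a' where "a' = s *\<^sub>R a"
  define b' where "b' = t *\<^sub>R b"
  have "a' \<in> K" using s(1) ab(1) sym[OF ab(1)] by (auto simp: a'_def)
  moreover have "b' \<in> K" using t(1) ab(2) sym[OF ab(2)] by (auto simp: b'_def)
  ultimately have K': "a' \<in> K" "b' \<in> K" by auto
  have m: "\<bar>cross2 a b\<bar> = \<bar>cross2 a' b'\<bar>" using s(1) t(1) by (auto simp: a'_def b'_def)
  note S = s(2)[folded a'_def] and T = t(2)[folded b'_def]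
  have 1: "\<bar>cross2 p q\<bar> \<le> cross2 w1 w3" if "p \<in> sector w1 w2" "q \<in> sector w1 w2" "p \<in> K" "q \<in> K" for p q
    using same_sector[OF u(1) un(4) K(2) w2_def] pos that by simp
  have 2: "\<bar>cross2 p q\<bar> \<le> cross2 w1 w3" if "p \<in> sector w2 w3" "q \<in> sector w2 w3" "p \<in> K" "q \<in> K" for p q
    using same_sector[OF un(4) u(2) K(4), of p q] pos that
    by (simp add: w2_def cross2_add cross2_commute[of w3 w1])
  have 3: "\<bar>cross2 p q\<bar> \<le> cross2 w1 w3"
    if "p \<in> sector w3 (- w1)" "q \<in> sector w3 (- w1)" "p \<in> K" "q \<in> K" for p q
    using same_sector[OF u(2) un(1) sym[OF K(3)] _ _ that(3,4,1,2)] pos c(2) by (simp add: w2_def)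
  have 4: "cross2 w1 w3 + 3 / 2 * \<bar>cross2 p q\<bar> \<le> area"
    if "p \<in> sector w1 w2" "q \<in> sector w2 w3" "p \<in> K" "q \<in> K" for p q
    using adjacent_sectors[OF u(1) un(4) u(2) w2_def pos] that by simp
  have 5: "cross2 w1 w3 + 3 / 2 * \<bar>cross2 p q\<bar> \<le> area"
    if "p \<in> sector w2 w3" "q \<in> sector w3 (- w1)" "p \<in> K" "q \<in> K" for p q
    using adjacent_sectors[OF un(4) u(2) un(1), of p q] pos that
    by (simp add: w2_def cross2_add cross2_commute[of w3 w1])
  have 6: "cross2 w1 w3 + 3 / 2 * \<bar>cross2 p q\<bar> \<le> area"
    if "p \<in> sector w3 (- w1)" "q \<in> sector (- w1) (- w2)" "p \<in> K" "q \<in> K" for p q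
    using adjacent_sectors[OF u(2) un(1) un(3), of p q] pos that
    by (simp add: w2_def cross2_add cross2_commute[of w3 w1])
  have seven: "cross2 w1 w3 + 3 / 2 * \<bar>cross2 p q\<bar> \<le> area"
    if "p \<in> sector w3 (- w1)" "q \<in> sector w1 w2" "p \<in> K" "q \<in> K" for p q
    using 6[OF that(1) sector_minus[OF that(2)] that(3) sym[OF that(4)]] by simp
  have sw: "\<bar>cross2 a' b'\<bar> = \<bar>cross2 b' a'\<bar>" using cross2_commute[of a' b'] by simp
  have "\<bar>cross2 a' b'\<bar> \<le> cross2 w1 w3 \<or> cross2 w1 w3 + 3 / 2 * \<bar>cross2 a' b'\<bar> \<le> area"
    using S T
    by (elim disjE)
       (simp_all only: 1 2 3 4 5 seven K' simp_thms, simp_all only: sw 4 5 seven K' simp_thms)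
  then show ?thesis using three m pos abs_ge_self[of "cross2 a b"] by linarith
qed

text \<open>The slope \<open>s\<close> encodes \<open>\<tau>\<close>, the supremum of the areas of triangles with half-sides in \<open>unit\<close> (or \<open>area / 2\<close> if that
  is larger); the coefficients are chosen so that all the bounds below are affine in \<open>s\<close>.\<close>

lemma slope_exists:
  obtains s where "10 / 9 \<le> s" "s \<le> 3 / 2"
    and "\<And>w1 w3. w1 \<in> unit \<Longrightarrow> w3 \<in> unit \<Longrightarrow> w1 + w3 \<in> unit \<Longrightarrow> 2 * cross2 w1 w3 \<le> area * (8 - 3 * s) / 7"
    and "\<And>a b. a \<in> K \<Longrightarrow> b \<in> K \<Longrightarrow> 4 * cross2 a b \<le> area * (8 + 4 * s) / 7"
proof -
  define T where "T = {2 * cross2 w1 w3 | w1 w3. w1 \<in> unit \<and> w3 \<in> unit \<and> w1 + w3 \<in> unit}"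
  have T1: "t \<le> 2 / 3 * area" if "t \<in> T" for t
    using that hexagon_area_le by (fastforce simp: T_def unit_def)
  have T2: "4 / 3 * t + 4 * cross2 a b \<le> 8 / 3 * area" if t: "t \<in> T" and "a \<in> K" "b \<in> K" for t a b
  proof -
    obtain w1 w3 where w: "t = 2 * cross2 w1 w3" "w1 \<in> unit" "w3 \<in> unit" "w1 + w3 \<in> unit"
      using t by (auto simp: T_def)
    show ?thesis
    proof (cases "0 < cross2 w1 w3")
      case True
      then show ?thesis
        using triangle_parallelogram_tradeoff[OF w(2-4) True that(2,3)] w(1) by (simp add: field_simps)
    next
      case False
      then show ?thesis using w(1) cross2_le_half_area[OF that(2,3)] area_pos by simp
    qed
  qed
  \<comment> \<open>Inserting \<open>area / 2\<close> makes the set nonempty and yields the upper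
    limit 3/2 of the slope.\<close>
  define \<tau> where "\<tau> = Sup (insert (area / 2) T)"
  have bdd: "bdd_above (insert (area / 2) T)"
    by (rule bdd_aboveI[of _ "2 / 3 * area"]) (use T1 area_pos in auto)
  have up: "t \<le> \<tau>" if "t \<in> insert (area / 2) T" for t
    unfolding \<tau>_def using that bdd by (rule cSup_upper)
  have "\<tau> \<le> 2 / 3 * area"
    unfolding \<tau>_def by (rule cSup_least) (use T1 area_pos in auto)
  then have \<tau>: "area / 2 \<le> \<tau>" "\<tau> \<le> 2 / 3 * area" using up[of "area / 2"] by simp_all
  have tr: "4 * cross2 a b \<le> 8 / 3 * area - 4 / 3 * \<tau>" if ab: "a \<in> K" "b \<in> K" for a b
  proof -
    have "\<tau> \<le> 2 * area - 3 * cross2 a b"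
      unfolding \<tau>_def
    proof (rule cSup_least)
      fix t assume "t \<in> insert (area / 2) T"
      then show "t \<le> 2 * area - 3 * cross2 a b"
        using T2[OF _ ab, of t] cross2_le_half_area[OF ab] by auto
    qed simp
    then show ?thesis by simp
  qed
  \<comment> \<open>Solved from \<tau> = area (8 - 3 s) / 7. The limits 2/3 and 1/2 of \<tau> / area
    become 10/9 and 3/2.\<close>
  define s where "s = (8 - 7 * (\<tau> / area)) / 3"
  have e: "area * (8 - 3 * s) / 7 = \<tau>" "area * (8 + 4 * s) / 7 = 8 / 3 * area - 4 / 3 * \<tau>"
    using area_pos by (simp_all add: s_def field_simps)
  show ?thesis
  proof (rule that[of s])
    show "10 / 9 \<le> s" "s \<le> 3 / 2" using \<tau> area_pos by (simp_all add: s_def field_simps)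
    show "2 * cross2 w1 w3 \<le> area * (8 - 3 * s) / 7"
      if "w1 \<in> unit" "w3 \<in> unit" "w1 + w3 \<in> unit" for w1 w3
      unfolding e using that up by (auto simp: T_def)
    show "4 * cross2 a b \<le> area * (8 + 4 * s) / 7" if "a \<in> K" "b \<in> K" for a b
      unfolding e using tr that by simp
  qed
qed

text \<open>The sums are twice the area by the shoelace formula and do not depend on
  \<open>c\<close>. Diagonals cut the polygon into triangles with two of the half-sides
  \<open>u i\<close> and quadrilaterals with three consecutive ones, which fit the bounds from
  inscribed parallelograms and hexagons.\<close>

lemma closed_polygon_area:
  fixes p u :: "nat \<Rightarrow> real^2"
  assumes "p k = p 0" and u_def: "\<And>i. u i = (1/2) *\<^sub>R (p (Suc i) - p i)"
  shows "k = 3 \<Longrightarrow> (\<Sum>i<k. cross2 (p i - c) (p (Suc i) - c)) = 4 * cross2 (u 0) (u 1)"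
    and "k = 4 \<Longrightarrow> (\<Sum>i<k. cross2 (p i - c) (p (Suc i) - c)) = 4 * cross2 (u 0) (u 1) + 4 * cross2 (u 2) (u 3)"
    and "k = 5 \<Longrightarrow> (\<Sum>i<k. cross2 (p i - c) (p (Suc i) - c)) =
      4 * (cross2 (u 0) (u 1) + cross2 (u 1) (u 2) + cross2 (u 0) (u 2)) + 4 * cross2 (u 3) (u 4)"
    and "k = 6 \<Longrightarrow> (\<Sum>i<k. cross2 (p i - c) (p (Suc i) - c)) =
      4 * (cross2 (u 0) (u 1) + cross2 (u 1) (u 2) + cross2 (u 0) (u 2))
      + 4 * (cross2 (u 3) (u 4) + cross2 (u 4) (u 5) + cross2 (u 3) (u 5))"
  using assms(1)
  by (simp_all add: u_def eval_nat_numeral cross2_def algebra_simps)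

end

section \<open>Angles and sectors of discs\<close>

lemma measure_uminus: "S \<in> lmeasurable \<Longrightarrow> measure lebesgue (uminus ` S) = measure lebesgue (S :: (real^2) set)"
  by (rule measure_orthogonal_image) (auto simp: orthogonal_transformation_def linear_uminus)

lemma measure_disc: "0 \<le> r \<Longrightarrow> measure lebesgue (ball c r :: (real^2) set) = pi * r\<^sup>2"
  using circle_area[of r c] by (simp add: measure_completion mult.commute)

text \<open>Lagrange's identity with the square of the inner product dropped.\<close>

lemma abs_cross2_le: "\<bar>cross2 p q\<bar> \<le> norm p * norm q"
proof -
  have "(cross2 p q)\<^sup>2 + (p \<bullet> q)\<^sup>2 = (p \<bullet> p) * (q \<bullet> q)"
    by (simp add: cross2_def inner_vec_def sum_2 power2_eq_square algebra_simps)
  also have "\<dots> = (norm p * norm q)\<^sup>2"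
    by (simp add: power_mult_distrib dot_square_norm)
  finally have "(cross2 p q)\<^sup>2 \<le> (norm p * norm q)\<^sup>2"
    by (metis le_add_same_cancel1 zero_le_power2)
  then show ?thesis
    by (metis abs_le_square_iff abs_mult abs_norm_cancel)
qed

lemma closed_halfplane_cross2: "closed {q. 0 \<le> cross2 p q}"
  unfolding cross2_def by (intro closed_Collect_le continuous_intros)

lemma sector_eq:
  assumes "0 < cross2 a b"
  shows "sector a b = {q. 0 \<le> cross2 a q \<and> 0 \<le> cross2 q b}"
proof (intro set_eqI iffI)
  fix q assume "q \<in> sector a b"
  then show "q \<in> {q. 0 \<le> cross2 a q \<and> 0 \<le> cross2 q b}"
    using assms by (auto simp: sector_def cross2_add)
next
  fix q assume q: "q \<in> {q. 0 \<le> cross2 a q \<and> 0 \<le> cross2 q b}"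
  have "cross2 a b *\<^sub>R q = cross2 a b *\<^sub>R ((cross2 q b / cross2 a b) *\<^sub>R a + (cross2 a q / cross2 a b) *\<^sub>R b)"
    using assms cross2_expansion[of a b q] by (simp add: scaleR_right_distrib)
  then have "q = (cross2 q b / cross2 a b) *\<^sub>R a + (cross2 a q / cross2 a b) *\<^sub>R b"
    using assms by simp
  moreover have "0 \<le> cross2 q b / cross2 a b" "0 \<le> cross2 a q / cross2 a b" using assms q by auto
  ultimately show "q \<in> sector a b" unfolding sector_def by blast
qed

lemma sector_commute: "sector a b = sector b a"
  unfolding sector_def by (auto simp: add.commute) (metis add.commute)+

lemma closed_sector:
  assumes "cross2 a b \<noteq> 0"
  shows "closed (sector a b)"
proof -
  have *: "closed (sector a b)" if "0 < cross2 a b" for a b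
  proof -
    have "sector a b = {q. 0 \<le> cross2 a q} \<inter> {q. 0 \<le> cross2 (- b) q}"
      unfolding sector_eq[OF that] by (auto simp: cross2_commute[of _ b])
    then show ?thesis by (simp only: closed_Int closed_halfplane_cross2)
  qed
  show ?thesis
    using *[of a b] *[of b a] assms cross2_commute[of a b] sector_commute[of a b] by fastforce
qed

lemma lmeasurable_sector_disc: "cross2 a b \<noteq> 0 \<Longrightarrow> sector a b \<inter> ball 0 r \<in> lmeasurable"
  by (intro bounded_set_imp_lmeasurable bounded_Int)
     (auto intro!: sets.Int simp: closed_sector borel_closed)

lemma measure_Un_negligible:
  assumes "A \<in> lmeasurable" "B \<in> lmeasurable" "negligible (A \<inter> B)"
  shows "measure lebesgue (A \<union> B) = measure lebesgue A + measure lebesgue B"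
  using assms by (simp add: measure_Un3 negligible_imp_measure0)

text \<open>The half disc and its reflection in the origin are congruent, overlap in a line and fill
  the disc.\<close>

lemma measure_halfdisc:
  assumes "a \<noteq> 0" "0 \<le> r"
  shows "measure lebesgue ({q. 0 \<le> cross2 a q} \<inter> ball 0 r) = pi * r\<^sup>2 / 2"
proof -
  define H where "H = {q. 0 \<le> cross2 a q} \<inter> ball 0 r"
  have H: "H \<in> lmeasurable"
    unfolding H_def by (intro bounded_set_imp_lmeasurable bounded_Int)
      (auto intro!: sets.Int simp: closed_halfplane_cross2 borel_closed)
  have U: "uminus ` H = {q. cross2 a q \<le> 0} \<inter> ball 0 r"
  proof (intro set_eqI iffI)
    fix q assume "q \<in> {q. cross2 a q \<le> 0} \<inter> ball 0 r"
    then have "- q \<in> H" by (simp add: H_def)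
    then show "q \<in> uminus ` H" by (metis image_eqI minus_minus)
  qed (auto simp: H_def)
  have H': "uminus ` H \<in> lmeasurable"
    using H by (metis measurable_linear_image linear_uminus)
  have "negligible (H \<inter> uminus ` H)"
    by (rule negligible_subset[OF negligible_cross2[OF assms(1), of 0]]) (auto simp: U H_def)
  then have "measure lebesgue (H \<union> uminus ` H) = measure lebesgue H + measure lebesgue H"
    using measure_Un_negligible[OF H H'] measure_uminus[OF H] by simp
  moreover have "H \<union> uminus ` H = ball 0 r" unfolding U by (auto simp: H_def)
  ultimately show ?thesis
    using measure_disc[OF assms(2), of 0] by (simp add: H_def[symmetric])
qed

text \<open>The angle sum of a triangle with sides \<open>a\<close> and \<open>b\<close> at one
  corner, angles being measured by area. After reflecting the third sector, the three sectors lie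
  between the consecutive directions a, b, b - a, - a and fill a half disc.\<close>

lemma sector_angle_sum:
  assumes pos: "0 < cross2 a b" and "0 \<le> r"
  shows "measure lebesgue (sector a b \<inter> ball 0 r) + measure lebesgue (sector (b - a) (- a) \<inter> ball 0 r)
    + measure lebesgue (sector (- b) (a - b) \<inter> ball 0 r) = pi * r\<^sup>2 / 2"
proof -
  define S where "S = sector a b \<inter> ball 0 r"
  define S' where "S' = sector b (b - a) \<inter> ball 0 r"
  define S'' where "S'' = sector (b - a) (- a) \<inter> ball 0 r"
  have c: "0 < cross2 b (b - a)" "0 < cross2 (b - a) (- a)"
    using pos by (simp_all add: cross2_add cross2_commute[of b a])
  have m: "S \<in> lmeasurable" "S' \<in> lmeasurable" "S'' \<in> lmeasurable"
    unfolding S_def S'_def S''_def using pos c by (simp_all add: lmeasurable_sector_disc)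
  have mem: "q \<in> S \<longleftrightarrow> 0 \<le> cross2 a q \<and> 0 \<le> cross2 q b \<and> norm q < r"
    "q \<in> S' \<longleftrightarrow> 0 \<le> cross2 b q \<and> 0 \<le> cross2 q b - cross2 q a \<and> norm q < r"
    "q \<in> S'' \<longleftrightarrow> 0 \<le> cross2 b q - cross2 a q \<and> 0 \<le> cross2 a q \<and> norm q < r" for q
    unfolding S_def S'_def S''_def sector_eq[OF pos] sector_eq[OF c(1)] sector_eq[OF c(2)]
    by (auto simp: cross2_add cross2_commute[of q a])
  have "negligible (S \<inter> S')"
    by (rule negligible_subset[OF negligible_cross2[of b 0]])
       (use pos mem in \<open>auto simp: cross2_commute[of _ b]\<close>)
  moreover have "negligible ((S \<union> S') \<inter> S'')"
  proof (rule negligible_subset)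
    show "negligible ({q. cross2 b (q - 0) = 0} \<union> {q. cross2 (b - a) (q - 0) = 0})"
      using pos by (intro negligible_Un negligible_cross2) auto
    show "(S \<union> S') \<inter> S'' \<subseteq> {q. cross2 b (q - 0) = 0} \<union> {q. cross2 (b - a) (q - 0) = 0}"
      using mem by (auto simp: cross2_add cross2_commute[of _ b] cross2_commute[of _ a])
  qed
  moreover have "S \<union> S' \<union> S'' = {q. 0 \<le> cross2 a q} \<inter> ball 0 r"
    using mem by (auto simp: cross2_commute[of _ b] cross2_commute[of _ a])
  moreover have "measure lebesgue ({q. 0 \<le> cross2 a q} \<inter> ball 0 r) = pi * r\<^sup>2 / 2"
    using pos assms(2) by (intro measure_halfdisc) auto
  ultimately have sum: "measure lebesgue S + measure lebesgue S' + measure lebesgue S'' = pi * r\<^sup>2 / 2"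
    using measure_Un_negligible[OF m(1,2)] measure_Un_negligible[OF fmeasurable.Un[OF m(1,2)] m(3)]
    by simp
  moreover have "uminus ` S' = sector (- b) (a - b) \<inter> ball 0 r"
  proof (intro set_eqI iffI)
    fix q assume "q \<in> sector (- b) (a - b) \<inter> ball 0 r"
    then have "- q \<in> S'" using sector_minus[of q "- b" "a - b"] by (simp add: S'_def)
    then show "q \<in> uminus ` S'" by (metis image_eqI minus_minus)
  next
    fix q assume "q \<in> uminus ` S'"
    then show "q \<in> sector (- b) (a - b) \<inter> ball 0 r"
      using sector_minus[of _ b "b - a"] by (auto simp: S'_def)
  qed
  ultimately show ?thesis
    using measure_uminus[OF m(2)] by (simp add: S_def S''_def)
qed

text \<open>Close to a corner a triangle coincides with the cone spanned by its two sides
  there.\<close>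

lemma triangle_corner:
  assumes "cross2 (y - x) (z - x) \<noteq> 0"
  shows "\<forall>\<^sub>F r in at_right 0. measure lebesgue (convex hull {x, y, z} \<inter> ball x r)
    = measure lebesgue (sector (y - x) (z - x) \<inter> ball 0 r)"
proof -
  define a where "a = y - x"
  define b where "b = z - x"
  have ne: "a \<noteq> 0" "b \<noteq> 0" using assms by (auto simp: a_def b_def)
  \<comment> \<open>A vector v = \<alpha> a + \<beta> b shorter than \<delta> has \<alpha> + \<beta>
    \<le> 1, because (\<alpha> + \<beta>) \<open>cross2 a b\<close> is
    \<open>cross2 v b + cross2 a v\<close>.\<close>
  define \<delta> where "\<delta> = \<bar>cross2 a b\<bar> / (norm a + norm b)"
  have d: "0 < \<delta>" using assms ne by (auto simp: \<delta>_def a_def[symmetric] b_def[symmetric] intro!: divide_pos_pos add_pos_pos)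
  have "convex hull {x, y, z} \<inter> ball x r = (+) x ` (sector a b \<inter> ball 0 r)" if r: "0 < r" "r < \<delta>" for r
  proof (intro set_eqI iffI)
    fix q assume q: "q \<in> convex hull {x, y, z} \<inter> ball x r"
    then obtain \<alpha> \<beta> where "0 \<le> \<alpha>" "0 \<le> \<beta>" "q = x + \<alpha> *\<^sub>R a + \<beta> *\<^sub>R b"
      unfolding in_triangle a_def b_def Int_iff by blast
    then have "q - x \<in> sector a b" by (auto simp: sector_def)
    then show "q \<in> (+) x ` (sector a b \<inter> ball 0 r)"
      using q by (intro image_eqI[of _ _ "q - x"]) (auto simp: dist_norm norm_minus_commute)
  next
    fix q assume "q \<in> (+) x ` (sector a b \<inter> ball 0 r)"
    then obtain \<alpha> \<beta> where q: "0 \<le> \<alpha>" "0 \<le> \<beta>" "q = x + (\<alpha> *\<^sub>R a + \<beta> *\<^sub>R b)"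
      "norm (\<alpha> *\<^sub>R a + \<beta> *\<^sub>R b) < r"
      unfolding sector_def by auto
    define v where "v = \<alpha> *\<^sub>R a + \<beta> *\<^sub>R b"
    have "(\<alpha> + \<beta>) * cross2 a b = cross2 v b + cross2 a v"
      by (simp add: v_def cross2_add algebra_simps)
    then have "(\<alpha> + \<beta>) * \<bar>cross2 a b\<bar> \<le> \<bar>cross2 v b\<bar> + \<bar>cross2 a v\<bar>"
      using q abs_triangle_ineq[of "cross2 v b" "cross2 a v"] by (metis abs_mult abs_of_nonneg add_nonneg_nonneg)
    also have "\<dots> \<le> norm v * (norm a + norm b)"
      using abs_cross2_le[of v b] abs_cross2_le[of a v] by (simp add: algebra_simps)
    also have "\<dots> \<le> \<delta> * (norm a + norm b)"
      using q(4) r by (intro mult_right_mono) (auto simp: v_def)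
    also have "\<dots> = \<bar>cross2 a b\<bar>"
      using d by (auto simp: \<delta>_def)
    finally have "\<alpha> + \<beta> \<le> 1" using assms by (simp add: a_def b_def)
    show "q \<in> convex hull {x, y, z} \<inter> ball x r"
    proof
      show "q \<in> convex hull {x, y, z}"
        unfolding in_triangle using q \<open>\<alpha> + \<beta> \<le> 1\<close>
        by (intro exI[of _ \<alpha>] exI[of _ \<beta>]) (simp add: a_def b_def)
      have "x - q = - (\<alpha> *\<^sub>R a + \<beta> *\<^sub>R b)" by (simp add: q(3))
      then show "q \<in> ball x r" using q(4) by (simp only: mem_ball dist_norm norm_minus_cancel)
    qed
  qed
  then have "measure lebesgue (convex hull {x, y, z} \<inter> ball x r) = measure lebesgue (sector a b \<inter> ball 0 r)"
    if "0 < r" "r < \<delta>" for r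
    using that by (simp add: measure_translation)
  then show ?thesis
    unfolding a_def b_def eventually_at_right_field using d by blast
qed

lemma triangle_angle_sum:
  assumes "cross2 (y - x) (z - x) \<noteq> 0"
  shows "\<forall>\<^sub>F r in at_right 0. measure lebesgue (convex hull {x, y, z} \<inter> ball x r)
    + measure lebesgue (convex hull {x, y, z} \<inter> ball y r)
    + measure lebesgue (convex hull {x, y, z} \<inter> ball z r) = pi * r\<^sup>2 / 2"
proof -
  have *: "\<forall>\<^sub>F r in at_right 0. measure lebesgue (convex hull {x, y, z} \<inter> ball x r)
    + measure lebesgue (convex hull {x, y, z} \<inter> ball y r)
    + measure lebesgue (convex hull {x, y, z} \<inter> ball z r) = pi * r\<^sup>2 / 2"
    if pos: "0 < cross2 (y - x) (z - x)" for x y z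
  proof -
    have p: "{y, z, x} = {x, y, z}" "{z, x, y} = {x, y, z}" by auto
    have e: "z - y = (z - x) - (y - x)" "x - y = - (y - x)" "x - z = - (z - x)" "y - z = (y - x) - (z - x)"
      by auto
    have c: "cross2 (z - y) (x - y) \<noteq> 0" "cross2 (x - z) (y - z) \<noteq> 0"
      using pos by (simp_all add: cross2_def algebra_simps)
    have c0: "cross2 (y - x) (z - x) \<noteq> 0" using pos by simp
    have r: "\<forall>\<^sub>F r in at_right (0 :: real). 0 < r" by (simp add: eventually_at_right_less)
    show ?thesis
      using triangle_corner[OF c0] triangle_corner[OF c(1)] triangle_corner[OF c(2)] r
    proof (eventually_elim, goal_cases)
      case (1 r)
      have "measure lebesgue (sector (y - x) (z - x) \<inter> ball 0 r)
          + measure lebesgue (sector (z - y) (x - y) \<inter> ball 0 r)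
          + measure lebesgue (sector (x - z) (y - z) \<inter> ball 0 r) = pi * r\<^sup>2 / 2"
        using sector_angle_sum[OF pos, of r] 1(4) by (simp only: e[symmetric])
      then show ?case using 1(1-3) unfolding p by argo
    qed
  qed
  consider "0 < cross2 (y - x) (z - x)" | "0 < cross2 (z - x) (y - x)"
    using assms cross2_commute[of "y - x" "z - x"] by linarith
  then show ?thesis
  proof cases
    case 2
    have "{x, z, y} = {x, y, z}" by auto
    then show ?thesis using *[OF 2] by (simp add: algebra_simps)
  qed (rule *)
qed

section \<open>Edges and faces of a subdivision\<close>

text \<open>\<open>polygonal_subdivision\<close> speaks of local finiteness for faces only. Local
  finiteness of the edges is assumed separately; in a packing it follows from the area of the
  translates.\<close>

locale plane_subdivision =
  fixes V :: "(real^2) set" and E F :: "(real^2) set set"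
  assumes subdivision: "polygonal_subdivision V E F"
    and finite_edges: "\<And>r. finite {e \<in> E. e \<inter> cball 0 r \<noteq> {}}"
begin

lemma face_polygon: "f \<in> F \<Longrightarrow> polytope f \<and> interior f \<noteq> {}"
  using subdivision by (auto simp: polygonal_subdivision_def convex_polygon_def)

lemma face_compact: "f \<in> F \<Longrightarrow> compact f"
  and face_convex: "f \<in> F \<Longrightarrow> convex f"
  and face_closed: "f \<in> F \<Longrightarrow> closed f"
  and face_interior: "f \<in> F \<Longrightarrow> interior f \<noteq> {}"
  and face_bounded: "f \<in> F \<Longrightarrow> bounded f"
  using face_polygon polytope_imp_compact polytope_imp_convex polytope_imp_closed polytope_imp_bounded by blast+

lemma face_closure_interior: "f \<in> F \<Longrightarrow> closure (interior f) = f"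
  using convex_closure_interior[OF face_convex face_interior] face_closed by simp

lemma faces_cover: "\<exists>f\<in>F. p \<in> f"
  using subdivision by (auto simp: polygonal_subdivision_def)

lemma edges_eq: "\<Union>E = (\<Union>f\<in>F. frontier f)"
  using subdivision by (simp add: polygonal_subdivision_def)

lemma vertices_subset: "V \<subseteq> \<Union>E"
  using subdivision unfolding polygonal_subdivision_def by blast

text \<open>An open set disjoint from the interior of \<open>g\<close> is disjoint from the closure
  of that interior, which is \<open>g\<close> itself.\<close>

lemma faces_disjoint:
  assumes "f \<in> F" "g \<in> F" "f \<noteq> g"
  shows "interior f \<inter> g = {}"
proof -
  have "interior f \<inter> interior g = {}"
    using subdivision assms by (simp add: polygonal_subdivision_def pairwise_def)
  then have "interior f \<inter> closure (interior g) = {}"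
    by (simp add: open_Int_closure_eq_empty)
  then show ?thesis using face_closure_interior[OF assms(2)] by simp
qed

lemma interior_no_edge:
  assumes "f \<in> F" "p \<in> interior f"
  shows "p \<notin> \<Union>E"
proof
  assume "p \<in> \<Union>E"
  then obtain g where g: "g \<in> F" "p \<in> frontier g" using edges_eq by auto
  then have "p \<in> g" using face_closed frontier_subset_eq by blast
  then have "f = g" using faces_disjoint[OF assms(1) g(1)] assms(2) by blast
  then show False using g assms(2) by (simp add: frontier_def)
qed

lemma edge_cases:
  assumes "e \<in> E"
  obtains x y where "x \<noteq> y" "e = closed_segment x y" "e \<inter> V = {x, y}"
  using subdivision assms by (auto simp: polygonal_subdivision_def)

lemma edges_meet: "e \<in> E \<Longrightarrow> e' \<in> E \<Longrightarrow> e \<noteq> e' \<Longrightarrow> e \<inter> e' \<subseteq> V"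
  using subdivision by (simp add: polygonal_subdivision_def pairwise_def)

lemma edge_compact: "e \<in> E \<Longrightarrow> compact e"
  by (metis edge_cases compact_segment)

lemma finite_edge_vertices: "e \<in> E \<Longrightarrow> finite (e \<inter> V)"
  by (metis edge_cases finite.simps)

lemma finite_vertices: "finite (V \<inter> cball 0 r)"
proof (rule finite_subset)
  show "V \<inter> cball 0 r \<subseteq> (\<Union>e\<in>{e \<in> E. e \<inter> cball 0 r \<noteq> {}}. e \<inter> V)"
    using vertices_subset by blast
  show "finite (\<Union>e\<in>{e \<in> E. e \<inter> cball 0 r \<noteq> {}}. e \<inter> V)"
    by (rule finite_UN_I[OF finite_edges]) (use finite_edge_vertices in blast)
qed

lemma finite_vertices_bounded:
  assumes "bounded S"
  shows "finite (V \<inter> S)"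
proof -
  obtain r where "S \<subseteq> cball 0 r" using bounded_subset_ballD[OF assms, of 0] ball_subset_cball by blast
  then show ?thesis by (intro finite_subset[OF _ finite_vertices[of r]]) blast
qed

lemma finite_edges_bounded:
  assumes "bounded S"
  shows "finite {e \<in> E. e \<inter> S \<noteq> {}}"
proof -
  obtain r where "S \<subseteq> cball 0 r" using bounded_subset_ballD[OF assms, of 0] ball_subset_cball by blast
  then show ?thesis by (intro finite_subset[OF _ finite_edges[of r]]) blast
qed

lemma finite_faces_bounded:
  assumes "bounded S"
  shows "finite {f \<in> F. f \<inter> S \<noteq> {}}"
proof -
  obtain r where r: "S \<subseteq> cball 0 r" using bounded_subset_ballD[OF assms, of 0] ball_subset_cball by blast
  have lf: "\<exists>U. open U \<and> p \<in> U \<and> finite {f \<in> F. f \<inter> U \<noteq> {}}" for p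
    using subdivision by (simp add: polygonal_subdivision_def locally_finite_in_def)
  then have "\<forall>p. \<exists>U. open U \<and> p \<in> U \<and> finite {f \<in> F. f \<inter> U \<noteq> {}}" by blast
  from choice[OF this] obtain U
    where U: "\<And>p. open (U p)" "\<And>p. p \<in> U p" "\<And>p. finite {f \<in> F. f \<inter> U p \<noteq> {}}"
    by blast
  have cov: "cball 0 r \<subseteq> (\<Union>p\<in>cball 0 r. U p)" using U(2) by blast
  obtain P where P: "P \<subseteq> cball 0 r" "finite P" "cball 0 r \<subseteq> (\<Union>p\<in>P. U p)"
    by (rule compactE_image[OF compact_cball, of "cball 0 r" U 0 r]) (use U(1) cov in blast)+
  have "{f \<in> F. f \<inter> S \<noteq> {}} \<subseteq> (\<Union>p\<in>P. {f \<in> F. f \<inter> U p \<noteq> {}})"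
    using P r by fastforce
  then show ?thesis by (rule finite_subset) (use P U in auto)
qed

text \<open>The edges make up the frontiers of all faces, so a connected set that avoids them cannot
  leave a face.\<close>

lemma connected_in_face:
  assumes "connected C" "C \<inter> \<Union>E = {}" "f \<in> F" "C \<inter> f \<noteq> {}"
  shows "C \<subseteq> interior f"
proof -
  have "C \<inter> frontier f = {}" using assms edges_eq by blast
  then have "C - f = {}" using connected_Int_frontier[OF assms(1,4)] by blast
  then show ?thesis using \<open>C \<inter> frontier f = {}\<close> closure_subset by (fastforce simp: frontier_def)
qed

text \<open>Only finitely many other edges come near \<open>p\<close>, and they meet
  \<open>e\<close> in vertices only. Hence a small disc about \<open>p\<close> contains nothing of
  the edges but a diameter along \<open>e\<close>.\<close>

lemma edge_local:
  assumes "e \<in> E" "p \<in> e" "p \<notin> V"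
  obtains x y \<epsilon> where "x \<noteq> y" "e = closed_segment x y" "e \<inter> V = {x, y}" "0 < \<epsilon>"
    "ball p \<epsilon> \<inter> \<Union>E = {q \<in> ball p \<epsilon>. cross2 (y - x) (q - p) = 0}" "ball p \<epsilon> \<inter> \<Union>E \<subseteq> e"
proof -
  obtain x y where xy: "x \<noteq> y" "e = closed_segment x y" "e \<inter> V = {x, y}"
    using edge_cases[OF assms(1)] .
  define S where "S = {e' \<in> E. e' \<inter> cball p 1 \<noteq> {}} - {e}"
  have "finite S" unfolding S_def using finite_edges_bounded[of "cball p 1"] by simp
  then have "closed (\<Union>S)" using edge_compact compact_imp_closed by (auto simp: S_def intro!: closed_Union)
  moreover have "p \<notin> \<Union>S" using edges_meet[OF assms(1)] assms(2,3) by (auto simp: S_def)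
  ultimately obtain d where d: "0 < d" "ball p d \<inter> \<Union>S = {}"
    by (metis Compl_iff open_Compl open_contains_ball disjoint_eq_subset_Compl inf_commute)
  have "p \<in> closed_segment x y" "p \<noteq> x" "p \<noteq> y" using assms xy by auto
  then obtain s where s: "0 < s" "s < 1" "p = (1 - s) *\<^sub>R x + s *\<^sub>R y"
    using in_segment(2)[of p x y] by (auto simp: open_segment_def)
  \<comment> \<open>The first two bounds keep the disc away from all other edges, the last one keeps
    it away from the ends of \<open>e\<close>.\<close>
  define \<epsilon> where "\<epsilon> = min (min d 1) (min s (1 - s) * norm (y - x))"
  have n0: "0 < norm (y - x)" using xy by simp
  then have e0: "0 < \<epsilon>" using d s by (simp add: \<epsilon>_def)
  have 1: "ball p \<epsilon> \<inter> \<Union>E \<subseteq> e"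
  proof
    fix q assume q: "q \<in> ball p \<epsilon> \<inter> \<Union>E"
    then obtain e' where e': "e' \<in> E" "q \<in> e'" by blast
    have "q \<in> cball p 1" "q \<in> ball p d" using q by (auto simp: \<epsilon>_def)
    then have "e' \<notin> S" using d e' by blast
    then show "q \<in> e" using e' \<open>q \<in> cball p 1\<close> by (auto simp: S_def)
  qed
  have 2: "q \<in> e" if q: "q \<in> ball p \<epsilon>" "cross2 (y - x) (q - p) = 0" for q
  proof -
    obtain t where t: "q - p = t *\<^sub>R (y - x)"
      using cross2_eq_0_imp_parallel[OF q(2)] xy by auto
    have "norm (q - p) < min s (1 - s) * norm (y - x)"
      using q(1) by (simp add: \<epsilon>_def dist_norm norm_minus_commute)
    then have "\<bar>t\<bar> * norm (y - x) < min s (1 - s) * norm (y - x)"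
      unfolding t by simp
    then have "\<bar>t\<bar> < min s (1 - s)" using n0 by simp
    then have "0 \<le> s + t" "s + t \<le> 1" by auto
    moreover have "q = (1 - (s + t)) *\<^sub>R x + (s + t) *\<^sub>R y"
      using t s(3) by (simp add: algebra_simps)
    ultimately show ?thesis unfolding xy(2) in_segment by blast
  qed
  have 3: "cross2 (y - x) (q - p) = 0" if q: "q \<in> e" for q
  proof -
    obtain t where "q = (1 - t) *\<^sub>R x + t *\<^sub>R y" using q unfolding xy(2) in_segment by blast
    then have "q - p = (t - s) *\<^sub>R (y - x)" using s(3) by (simp add: vec2_eq_iff algebra_simps)
    then show ?thesis by simp
  qed
  have "ball p \<epsilon> \<inter> \<Union>E = {q \<in> ball p \<epsilon>. cross2 (y - x) (q - p) = 0}"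
    using 1 2 3 assms(1) by blast
  then show ?thesis using that[OF xy e0 _ 1] by blast
qed

text \<open>The open half disc to the left (\<open>s = 1\<close>) or right (\<open>s = -1\<close>)
  of the line through \<open>p\<close> in direction \<open>a\<close>.\<close>

definition half_disc :: "real^2 \<Rightarrow> real^2 \<Rightarrow> real \<Rightarrow> real \<Rightarrow> (real^2) set" where
  "half_disc a p \<epsilon> s = {q \<in> ball p \<epsilon>. 0 < s * cross2 a (q - p)}"

lemma convex_half_disc: "convex (half_disc a p \<epsilon> s)"
proof -
  define n where "n = (s *\<^sub>R vector [- a $ 2, a $ 1] :: real^2)"
  have "half_disc a p \<epsilon> s = ball p \<epsilon> \<inter> {q. n \<bullet> q > s * cross2 a p}"
    by (auto simp: half_disc_def cross2_def n_def inner_vec_def sum_2 algebra_simps)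
  then show ?thesis by (simp only: convex_Int convex_halfspace_gt convex_ball)
qed

lemma half_disc_avoids:
  assumes "ball p \<epsilon> \<inter> U = {q \<in> ball p \<epsilon>. cross2 a (q - p) = 0}"
  shows "half_disc a p \<epsilon> s \<inter> U = {}"
proof -
  have False if q: "q \<in> ball p \<epsilon>" "0 < s * cross2 a (q - p)" "q \<in> U" for q
  proof -
    have "q \<in> {q \<in> ball p \<epsilon>. cross2 a (q - p) = 0}" using q assms by blast
    then show False using q(2) by simp
  qed
  then show ?thesis unfolding half_disc_def by blast
qed

lemma half_disc_closure:
  assumes "q \<in> ball p \<epsilon>" "cross2 a (q - p) = 0" "half_disc a p \<epsilon> s \<noteq> {}"
  shows "q \<in> closure (half_disc a p \<epsilon> s)"
proof -
  obtain z where z: "z \<in> half_disc a p \<epsilon> s" using assms(3) by blast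
  have "q \<noteq> z" using z assms(2) by (auto simp: half_disc_def)
  have "open_segment q z \<subseteq> half_disc a p \<epsilon> s"
  proof
    fix v assume v: "v \<in> open_segment q z"
    then obtain u where u: "0 < u" "u < 1" "v = (1 - u) *\<^sub>R q + u *\<^sub>R z"
      by (auto simp: in_segment)
    have "closed_segment q z \<subseteq> ball p \<epsilon>"
      by (rule closed_segment_subset) (use assms(1) z in \<open>auto simp: half_disc_def\<close>)
    then have "v \<in> ball p \<epsilon>" using open_closed_segment[OF v] by blast
    moreover have "v - p = (1 - u) *\<^sub>R (q - p) + u *\<^sub>R (z - p)"
      using u(3) by (simp add: algebra_simps)
    then have e: "s * cross2 a (v - p) = u * (s * cross2 a (z - p))"
      using assms(2) by (simp add: cross2_add(1,2))
    have "0 < s * cross2 a (z - p)" using z by (simp add: half_disc_def)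
    then have "0 < s * cross2 a (v - p)" unfolding e by (rule mult_pos_pos[OF u(1)])
    ultimately show "v \<in> half_disc a p \<epsilon> s" by (simp add: half_disc_def)
  qed
  then have "closure (open_segment q z) \<subseteq> closure (half_disc a p \<epsilon> s)" by (rule closure_mono)
  then show ?thesis using \<open>q \<noteq> z\<close> by auto
qed

lemma half_disc_nonempty:
  assumes "a \<noteq> 0" "0 < \<epsilon>" "s = 1 \<or> s = -1"
  shows "half_disc a p \<epsilon> s \<noteq> {}"
proof -
  define n :: "real^2" where "n = vector [- a $ 2, a $ 1]"
  have "cross2 a n = (a $ 1)\<^sup>2 + (a $ 2)\<^sup>2"
    by (simp add: n_def cross2_def power2_eq_square)
  moreover have "a $ 1 \<noteq> 0 \<or> a $ 2 \<noteq> 0" using assms(1) by (simp add: vec2_eq_iff)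
  ultimately have n: "cross2 a n > 0" by (simp only: sum_power2_gt_zero_iff)
  then have "n \<noteq> 0" by auto
  note n = this n
  define q where "q = p + (s * \<epsilon> / (2 * norm n)) *\<^sub>R n"
  have "dist p q = \<epsilon> / 2" using n assms by (auto simp: q_def dist_norm)
  moreover have "s * cross2 a (q - p) = \<epsilon> / (2 * norm n) * cross2 a n"
    using assms(3) by (auto simp: q_def)
  ultimately have "q \<in> half_disc a p \<epsilon> s"
    using n assms(2) by (simp add: half_disc_def)
  then show ?thesis by blast
qed

text \<open>The face has interior points arbitrarily close to \<open>p\<close>, so one of them lies
  in a half disc at \<open>p\<close>. The face contains this whole half disc, and the closure adds
  the diameter along \<open>e\<close>.\<close>

lemma edge_point_face:
  assumes "e \<in> E" "p \<in> e" "p \<notin> V" "f \<in> F" "p \<in> f"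
  shows "\<exists>\<epsilon>>0. ball p \<epsilon> \<inter> e \<subseteq> f"
proof -
  obtain x y \<epsilon> where xy: "x \<noteq> y" "e = closed_segment x y" "e \<inter> V = {x, y}" "0 < \<epsilon>"
    and loc: "ball p \<epsilon> \<inter> \<Union>E = {q \<in> ball p \<epsilon>. cross2 (y - x) (q - p) = 0}" "ball p \<epsilon> \<inter> \<Union>E \<subseteq> e"
    using edge_local[OF assms(1-3)] .
  have "p \<in> closure (interior f)" using assms face_closure_interior by simp
  then obtain q where q: "q \<in> interior f" "q \<in> ball p \<epsilon>"
    using xy(4) by (metis closure_approachable dist_commute mem_ball)
  have "cross2 (y - x) (q - p) \<noteq> 0"
    using interior_no_edge[OF assms(4) q(1)] loc(1) q(2) by blast
  then obtain s where s: "s = 1 \<or> s = -1" "0 < s * cross2 (y - x) (q - p)"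
    by (metis mult_1 mult_minus1 neg_0_less_iff_less not_less_iff_gr_or_eq)
  let ?H = "half_disc (y - x) p \<epsilon> s"
  have qH: "q \<in> ?H" using q s by (simp add: half_disc_def)
  have "?H \<inter> \<Union>E = {}" using half_disc_avoids[OF loc(1)] .
  then have "?H \<subseteq> interior f"
    using connected_in_face[OF convex_connected[OF convex_half_disc] _ assms(4)] qH q(1) interior_subset by blast
  then have "closure ?H \<subseteq> f" using face_closure_interior[OF assms(4)] closure_mono by blast
  then have "ball p \<epsilon> \<inter> e \<subseteq> f"
    using half_disc_closure[of _ p \<epsilon> "y - x" s] qH loc(1) assms(1) by blast
  then show ?thesis using xy(4) by blast
qed

text \<open>By \<open>edge_point_face\<close> the part of the open edge inside \<open>f\<close> is
  open as well as closed, and the open edge is connected.\<close>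

lemma edge_in_face:
  assumes e: "e \<in> E" "p \<in> e" "p \<notin> V" and f: "f \<in> F" "p \<in> f"
  shows "e \<subseteq> frontier f"
proof -
  obtain x y where xy: "x \<noteq> y" "e = closed_segment x y" "e \<inter> V = {x, y}"
    using edge_cases[OF e(1)] .
  let ?O = "open_segment x y"
  have O: "?O = e - V" using xy by (auto simp: open_segment_def)
  have "closedin (top_of_set ?O) (?O \<inter> f)"
    using face_closed[OF f(1)] by (simp add: closedin_closed_Int)
  moreover have "openin (top_of_set ?O) (?O \<inter> f)"
    unfolding openin_contains_ball
  proof (intro conjI ballI)
    fix q assume q: "q \<in> ?O \<inter> f"
    obtain \<epsilon> where "0 < \<epsilon>" "ball q \<epsilon> \<inter> e \<subseteq> f"
      using edge_point_face[OF e(1) _ _ f(1), of q] q O by blast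
    then show "\<exists>\<epsilon>>0. ball q \<epsilon> \<inter> ?O \<subseteq> ?O \<inter> f" using O by blast
  qed simp
  moreover have "?O \<inter> f \<noteq> {}" using e f O by blast
  ultimately have "?O \<inter> f = ?O"
    using convex_connected[OF convex_open_segment] unfolding connected_clopen by blast
  then have "closure ?O \<subseteq> f" using face_closed[OF f(1)] by (metis closure_minimal inf.cobounded2)
  then have "e \<subseteq> f" using xy by simp
  moreover have "e \<inter> interior f = {}" using interior_no_edge[OF f(1)] e(1) by blast
  ultimately show ?thesis
    unfolding frontier_def closure_closed[OF face_closed[OF f(1)]] by blast
qed

text \<open>Each of the two half discs at the midpoint of the edge lies in the interior of one face.
  The two faces differ: otherwise convexity would put the midpoint into the interior of a
  face.\<close>

lemma card_edge_faces:
  assumes "e \<in> E"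
  shows "card {f \<in> F. e \<subseteq> frontier f} = 2"
proof -
  obtain a b where ab: "a \<noteq> b" "e = closed_segment a b" "e \<inter> V = {a, b}"
    using edge_cases[OF assms] .
  define p where "p = midpoint a b"
  have "p \<noteq> a" "p \<noteq> b" using ab(1) by (simp_all add: p_def midpoint_eq_endpoint)
  moreover have "p \<in> e" by (simp add: p_def ab(2))
  ultimately have p: "p \<in> e" "p \<notin> V" using ab(3) by blast+
  obtain x y \<epsilon> where xy: "x \<noteq> y" "e = closed_segment x y" "e \<inter> V = {x, y}" "0 < \<epsilon>"
    and loc: "ball p \<epsilon> \<inter> \<Union>E = {q \<in> ball p \<epsilon>. cross2 (y - x) (q - p) = 0}" "ball p \<epsilon> \<inter> \<Union>E \<subseteq> e"
    using edge_local[OF assms p] .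
  let ?H = "half_disc (y - x) p \<epsilon>"
  have H: "\<exists>f\<in>F. ?H s \<subseteq> interior f" if s: "s = 1 \<or> s = -1" for s
  proof -
    obtain q where q: "q \<in> ?H s" using half_disc_nonempty[of "y - x" \<epsilon> s p] xy s by auto
    obtain f where f: "f \<in> F" "q \<in> f" using faces_cover by blast
    have "?H s \<inter> \<Union>E = {}" using half_disc_avoids[OF loc(1)] .
    then show ?thesis
      using connected_in_face[OF convex_connected[OF convex_half_disc] _ f(1)] q f by blast
  qed
  obtain f where f: "f \<in> F" "?H 1 \<subseteq> interior f" using H[of 1] by auto
  obtain g where g: "g \<in> F" "?H (-1) \<subseteq> interior g" using H[of "-1"] by auto
  have pin: "p \<in> h" if h: "h \<in> F" "?H s \<subseteq> interior h" and s: "s = 1 \<or> s = -1" for h s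
  proof -
    have "p \<in> closure (?H s)"
      using half_disc_closure[of p p \<epsilon> "y - x" s] half_disc_nonempty[of "y - x" \<epsilon> s p] xy s by auto
    then show ?thesis using face_closure_interior[OF h(1)] closure_mono[OF h(2)] by blast
  qed
  have "f \<noteq> g"
  proof
    assume "f = g"
    obtain q where q: "q \<in> ?H 1" using half_disc_nonempty[of "y - x" \<epsilon> 1 p] xy by auto
    define q' where "q' = p - (q - p)"
    have q'p: "q' - p = - (q - p)" by (simp add: q'_def)
    have "dist p q' = dist p q" by (simp add: q'_def dist_norm norm_minus_commute)
    moreover have "cross2 (y - x) (q' - p) = - cross2 (y - x) (q - p)" by (simp only: q'p cross2_simps)
    ultimately have "q' \<in> ?H (-1)" using q unfolding half_disc_def by simp
    have "p = (1/2) *\<^sub>R q + (1/2) *\<^sub>R q'" by (simp add: q'_def vec2_eq_iff field_simps)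
    moreover have "(1/2) *\<^sub>R q + (1/2) *\<^sub>R q' \<in> interior f"
      by (rule convexD[OF convex_interior[OF face_convex[OF f(1)]]])
        (use q \<open>q' \<in> _\<close> f g \<open>f = g\<close> in auto)
    ultimately show False using interior_no_edge[OF f(1)] p(1) assms by auto
  qed
  moreover have "{h \<in> F. e \<subseteq> frontier h} = {f, g}"
  proof (intro set_eqI iffI)
    fix h assume h: "h \<in> {h \<in> F. e \<subseteq> frontier h}"
    then have "p \<in> closure (interior h)"
      using p face_closure_interior face_closed frontier_subset_closed by blast
    then obtain q where q: "q \<in> interior h" "q \<in> ball p \<epsilon>"
      using xy(4) by (metis closure_approachable dist_commute mem_ball)
    have "cross2 (y - x) (q - p) \<noteq> 0"
      using interior_no_edge[of h q] h loc(1) q by blast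
    then have "q \<in> ?H 1 \<or> q \<in> ?H (-1)" using q(2) by (auto simp: half_disc_def)
    then have "q \<in> interior f \<or> q \<in> interior g" using f g by blast
    then show "h \<in> {f, g}"
      using faces_disjoint[of f h] faces_disjoint[of g h] f g h q(1) interior_subset by blast
  next
    fix h assume "h \<in> {f, g}"
    then show "h \<in> {h \<in> F. e \<subseteq> frontier h}"
      using edge_in_face[OF assms p] pin[of f 1] pin[of g "-1"] f g by auto
  qed
  ultimately show ?thesis by simp
qed

end

section \<open>The boundary cycle of a face\<close>

definition cone_over :: "real^2 \<Rightarrow> (real^2) set \<Rightarrow> (real^2) set" where
  "cone_over c e = {c + r *\<^sub>R (p - c) | r p. 0 \<le> r \<and> r \<le> 1 \<and> p \<in> e}"

lemma cone_over_segment: "cone_over c (closed_segment x y) = convex hull {c, x, y}"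
proof (intro set_eqI iffI)
  fix q assume "q \<in> cone_over c (closed_segment x y)"
  then obtain r u where r: "0 \<le> r" "r \<le> 1" "0 \<le> u" "u \<le> 1" "q = c + r *\<^sub>R ((1 - u) *\<^sub>R x + u *\<^sub>R y - c)"
    by (auto simp: cone_over_def in_segment)
  have "0 \<le> r * (1 - u)" "0 \<le> r * u" using r by auto
  moreover have "r * (1 - u) + r * u \<le> 1" using r by (simp add: algebra_simps)
  moreover have "q = c + (r * (1 - u)) *\<^sub>R (x - c) + (r * u) *\<^sub>R (y - c)"
    using r(5) by (simp add: vec2_eq_iff algebra_simps)
  ultimately show "q \<in> convex hull {c, x, y}" unfolding in_triangle by blast
next
  fix q assume "q \<in> convex hull {c, x, y}"
  then obtain \<alpha> \<beta> where q: "0 \<le> \<alpha>" "0 \<le> \<beta>" "\<alpha> + \<beta> \<le> 1" "q = c + \<alpha> *\<^sub>R (x - c) + \<beta> *\<^sub>R (y - c)"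
    unfolding in_triangle by blast
  show "q \<in> cone_over c (closed_segment x y)"
  proof (cases "\<alpha> + \<beta> = 0")
    case True
    then have "\<alpha> = 0" "\<beta> = 0" using q by auto
    then have "q = c + 0 *\<^sub>R (x - c)" using q by simp
    then show ?thesis unfolding cone_over_def
      by (intro CollectI exI[of _ 0] exI[of _ x]) auto
  next
    case False
    define u where "u = \<beta> / (\<alpha> + \<beta>)"
    have u: "0 \<le> u" "u \<le> 1" "(\<alpha> + \<beta>) * u = \<beta>" "(\<alpha> + \<beta>) * (1 - u) = \<alpha>"
      using False q(1,2) by (auto simp: u_def right_diff_distrib)
    have "(\<alpha> + \<beta>) *\<^sub>R ((1 - u) *\<^sub>R x + u *\<^sub>R y - c) = ((\<alpha> + \<beta>) * (1 - u)) *\<^sub>R x + ((\<alpha> + \<beta>) * u) *\<^sub>R y - (\<alpha> + \<beta>) *\<^sub>R c"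
      by (simp add: scaleR_right_distrib scaleR_right_diff_distrib)
    also have "\<dots> = \<alpha> *\<^sub>R (x - c) + \<beta> *\<^sub>R (y - c)" unfolding u by (simp add: algebra_simps)
    finally have "q = c + (\<alpha> + \<beta>) *\<^sub>R ((1 - u) *\<^sub>R x + u *\<^sub>R y - c)" using q(4) by simp
    moreover have "(1 - u) *\<^sub>R x + u *\<^sub>R y \<in> closed_segment x y" using u by (auto simp: in_segment)
    moreover have "0 \<le> \<alpha> + \<beta>" using q by simp
    ultimately show ?thesis unfolding cone_over_def using q(3) by blast
  qed
qed

text \<open>The pigeonhole principle gives a repetition, and injectivity cancels it back to a return
  to \<open>x\<close>. Taking the least period makes the orbit free of repetitions.\<close>

lemma bij_eventually_cyclic:
  assumes "bij_betw \<sigma> S S" "finite S" "x \<in> S"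
  obtains m where "0 < m" "(\<sigma> ^^ m) x = x" "inj_on (\<lambda>i. (\<sigma> ^^ i) x) {..<m}" "\<And>i. (\<sigma> ^^ i) x \<in> S"
proof -
  have inS: "(\<sigma> ^^ i) x \<in> S" for i
    by (induction i) (use assms in \<open>auto simp: bij_betw_apply\<close>)
  have inj: "inj_on \<sigma> S" using assms(1) by (simp add: bij_betw_def)
  have cancel: "(\<sigma> ^^ j) x = x" if "(\<sigma> ^^ i) x = (\<sigma> ^^ (i + j)) x" for i j
    using that
  proof (induction i)
    case (Suc i)
    then have "\<sigma> ((\<sigma> ^^ i) x) = \<sigma> ((\<sigma> ^^ (i + j)) x)" by simp
    then have "(\<sigma> ^^ i) x = (\<sigma> ^^ (i + j)) x" using inj inS by (meson inj_onD)
    then show ?case by (rule Suc.IH)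
  qed simp
  have "\<not> inj_on (\<lambda>i. (\<sigma> ^^ i) x) {..card S}"
  proof
    assume "inj_on (\<lambda>i. (\<sigma> ^^ i) x) {..card S}"
    then have "card {..card S} \<le> card S"
      by (rule card_inj_on_le) (use inS assms in auto)
    then show False by simp
  qed
  then obtain i j where "i < j" "(\<sigma> ^^ i) x = (\<sigma> ^^ j) x"
    unfolding inj_on_def by (metis linorder_neqE_nat)
  then have ex: "0 < j - i \<and> (\<sigma> ^^ (j - i)) x = x" using cancel[of i "j - i"] by simp
  define m where "m = (LEAST m. 0 < m \<and> (\<sigma> ^^ m) x = x)"
  have m: "0 < m" "(\<sigma> ^^ m) x = x"
    using LeastI[of "\<lambda>m. 0 < m \<and> (\<sigma> ^^ m) x = x", OF ex] by (auto simp: m_def)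
  have least: "\<not> (0 < k \<and> (\<sigma> ^^ k) x = x)" if "k < m" for k
    using not_less_Least that unfolding m_def by blast
  have "inj_on (\<lambda>i. (\<sigma> ^^ i) x) {..<m}"
  proof (rule linorder_inj_onI)
    fix i j assume "i < j" "i \<in> {..<m}" "j \<in> {..<m}"
    show "(\<sigma> ^^ i) x \<noteq> (\<sigma> ^^ j) x"
    proof
      assume "(\<sigma> ^^ i) x = (\<sigma> ^^ j) x"
      then have "(\<sigma> ^^ (j - i)) x = x" using cancel[of i "j - i"] \<open>i < j\<close> by simp
      moreover have "j - i < m" "0 < j - i" using \<open>i < j\<close> \<open>j \<in> _\<close> by auto
      ultimately show False using least[of "j - i"] by blast
    qed
  qed auto
  then show ?thesis using that m inS by blast
qed

lemma frequently_in_closed: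
  assumes "closed S" "(g \<longlongrightarrow> l) F" "\<exists>\<^sub>F t in F. g t \<in> S"
  shows "l \<in> S"
proof (rule ccontr)
  assume "l \<notin> S"
  then have "\<forall>\<^sub>F t in F. g t \<in> - S"
    using assms by (intro topological_tendstoD) auto
  then show False using assms(3) by (simp add: frequently_def)
qed

lemma (in plane_subdivision) sides_finite: "f \<in> F \<Longrightarrow> finite (sides E f)"
proof -
  assume f: "f \<in> F"
  have "sides E f \<subseteq> {e \<in> E. e \<inter> f \<noteq> {}}"
  proof
    fix e assume e: "e \<in> sides E f"
    then have "e \<in> E" by (simp add: sides_def)
    then obtain x y where "x \<noteq> y" "e = closed_segment x y" "e \<inter> V = {x, y}" by (rule edge_cases)
    then have "x \<in> e" by simp
    then show "e \<in> {e \<in> E. e \<inter> f \<noteq> {}}"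
      using e face_closed[OF f] frontier_subset_eq[of f] by (auto simp: sides_def)
  qed
  then show ?thesis using finite_edges_bounded[OF face_bounded[OF f]] finite_subset by blast
qed

text \<open>The interior point \<open>c\<close> is the origin from which the frontier of
  \<open>f\<close> is ordered by direction.\<close>

locale subdivision_face = plane_subdivision +
  fixes f c
  assumes f: "f \<in> F" and c: "c \<in> interior f"
begin

abbreviation "S \<equiv> sides E f"

abbreviation "W \<equiv> V \<inter> f"

lemma side_edge: "e \<in> S \<Longrightarrow> e \<in> E" and side_frontier: "e \<in> S \<Longrightarrow> e \<subseteq> frontier f"
  by (auto simp: sides_def)

lemma frontier_f: "p \<in> frontier f \<longleftrightarrow> p \<in> f \<and> p \<notin> interior f"
  using face_closed[OF f] by (simp add: frontier_def)

lemma finite_W: "finite W"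
  using finite_vertices_bounded[OF face_bounded[OF f]] .

lemma W_frontier: "x \<in> W \<Longrightarrow> x \<in> frontier f"
  using interior_no_edge[OF f] vertices_subset frontier_f by blast

lemma side_cases:
  assumes "e \<in> S"
  obtains x y where "x \<noteq> y" "e = closed_segment x y" "e \<inter> V = {x, y}" "x \<in> W" "y \<in> W"
proof -
  obtain x y where xy: "x \<noteq> y" "e = closed_segment x y" "e \<inter> V = {x, y}"
    using edge_cases[OF side_edge[OF assms]] .
  moreover have "e \<subseteq> f" using side_frontier[OF assms] frontier_f by blast
  ultimately show ?thesis using that by blast
qed

lemma side_ends:
  assumes "closed_segment x y \<in> S"
  shows "x \<in> W \<and> y \<in> W"
proof -
  obtain a b where "closed_segment x y = closed_segment a b" "a \<in> W" "b \<in> W"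
    using side_cases[OF assms] by metis
  then show ?thesis using closed_segment_eq[of x y a b] by (auto simp: doubleton_eq_iff)
qed

lemma side_vertices:
  assumes "closed_segment x y \<in> S"
  shows "closed_segment x y \<inter> V = {x, y}"
proof -
  obtain a b where "closed_segment x y = closed_segment a b" "closed_segment x y \<inter> V = {a, b}"
    using side_cases[OF assms] by metis
  then show ?thesis using closed_segment_eq[of x y a b] by auto
qed

lemma connected_frontier: "connected (frontier f)"
  using connected_sphere_gen[OF face_convex[OF f] face_bounded[OF f]]
    rel_frontier_nonempty_interior[OF face_interior[OF f]] aff_dim_nonempty_interior[OF face_interior[OF f]]
  by simp

lemma frontier_not_singleton: "frontier f \<noteq> {a}"
proof
  assume "frontier f = {a}"
  then have "f = convex hull {a}"
    using Krein_Milman_frontier[OF face_convex[OF f] face_compact[OF f]] by simp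
  then show False using face_interior[OF f] by simp
qed

text \<open>For points of the frontier that are not vertices this is \<open>edge_in_face\<close>.
  The frontier is connected with more than one point, hence has no isolated points, so its finitely
  many vertices are limits of other points and follow by closedness.\<close>

lemma frontier_sides: "frontier f = \<Union>S"
proof
  show "\<Union>S \<subseteq> frontier f" using side_frontier by blast
  have cl: "closed (\<Union>S)"
    by (intro closed_Union sides_finite f ballI compact_imp_closed edge_compact side_edge)
  have nonV: "p \<in> \<Union>S" if p: "p \<in> frontier f" "p \<notin> V" for p
  proof -
    obtain e where e: "e \<in> E" "p \<in> e" using edges_eq p f by blast
    then have "e \<subseteq> frontier f" using edge_in_face[OF e p(2) f] p frontier_f by blast
    then show ?thesis using e by (auto simp: sides_def)
  qed
  show "frontier f \<subseteq> \<Union>S"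
  proof
    fix p assume p: "p \<in> frontier f"
    have "p islimpt frontier f"
      using connected_imp_perfect[OF connected_frontier p] frontier_not_singleton by blast
    also have "frontier f = (frontier f \<inter> V) \<union> (frontier f - V)" by blast
    finally have "p islimpt (frontier f - V)"
      using islimpt_Un_finite[of "frontier f \<inter> V" p "frontier f - V"] finite_subset[OF _ finite_W, of "frontier f \<inter> V"]
        frontier_f by blast
    then have "p \<in> closure (frontier f - V)" by (simp add: closure_def)
    also have "\<dots> \<subseteq> \<Union>S" by (rule closure_minimal) (use nonV cl in auto)
    finally show "p \<in> \<Union>S" .
  qed
qed

lemma sides_nonempty: "S \<noteq> {}"
proof -
  have "f \<noteq> UNIV" using face_bounded[OF f] not_bounded_UNIV by auto
  then have "frontier f \<noteq> {}" using c interior_subset by (auto simp: frontier_eq_empty)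
  then show ?thesis using frontier_sides by auto
qed

lemma radial_interior: "p \<in> f \<Longrightarrow> 0 \<le> t \<Longrightarrow> t < 1 \<Longrightarrow> c + t *\<^sub>R (p - c) \<in> interior f"
  using mem_interior_convex_shrink[OF face_convex[OF f] c, of p "1 - t"]
  by (simp add: scaleR_left_diff_distrib)

text \<open>If a ray from \<open>c\<close> met the frontier twice, the nearer point would be
  interior by convexity.\<close>

lemma radial_unique:
  assumes "p \<in> frontier f" "p' \<in> frontier f" "0 \<le> t" "p' - c = t *\<^sub>R (p - c)"
  shows "p' = p"
proof (cases "t < 1")
  case True
  have "p' = c + t *\<^sub>R (p - c)" using assms(4) by (simp add: algebra_simps)
  then have "p' \<in> interior f" using radial_interior[of p t] assms True frontier_f by auto
  then show ?thesis using assms(2) frontier_f by blast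
next
  case False
  show ?thesis
  proof (cases "t = 1")
    case False
    then have "1 < t" using \<open>\<not> t < 1\<close> by simp
    then have "(1 / t) *\<^sub>R (p' - c) = p - c" using assms(4) by simp
    then have "p = c + (1 / t) *\<^sub>R (p' - c)" by simp
    then have "p \<in> interior f" using radial_interior[of p' "1 / t"] assms \<open>1 < t\<close> frontier_f by auto
    then show ?thesis using assms(1) frontier_f by blast
  qed (use assms in auto)
qed

lemma frontier_not_centre: "p \<in> frontier f \<Longrightarrow> p \<noteq> c"
  using c frontier_f by blast

text \<open>If \<open>x\<close>, \<open>y\<close> and \<open>c\<close> were collinear, then either
  both ends would lie on one ray from \<open>c\<close>, or \<open>c\<close> would lie on the side
  and hence on the frontier.\<close>

lemma side_cross:
  assumes "closed_segment x y \<in> S" "x \<noteq> y"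
  shows "cross2 (x - c) (y - c) \<noteq> 0"
proof
  assume 0: "cross2 (x - c) (y - c) = 0"
  have fr: "x \<in> frontier f" "y \<in> frontier f" using side_frontier[OF assms(1)] by auto
  obtain t where t: "y - c = t *\<^sub>R (x - c)"
    using cross2_eq_0_imp_parallel[OF 0] frontier_not_centre[OF fr(1)] by auto
  have "t < 0"
    using radial_unique[OF fr _ t] assms(2) by force
  then have "0 \<le> 1 / (1 - t)" "1 / (1 - t) \<le> 1" by auto
  moreover have "c = (1 - 1 / (1 - t)) *\<^sub>R x + (1 / (1 - t)) *\<^sub>R y"
  proof -
    have y: "y = c + t *\<^sub>R (x - c)" using t by (simp add: algebra_simps)
    have m: "(1 - t) * (1 - 1 / (1 - t)) = - t" "(1 - t) * (1 / (1 - t)) = 1"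
      using \<open>t < 0\<close> by (simp_all add: right_diff_distrib)
    have "(1 - t) *\<^sub>R ((1 - 1 / (1 - t)) *\<^sub>R x + (1 / (1 - t)) *\<^sub>R y) = (- t) *\<^sub>R x + 1 *\<^sub>R y"
      unfolding scaleR_right_distrib scaleR_scaleR m ..
    also have "\<dots> = (1 - t) *\<^sub>R c" by (simp add: y algebra_simps)
    finally have "(1 - t) *\<^sub>R ((1 - 1 / (1 - t)) *\<^sub>R x + (1 / (1 - t)) *\<^sub>R y) = (1 - t) *\<^sub>R c" .
    then show ?thesis using \<open>t < 0\<close> by simp
  qed
  ultimately have "c \<in> closed_segment x y" unfolding in_segment by blast
  then show False using side_frontier[OF assms(1)] c frontier_f by blast
qed

lemma cone_subset:
  assumes "e \<in> S"
  shows "cone_over c e \<subseteq> f"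
proof
  fix q assume "q \<in> cone_over c e"
  then obtain r p where p: "0 \<le> r" "r \<le> 1" "p \<in> e" "q = c + r *\<^sub>R (p - c)"
    by (auto simp: cone_over_def)
  have "p \<in> f" using p side_frontier[OF assms] frontier_f by blast
  moreover have "c \<in> f" using c interior_subset by blast
  ultimately have "(1 - r) *\<^sub>R c + r *\<^sub>R p \<in> f" using convexD_alt[OF face_convex[OF f]] p by blast
  moreover have "q = (1 - r) *\<^sub>R c + r *\<^sub>R p" by (simp add: p(4) algebra_simps)
  ultimately show "q \<in> f" by simp
qed

lemma face_eq_cones: "f = (\<Union>e\<in>S. cone_over c e)"
proof
  show "(\<Union>e\<in>S. cone_over c e) \<subseteq> f" using cone_subset by blast
  show "f \<subseteq> (\<Union>e\<in>S. cone_over c e)"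
  proof
    fix q assume q: "q \<in> f"
    show "q \<in> (\<Union>e\<in>S. cone_over c e)"
    proof (cases "q = c")
      case True
      obtain e where e: "e \<in> S" using sides_nonempty by blast
      then obtain x where "x \<in> e" using side_cases by (metis ends_in_segment(1))
      then have "q \<in> cone_over c e" unfolding cone_over_def True
        by (intro CollectI exI[of _ 0] exI[of _ x]) auto
      then show ?thesis using e by blast
    next
      case False
      then obtain d where d: "0 < d" "c + d *\<^sub>R (q - c) \<in> frontier f"
        using ray_to_frontier[OF face_bounded[OF f] c, of "q - c"] by auto
      define p where "p = c + d *\<^sub>R (q - c)"
      have "1 \<le> d"
      proof (rule ccontr)
        assume "\<not> 1 \<le> d"
        then show False using radial_interior[OF q, of d] d frontier_f by auto
      qed
      then have "q = c + (1 / d) *\<^sub>R (p - c)" by (simp add: p_def)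
      moreover obtain e where "e \<in> S" "p \<in> e" using d(2) frontier_sides by (auto simp: p_def)
      moreover have "0 \<le> 1 / d" "1 / d \<le> 1" using \<open>1 \<le> d\<close> by auto
      ultimately show ?thesis unfolding cone_over_def by blast
    qed
  qed
qed

text \<open>The ray from \<open>c\<close> through a common point meets both sides, in the same point
  by \<open>radial_unique\<close>; different edges share only vertices.\<close>

lemma cones_meet:
  assumes "e \<in> S" "e' \<in> S" "e \<noteq> e'" "q \<in> cone_over c e" "q \<in> cone_over c e'" "q \<noteq> c"
  obtains v r where "v \<in> e \<inter> e'" "v \<in> V" "0 < r" "q = c + r *\<^sub>R (v - c)"
proof -
  obtain r p where p: "0 \<le> r" "p \<in> e" "q = c + r *\<^sub>R (p - c)"
    using assms(4) by (auto simp: cone_over_def)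
  obtain r' p' where p': "0 \<le> r'" "p' \<in> e'" "q = c + r' *\<^sub>R (p' - c)"
    using assms(5) by (auto simp: cone_over_def)
  have r: "0 < r" "0 < r'" using assms(6) p p' by (auto simp: less_le)
  have "r *\<^sub>R (p - c) = r' *\<^sub>R (p' - c)" using p(3) p'(3) by (metis add_left_cancel)
  then have "(1 / r') *\<^sub>R (r *\<^sub>R (p - c)) = p' - c" using r by simp
  then have "p' - c = (r / r') *\<^sub>R (p - c)" by simp
  then have "p' = p"
    using radial_unique[of p p' "r / r'"] side_frontier assms p p' r by auto
  then show ?thesis
    using that[of p r] edges_meet[OF side_edge side_edge, OF assms(1-3)] p p' r by blast
qed

lemma cone_frontier:
  assumes "e \<in> S" "q \<in> cone_over c e" "q \<in> frontier f"
  shows "q \<in> e"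
proof -
  obtain r p where p: "0 \<le> r" "r \<le> 1" "p \<in> e" "q = c + r *\<^sub>R (p - c)"
    using assms(2) by (auto simp: cone_over_def)
  have "q \<in> interior f" if "r < 1"
    using radial_interior[of p r] p that side_frontier[OF assms(1)] frontier_f by auto
  then have "r = 1" using p(2) assms(3) frontier_f by fastforce
  then show ?thesis using p by simp
qed

lemma cone_lmeasurable: "e \<in> S \<Longrightarrow> cone_over c e \<in> lmeasurable"
  by (metis side_cases cone_over_segment lmeasurable_convex_hull finite.emptyI finite.insertI)

lemma cone_closed: "e \<in> S \<Longrightarrow> closed (cone_over c e)"
  by (metis side_cases cone_over_segment finite_imp_compact_convex_hull compact_imp_closed finite.emptyI finite.insertI)

lemma cones_negligible:
  assumes "e \<in> S" "e' \<in> S" "e \<noteq> e'"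
  shows "negligible (cone_over c e \<inter> cone_over c e')"
proof (rule negligible_subset)
  have "finite (e \<inter> V)" using finite_edge_vertices side_edge assms by blast
  then show "negligible (\<Union>v\<in>e \<inter> V. {q. cross2 (v - c) (q - c) = 0})"
  proof (rule negligible_Union[OF finite_imageI])
    fix T assume "T \<in> (\<lambda>v. {q. cross2 (v - c) (q - c) = 0}) ` (e \<inter> V)"
    then obtain v where v: "v \<in> e" "T = {q. cross2 (v - c) (q - c) = 0}" by blast
    then have "v - c \<noteq> 0" using frontier_not_centre side_frontier[OF assms(1)] by auto
    then show "negligible T" unfolding v by (rule negligible_cross2)
  qed
  show "cone_over c e \<inter> cone_over c e' \<subseteq> (\<Union>v\<in>e \<inter> V. {q. cross2 (v - c) (q - c) = 0})"
  proof
    fix q assume q: "q \<in> cone_over c e \<inter> cone_over c e'"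
    show "q \<in> (\<Union>v\<in>e \<inter> V. {q. cross2 (v - c) (q - c) = 0})"
    proof (cases "q = c")
      case True
      obtain x where "x \<in> e \<inter> V" using side_cases[OF assms(1)] by (metis insertI1)
      then show ?thesis using True by auto
    next
      case False
      obtain v r where "v \<in> e \<inter> e'" "v \<in> V" "0 < r" "q = c + r *\<^sub>R (v - c)"
        using cones_meet[OF assms _ _ False] q by blast
      then show ?thesis by (intro UN_I[of v]) auto
    qed
  qed
qed

text \<open>With a small disc about a vertex for \<open>B\<close> this computes the angle of the
  face there; with \<open>B = f\<close> it computes the area.\<close>

lemma measure_face_inter:
  assumes "B \<in> lmeasurable"
  shows "measure lebesgue (f \<inter> B) = (\<Sum>e\<in>S. measure lebesgue (cone_over c e \<inter> B))"
proof -
  have "f \<inter> B = \<Union>((\<lambda>e. cone_over c e \<inter> B) ` S)" using face_eq_cones by blast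
  also have "measure lebesgue \<dots> = (\<Sum>e\<in>S. measure lebesgue (cone_over c e \<inter> B))"
  proof (rule measure_negligible_finite_Union_image)
    show "pairwise (\<lambda>x y. negligible (cone_over c x \<inter> B \<inter> (cone_over c y \<inter> B))) S"
    proof (rule pairwiseI)
      fix x y assume "x \<in> S" "y \<in> S" "x \<noteq> y"
      then show "negligible (cone_over c x \<inter> B \<inter> (cone_over c y \<inter> B))"
        by (intro negligible_subset[OF cones_negligible[of x y]]) auto
    qed
  qed (use assms sides_finite f cone_lmeasurable in auto)
  finally show ?thesis .
qed

lemma measure_cone: "closed_segment x y \<in> S \<Longrightarrow>
    measure lebesgue (cone_over c (closed_segment x y)) = \<bar>cross2 (x - c) (y - c)\<bar> / 2"
  by (simp add: cone_over_segment measure_triangle)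

lemma measure_face: "measure lebesgue f = (\<Sum>e\<in>S. measure lebesgue (cone_over c e))"
proof -
  have "f \<in> lmeasurable" using face_compact[OF f] lmeasurable_compact by blast
  moreover have "cone_over c e \<inter> f = cone_over c e" if "e \<in> S" for e
    using cone_subset[OF that] by blast
  ultimately show ?thesis using measure_face_inter[of f] by simp
qed

lemma eventually_ball_subset:
  assumes "open U" "x \<in> U"
  shows "\<forall>\<^sub>F r in at_right 0. ball x r \<subseteq> U"
proof -
  obtain d where "0 < d" "ball x d \<subseteq> U" using assms open_contains_ball by blast
  then show ?thesis
    unfolding eventually_at_right_field by (intro exI[of _ d]) (auto simp: subset_iff)
qed

text \<open>Every triangle spanned by \<open>c\<close> and a side contributes
  \<open>pi * r\<^sup>2 / 2\<close>. Taking away the full angle around \<open>c\<close> leaves the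
  angles at the vertices.\<close>

lemma angle_sum:
  "\<forall>\<^sub>F r in at_right 0. (\<Sum>x\<in>W. measure lebesgue (f \<inter> ball x r)) = (card S / 2 - 1) * (pi * r\<^sup>2)"
proof -
  define A where "A = (\<lambda>e x r. measure lebesgue (cone_over c e \<inter> ball x r))"
  have 1: "\<forall>\<^sub>F r in at_right 0. \<forall>e\<in>S. A e c r + (\<Sum>x\<in>e \<inter> V. A e x r) = pi * r\<^sup>2 / 2"
  proof (intro eventually_ball_finite sides_finite f ballI)
    fix e assume e: "e \<in> S"
    then obtain x y where xy: "x \<noteq> y" "e = closed_segment x y" "e \<inter> V = {x, y}" using side_cases by metis
    have "cross2 (x - c) (y - c) \<noteq> 0" using side_cross e xy by blast
    from triangle_angle_sum[OF this]
    show "\<forall>\<^sub>F r in at_right 0. A e c r + (\<Sum>x\<in>e \<inter> V. A e x r) = pi * r\<^sup>2 / 2"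
      unfolding A_def xy(3) using xy(1) by (simp add: xy(2) cone_over_segment add.assoc)
  qed
  have 2: "\<forall>\<^sub>F r in at_right 0. \<forall>e\<in>S. \<forall>x\<in>W. x \<notin> e \<longrightarrow> A e x r = 0"
  proof (intro eventually_ball_finite sides_finite f finite_W ballI)
    fix e x assume e: "e \<in> S" and x: "x \<in> W"
    show "\<forall>\<^sub>F r in at_right 0. x \<notin> e \<longrightarrow> A e x r = 0"
    proof (cases "x \<in> e")
      case False
      then have "x \<in> - cone_over c e" using cone_frontier[OF e] W_frontier[OF x] by blast
      then have "\<forall>\<^sub>F r in at_right 0. ball x r \<subseteq> - cone_over c e"
        using cone_closed[OF e] by (intro eventually_ball_subset) auto
      then show ?thesis
      proof eventually_elim
        case (elim r)
        then have "cone_over c e \<inter> ball x r = {}" by blast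
        then show ?case by (simp add: A_def)
      qed
    qed simp
  qed
  have 3: "\<forall>\<^sub>F r in at_right 0. ball c r \<subseteq> interior f"
    using c by (intro eventually_ball_subset) auto
  have 4: "\<forall>\<^sub>F r in at_right (0 :: real). 0 < r" by (simp add: eventually_at_right_less)
  from 1 2 3 4 show ?thesis
  proof eventually_elim
    case (elim r)
    have fb: "measure lebesgue (f \<inter> ball x r) = (\<Sum>e\<in>S. A e x r)" for x
      unfolding A_def by (rule measure_face_inter) simp
    have "f \<inter> ball c r = ball c r" using elim(3) interior_subset by blast
    then have cc: "(\<Sum>e\<in>S. A e c r) = pi * r\<^sup>2"
      using fb[of c] measure_disc[of r c] elim(4) by simp
    have "(\<Sum>x\<in>W. measure lebesgue (f \<inter> ball x r)) = (\<Sum>x\<in>W. \<Sum>e\<in>S. A e x r)"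
      by (simp only: fb)
    also have "\<dots> = (\<Sum>e\<in>S. \<Sum>x\<in>W. A e x r)" by (rule sum.swap)
    also have "\<dots> = (\<Sum>e\<in>S. \<Sum>x\<in>e \<inter> V. A e x r)"
    proof (rule sum.cong[OF refl], rule sum.mono_neutral_right[OF finite_W])
      fix e assume e: "e \<in> S"
      show "e \<inter> V \<subseteq> W" using side_frontier[OF e] frontier_f by blast
      show "\<forall>x\<in>W - e \<inter> V. A e x r = 0" using elim(2) e by blast
    qed
    also have "\<dots> = (\<Sum>e\<in>S. pi * r\<^sup>2 / 2 - A e c r)"
      by (rule sum.cong) (use elim(1) in \<open>auto simp: algebra_simps\<close>)
    also have "\<dots> = (card S / 2 - 1) * (pi * r\<^sup>2)"
      by (simp add: sum_subtractf cc algebra_simps)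
    finally show ?case .
  qed
qed

lemma side_of_vertex:
  assumes "e \<in> S" "x \<in> e" "x \<in> W"
  obtains y where "x \<noteq> y" "e = closed_segment x y" "e \<inter> V = {x, y}" "y \<in> W"
proof -
  obtain a b where ab: "a \<noteq> b" "e = closed_segment a b" "e \<inter> V = {a, b}" "a \<in> W" "b \<in> W"
    using side_cases[OF assms(1)] .
  then have "x = a \<or> x = b" using assms by blast
  then show ?thesis
    using that[of b] that[of a] ab closed_segment_commute[of a b] by (auto simp: insert_commute)
qed

text \<open>Points near the radius from \<open>c\<close> to \<open>x\<close>, on the side given by \<open>s\<close>, lie in the
  cone over some side, and that side must end in \<open>x\<close>.\<close>

lemma neighbour_side_exists:
  assumes x: "x \<in> W" and s: "s = 1 \<or> s = -1"
  shows "\<exists>y. closed_segment x y \<in> S \<and> x \<noteq> y \<and> 0 < s * cross2 (x - c) (y - c)"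
proof -
  define a where "a = x - c"
  define n :: "real^2" where "n = vector [- a $ 2, a $ 1]"
  have "a \<noteq> 0" using frontier_not_centre[OF W_frontier[OF x]] by (simp add: a_def)
  have "cross2 a n = (a $ 1)\<^sup>2 + (a $ 2)\<^sup>2"
    by (simp add: n_def cross2_def power2_eq_square)
  moreover have "a $ 1 \<noteq> 0 \<or> a $ 2 \<noteq> 0" using \<open>a \<noteq> 0\<close> by (simp add: vec2_eq_iff)
  ultimately have n: "cross2 a n > 0" by (simp only: sum_power2_gt_zero_iff)
  \<comment> \<open>The points \<open>z t\<close> approach the midpoint of \<open>c\<close> and
    \<open>x\<close> from the side \<open>s\<close>. One of the finitely many cones contains
    \<open>z t\<close> for arbitrarily small \<open>t\<close>, and being closed it contains the
    midpoint.\<close>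
  define z where "z = (\<lambda>t. (c + (1/2) *\<^sub>R a) + (t * s) *\<^sub>R n)"
  have lim: "(z \<longlongrightarrow> c + (1/2) *\<^sub>R a) (at_right 0)"
    unfolding z_def by (auto intro!: tendsto_eq_intros)
  have mid: "c + (1/2) *\<^sub>R a \<in> interior f"
    unfolding a_def using radial_interior[of x "1/2"] x by simp
  have "\<forall>\<^sub>F t in at_right 0. z t \<in> interior f"
    by (rule topological_tendstoD[OF lim _ mid]) simp
  then have "\<forall>\<^sub>F t in at_right 0. \<exists>e\<in>S. z t \<in> cone_over c e"
  proof eventually_elim
    case (elim t)
    then have "z t \<in> f" using interior_subset by blast
    then show ?case using face_eq_cones by blast
  qed
  then have "\<exists>\<^sub>F t in at_right 0. \<exists>e\<in>S. z t \<in> cone_over c e"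
    by (intro eventually_frequently) auto
  from frequently_bex_finite[OF sides_finite[OF f] this]
  obtain e where e: "e \<in> S" "\<exists>\<^sub>F t in at_right 0. z t \<in> cone_over c e" by blast
  have "c + (1/2) *\<^sub>R a \<in> cone_over c e"
    by (rule frequently_in_closed[OF cone_closed[OF e(1)] lim e(2)])
  then obtain r p where p: "0 \<le> r" "p \<in> e" "c + (1/2) *\<^sub>R a = c + r *\<^sub>R (p - c)"
    by (auto simp: cone_over_def)
  then have rp: "(1/2) *\<^sub>R a = r *\<^sub>R (p - c)" by (simp only: add_left_cancel)
  then have "2 *\<^sub>R ((1/2) *\<^sub>R a) = 2 *\<^sub>R (r *\<^sub>R (p - c))" by simp
  then have "x - c = (2 * r) *\<^sub>R (p - c)" by (simp add: a_def)
  then have "x = p"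
    using radial_unique[of p x "2 * r"] side_frontier[OF e(1)] p W_frontier[OF x] by auto
  then have "x \<in> e" using p by simp
  then obtain y where y: "x \<noteq> y" "e = closed_segment x y" "e \<inter> V = {x, y}" "y \<in> W"
    using side_of_vertex[OF e(1) _ x] by blast
  have "\<exists>\<^sub>F t in at_right 0. (0 :: real) < t \<and> z t \<in> cone_over c e"
    using e(2) eventually_at_right_less[of "0 :: real"] by (rule frequently_eventually_conj)
  then obtain t where t: "z t \<in> cone_over c e" "0 < t" using frequently_ex by blast
  have "z t \<in> convex hull {c, x, y}" using t(1) unfolding y(2) cone_over_segment .
  then obtain \<alpha> \<beta> where ab: "0 \<le> \<beta>" "z t = c + \<alpha> *\<^sub>R (x - c) + \<beta> *\<^sub>R (y - c)"
    unfolding in_triangle by blast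
  have "cross2 a (z t - c) = t * s * cross2 a n"
    by (simp add: z_def cross2_add)
  moreover have "cross2 a (z t - c) = \<beta> * cross2 (x - c) (y - c)"
    unfolding ab(2) by (simp add: a_def cross2_add(2))
  ultimately have "t * s * cross2 a n = \<beta> * cross2 (x - c) (y - c)" by simp
  then have "s * (t * s * cross2 a n) = \<beta> * (s * cross2 (x - c) (y - c))" by simp
  moreover have "s * (t * s * cross2 a n) = t * cross2 a n" using s by auto
  ultimately have "\<beta> * (s * cross2 (x - c) (y - c)) = t * cross2 a n" by simp
  then have "0 < \<beta> * (s * cross2 (x - c) (y - c))" using t n by simp
  then have "0 < s * cross2 (x - c) (y - c)" using ab(1) by (auto simp: zero_less_mult_iff)
  then show ?thesis using y e by blast
qed

text \<open>The cones over two such sides would overlap on one side of the radius to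
  \<open>x\<close>, while cones over different sides meet only in rays to common vertices.\<close>

lemma neighbour_side_unique:
  assumes "closed_segment x y \<in> S" "closed_segment x y' \<in> S" "x \<noteq> y" "x \<noteq> y'" and s: "s = 1 \<or> s = -1"
    and pos: "0 < s * cross2 (x - c) (y - c)" "0 < s * cross2 (x - c) (y' - c)"
  shows "y = y'"
proof (rule ccontr)
  assume "y \<noteq> y'"
  then have ne: "closed_segment x y \<noteq> closed_segment x y'"
    using assms(3,4) by (metis closed_segment_eq doubleton_eq_iff)
  define a where "a = x - c"
  define b where "b = y - c"
  define b' where "b' = y' - c"
  have ab: "cross2 a b \<noteq> 0" using pos(1) by (auto simp: a_def b_def)
  define \<rho> where "\<rho> = cross2 b' b / cross2 a b"
  define \<mu> where "\<mu> = cross2 a b' / cross2 a b"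
  have "0 < \<mu>"
    using s pos by (auto simp: \<mu>_def a_def b_def b'_def zero_less_divide_iff zero_less_mult_iff)
  have "cross2 a b *\<^sub>R b' = cross2 a b *\<^sub>R (\<rho> *\<^sub>R a + \<mu> *\<^sub>R b)"
    using ab cross2_expansion[of a b b'] by (simp add: \<rho>_def \<mu>_def scaleR_right_distrib)
  then have b': "b' = \<rho> *\<^sub>R a + \<mu> *\<^sub>R b" using ab by simp
  \<comment> \<open>So small that the coordinates of \<open>z\<close> are admissible in both cones,
    with \<epsilon> \<le> 1/2 and the perturbation of the coordinates at most 1/2.\<close>
  define \<epsilon> where "\<epsilon> = 1 / (2 * (1 + \<bar>\<rho>\<bar> + \<bar>\<mu>\<bar>))"
  have e: "0 < \<epsilon>" "\<epsilon> * (1 + \<bar>\<rho>\<bar> + \<bar>\<mu>\<bar>) = 1 / 2"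
    by (simp_all add: \<epsilon>_def field_simps)
  define z where "z = c + (1/2) *\<^sub>R a + \<epsilon> *\<^sub>R b'"
  have b1: "\<bar>\<epsilon> * \<rho>\<bar> + \<bar>\<epsilon> * \<mu>\<bar> \<le> 1 / 2" "\<epsilon> \<le> 1 / 2"
  proof -
    have "0 \<le> \<epsilon> * \<bar>\<rho>\<bar>" "0 \<le> \<epsilon> * \<bar>\<mu>\<bar>" using e(1) by auto
    moreover have "\<epsilon> + \<epsilon> * \<bar>\<rho>\<bar> + \<epsilon> * \<bar>\<mu>\<bar> = 1 / 2" using e(2) by (simp add: distrib_left)
    moreover have "\<bar>\<epsilon> * \<rho>\<bar> = \<epsilon> * \<bar>\<rho>\<bar>" "\<bar>\<epsilon> * \<mu>\<bar> = \<epsilon> * \<bar>\<mu>\<bar>" using e(1) by (simp_all add: abs_mult)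
    ultimately show "\<bar>\<epsilon> * \<rho>\<bar> + \<bar>\<epsilon> * \<mu>\<bar> \<le> 1 / 2" "\<epsilon> \<le> 1 / 2" using e(1) by linarith+
  qed
  have "z \<in> cone_over c (closed_segment x y')"
    unfolding cone_over_segment in_triangle using e(1) b1(2)
    by (intro exI[of _ "1/2"] exI[of _ \<epsilon>]) (simp add: z_def a_def b'_def)
  moreover have "z \<in> cone_over c (closed_segment x y)"
    unfolding cone_over_segment in_triangle
  proof (intro exI conjI)
    show "z = c + (1/2 + \<epsilon> * \<rho>) *\<^sub>R (x - c) + (\<epsilon> * \<mu>) *\<^sub>R (y - c)"
      unfolding z_def b' a_def[symmetric] b_def[symmetric] by (simp add: algebra_simps)
    show "0 \<le> 1/2 + \<epsilon> * \<rho>"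
      using b1(1) abs_ge_minus_self[of "\<epsilon> * \<rho>"] abs_ge_zero[of "\<epsilon> * \<mu>"] by linarith
    show "0 \<le> \<epsilon> * \<mu>" using e(1) \<open>0 < \<mu>\<close> by simp
    show "1/2 + \<epsilon> * \<rho> + \<epsilon> * \<mu> \<le> 1"
      using b1(1) abs_ge_self[of "\<epsilon> * \<rho>"] abs_ge_self[of "\<epsilon> * \<mu>"] by linarith
  qed
  moreover have cz: "cross2 a (z - c) = \<epsilon> * cross2 a b'" by (simp add: z_def cross2_add)
  then have cz0: "cross2 a (z - c) \<noteq> 0" using e(1) pos(2) by (auto simp: a_def b'_def)
  then have "z \<noteq> c" by auto
  ultimately obtain v r where v: "v \<in> closed_segment x y \<inter> closed_segment x y'" "v \<in> V" "z = c + r *\<^sub>R (v - c)"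
    using cones_meet[OF assms(1,2) ne, of z] by blast
  have "closed_segment x y \<inter> V = {x, y}" "closed_segment x y' \<inter> V = {x, y'}"
    using side_vertices assms(1,2) by auto
  then have "v = x" using v \<open>y \<noteq> y'\<close> by blast
  then have "cross2 a (z - c) = 0" using v(3) by (simp add: a_def)
  then show False using cz0 by simp
qed

text \<open>The successor in counterclockwise order around \<open>c\<close>.\<close>

definition next_vertex :: "real^2 \<Rightarrow> real^2" where
  "next_vertex x = (THE y. closed_segment x y \<in> S \<and> x \<noteq> y \<and> 0 < cross2 (x - c) (y - c))"

lemma next_vertex:
  assumes "x \<in> W"
  shows "closed_segment x (next_vertex x) \<in> S" "x \<noteq> next_vertex x"
    "0 < cross2 (x - c) (next_vertex x - c)" "next_vertex x \<in> W"
proof -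
  have "\<exists>!y. closed_segment x y \<in> S \<and> x \<noteq> y \<and> 0 < cross2 (x - c) (y - c)"
    using neighbour_side_exists[OF assms, of 1] neighbour_side_unique[of x _ _ 1] by auto
  from theI'[OF this] show 1: "closed_segment x (next_vertex x) \<in> S" "x \<noteq> next_vertex x"
    "0 < cross2 (x - c) (next_vertex x - c)" unfolding next_vertex_def by auto
  then show "next_vertex x \<in> W" using side_ends by blast
qed

lemma next_vertex_eqI:
  assumes "x \<in> W" "closed_segment x y \<in> S" "x \<noteq> y" "0 < cross2 (x - c) (y - c)"
  shows "next_vertex x = y"
  using neighbour_side_unique[of x "next_vertex x" y 1] next_vertex[OF assms(1)] assms by simp

text \<open>Surjective, since the neighbour of \<open>x\<close> in clockwise direction has
  \<open>x\<close> as its successor.\<close>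

lemma next_vertex_bij: "bij_betw next_vertex W W"
proof -
  have "W \<subseteq> next_vertex ` W"
  proof
    fix x assume x: "x \<in> W"
    obtain y where y: "closed_segment x y \<in> S" "x \<noteq> y" "0 < -1 * cross2 (x - c) (y - c)"
      using neighbour_side_exists[OF x, of "-1"] by auto
    have "y \<in> W" using y side_ends by blast
    moreover have "next_vertex y = x"
      by (rule next_vertex_eqI) (use y \<open>y \<in> W\<close> cross2_commute[of "x - c" "y - c"] in \<open>auto simp: closed_segment_commute\<close>)
    ultimately show "x \<in> next_vertex ` W" by blast
  qed
  then have im: "next_vertex ` W = W" using next_vertex(4) by blast
  then have "inj_on next_vertex W" using finite_W by (simp add: eq_card_imp_inj_on)
  then show ?thesis using im by (simp add: bij_betw_def)
qed

text \<open>Each side is charged to the end from which it runs counterclockwise.\<close>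

lemma sides_bij: "bij_betw (\<lambda>x. closed_segment x (next_vertex x)) W S"
proof (rule bij_betw_imageI)
  show "inj_on (\<lambda>x. closed_segment x (next_vertex x)) W"
  proof (rule inj_onI, rule ccontr)
    fix x x' assume x: "x \<in> W" "x' \<in> W" and eq: "closed_segment x (next_vertex x) = closed_segment x' (next_vertex x')"
      and ne: "x \<noteq> x'"
    then have "next_vertex x = x'" "next_vertex x' = x" by (metis closed_segment_eq doubleton_eq_iff)+
    then show False
      using next_vertex(3)[OF x(1)] next_vertex(3)[OF x(2)] cross2_commute[of "x - c" "x' - c"] by simp
  qed
  show "(\<lambda>x. closed_segment x (next_vertex x)) ` W = S"
  proof
    show "(\<lambda>x. closed_segment x (next_vertex x)) ` W \<subseteq> S" using next_vertex(1) by blast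
    show "S \<subseteq> (\<lambda>x. closed_segment x (next_vertex x)) ` W"
    proof
      fix e assume e: "e \<in> S"
      obtain x y where xy: "x \<noteq> y" "e = closed_segment x y" "e \<inter> V = {x, y}" "x \<in> W" "y \<in> W"
        using side_cases[OF e] .
      have "cross2 (x - c) (y - c) \<noteq> 0" using side_cross e xy by blast
      then consider "0 < cross2 (x - c) (y - c)" | "0 < cross2 (y - c) (x - c)"
        using cross2_commute[of "x - c" "y - c"] by linarith
      then show "e \<in> (\<lambda>x. closed_segment x (next_vertex x)) ` W"
      proof cases
        case 1
        then have "next_vertex x = y" using next_vertex_eqI[OF xy(4)] xy e by blast
        then show ?thesis using xy by blast
      next
        case 2
        then have "next_vertex y = x"
          using next_vertex_eqI[OF xy(5), of x] xy e closed_segment_commute[of x y] by simp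
        then show ?thesis using xy closed_segment_commute[of x y] by blast
      qed
    qed
  qed
qed

lemma card_W: "card W = card S"
  using bij_betw_same_card[OF sides_bij] .

text \<open>A single orbit of \<open>next_vertex\<close> exhausts the vertices: the sides starting
  in the orbit and those starting outside it form two disjoint closed sets that cover the connected
  frontier.\<close>

lemma face_cycle:
  obtains p :: "nat \<Rightarrow> real^2" and k where "k = card S" "3 \<le> k" "p k = p 0" "\<And>i. p i \<in> W"
    "\<And>i. closed_segment (p i) (p (Suc i)) \<in> S" "\<And>i. p i \<noteq> p (Suc i)" "W = p ` {..<k}"
    "measure lebesgue f = (\<Sum>i<k. cross2 (p i - c) (p (Suc i) - c)) / 2"
proof -
  obtain e where "e \<in> S" using sides_nonempty by blast
  then obtain x0 where x0: "x0 \<in> W" using side_cases by metis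
  define p where "p = (\<lambda>i. (next_vertex ^^ i) x0)"
  obtain m where m: "0 < m" "p m = x0" "inj_on p {..<m}" and pW: "\<And>i. p i \<in> W"
    using bij_eventually_cyclic[OF next_vertex_bij finite_W x0] unfolding p_def by blast
  have pSuc: "p (Suc i) = next_vertex (p i)" for i by (simp add: p_def)
  have pp: "0 < cross2 (p i - c) (p (Suc i) - c)" for i using next_vertex(3)[OF pW[of i]] by (simp add: pSuc)
  define C where "C = p ` {..<m}"
  have C: "C \<subseteq> W" "x0 \<in> C" using pW m by (auto simp: C_def p_def image_iff intro!: bexI[of _ 0])
  have C_next: "next_vertex x \<in> C" if x: "x \<in> C" for x
  proof -
    obtain i where i: "x = p i" "i < m" using x by (auto simp: C_def)
    show ?thesis
    proof (cases "Suc i = m")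
      case True
      then show ?thesis using i pSuc[of i] m(2) C(2) by simp
    next
      case False
      then show ?thesis using i pSuc[of i] by (auto simp: C_def intro!: image_eqI[of _ _ "Suc i"])
    qed
  qed
  let ?e = "\<lambda>x. closed_segment x (next_vertex x)"
  have CW_next: "next_vertex x \<in> W - C" if "x \<in> W - C" for x
  proof -
    have im: "next_vertex ` C = C"
      using C_next finite_subset[OF C(1) finite_W] inj_on_subset[OF bij_betw_imp_inj_on[OF next_vertex_bij] C(1)]
      by (intro endo_inj_surj) auto
    have "next_vertex x \<in> next_vertex ` C \<longleftrightarrow> x \<in> C"
      by (rule inj_on_image_mem_iff[OF bij_betw_imp_inj_on[OF next_vertex_bij] _ C(1)]) (use that in blast)
    then have "next_vertex x \<notin> C" unfolding im using that by blast
    then show ?thesis using next_vertex(4) that by blast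
  qed
  have fr: "frontier f = \<Union>(?e ` C) \<union> \<Union>(?e ` (W - C))"
  proof -
    have "W = C \<union> (W - C)" using C(1) by blast
    then have "S = ?e ` C \<union> ?e ` (W - C)"
      using bij_betw_imp_surj_on[OF sides_bij] by (metis image_Un)
    then show ?thesis unfolding frontier_sides by (simp only: Union_Un_distrib)
  qed
  have disj: "\<Union>(?e ` C) \<inter> \<Union>(?e ` (W - C)) = {}"
  proof (rule equals0I)
    fix q assume "q \<in> \<Union>(?e ` C) \<inter> \<Union>(?e ` (W - C))"
    then obtain x x' where x: "x \<in> C" "q \<in> ?e x" "x' \<in> W - C" "q \<in> ?e x'" by blast
    have xW: "x \<in> W" "x' \<in> W" using x C(1) by auto
    have eV: "?e v \<inter> V = {v, next_vertex v}" if "v \<in> W" for v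
      by (rule side_vertices[OF next_vertex(1)[OF that]])
    have "x \<noteq> x'" using x by blast
    then have "?e x \<noteq> ?e x'" using inj_onD[OF bij_betw_imp_inj_on[OF sides_bij] _ xW] by blast
    then have "q \<in> V"
      using edges_meet[OF side_edge side_edge, OF next_vertex(1)[OF xW(1)] next_vertex(1)[OF xW(2)]] x by blast
    then have "q \<in> {x, next_vertex x}" "q \<in> {x', next_vertex x'}" using eV xW x by blast+
    then have "q = x \<or> q = next_vertex x" "q = x' \<or> q = next_vertex x'" by simp_all
    then have "q \<in> C" "q \<in> W - C" using x(1,3) C_next[OF x(1)] CW_next[OF x(3)] by metis+
    then show False by blast
  qed
  have "W - C = {}"
  proof (rule ccontr)
    assume "W - C \<noteq> {}"
    then have "\<Union>(?e ` (W - C)) \<noteq> {}" by force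
    moreover have "\<Union>(?e ` C) \<noteq> {}" using C(2) by force
    moreover have "closed (\<Union>(?e ` C))" "closed (\<Union>(?e ` (W - C)))"
      using finite_W finite_subset[OF C(1) finite_W] by (auto intro!: closed_Union)
    moreover have "\<not> connected (P \<union> Q)"
      if "closed P" "closed Q" "P \<inter> Q = {}" "P \<noteq> {}" "Q \<noteq> {}" for P Q :: "(real^2) set"
      using that unfolding connected_closed by blast
    ultimately show False using connected_frontier disj unfolding fr by blast
  qed
  then have CW: "C = W" using C(1) by blast
  then have km: "m = card S" using card_W card_image[OF m(3)] by (simp add: C_def)
  \<comment> \<open>Cycles of length 1 or 2 contradict the positive orientation of every
    step.\<close>
  have "m \<noteq> 1" using pp[of 0] m(2) by (auto simp: p_def)
  moreover have "m \<noteq> 2"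
  proof
    assume "m = 2"
    then show False
      using pp[of 0] pp[of 1] m(2) cross2_commute[of "p 0 - c" "p 1 - c"]
      by (simp add: numeral_2_eq_2 p_def)
  qed
  ultimately have "3 \<le> m" using m(1) by linarith
  have "measure lebesgue f = (\<Sum>x\<in>W. measure lebesgue (cone_over c (?e x)))"
    unfolding measure_face using sum.reindex_bij_betw[OF sides_bij, of "\<lambda>e. measure lebesgue (cone_over c e)"] by simp
  also have "\<dots> = (\<Sum>x\<in>W. cross2 (x - c) (next_vertex x - c) / 2)"
    by (rule sum.cong[OF refl]) (simp only: measure_cone[OF next_vertex(1)] abs_of_pos[OF next_vertex(3)])
  also have "\<dots> = (\<Sum>i<m. cross2 (p i - c) (p (Suc i) - c) / 2)"
    unfolding CW[symmetric] C_def sum.reindex[OF m(3)] by (simp add: pSuc)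
  finally have area: "measure lebesgue f = (\<Sum>i<m. cross2 (p i - c) (p (Suc i) - c)) / 2"
    by (simp add: sum_divide_distrib)
  show ?thesis
  proof (rule that[OF km \<open>3 \<le> m\<close> _ pW _ _ _ area])
    show "p m = p 0" using m(2) by (simp add: p_def)
    show "closed_segment (p i) (p (Suc i)) \<in> S" "p i \<noteq> p (Suc i)" for i
      unfolding pSuc using next_vertex(1,2)[OF pW] by blast+
    show "W = p ` {..<m}" using CW C_def by simp
  qed
qed

end

section \<open>Packings as subdivisions with unit edges\<close>

locale norm_subdivision = symmetric_domain K + subdivision_face V E F f c
  for K V E F f c +
  assumes edge_unit: "\<And>x y. closed_segment x y \<in> E \<Longrightarrow> x \<noteq> y \<Longrightarrow> (1/2) *\<^sub>R (y - x) \<in> unit"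
    and card_sides: "card (sides E f) \<le> 6"
begin

text \<open>The line in the second bound takes at 3 and 4 sides exactly the values assumed in
  \<open>tri\<close> and \<open>quad\<close>. The first bound uses only that triangles have at most
  the area of \<open>K\<close> and quadrilaterals at most twice that area.\<close>

lemma face_area_le_linear:
  fixes s :: real
  assumes s: "10 / 9 \<le> s" "s \<le> 3 / 2"
    and tri: "\<And>w1 w3. w1 \<in> unit \<Longrightarrow> w3 \<in> unit \<Longrightarrow> w1 + w3 \<in> unit \<Longrightarrow> 2 * cross2 w1 w3 \<le> area * (8 - 3 * s) / 7"
    and quad: "\<And>a b. a \<in> K \<Longrightarrow> b \<in> K \<Longrightarrow> 4 * cross2 a b \<le> area * (8 + 4 * s) / 7"
  shows "measure lebesgue f \<le> area * (real (card S) - 2)"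
    and "measure lebesgue f \<le> area * (s * card S + (8 - 24 * s) / 7)"
proof -
  obtain k p where cyc: "k = card S" "3 \<le> k" "p k = p 0" "\<And>i. p i \<in> W"
    "\<And>i. closed_segment (p i) (p (Suc i)) \<in> S" "\<And>i. p i \<noteq> p (Suc i)" "W = p ` {..<k}"
    "measure lebesgue f = (\<Sum>i<k. cross2 (p i - c) (p (Suc i) - c)) / 2"
    by (rule face_cycle) (rule that)
  note p = cyc(1-3,5,6,8)
  define u where "u = (\<lambda>i. (1/2) *\<^sub>R (p (Suc i) - p i))"
  have u: "u i \<in> unit" for i
    unfolding u_def using edge_unit side_edge p by blast
  then have uK: "u i \<in> K" for i by (auto simp: unit_def)
  have half: "2 * cross2 (u i) (u j) \<le> area" for i j using cross2_le_half_area uK by blast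
  have chain: "cross2 (u i) (u j) + cross2 (u j) (u l) + cross2 (u i) (u l) \<le> area" for i j l
    using chain_cross2_le_area uK by blast
  have q: "4 * cross2 (u i) (u j) \<le> area * (8 + 4 * s) / 7" for i j using quad uK by blast
  have "u i = (1/2) *\<^sub>R (p (Suc i) - p i)" for i by (simp add: u_def)
  note poly = closed_polygon_area[of p k u c, OF p(3) this]
  have "k = 3 \<or> k = 4 \<or> k = 5 \<or> k = 6" using p(1,2) card_sides by linarith
  then have "measure lebesgue f \<le> area * (k - 2) \<and> measure lebesgue f \<le> area * (s * k + (8 - 24 * s) / 7)"
  proof (elim disjE)
    assume k: "k = 3"
    \<comment> \<open>The half-sides add up to 0, so \<open>u 0 + u 1\<close> is again in
      \<open>unit\<close> and the triangle bound \<open>tri\<close> applies.\<close>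
    have "u 0 + u 1 = - u 2"
      using p(3) unfolding k u_def by (simp add: numeral_3_eq_3 numeral_2_eq_2 vec2_eq_iff field_simps)
    then have "u 0 + u 1 \<in> unit" using unit_minus[OF u[of 2]] by simp
    then have "2 * cross2 (u 0) (u 1) \<le> area * (8 - 3 * s) / 7" using tri u by blast
    moreover have "measure lebesgue f = 2 * cross2 (u 0) (u 1)" using p(6) poly(1)[OF k] by simp
    ultimately show ?thesis using half[of 0 1] k by (simp add: field_simps)
  next
    assume k: "k = 4"
    have "measure lebesgue f = 2 * cross2 (u 0) (u 1) + 2 * cross2 (u 2) (u 3)" using p(6) poly(2)[OF k] by simp
    then show ?thesis using half[of 0 1] half[of 2 3] q[of 0 1] q[of 2 3] k by (simp add: field_simps)
  next
    assume k: "k = 5"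
    have m: "measure lebesgue f = 2 * (cross2 (u 0) (u 1) + cross2 (u 1) (u 2) + cross2 (u 0) (u 2)) + 2 * cross2 (u 3) (u 4)"
      using p(6) poly(3)[OF k] by simp
    \<comment> \<open>Equivalent to \<open>10 / 9 \<le> s\<close>. The same condition makes the
      bound 4 for hexagons fit below the line.\<close>
    have "area * (2 + (4 + 2 * s) / 7) \<le> area * (s * 5 + (8 - 24 * s) / 7)"
      using s area_pos by (intro mult_left_mono) (auto simp: field_simps)
    moreover have "area * (2 + (4 + 2 * s) / 7) = 2 * area + area * (8 + 4 * s) / 7 / 2"
      by (simp add: field_simps)
    ultimately show ?thesis using m chain[of 0 1 2] half[of 3 4] q[of 3 4] k by simp
  next
    assume k: "k = 6"
    have m: "measure lebesgue f = 2 * (cross2 (u 0) (u 1) + cross2 (u 1) (u 2) + cross2 (u 0) (u 2))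
        + 2 * (cross2 (u 3) (u 4) + cross2 (u 4) (u 5) + cross2 (u 3) (u 5))"
      using p(6) poly(4)[OF k] by simp
    have "area * 4 \<le> area * (s * 6 + (8 - 24 * s) / 7)"
      using s area_pos by (intro mult_left_mono) (auto simp: field_simps)
    then show ?thesis using m chain[of 0 1 2] chain[of 3 4 5] k by simp
  qed
  moreover have "real (k - 2) = real k - 2" using p(2) by simp
  ultimately show "measure lebesgue f \<le> area * (real (card S) - 2)"
    "measure lebesgue f \<le> area * (s * card S + (8 - 24 * s) / 7)"
    using p(1) by (simp_all add: of_nat_diff)
qed

text \<open>Two vertices are joined by at most six steps along the boundary cycle, and the face is
  the convex hull of its frontier.\<close>

lemma face_subset_cball:
  assumes edge: "\<And>x y. closed_segment x y \<in> E \<Longrightarrow> dist x y \<le> d" and x: "x \<in> W"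
  shows "f \<subseteq> cball x (6 * d)"
proof -
  obtain p k where p: "k = card S" "W = p ` {..<k}" "\<And>i. closed_segment (p i) (p (Suc i)) \<in> S"
    using face_cycle by metis
  have step: "dist (p i) (p (Suc i)) \<le> d" for i using edge side_edge p(3) by blast
  then have d0: "0 \<le> d" using zero_le_dist order_trans by blast
  have far: "dist (p i) (p (i + j)) \<le> j * d" for i j
  proof (induction j)
    case (Suc j)
    have "dist (p i) (p (i + Suc j)) \<le> dist (p i) (p (i + j)) + dist (p (i + j)) (p (Suc (i + j)))"
      using dist_triangle by simp
    then show ?case using Suc step[of "i + j"] by (simp add: algebra_simps)
  qed simp
  have le: "dist (p i) (p j) \<le> 6 * d" if "i \<le> j" "j < k" for i j
  proof -
    have "dist (p i) (p j) \<le> (j - i) * d" using far[of i "j - i"] that by simp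
    also have "\<dots> \<le> 6 * d" using that p(1) card_sides d0 by (intro mult_right_mono) auto
    finally show ?thesis .
  qed
  obtain a where a: "a < k" "x = p a" using x p(2) by auto
  have "W \<subseteq> cball x (6 * d)"
  proof
    fix y assume "y \<in> W"
    then obtain b where "b < k" "y = p b" using p(2) by auto
    then show "y \<in> cball x (6 * d)" using a le[of a b] le[of b a] by (cases "a \<le> b") (auto simp: dist_commute)
  qed
  then have "e \<subseteq> cball x (6 * d)" if "e \<in> S" for e
    using side_cases[OF that] closed_segment_subset[OF _ _ convex_cball] by (metis subsetD)
  then have "frontier f \<subseteq> cball x (6 * d)" using frontier_sides by blast
  then have "convex hull (frontier f) \<subseteq> cball x (6 * d)" by (intro hull_minimal convex_cball)
  then show ?thesis using Krein_Milman_frontier[OF face_convex[OF f] face_compact[OF f]] by simp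
qed

end

text \<open>Fixes the witnesses in \<open>admissible_packing\<close> and
  \<open>centrosymmetric\<close>.\<close>

locale packing =
  fixes D X :: "(real^2) set" and F :: "(real^2) set set" and c0 :: "real^2"
  assumes domain: "convex_domain D" and centre: "\<And>x. x \<in> D \<Longrightarrow> 2 *\<^sub>R c0 - x \<in> D"
    and pack: "translate_packing D X"
    and subdiv: "polygonal_subdivision X (touching_segments D X) F"
    and six: "\<And>f. f \<in> F \<Longrightarrow> card (sides (touching_segments D X) f) \<le> 6"
begin

definition K :: "(real^2) set" where "K = (\<lambda>x. x - c0) ` D"

abbreviation "E \<equiv> touching_segments D X"

lemma D_facts: "compact D" "convex D" "interior D \<noteq> {}"
  using domain by (auto simp: convex_domain_def)

lemma K_iff: "w \<in> K \<longleftrightarrow> w + c0 \<in> D"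
  by (force simp: K_def image_iff)

lemma K_translate: "K = (+) (- c0) ` D"
  by (auto simp: K_def)

lemma interior_K: "w \<in> interior K \<longleftrightarrow> w + c0 \<in> interior D"
  unfolding K_translate interior_translation by (force simp: image_iff)

sublocale symmetric_domain K
proof
  show "compact K" unfolding K_translate using D_facts compact_translation by blast
  show "convex K" unfolding K_translate using D_facts convex_translation by blast
  show "interior K \<noteq> {}" unfolding K_translate interior_translation using D_facts by simp
  show "- x \<in> K" if "x \<in> K" for x
    using centre[of "x + c0"] that unfolding K_iff by (simp add: scaleR_2)
qed

lemma area_K: "area = measure lebesgue D"
  unfolding K_translate by (rule measure_translation)

text \<open>A common point \<open>x + d = y + d'\<close> exhibits the half difference as the
  midpoint of two points of \<open>K\<close>. If it were interior to \<open>K\<close>, the midpoint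
  of the two centres would be interior to both translates.\<close>

lemma neighbour_unit:
  assumes x: "x \<in> X" and y: "y \<in> neighbours D X x"
  shows "(1/2) *\<^sub>R (y - x) \<in> unit"
proof -
  obtain z where "z \<in> (+) x ` D" "z \<in> (+) y ` D" using y by (auto simp: neighbours_def)
  then obtain d d' where d: "d \<in> D" "d' \<in> D" "z = x + d" "z = y + d'" by auto
  have dK: "d - c0 \<in> K" "- (d' - c0) \<in> K" using d sym[of "d' - c0"] by (auto simp: K_iff)
  have "(1/2) *\<^sub>R (y - x) = (1/2) *\<^sub>R (d - c0) + (1/2) *\<^sub>R (- (d' - c0))"
  proof -
    have "y - x = (d - c0) + (- (d' - c0))" using d(3,4) by (simp add: algebra_simps)
    then show ?thesis by (simp only: scaleR_right_distrib)
  qed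
  also have "\<dots> \<in> K" by (rule convexD[OF convex dK]) auto
  finally have 1: "(1/2) *\<^sub>R (y - x) \<in> K" .
  have "(1/2) *\<^sub>R (y - x) \<notin> interior K"
  proof
    define w where "w = (1/2) *\<^sub>R (y - x)"
    assume "(1/2) *\<^sub>R (y - x) \<in> interior K"
    then have w: "w \<in> interior K" by (simp add: w_def)
    have "uminus ` K = K" using sym by (force simp: image_iff)
    then have "- w \<in> interior K" using w by (metis imageI interior_negations)
    then have "x + (w + c0) \<in> interior ((+) x ` D)" "y + (- w + c0) \<in> interior ((+) y ` D)"
      using w by (auto simp: interior_translation interior_K)
    moreover have "x + (w + c0) = y + (- w + c0)" by (simp add: w_def vec2_eq_iff field_simps)
    ultimately show False
      using pack y x by (auto simp: translate_packing_def pairwise_def neighbours_def)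
  qed
  then show ?thesis using 1 by (simp add: unit_def)
qed

lemma neighbours_sym: "x \<in> X \<Longrightarrow> y \<in> neighbours D X x \<Longrightarrow> y \<in> X \<and> x \<in> neighbours D X y"
  by (auto simp: neighbours_def)

lemma edge_touching:
  assumes "closed_segment x y \<in> E"
  shows "x \<in> X \<and> y \<in> neighbours D X x"
proof -
  obtain a b where "closed_segment x y = closed_segment a b" "a \<in> X" "b \<in> neighbours D X a"
    using assms by (auto simp: touching_segments_def)
  then show ?thesis
    using neighbours_sym[of a b] closed_segment_eq[of x y a b] by (auto simp: doubleton_eq_iff)
qed

lemma edge_unit:
  assumes "closed_segment x y \<in> E" "x \<noteq> y"
  shows "(1/2) *\<^sub>R (y - x) \<in> unit"
  using edge_touching[OF assms(1)] neighbour_unit by blast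

text \<open>Measured from the origin and not from the centre of \<open>D\<close>, so that the
  translate by \<open>x\<close> stays within \<open>\<rho>\<close> of \<open>x\<close>.\<close>

definition \<rho> :: real where "\<rho> = (SOME r. 0 < r \<and> D \<subseteq> ball 0 r)"

lemma \<rho>: "0 < \<rho>" "D \<subseteq> ball 0 \<rho>"
  using someI_ex[of "\<lambda>r. 0 < r \<and> D \<subseteq> ball 0 r"] bounded_subset_ballD[OF compact_imp_bounded[OF D_facts(1)], of 0]
  by (auto simp: \<rho>_def)

lemma translate_norm: "z \<in> (+) x ` D \<Longrightarrow> norm (z - x) < \<rho>"
  using \<rho>(2) by auto

lemma neighbour_dist:
  assumes "y \<in> neighbours D X x"
  shows "dist x y \<le> 2 * \<rho>"
proof -
  obtain z where z: "z \<in> (+) x ` D" "z \<in> (+) y ` D" using assms by (auto simp: neighbours_def)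
  have "dist x y \<le> dist z x + dist z y" by (metis dist_commute dist_triangle2 add.commute)
  then show ?thesis using translate_norm[OF z(1)] translate_norm[OF z(2)] by (simp add: dist_norm)
qed

lemma edge_dist: "closed_segment x y \<in> E \<Longrightarrow> dist x y \<le> 2 * \<rho>"
  using edge_touching neighbour_dist by blast

lemma card_area_le:
  assumes "finite Y" "Y \<subseteq> X" "A \<in> lmeasurable" "\<And>x. x \<in> Y \<Longrightarrow> (+) x ` D \<subseteq> A"
  shows "card Y * area \<le> measure lebesgue A"
proof -
  have m: "(+) x ` D \<in> lmeasurable" for x
    using D_facts compact_translation lmeasurable_compact by blast
  have "(\<Sum>x\<in>Y. measure lebesgue ((+) x ` D)) = measure lebesgue (\<Union>x\<in>Y. (+) x ` D)"
  proof (rule measure_negligible_finite_Union_image[symmetric])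
    show "pairwise (\<lambda>x y. negligible ((+) x ` D \<inter> (+) y ` D)) Y"
    proof (rule pairwiseI)
      fix x y assume "x \<in> Y" "y \<in> Y" "x \<noteq> y"
      then have "interior ((+) x ` D \<inter> (+) y ` D) = {}"
        using pack assms(2) by (auto simp: translate_packing_def pairwise_def)
      then show "negligible ((+) x ` D \<inter> (+) y ` D)"
        using D_facts by (subst negligible_convex_interior) (auto intro!: convex_Int convex_translation)
    qed
  qed (use assms m in auto)
  also have "\<dots> \<le> measure lebesgue A"
    using assms m by (intro measure_mono_fmeasurable) (auto intro!: sets.finite_UN fmeasurableD)
  finally show ?thesis by (simp add: measure_translation area_K)
qed

text \<open>Finiteness results from the bound itself: an infinite family would have finite
  subfamilies that are too large.\<close>

lemma card_area_le_bounded: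
  assumes "Y \<subseteq> X" "A \<in> lmeasurable" "\<And>x. x \<in> Y \<Longrightarrow> (+) x ` D \<subseteq> A"
  shows "finite Y" "card Y * area \<le> measure lebesgue A"
proof -
  show fin: "finite Y"
  proof (rule ccontr)
    assume inf: "infinite Y"
    define n where "n = Suc (nat \<lceil>measure lebesgue A / area\<rceil>)"
    obtain Z where Z: "Z \<subseteq> Y" "finite Z" "card Z = n" using infinite_arbitrarily_large[OF inf] by blast
    have "card Z * area \<le> measure lebesgue A"
      by (rule card_area_le) (use assms Z in auto)
    then have "n \<le> measure lebesgue A / area" using area_pos Z by (simp add: field_simps)
    then show False unfolding n_def by linarith
  qed
  show "card Y * area \<le> measure lebesgue A"
    by (rule card_area_le[OF fin assms])
qed

lemma finite_X_cball: "finite (X \<inter> cball x r)"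
proof (rule card_area_le_bounded(1)[of _ "ball x (r + \<rho>)"])
  fix y assume y: "y \<in> X \<inter> cball x r"
  show "(+) y ` D \<subseteq> ball x (r + \<rho>)"
  proof
    fix z assume z: "z \<in> (+) y ` D"
    then show "z \<in> ball x (r + \<rho>)"
      using translate_norm[OF z] y dist_triangle[of x z y] by (simp add: dist_norm norm_minus_commute)
  qed
qed auto

sublocale plane_subdivision X E F
proof
  show "polygonal_subdivision X E F" by (rule subdiv)
  fix r
  have "{e \<in> E. e \<inter> cball 0 r \<noteq> {}} \<subseteq> (\<lambda>(x, y). closed_segment x y) `
      ((X \<inter> cball 0 (r + 2 * \<rho>)) \<times> (X \<inter> cball 0 (r + 2 * \<rho>)))"
  proof
    fix e assume e: "e \<in> {e \<in> E. e \<inter> cball 0 r \<noteq> {}}"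
    then obtain x y where xy: "e = closed_segment x y" "x \<in> X" "y \<in> neighbours D X x"
      by (auto simp: touching_segments_def)
    obtain z where z: "z \<in> closed_segment x y" "norm z \<le> r" using e xy by auto
    have "dist x y \<le> 2 * \<rho>" using neighbour_dist xy by blast
    moreover have "dist z x \<le> dist x y" "dist z y \<le> dist x y"
      using z(1) dist_in_closed_segment by blast+
    moreover have "norm x \<le> norm z + dist z x" "norm y \<le> norm z + dist z y"
      by (metis add.commute dist_norm norm_minus_commute norm_triangle_sub)+
    ultimately have "norm x \<le> r + 2 * \<rho>" "norm y \<le> r + 2 * \<rho>" using z(2) by linarith+
    then show "e \<in> (\<lambda>(x, y). closed_segment x y) ` ((X \<inter> cball 0 (r + 2 * \<rho>)) \<times> (X \<inter> cball 0 (r + 2 * \<rho>)))"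
      using xy neighbours_sym[of x y] by (intro image_eqI[of _ _ "(x, y)"]) auto
  qed
  then show "finite {e \<in> E. e \<inter> cball 0 r \<noteq> {}}"
    by (rule finite_subset) (intro finite_imageI finite_cartesian_product finite_X_cball)
qed

lemma norm_subdivision: "f \<in> F \<Longrightarrow> c \<in> interior f \<Longrightarrow> norm_subdivision K X E F f c"
  by unfold_locales (use edge_unit six in auto)

lemma subdivision_face: "f \<in> F \<Longrightarrow> c \<in> interior f \<Longrightarrow> subdivision_face X E F f c"
  by unfold_locales

text \<open>Six sides of length at most \<open>2 * \<rho>\<close>: no face extends farther than
  \<open>L\<close> from any of its vertices.\<close>

abbreviation L :: real where "L \<equiv> 12 * \<rho>"

lemma face_diameter:
  assumes "f \<in> F" "x \<in> X" "x \<in> f"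
  shows "f \<subseteq> cball x L"
proof -
  obtain c where "c \<in> interior f" using face_interior[OF assms(1)] by blast
  then interpret norm_subdivision K X E F f c by (rule norm_subdivision[OF assms(1)])
  show ?thesis using face_subset_cball[of "2 * \<rho>" x] edge_dist assms by auto
qed

lemma card_neighbours: "x \<in> X \<Longrightarrow> card {e \<in> E. x \<in> e} = card (neighbours D X x)"
proof -
  assume x: "x \<in> X"
  have "bij_betw (closed_segment x) (neighbours D X x) {e \<in> E. x \<in> e}"
  proof (rule bij_betw_imageI)
    show "inj_on (closed_segment x) (neighbours D X x)"
      by (rule inj_onI) (auto simp: closed_segment_eq doubleton_eq_iff)
    show "closed_segment x ` neighbours D X x = {e \<in> E. x \<in> e}"
    proof
      show "closed_segment x ` neighbours D X x \<subseteq> {e \<in> E. x \<in> e}"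
        using x by (auto simp: touching_segments_def)
      show "{e \<in> E. x \<in> e} \<subseteq> closed_segment x ` neighbours D X x"
      proof
        fix e assume e: "e \<in> {e \<in> E. x \<in> e}"
        then obtain a b where ab: "a \<noteq> b" "e = closed_segment a b" "e \<inter> X = {a, b}" using edge_cases by blast
        then have "x = a \<or> x = b" using e x by blast
        then obtain y where "e = closed_segment x y" using ab closed_segment_commute by metis
        then show "e \<in> closed_segment x ` neighbours D X x" using edge_touching[of x y] e by blast
      qed
    qed
  qed
  then show ?thesis by (rule bij_betw_same_card[symmetric])
qed

end

section \<open>Counting faces, edges and angles in discs\<close>

context packing
begin

abbreviation N :: "real \<Rightarrow> nat" where "N R \<equiv> card (X \<inter> cball 0 R)"

abbreviation deg_sum :: "real \<Rightarrow> nat" where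
  "deg_sum R \<equiv> \<Sum>x\<in>X \<inter> cball 0 R. card (neighbours D X x)"

text \<open>All neighbours of \<open>x\<close> are translates with disjoint interiors inside a disc
  of radius \<open>3 * \<rho>\<close> about \<open>x\<close>.\<close>

lemma degree_bounded: "\<exists>M. \<forall>x\<in>X. card (neighbours D X x) \<le> M"
proof -
  have "card (neighbours D X x) \<le> nat \<lceil>measure lebesgue (ball 0 (3 * \<rho>) :: (real^2) set) / area\<rceil>" if "x \<in> X" for x
  proof -
    have "(+) y ` D \<subseteq> ball x (3 * \<rho>)" if y: "y \<in> neighbours D X x" for y
    proof
      fix z assume z: "z \<in> (+) y ` D"
      then show "z \<in> ball x (3 * \<rho>)"
        using translate_norm[OF z] neighbour_dist[OF y] dist_triangle[of x z y]
        by (simp add: dist_norm norm_minus_commute)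
    qed
    then have "card (neighbours D X x) * area \<le> measure lebesgue (ball x (3 * \<rho>))"
      by (intro card_area_le_bounded(2)) (auto simp: neighbours_def)
    also have "\<dots> = measure lebesgue (ball 0 (3 * \<rho>) :: (real^2) set)"
      using \<rho>(1) by (simp add: circle_area)
    finally have "card (neighbours D X x) \<le> measure lebesgue (ball 0 (3 * \<rho>) :: (real^2) set) / area"
      using area_pos by (simp add: field_simps)
    then show ?thesis by linarith
  qed
  then show ?thesis by blast
qed

text \<open>Only vertices this close to the boundary of the disc can belong to faces that are
  missing in \<open>G R\<close>.\<close>

definition annulus :: "real \<Rightarrow> (real^2) set" where
  "annulus R = X \<inter> cball 0 R - cball 0 (R - L)"

text \<open>Linear in \<open>R\<close>, hence negligible against the area of the disc.\<close>

lemma annulus_card: "L + \<rho> \<le> R \<Longrightarrow> card (annulus R) * area \<le> 2 * pi * (2 * \<rho> + L) * R"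
proof -
  assume R: "L + \<rho> \<le> R"
  let ?A = "ball 0 (R + \<rho>) - ball (0 :: real^2) (R - L - \<rho>)"
  have "(+) x ` D \<subseteq> ?A" if x: "x \<in> annulus R" for x
  proof
    fix z assume z: "z \<in> (+) x ` D"
    have "norm x \<le> R" "R - L < norm x" using x by (auto simp: annulus_def)
    moreover have "norm z \<le> norm x + norm (z - x)" "norm x \<le> norm z + norm (z - x)"
      by (metis norm_triangle_sub, metis norm_minus_commute norm_triangle_sub)
    ultimately show "z \<in> ?A" using translate_norm[OF z] by auto
  qed
  then have "card (annulus R) * area \<le> measure lebesgue ?A"
    by (intro card_area_le_bounded(2)) (auto simp: annulus_def)
  also have "\<dots> = pi * (R + \<rho>)\<^sup>2 - pi * (R - L - \<rho>)\<^sup>2"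
    using R \<rho>(1) by (subst measurable_measure_Diff) (auto simp: circle_area)
  also have "\<dots> = pi * ((2 * \<rho> + L) * (2 * R - L))" by (simp add: power2_eq_square algebra_simps)
  also have "\<dots> \<le> pi * ((2 * \<rho> + L) * (2 * R))" using \<rho>(1) by (intro mult_left_mono) auto
  finally show ?thesis by (simp add: algebra_simps)
qed

text \<open>Faces are selected by their vertices, so that every incidence of a selected face with a
  vertex takes place inside the disc.\<close>

definition G :: "real \<Rightarrow> (real^2) set set" where "G R = {f \<in> F. X \<inter> f \<subseteq> cball 0 R}"

lemma G_subset: "f \<in> G R \<Longrightarrow> f \<in> F"
  by (simp add: G_def)

lemma face_vertex: "f \<in> F \<Longrightarrow> \<exists>x. x \<in> X \<and> x \<in> f"
proof -
  assume f: "f \<in> F"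
  obtain c where c: "c \<in> interior f" using face_interior[OF f] by blast
  interpret subdivision_face X E F f c by (rule subdivision_face[OF f c])
  show ?thesis using sides_nonempty side_cases by (metis IntD1 IntD2 ex_in_conv)
qed

lemma finite_G: "finite (G R)"
proof (rule finite_subset)
  show "G R \<subseteq> {f \<in> F. f \<inter> cball 0 R \<noteq> {}}" using face_vertex by (fastforce simp: G_def)
qed (simp add: finite_faces_bounded)

lemma face_in_G:
  assumes "f \<in> F" "p \<in> f" "norm p \<le> R - L"
  shows "f \<in> G R"
proof -
  have "norm x \<le> R" if x: "x \<in> X" "x \<in> f" for x
  proof -
    have "dist x p \<le> L" using face_diameter[OF assms(1) x] assms(2) by auto
    then show ?thesis using assms(3) norm_triangle_sub[of x p] by (simp add: dist_norm)
  qed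
  then show ?thesis using assms(1) by (auto simp: G_def)
qed

text \<open>By \<open>face_diameter\<close> every face that meets the smaller disc has all its
  vertices in the larger one.\<close>

lemma disc_area_le: "L \<le> R \<Longrightarrow> pi * (R - L)\<^sup>2 \<le> (\<Sum>f\<in>G R. measure lebesgue f)"
proof -
  assume R: "L \<le> R"
  have m: "f \<in> lmeasurable" if "f \<in> G R" for f
    using face_compact G_subset that lmeasurable_compact by blast
  have "pi * (R - L)\<^sup>2 = measure lebesgue (ball 0 (R - L) :: (real^2) set)"
    using R by (simp add: circle_area)
  also have "\<dots> \<le> measure lebesgue (\<Union>(G R))"
  proof (rule measure_mono_fmeasurable)
    show "ball 0 (R - L) \<subseteq> \<Union>(G R)"
    proof
      fix p :: "real^2" assume "p \<in> ball 0 (R - L)"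
      moreover obtain f where "f \<in> F" "p \<in> f" using faces_cover by blast
      ultimately show "p \<in> \<Union>(G R)" using face_in_G[of f p R] by auto
    qed
    show "\<Union>(G R) \<in> lmeasurable" using m finite_G by (intro fmeasurable.finite_Union) auto
  qed simp
  also have "\<dots> \<le> (\<Sum>f\<in>G R. measure lebesgue f)"
    using measure_UNION_le[of "G R" "\<lambda>f. f" lebesgue] finite_G m by (auto simp: fmeasurableD)
  finally show ?thesis .
qed

text \<open>The nearby faces that miss \<open>x\<close> have positive distance from it, so a small
  disc about \<open>x\<close> is divided among the faces containing \<open>x\<close>.\<close>

lemma vertex_angles:
  assumes x: "x \<in> X"
  shows "\<forall>\<^sub>F r in at_right 0. (\<Sum>f\<in>{f \<in> F. x \<in> f}. measure lebesgue (f \<inter> ball x r)) = pi * r\<^sup>2"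
proof -
  define H where "H = {f \<in> F. f \<inter> ball x 1 \<noteq> {}}"
  have fH: "finite H" unfolding H_def by (rule finite_faces_bounded) simp
  have 1: "\<forall>\<^sub>F r in at_right 0. \<forall>f\<in>H. x \<notin> f \<longrightarrow> f \<inter> ball x r = {}"
  proof (intro eventually_ball_finite fH ballI)
    fix f assume "f \<in> H"
    then have cl: "closed f" using face_closed by (auto simp: H_def)
    show "\<forall>\<^sub>F r in at_right 0. x \<notin> f \<longrightarrow> f \<inter> ball x r = {}"
    proof (cases "x \<in> f")
      case False
      then obtain d where d: "0 < d" "ball x d \<subseteq> - f"
        using cl by (metis Compl_iff open_Compl open_contains_ball)
      show ?thesis
        unfolding eventually_at_right_field using d by (intro exI[of _ d]) (auto simp: subset_iff disjoint_iff)
    qed simp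
  qed
  have 2: "\<forall>\<^sub>F r in at_right (0 :: real). 0 < r" "\<forall>\<^sub>F r in at_right (0 :: real). r < 1"
    by (simp add: eventually_at_right_less, unfold eventually_at_right_field, intro exI[of _ 1], simp)
  from 1 2 show ?thesis
  proof eventually_elim
    case (elim r)
    let ?Fx = "{f \<in> F. x \<in> f}"
    have sub: "?Fx \<subseteq> H" by (auto simp: H_def)
    have "ball x r \<subseteq> \<Union>?Fx"
    proof
      fix p assume p: "p \<in> ball x r"
      obtain f where f: "f \<in> F" "p \<in> f" using faces_cover by blast
      have "p \<in> ball x 1" using p elim(3) by simp
      then have "f \<in> H" using f by (auto simp: H_def)
      then have "x \<in> f" using elim(1) f p by blast
      then show "p \<in> \<Union>?Fx" using f by blast
    qed
    then have "ball x r = \<Union>((\<lambda>f. f \<inter> ball x r) ` ?Fx)" by blast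
    then have "pi * r\<^sup>2 = measure lebesgue (\<Union>((\<lambda>f. f \<inter> ball x r) ` ?Fx))"
      using measure_disc[of r x] elim(2) by simp
    also have "\<dots> = (\<Sum>f\<in>?Fx. measure lebesgue (f \<inter> ball x r))"
    proof (rule measure_negligible_finite_Union_image)
      show "pairwise (\<lambda>f g. negligible (f \<inter> ball x r \<inter> (g \<inter> ball x r))) ?Fx"
      proof (rule pairwiseI)
        fix f g assume fg: "f \<in> ?Fx" "g \<in> ?Fx" "f \<noteq> g"
        then have "interior (f \<inter> g) = {}" using faces_disjoint[of f g] interior_subset[of g] by auto
        then have "negligible (f \<inter> g)"
          using fg face_convex by (subst negligible_convex_interior) (auto intro!: convex_Int)
        then show "negligible (f \<inter> ball x r \<inter> (g \<inter> ball x r))" by (rule negligible_subset) blast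
      qed
      show "f \<inter> ball x r \<in> lmeasurable" if "f \<in> ?Fx" for f
        using that face_compact lmeasurable_compact by (intro fmeasurable.Int) auto
    qed (use sub fH finite_subset in auto)
    finally show ?case by simp
  qed
qed

lemma face_angles:
  assumes "f \<in> F"
  shows "\<forall>\<^sub>F r in at_right 0. (\<Sum>x\<in>X \<inter> f. measure lebesgue (f \<inter> ball x r))
    = (real (card (sides E f)) / 2 - 1) * (pi * r\<^sup>2)"
proof -
  obtain c where c: "c \<in> interior f" using face_interior[OF assms] by blast
  interpret subdivision_face X E F f c by (rule subdivision_face[OF assms c])
  show ?thesis by (rule angle_sum)
qed

lemma in_G_vertex: "f \<in> G R \<Longrightarrow> x \<in> X \<Longrightarrow> x \<in> f \<Longrightarrow> x \<in> cball 0 R"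
  by (auto simp: G_def)

lemma inner_faces: "x \<in> X \<inter> cball 0 R - annulus R \<Longrightarrow> {f \<in> F. x \<in> f} = {f \<in> G R. x \<in> f}"
  using face_in_G G_subset by (fastforce simp: annulus_def)

text \<open>Each vertex far from the boundary of the disc receives the full angle \<open>2\<pi>\<close> from the faces in
  \<open>G R\<close>, and a face with \<open>k\<close> sides distributes \<open>(k - 2)\<pi>\<close>. This replaces Euler's formula.\<close>

lemma angle_count:
  shows "(\<Sum>f\<in>G R. real (card (sides E f)) / 2 - 1) \<le> N R"
    and "real (N R) - real (card (annulus R)) \<le> (\<Sum>f\<in>G R. real (card (sides E f)) / 2 - 1)"
proof -
  let ?B = "X \<inter> cball 0 R"
  have fB: "finite ?B" by (rule finite_X_cball)
  have "\<forall>\<^sub>F r in at_right 0. (\<forall>f\<in>G R. (\<Sum>x\<in>X \<inter> f. measure lebesgue (f \<inter> ball x r))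
      = (real (card (sides E f)) / 2 - 1) * (pi * r\<^sup>2)) \<and>
    (\<forall>x\<in>?B. (\<Sum>f\<in>{f \<in> F. x \<in> f}. measure lebesgue (f \<inter> ball x r)) = pi * r\<^sup>2) \<and> 0 < r"
    using face_angles vertex_angles G_subset
    by (intro eventually_conj eventually_ball_finite finite_G fB ballI) (auto simp: eventually_at_right_less)
  then obtain r where r: "0 < r"
    and fa: "\<And>f. f \<in> G R \<Longrightarrow> (\<Sum>x\<in>X \<inter> f. measure lebesgue (f \<inter> ball x r)) = (real (card (sides E f)) / 2 - 1) * (pi * r\<^sup>2)"
    and va: "\<And>x. x \<in> ?B \<Longrightarrow> (\<Sum>f\<in>{f \<in> F. x \<in> f}. measure lebesgue (f \<inter> ball x r)) = pi * r\<^sup>2"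
    using eventually_happens'[of "at_right (0::real)"] by force
  \<comment> \<open>The fraction of the full angle at \<open>x\<close> that \<open>f\<close>
    occupies. One radius \<open>r\<close> serves all the finitely many faces and vertices
    involved.\<close>
  define a where "a = (\<lambda>(f :: (real^2) set) x. measure lebesgue (f \<inter> ball x r) / (pi * r\<^sup>2))"
  have pr: "0 < pi * r\<^sup>2" using r by simp
  have "(\<Sum>f\<in>G R. real (card (sides E f)) / 2 - 1) = (\<Sum>f\<in>G R. \<Sum>x\<in>X \<inter> f. a f x)"
  proof (rule sum.cong[OF refl])
    fix f assume "f \<in> G R"
    then show "real (card (sides E f)) / 2 - 1 = (\<Sum>x\<in>X \<inter> f. a f x)"
      using fa[of f] r by (simp add: a_def flip: sum_divide_distrib)
  qed
  also have "\<dots> = (\<Sum>f\<in>G R. \<Sum>x\<in>{x \<in> ?B. x \<in> f}. a f x)"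
    by (intro sum.cong refl) (use in_G_vertex in auto)
  also have "\<dots> = (\<Sum>x\<in>?B. \<Sum>f\<in>{f \<in> G R. x \<in> f}. a f x)"
    by (rule sum.swap_restrict[OF finite_G fB])
  finally have eq: "(\<Sum>f\<in>G R. real (card (sides E f)) / 2 - 1) = (\<Sum>x\<in>?B. \<Sum>f\<in>{f \<in> G R. x \<in> f}. a f x)" .
  have one: "(\<Sum>f\<in>{f \<in> F. x \<in> f}. a f x) = 1" if "x \<in> ?B" for x
    using va[OF that] r by (simp add: a_def flip: sum_divide_distrib)
  have nn: "0 \<le> a f x" for f x using pr by (simp add: a_def)
  have finx: "finite {f \<in> F. x \<in> f}" for x
    using finite_faces_bounded[of "{x}"] by simp
  have "(\<Sum>f\<in>{f \<in> G R. x \<in> f}. a f x) \<le> 1" if "x \<in> ?B" for x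
    unfolding one[OF that, symmetric] by (rule sum_mono2[OF finx]) (use G_subset nn in auto)
  then have "(\<Sum>x\<in>?B. \<Sum>f\<in>{f \<in> G R. x \<in> f}. a f x) \<le> (\<Sum>x\<in>?B. 1)" by (rule sum_mono)
  then show "(\<Sum>f\<in>G R. real (card (sides E f)) / 2 - 1) \<le> N R" unfolding eq by simp
  have "(\<Sum>x\<in>?B - annulus R. 1) = (\<Sum>x\<in>?B - annulus R. \<Sum>f\<in>{f \<in> G R. x \<in> f}. a f x)"
  proof (rule sum.cong[OF refl])
    fix x assume x: "x \<in> ?B - annulus R"
    show "1 = (\<Sum>f\<in>{f \<in> G R. x \<in> f}. a f x)"
      using one[of x] x unfolding inner_faces[OF x] by simp
  qed
  also have "\<dots> \<le> (\<Sum>x\<in>?B. \<Sum>f\<in>{f \<in> G R. x \<in> f}. a f x)"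
    by (rule sum_mono2[OF fB]) (auto intro: sum_nonneg nn)
  finally have "real (card (?B - annulus R)) \<le> (\<Sum>f\<in>G R. real (card (sides E f)) / 2 - 1)" unfolding eq by simp
  moreover have "card (?B - annulus R) = card ?B - card (annulus R)"
    by (rule card_Diff_subset) (auto simp: annulus_def intro: finite_subset[OF _ fB])
  moreover have "card (annulus R) \<le> card ?B" by (rule card_mono[OF fB]) (auto simp: annulus_def)
  ultimately show "real (N R) - real (card (annulus R)) \<le> (\<Sum>f\<in>G R. real (card (sides E f)) / 2 - 1)" by (simp add: of_nat_diff)
qed

text \<open>Counts triples of a vertex, an edge at it and a face of \<open>G R\<close> bordered by
  this edge. A side has two ends, which gives twice the number of sides; an edge borders two faces,
  which gives twice the degree, except near the boundary of the disc where faces are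
  missing.\<close>

lemma edge_count:
  assumes M: "\<And>x. x \<in> X \<Longrightarrow> card (neighbours D X x) \<le> M"
  shows "(\<Sum>f\<in>G R. card (sides E f)) \<le> deg_sum R"
    and "deg_sum R \<le> (\<Sum>f\<in>G R. card (sides E f)) + M * card (annulus R)"
proof -
  let ?B = "X \<inter> cball 0 R"
  have fB: "finite ?B" by (rule finite_X_cball)
  let ?Ex = "\<lambda>x. {e \<in> E. x \<in> e}"
  have finEx: "finite (?Ex x)" for x using finite_edges_bounded[of "{x}"] by simp
  have fs: "finite (sides E f)" if "f \<in> G R" for f using sides_finite G_subset that by blast
  have two: "2 * card (sides E f) = (\<Sum>x\<in>{x \<in> ?B. x \<in> f}. card {e \<in> sides E f. x \<in> e})" if f: "f \<in> G R" for f
  proof -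
    have "(\<Sum>x\<in>{x \<in> ?B. x \<in> f}. card {e \<in> sides E f. x \<in> e}) = (\<Sum>x\<in>{x \<in> ?B. x \<in> f}. \<Sum>e\<in>{e \<in> sides E f. x \<in> e}. 1)"
      by simp
    also have "\<dots> = (\<Sum>e\<in>sides E f. \<Sum>x\<in>{x \<in> {x \<in> ?B. x \<in> f}. x \<in> e}. 1)"
      by (rule sum.swap_restrict[OF _ fs[OF f]]) (rule finite_subset[OF _ fB], blast)
    also have "\<dots> = (\<Sum>e\<in>sides E f. 2)"
    proof (rule sum.cong[OF refl])
      fix e assume e: "e \<in> sides E f"
      have eE: "e \<in> E" "e \<subseteq> frontier f" using e by (auto simp: sides_def)
      obtain x y where xy: "x \<noteq> y" "e \<inter> X = {x, y}" using edge_cases[OF eE(1)] by metis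
      have "e \<subseteq> f" using eE face_closed[OF G_subset[OF f]] frontier_subset_closed by blast
      then have "{x \<in> {x \<in> ?B. x \<in> f}. x \<in> e} = e \<inter> X" using in_G_vertex[OF f] by blast
      then show "(\<Sum>x\<in>{x \<in> {x \<in> ?B. x \<in> f}. x \<in> e}. 1) = (2 :: nat)" using xy by simp
    qed
    finally show ?thesis by simp
  qed
  have "2 * (\<Sum>f\<in>G R. card (sides E f)) = (\<Sum>f\<in>G R. \<Sum>x\<in>{x \<in> ?B. x \<in> f}. card {e \<in> sides E f. x \<in> e})"
    unfolding sum_distrib_left by (rule sum.cong[OF refl]) (rule two)
  also have "\<dots> = (\<Sum>x\<in>?B. \<Sum>f\<in>{f \<in> G R. x \<in> f}. card {e \<in> sides E f. x \<in> e})"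
    by (rule sum.swap_restrict[OF finite_G fB])
  also have "\<dots> = (\<Sum>x\<in>?B. \<Sum>e\<in>?Ex x. card {f \<in> G R. e \<subseteq> frontier f})"
  proof (rule sum.cong[OF refl])
    fix x assume "x \<in> ?B"
    have fx: "f \<in> {f \<in> G R. x \<in> f}" if "f \<in> G R" "x \<in> e" "e \<subseteq> frontier f" for f e
      using that frontier_subset_closed[OF face_closed[OF G_subset[OF that(1)]]] by blast
    have "(\<Sum>f\<in>{f \<in> G R. x \<in> f}. card {e \<in> sides E f. x \<in> e})
        = (\<Sum>f\<in>{f \<in> G R. x \<in> f}. \<Sum>e\<in>{e \<in> ?Ex x. e \<subseteq> frontier f}. 1)"
      by (rule sum.cong[OF refl]) (auto simp: sides_def intro!: arg_cong[where f = card])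
    also have "\<dots> = (\<Sum>e\<in>?Ex x. \<Sum>f\<in>{f \<in> {f \<in> G R. x \<in> f}. e \<subseteq> frontier f}. 1)"
      by (rule sum.swap_restrict) (use finite_G finEx in auto)
    also have "\<dots> = (\<Sum>e\<in>?Ex x. card {f \<in> G R. e \<subseteq> frontier f})"
    proof (rule sum.cong[OF refl])
      fix e assume "e \<in> ?Ex x"
      then have "{f \<in> {f \<in> G R. x \<in> f}. e \<subseteq> frontier f} = {f \<in> G R. e \<subseteq> frontier f}"
        using fx by blast
      then show "(\<Sum>f\<in>{f \<in> {f \<in> G R. x \<in> f}. e \<subseteq> frontier f}. 1) = card {f \<in> G R. e \<subseteq> frontier f}" by simp
    qed
    finally show "(\<Sum>f\<in>{f \<in> G R. x \<in> f}. card {e \<in> sides E f. x \<in> e}) = (\<Sum>e\<in>?Ex x. card {f \<in> G R. e \<subseteq> frontier f})" .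
  qed
  finally have eq: "2 * (\<Sum>f\<in>G R. card (sides E f)) = (\<Sum>x\<in>?B. \<Sum>e\<in>?Ex x. card {f \<in> G R. e \<subseteq> frontier f})" .
  have finF: "finite {f \<in> F. e \<subseteq> frontier f}" if "e \<in> E" for e
    by (rule card_ge_0_finite) (simp add: card_edge_faces[OF that])
  have le2: "card {f \<in> G R. e \<subseteq> frontier f} \<le> 2" if "e \<in> E" for e
    unfolding card_edge_faces[OF that, symmetric] by (rule card_mono[OF finF[OF that]]) (use G_subset in auto)
  have deg: "(\<Sum>e\<in>?Ex x. 2) = 2 * card (neighbours D X x)" if "x \<in> ?B" for x
    using card_neighbours[of x] that by simp
  have "(\<Sum>x\<in>?B. \<Sum>e\<in>?Ex x. card {f \<in> G R. e \<subseteq> frontier f}) \<le> (\<Sum>x\<in>?B. \<Sum>e\<in>?Ex x. 2)"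
    by (intro sum_mono) (use le2 in auto)
  also have "\<dots> = (\<Sum>x\<in>?B. 2 * card (neighbours D X x))"
    by (rule sum.cong[OF refl]) (rule deg)
  also have "\<dots> = 2 * deg_sum R" by (simp add: sum_distrib_left)
  finally show "(\<Sum>f\<in>G R. card (sides E f)) \<le> deg_sum R" using eq by linarith
  have "2 * (\<Sum>x\<in>?B - annulus R. card (neighbours D X x)) = (\<Sum>x\<in>?B - annulus R. \<Sum>e\<in>?Ex x. 2)"
    unfolding sum_distrib_left by (rule sum.cong[OF refl]) (use deg in auto)
  also have "\<dots> = (\<Sum>x\<in>?B - annulus R. \<Sum>e\<in>?Ex x. card {f \<in> G R. e \<subseteq> frontier f})"
  proof (intro sum.cong refl)
    fix x e assume x: "x \<in> ?B - annulus R" and e: "e \<in> ?Ex x"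
    have "{f \<in> F. e \<subseteq> frontier f} = {f \<in> G R. e \<subseteq> frontier f}"
      using inner_faces[OF x] e face_closed frontier_subset_closed G_subset by blast
    then show "2 = card {f \<in> G R. e \<subseteq> frontier f}" using card_edge_faces[of e] e by simp
  qed
  also have "\<dots> \<le> (\<Sum>x\<in>?B. \<Sum>e\<in>?Ex x. card {f \<in> G R. e \<subseteq> frontier f})"
    by (rule sum_mono2[OF fB]) auto
  finally have "(\<Sum>x\<in>?B - annulus R. card (neighbours D X x)) \<le> (\<Sum>f\<in>G R. card (sides E f))"
    using eq by linarith
  moreover have "deg_sum R = (\<Sum>x\<in>?B - annulus R. card (neighbours D X x)) + (\<Sum>x\<in>annulus R. card (neighbours D X x))"
    by (rule sum.subset_diff) (use fB in \<open>auto simp: annulus_def\<close>)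
  moreover have "(\<Sum>x\<in>annulus R. card (neighbours D X x)) \<le> (\<Sum>x\<in>annulus R. M)"
    by (rule sum_mono) (use M in \<open>auto simp: annulus_def\<close>)
  ultimately show "deg_sum R \<le> (\<Sum>f\<in>G R. card (sides E f)) + M * card (annulus R)"
    by (simp add: mult.commute)
qed

text \<open>Let k be the number of sides and P = k/2 - \<open>card (G R)\<close> the angle count.
  Then c1 k + c2 \<open>card (G R)\<close> = (c1 + c2/2) k - c2 P, and k and P differ from
  \<open>deg_sum R\<close> and \<open>N R\<close> by at most a constant times
  \<open>card (annulus R)\<close>.\<close>

lemma count_inequality:
  fixes c1 c2 :: real
  assumes area_le: "\<And>f. f \<in> F \<Longrightarrow> measure lebesgue f \<le> area * (c1 * card (sides E f) + c2)"
  shows "\<exists>C\<ge>0. \<forall>R\<ge>L + \<rho>. pi * (R - L)\<^sup>2 \<le> area * ((c1 + c2 / 2) * deg_sum R - c2 * N R) + C * R"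
proof -
  obtain M where M: "\<And>x. x \<in> X \<Longrightarrow> card (neighbours D X x) \<le> M" using degree_bounded by blast
  define c where "c = \<bar>c1 + c2 / 2\<bar> * M + \<bar>c2\<bar>"
  have c0: "0 \<le> c" by (simp add: c_def)
  have "pi * (R - L)\<^sup>2 \<le> area * ((c1 + c2 / 2) * deg_sum R - c2 * N R) + (c * (2 * pi * (2 * \<rho> + L))) * R"
    if R: "L + \<rho> \<le> R" for R
  proof -
    define k where "k = real (\<Sum>f\<in>G R. card (sides E f))"
    define P where "P = (\<Sum>f\<in>G R. real (card (sides E f)) / 2 - 1)"
    define n where "n = real (card (annulus R))"
    have Pk: "P = k / 2 - card (G R)"
      by (simp add: P_def k_def sum_subtractf sum_divide_distrib)
    have k: "k \<le> deg_sum R" "deg_sum R \<le> k + M * n"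
      using edge_count[OF M, of R] unfolding k_def n_def by (simp_all only: of_nat_le_iff of_nat_add[symmetric] of_nat_mult[symmetric])
    have P: "P \<le> N R" "N R - n \<le> P" using angle_count[of R] by (auto simp: P_def n_def)
    have "L \<le> R" using R \<rho>(1) by simp
    then have "pi * (R - L)\<^sup>2 \<le> (\<Sum>f\<in>G R. measure lebesgue f)" by (rule disc_area_le)
    also have "\<dots> \<le> (\<Sum>f\<in>G R. area * (c1 * card (sides E f) + c2))"
      by (rule sum_mono) (use area_le G_subset in blast)
    also have "\<dots> = area * (c1 * k + c2 * card (G R))"
      by (simp add: k_def sum.distrib flip: sum_distrib_left)
    also have "c1 * k + c2 * card (G R) = (c1 + c2 / 2) * k - c2 * P"
      unfolding Pk by (simp add: algebra_simps)
    also have "\<dots> = (c1 + c2 / 2) * deg_sum R - c2 * N R - (c1 + c2 / 2) * (deg_sum R - k) + c2 * (N R - P)"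
      by (simp add: algebra_simps)
    also have "\<dots> \<le> (c1 + c2 / 2) * deg_sum R - c2 * N R + c * n"
    proof -
      have "\<bar>(c1 + c2 / 2) * (deg_sum R - k)\<bar> \<le> \<bar>c1 + c2 / 2\<bar> * (M * n)"
        unfolding abs_mult using k by (intro mult_left_mono) auto
      moreover have "\<bar>c2 * (N R - P)\<bar> \<le> \<bar>c2\<bar> * n"
        unfolding abs_mult using P by (intro mult_left_mono) auto
      ultimately show ?thesis unfolding c_def by (simp add: algebra_simps)
    qed
    finally have "pi * (R - L)\<^sup>2 \<le> area * ((c1 + c2 / 2) * deg_sum R - c2 * N R + c * n)"
      using area_pos by (simp add: mult_left_mono)
    also have "\<dots> = area * ((c1 + c2 / 2) * deg_sum R - c2 * N R) + c * (n * area)"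
      by (simp add: algebra_simps)
    also have "c * (n * area) \<le> c * (2 * pi * (2 * \<rho> + L) * R)"
      using annulus_card[OF R] c0 by (intro mult_left_mono) (auto simp: n_def)
    finally show ?thesis by (simp add: algebra_simps)
  qed
  moreover have "0 \<le> c * (2 * pi * (2 * \<rho> + L))" using c0 \<rho>(1) by simp
  ultimately show ?thesis by blast
qed

text \<open>\<open>(c1 + c2 / 2) * l - c2\<close> is the limiting bound on the area per point in
  units of \<open>area\<close>; its reciprocal bounds the density. The terms of order
  \<open>R\<close> in \<open>count_inequality\<close> vanish after division by
  \<open>pi * R\<^sup>2\<close>.\<close>

lemma asymptotic_bound:
  fixes c1 c2 :: real
  assumes area_le: "\<And>f. f \<in> F \<Longrightarrow> measure lebesgue f \<le> area * (c1 * card (sides E f) + c2)"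
    and pos: "0 < (c1 + c2 / 2) * l - c2" and b: "b \<le> 1 / ((c1 + c2 / 2) * l - c2)"
  shows "asymptotic_lower_bound D X l b"
  unfolding asymptotic_lower_bound_def
proof (intro allI impI)
  fix R :: "nat \<Rightarrow> real"
  assume R: "filterlim R at_top sequentially"
    and l: "(\<lambda>j. average_neighbours D X (R j)) \<longlonglongrightarrow> l"
  obtain C where C: "\<And>R. L + \<rho> \<le> R \<Longrightarrow> pi * (R - L)\<^sup>2 \<le> area * ((c1 + c2 / 2) * deg_sum R - c2 * N R) + C * R"
    using count_inequality[OF area_le] by blast
  define h where "h = (\<lambda>j. (c1 + c2 / 2) * average_neighbours D X (R j) - c2)"
  define g where "g = (\<lambda>j. ((1 - L / R j)\<^sup>2 - C / (pi * R j)) / h j)"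
  have h: "h \<longlonglongrightarrow> (c1 + c2 / 2) * l - c2"
    unfolding h_def by (intro tendsto_intros l)
  have inv: "(\<lambda>j. a / R j) \<longlonglongrightarrow> 0" for a
    by (rule real_tendsto_divide_at_top[OF tendsto_const R])
  have "(\<lambda>j. (1 - L / R j)\<^sup>2 - (C / pi) / R j) \<longlonglongrightarrow> (1 - 0)\<^sup>2 - 0"
    by (intro tendsto_intros inv)
  then have g: "g \<longlonglongrightarrow> 1 / ((c1 + c2 / 2) * l - c2)"
    unfolding g_def using h pos by (intro tendsto_divide) auto
  have "\<forall>\<^sub>F j in sequentially. L + \<rho> \<le> R j"
    using R by (simp add: filterlim_at_top)
  moreover have "\<forall>\<^sub>F j in sequentially. 0 < h j"
    using h pos by (rule order_tendstoD)
  ultimately have "\<forall>\<^sub>F j in sequentially. ereal (g j) \<le> ereal (packing_density D X (R j))"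
  proof eventually_elim
    case (elim j)
    have R0: "0 < R j" using elim(1) \<rho>(1) by linarith
    \<comment> \<open>In a disc without points the average is 0 / 0 = 0, and the identity still
      holds.\<close>
    have "deg_sum (R j) = average_neighbours D X (R j) * N (R j)"
    proof (cases "N (R j) = 0")
      case True
      then have "X \<inter> cball 0 (R j) = {}" using finite_X_cball by simp
      then show ?thesis by simp
    qed (simp add: average_neighbours_def)
    then have "(c1 + c2 / 2) * deg_sum (R j) - c2 * N (R j) = N (R j) * h j"
      by (simp add: h_def algebra_simps)
    then have "pi * (R j - L)\<^sup>2 \<le> area * (N (R j) * h j) + C * R j" using C[OF elim(1)] by simp
    then have "(pi * (R j - L)\<^sup>2 - C * R j) / (pi * (R j)\<^sup>2) \<le> (area * (N (R j) * h j)) / (pi * (R j)\<^sup>2)"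
      using R0 by (intro divide_right_mono) auto
    also have "\<dots> = packing_density D X (R j) * h j"
      by (simp add: packing_density_def area_K)
    also have "(pi * (R j - L)\<^sup>2 - C * R j) / (pi * (R j)\<^sup>2) = (1 - L / R j)\<^sup>2 - C / (pi * R j)"
      using R0 by (simp add: field_simps power2_eq_square)
    finally show ?case using elim(2) by (simp add: g_def field_simps)
  qed
  then have "liminf (\<lambda>j. ereal (g j)) \<le> liminf (\<lambda>j. ereal (packing_density D X (R j)))"
    by (rule Liminf_mono)
  moreover have "liminf (\<lambda>j. ereal (g j)) = ereal (1 / ((c1 + c2 / 2) * l - c2))"
    using g by (intro lim_imp_Liminf) auto
  ultimately show "ereal b \<le> liminf (\<lambda>j. ereal (packing_density D X (R j)))"
    using b by (metis ereal_less_eq(3) order_trans)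
qed

lemma face_area:
  fixes s :: real
  assumes "f \<in> F" and s: "10 / 9 \<le> s" "s \<le> 3 / 2"
    and tri: "\<And>w1 w3. w1 \<in> unit \<Longrightarrow> w3 \<in> unit \<Longrightarrow> w1 + w3 \<in> unit \<Longrightarrow> 2 * cross2 w1 w3 \<le> area * (8 - 3 * s) / 7"
    and quad: "\<And>a b. a \<in> K \<Longrightarrow> b \<in> K \<Longrightarrow> 4 * cross2 a b \<le> area * (8 + 4 * s) / 7"
  shows "measure lebesgue f \<le> area * (1 * real (card (sides E f)) + (-2))"
    and "measure lebesgue f \<le> area * (s * card (sides E f) + (8 - 24 * s) / 7)"
proof -
  obtain c where c: "c \<in> interior f" using face_interior[OF assms(1)] by blast
  interpret norm_subdivision K X E F f c by (rule norm_subdivision[OF assms(1) c])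
  show "measure lebesgue f \<le> area * (1 * real (card (sides E f)) + (-2))"
    using face_area_le_linear(1)[OF s tri quad] by simp
  show "measure lebesgue f \<le> area * (s * card (sides E f) + (8 - 24 * s) / 7)"
    using face_area_le_linear(2)[OF s tri quad] .
qed

theorem lower_bounds:
  shows "24/5 \<le> l \<Longrightarrow> l \<le> 6 \<Longrightarrow> asymptotic_lower_bound D X l (3/4 * (2 / (- (1/3) * l + 4)))"
    and "4 \<le> l \<Longrightarrow> l \<le> 24/5 \<Longrightarrow> asymptotic_lower_bound D X l (2 / (8 - l))"
    and "asymptotic_lower_bound D X l (1/2)"
proof -
  obtain s where s: "10 / 9 \<le> s" "s \<le> 3 / 2"
    and tri: "\<And>w1 w3. w1 \<in> unit \<Longrightarrow> w3 \<in> unit \<Longrightarrow> w1 + w3 \<in> unit \<Longrightarrow> 2 * cross2 w1 w3 \<le> area * (8 - 3 * s) / 7"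
    and quad: "\<And>a b. a \<in> K \<Longrightarrow> b \<in> K \<Longrightarrow> 4 * cross2 a b \<le> area * (8 + 4 * s) / 7"
    using slope_exists by blast
  note fa = face_area[OF _ s tri quad]
  define h where "h = (s + (8 - 24 * s) / 7 / 2) * l - (8 - 24 * s) / 7"
  \<comment> \<open>The coefficient of \<open>s\<close> vanishes at 24/5, and its sign decides which
    end of the interval for \<open>s\<close> is the worst case: 10/9 for larger \<open>l\<close>,
    3/2 for smaller \<open>l\<close>.\<close>
  have h: "h = (4 * l - 8 + s * (24 - 5 * l)) / 7" by (simp add: h_def field_simps)
  \<comment> \<open>The bound \<open>card (sides E f) - 2\<close> leads to the constant value 2 for
    the area per point.\<close>
  show "asymptotic_lower_bound D X l (1/2)"
    by (rule asymptotic_bound[OF fa(1)]) auto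
  show "asymptotic_lower_bound D X l (3/4 * (2 / (- (1/3) * l + 4)))" if l: "24/5 \<le> l" "l \<le> 6"
  proof -
    have "24 - 5 * l \<le> 0" using l by simp
    then have "(24 - 5 * l) * s \<le> (24 - 5 * l) * (10 / 9)" "(24 - 5 * l) * (3 / 2) \<le> (24 - 5 * l) * s"
      using s by (intro mult_left_mono_neg; simp)+
    then have "h \<le> (24 - 2 * l) / 9" "0 < h" using l by (simp_all add: h field_simps)
    then have "9 / (24 - 2 * l) \<le> 1 / h" using l by (simp add: field_simps)
    moreover have "3/4 * (2 / (- (1/3) * l + 4)) = 9 / (24 - 2 * l)" using l by (simp add: field_simps)
    ultimately show ?thesis
      using asymptotic_bound[OF fa(2), of l] \<open>0 < h\<close> unfolding h_def by simp
  qed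
  show "asymptotic_lower_bound D X l (2 / (8 - l))" if l: "4 \<le> l" "l \<le> 24/5"
  proof -
    have "0 \<le> 24 - 5 * l" using l by simp
    then have "(24 - 5 * l) * s \<le> (24 - 5 * l) * (3 / 2)" "0 \<le> (24 - 5 * l) * s"
      using s by (intro mult_left_mono mult_nonneg_nonneg; simp)+
    then have "h \<le> (8 - l) / 2" "0 < h" using l by (simp_all add: h field_simps)
    then have "2 / (8 - l) \<le> 1 / h" using l by (simp add: field_simps)
    then show ?thesis
      using asymptotic_bound[OF fa(2), of l] \<open>0 < h\<close> unfolding h_def by simp
  qed
qed

end

lemma packing_lower_bounds:
  assumes "convex_domain D" "centrosymmetric D" "admissible_packing D X"
  shows "24/5 \<le> l \<Longrightarrow> l \<le> 6 \<Longrightarrow> asymptotic_lower_bound D X l (3/4 * (2 / (- (1/3) * l + 4)))"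
    and "4 \<le> l \<Longrightarrow> l \<le> 24/5 \<Longrightarrow> asymptotic_lower_bound D X l (2 / (8 - l))"
    and "asymptotic_lower_bound D X l (1/2)"
proof -
  obtain c0 where c0: "\<And>x. x \<in> D \<Longrightarrow> 2 *\<^sub>R c0 - x \<in> D" using assms(2) by (auto simp: centrosymmetric_def)
  obtain F where F: "translate_packing D X" "polygonal_subdivision X (touching_segments D X) F"
    "\<And>f. f \<in> F \<Longrightarrow> card (sides (touching_segments D X) f) \<le> 6"
    using assms(3) by (auto simp: admissible_packing_def)
  interpret packing D X F c0 using assms c0 F by unfold_locales
  show "24/5 \<le> l \<Longrightarrow> l \<le> 6 \<Longrightarrow> asymptotic_lower_bound D X l (3/4 * (2 / (- (1/3) * l + 4)))"
    and "4 \<le> l \<Longrightarrow> l \<le> 24/5 \<Longrightarrow> asymptotic_lower_bound D X l (2 / (8 - l))"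
    and "asymptotic_lower_bound D X l (1/2)"
    by (fact lower_bounds)+
qed

section \<open>Affine images and subdivisions along lattice segments\<close>

locale linear_bijection =
  fixes L :: "real^2 \<Rightarrow> real^2"
  assumes linear: "linear L" and inj: "inj L"
begin

lemma surj: "surj L"
  using linear inj linear_injective_imp_surjective by blast

lemma interior_image: "interior (L ` S) = L ` interior S"
  by (rule interior_injective_linear_image[OF linear inj])

lemma frontier_image: "frontier (L ` S) = L ` frontier S"
  unfolding frontier_def interior_image closure_injective_linear_image[OF linear inj, symmetric]
  by (simp add: image_set_diff[OF inj])

lemma image_Int_empty: "L ` A \<inter> L ` B = {} \<longleftrightarrow> A \<inter> B = {}"
  using inj by (auto simp: inj_def)

lemma segment_image: "closed_segment (L x) (L y) = L ` closed_segment x y"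
  by (rule closed_segment_linear_image[OF linear])

lemma translate_image: "(+) (L x) ` (\<lambda>d. c + L d) ` D = (\<lambda>d. c + L d) ` (+) x ` D"
  using linear_add[OF linear] by (auto simp: image_image algebra_simps)

lemma affine_image: "(\<lambda>d. c + L d) ` D = (+) c ` L ` D"
  by (auto simp: image_image)

lemma affine_Int_empty: "(\<lambda>d. c + L d) ` A \<inter> (\<lambda>d. c + L d) ` B = {} \<longleftrightarrow> A \<inter> B = {}"
proof -
  have "inj (\<lambda>d. c + L d)" using inj by (simp add: inj_def)
  then have "(\<lambda>d. c + L d) ` A \<inter> (\<lambda>d. c + L d) ` B = (\<lambda>d. c + L d) ` (A \<inter> B)" by (rule image_Int[symmetric])
  then show ?thesis by simp
qed

lemma neighbours_image:
  assumes "x \<in> X"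
  shows "neighbours ((\<lambda>d. c + L d) ` D) (L ` X) (L x) = L ` neighbours D X x"
proof -
  have "(+) (L x) ` (\<lambda>d. c + L d) ` D \<inter> (+) (L y) ` (\<lambda>d. c + L d) ` D \<noteq> {} \<longleftrightarrow> (+) x ` D \<inter> (+) y ` D \<noteq> {}" for y
    by (simp only: translate_image affine_Int_empty)
  then have iff: "L y \<in> neighbours ((\<lambda>d. c + L d) ` D) (L ` X) (L x) \<longleftrightarrow> y \<in> neighbours D X x" for y
    unfolding neighbours_def using inj_eq[OF inj] inj_image_mem_iff[OF inj] by simp
  show ?thesis
  proof (intro set_eqI iffI)
    fix z assume z: "z \<in> neighbours ((\<lambda>d. c + L d) ` D) (L ` X) (L x)"
    then obtain y where "z = L y" by (auto simp: neighbours_def)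
    then show "z \<in> L ` neighbours D X x" using z iff by simp
  qed (use iff in auto)
qed

lemma touching_segments_image:
  "touching_segments ((\<lambda>d. c + L d) ` D) (L ` X) = (`) L ` touching_segments D X"
proof
  show "touching_segments ((\<lambda>d. c + L d) ` D) (L ` X) \<subseteq> (`) L ` touching_segments D X"
    unfolding touching_segments_def using neighbours_image by (fastforce simp: segment_image)
  show "(`) L ` touching_segments D X \<subseteq> touching_segments ((\<lambda>d. c + L d) ` D) (L ` X)"
  proof
    fix e assume "e \<in> (`) L ` touching_segments D X"
    then obtain x y where xy: "x \<in> X" "y \<in> neighbours D X x" "e = closed_segment (L x) (L y)"
      by (auto simp: touching_segments_def segment_image)
    then have "L y \<in> neighbours ((\<lambda>d. c + L d) ` D) (L ` X) (L x)" using neighbours_image by blast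
    then show "e \<in> touching_segments ((\<lambda>d. c + L d) ` D) (L ` X)"
      unfolding touching_segments_def using xy by blast
  qed
qed

lemma translate_packing_image:
  assumes "translate_packing D X"
  shows "translate_packing ((\<lambda>d. c + L d) ` D) (L ` X)"
  unfolding translate_packing_def
proof (rule pairwise_imageI)
  fix x y assume "x \<in> X" "y \<in> X" "x \<noteq> y"
  then have "interior ((+) x ` D) \<inter> interior ((+) y ` D) = {}"
    using assms by (simp add: translate_packing_def pairwise_def)
  then have "(\<lambda>d. c + L d) ` interior ((+) x ` D) \<inter> (\<lambda>d. c + L d) ` interior ((+) y ` D) = {}"
    by (simp add: affine_Int_empty)
  then show "interior ((+) (L x) ` (\<lambda>d. c + L d) ` D) \<inter> interior ((+) (L y) ` (\<lambda>d. c + L d) ` D) = {}"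
    unfolding translate_image by (simp add: affine_image interior_translation interior_image)
qed

lemma subdivision_image:
  assumes "polygonal_subdivision V E F"
  shows "polygonal_subdivision (L ` V) ((`) L ` E) ((`) L ` F)"
proof -
  note P = assms[unfolded polygonal_subdivision_def]
  have 1: "\<forall>f\<in>(`) L ` F. convex_polygon f"
    using P by (auto simp: convex_polygon_def interior_image intro!: polytope_linear_image[OF linear])
  have 2: "\<Union>((`) L ` F) = UNIV"
    using P surj by (metis image_Union)
  have 3: "pairwise (\<lambda>f g. interior f \<inter> interior g = {}) ((`) L ` F)"
    by (rule pairwise_imageI) (use P in \<open>auto simp: interior_image image_Int_empty pairwise_def\<close>)
  have 4: "locally_finite_in euclidean ((`) L ` F)"
    unfolding locally_finite_in_def
  proof (intro conjI ballI)
    fix p :: "real^2"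
    obtain q where q: "p = L q" using surj by blast
    obtain U where U: "open U" "q \<in> U" "finite {f \<in> F. f \<inter> U \<noteq> {}}"
    proof -
      have "locally_finite_in euclidean F" using P by blast
      then have "\<exists>U. open U \<and> q \<in> U \<and> finite {f \<in> F. f \<inter> U \<noteq> {}}"
        by (simp add: locally_finite_in_def)
      then show thesis using that by blast
    qed
    have "{f \<in> (`) L ` F. f \<inter> L ` U \<noteq> {}} \<subseteq> (`) L ` {f \<in> F. f \<inter> U \<noteq> {}}"
    proof
      fix g assume "g \<in> {f \<in> (`) L ` F. f \<inter> L ` U \<noteq> {}}"
      then obtain f where f: "f \<in> F" "g = L ` f" "L ` f \<inter> L ` U \<noteq> {}" by auto
      then have "f \<in> {f \<in> F. f \<inter> U \<noteq> {}}" by (simp add: image_Int_empty)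
      then show "g \<in> (`) L ` {f \<in> F. f \<inter> U \<noteq> {}}" unfolding f(2) by (rule imageI)
    qed
    then have "finite {f \<in> (`) L ` F. f \<inter> L ` U \<noteq> {}}" by (rule finite_surj[OF U(3)])
    moreover have "open (L ` U)" by (rule open_surjective_linear_image[OF U(1) linear surj])
    ultimately show "\<exists>V. openin euclidean V \<and> p \<in> V \<and> finite {f \<in> (`) L ` F. f \<inter> V \<noteq> {}}"
      using U(2) q by auto
  qed simp
  have 5: "\<forall>e\<in>(`) L ` E. \<exists>x y. x \<noteq> y \<and> e = closed_segment x y \<and> e \<inter> L ` V = {x, y}"
  proof
    fix e assume "e \<in> (`) L ` E"
    then obtain e' where e': "e' \<in> E" "e = L ` e'" by blast
    have "\<forall>e\<in>E. \<exists>x y. x \<noteq> y \<and> e = closed_segment x y \<and> e \<inter> V = {x, y}" using P by (elim conjE) assumption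
    then obtain x y where xy: "x \<noteq> y" "e' = closed_segment x y" "e' \<inter> V = {x, y}" using e'(1) by blast
    have "e \<inter> L ` V = L ` (e' \<inter> V)" using e'(2) image_Int[OF inj] by metis
    then have "e \<inter> L ` V = {L x, L y}" using xy by simp
    moreover have "L x \<noteq> L y" using xy inj by (auto simp: inj_def)
    ultimately show "\<exists>x y. x \<noteq> y \<and> e = closed_segment x y \<and> e \<inter> L ` V = {x, y}"
      using e'(2) xy(2) segment_image[of x y] by (intro exI[of _ "L x"] exI[of _ "L y"]) simp
  qed
  have 6: "pairwise (\<lambda>e e'. e \<inter> e' \<subseteq> L ` V) ((`) L ` E)"
  proof (rule pairwise_imageI)
    fix x y assume "x \<in> E" "y \<in> E" "x \<noteq> y"
    then have "x \<inter> y \<subseteq> V" using P by (simp add: pairwise_def)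
    then show "L ` x \<inter> L ` y \<subseteq> L ` V" using image_Int[OF inj] by (metis image_mono)
  qed
  have 7: "L ` V \<subseteq> \<Union>((`) L ` E)" using P by blast
  have 8: "\<Union>((`) L ` E) = (\<Union>f\<in>(`) L ` F. frontier f)"
  proof -
    have "\<Union>((`) L ` E) = L ` \<Union>E" by (rule image_Union[symmetric])
    also have "\<dots> = (\<Union>f\<in>F. L ` frontier f)" using P by (simp add: image_UN)
    finally show ?thesis by (simp add: frontier_image)
  qed
  show ?thesis unfolding polygonal_subdivision_def using 1 2 3 4 5 6 7 8 by (intro conjI)
qed

lemma admissible_image:
  assumes "admissible_packing D X"
  shows "admissible_packing ((\<lambda>d. c + L d) ` D) (L ` X)"
proof -
  let ?E = "touching_segments D X"
  obtain F where F: "polygonal_subdivision X ?E F" "\<And>f. f \<in> F \<Longrightarrow> finite (sides ?E f) \<and> card (sides ?E f) \<le> 6"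
    and T: "translate_packing D X"
    using assms unfolding admissible_packing_def by blast
  have s: "sides ((`) L ` ?E) (L ` f) = (`) L ` sides ?E f" for f
    unfolding sides_def frontier_image using inj by (auto simp: inj_image_subset_iff)
  have c: "card ((`) L ` sides ?E f) = card (sides ?E f)" for f
    by (rule card_image) (use inj_image_eq_iff[OF inj] in \<open>auto simp: inj_on_def\<close>)
  show ?thesis
    unfolding admissible_packing_def touching_segments_image
    using subdivision_image[OF F(1)] translate_packing_image[OF T] F(2)
    by (intro conjI exI[of _ "(`) L ` F"]) (auto simp: s c)
qed

end

section \<open>Segments between lattice points\<close>

definition pt :: "int \<times> int \<Rightarrow> real^2" where
  "pt a = vector [of_int (fst a), of_int (snd a)]"

lemma pt_simps [simp]: "pt a $ 1 = of_int (fst a)" "pt a $ 2 = of_int (snd a)"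
  by (simp_all add: pt_def)

lemma pt_eq_iff [simp]: "pt a = pt b \<longleftrightarrow> a = b"
  by (auto simp: vec2_eq_iff prod_eq_iff)

text \<open>Membership in a lattice segment in terms of coordinates, so that case distinctions end
  in linear arithmetic.\<close>

definition on_seg :: "int \<times> int \<Rightarrow> int \<times> int \<Rightarrow> real \<Rightarrow> real \<Rightarrow> bool" where
  "on_seg a b x y \<longleftrightarrow> (\<exists>t::real. 0 \<le> t \<and> t \<le> 1 \<and>
    x = real_of_int (fst a) + t * real_of_int (fst b - fst a) \<and> y = real_of_int (snd a) + t * real_of_int (snd b - snd a))"

lemma in_lattice_segment: "p \<in> closed_segment (pt a) (pt b) \<longleftrightarrow> on_seg a b (p $ 1) (p $ 2)"
  by (simp add: in_segment on_seg_def vec2_eq_iff algebra_simps)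

lemma on_seg_commute: "on_seg a b x y \<longleftrightarrow> on_seg b a x y"
  using in_lattice_segment[of "vector [x, y]" a b] in_lattice_segment[of "vector [x, y]" b a]
    closed_segment_commute[of "pt a" "pt b"] by simp

text \<open>The moves of a chess king. The edges of all tilings below are among them.\<close>

definition king :: "int \<times> int \<Rightarrow> bool" where
  "king v \<longleftrightarrow> \<bar>fst v\<bar> \<le> 1 \<and> \<bar>snd v\<bar> \<le> 1 \<and> v \<noteq> (0, 0)"

lemma between_unit_ints:
  fixes a b :: int and t :: real
  assumes "\<bar>b - a\<bar> \<le> 1" "0 \<le> t" "t \<le> 1" "x = a + t * (b - a)" "a \<noteq> b \<Longrightarrow> 0 < t \<and> t < 1"
  shows "(a = \<lfloor>x\<rfloor> \<and> b = \<lceil>x\<rceil>) \<or> (a = \<lceil>x\<rceil> \<and> b = \<lfloor>x\<rfloor>)"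
proof -
  consider "b = a" | "b = a + 1" | "b = a - 1" using assms(1) by linarith
  then show ?thesis
  proof cases
    case 2
    then have x: "x = a + t" "0 < t" "t < 1" using assms by auto
    then have "\<lfloor>x\<rfloor> = a" "\<lceil>x\<rceil> = a + 1" by (simp_all only: floor_eq_iff ceiling_eq_iff, auto)
    then show ?thesis using 2 by simp
  next
    case 3
    then have x: "x = a - t" "0 < t" "t < 1" using assms by auto
    then have "\<lfloor>x\<rfloor> = a - 1" "\<lceil>x\<rceil> = a" by (simp_all add: floor_eq_iff ceiling_eq_iff)
    then show ?thesis using 3 by simp
  qed (use assms in auto)
qed

text \<open>Rounding the coordinates of an inner point recovers the ends, up to the choice between
  the two diagonals of a cell. For horizontal and vertical segments both alternatives
  coincide.\<close>

lemma king_segment_point: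
  assumes k: "king (b - a)" and p: "on_seg a b x y"     and n: "(x, y) \<noteq> (real_of_int (fst a), real_of_int (snd a))" "(x, y) \<noteq> (real_of_int (fst b), real_of_int (snd b))"
  shows "{a, b} = {(\<lfloor>x\<rfloor>, \<lfloor>y\<rfloor>), (\<lceil>x\<rceil>, \<lceil>y\<rceil>)} \<or> {a, b} = {(\<lfloor>x\<rfloor>, \<lceil>y\<rceil>), (\<lceil>x\<rceil>, \<lfloor>y\<rfloor>)}"
proof -
  obtain t :: real where t: "0 \<le> t" "t \<le> 1" "x = real_of_int (fst a) + t * real_of_int (fst b - fst a)"
    "y = real_of_int (snd a) + t * real_of_int (snd b - snd a)"
    using p unfolding on_seg_def by blast
  have "t \<noteq> 0" "t \<noteq> 1" using n t by auto
  then have t01: "0 < t" "t < 1" using t by auto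
  have "(fst a = \<lfloor>x\<rfloor> \<and> fst b = \<lceil>x\<rceil>) \<or> (fst a = \<lceil>x\<rceil> \<and> fst b = \<lfloor>x\<rfloor>)"
    by (rule between_unit_ints[of "fst b" "fst a" t]) (use k t t01 in \<open>auto simp: king_def\<close>)
  moreover have "(snd a = \<lfloor>y\<rfloor> \<and> snd b = \<lceil>y\<rceil>) \<or> (snd a = \<lceil>y\<rceil> \<and> snd b = \<lfloor>y\<rfloor>)"
    by (rule between_unit_ints[of "snd b" "snd a" t]) (use k t t01 in \<open>auto simp: king_def\<close>)
  ultimately show ?thesis by (cases a; cases b) auto
qed

text \<open>A face is encoded by a list of inequalities m x + n y \<le> b, so that membership in the
  face and in its interior become the arithmetic predicates \<open>inside\<close> and
  \<open>strictly_inside\<close>.\<close>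

definition halfplanes :: "(real \<times> real \<times> real) list \<Rightarrow> (real^2) set" where
  "halfplanes C = {p. \<forall>(m, n, b)\<in>set C. m * p $ 1 + n * p $ 2 \<le> b}"

definition inside :: "(real \<times> real \<times> real) list \<Rightarrow> real \<Rightarrow> real \<Rightarrow> bool" where
  "inside C x y \<longleftrightarrow> (\<forall>(m, n, b)\<in>set C. m * x + n * y \<le> b)"

definition strictly_inside :: "(real \<times> real \<times> real) list \<Rightarrow> real \<Rightarrow> real \<Rightarrow> bool" where
  "strictly_inside C x y \<longleftrightarrow> (\<forall>(m, n, b)\<in>set C. m * x + n * y < b)"

lemma in_halfplanes: "p \<in> halfplanes C \<longleftrightarrow> inside C (p $ 1) (p $ 2)"
  by (simp add: halfplanes_def inside_def)

lemma halfplanes_Cons: "halfplanes ((m, n, b) # C) = {p. (vector [m, n] :: real^2) \<bullet> p \<le> b} \<inter> halfplanes C"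
  by (auto simp: halfplanes_def inner_vec_def sum_2)

lemma polyhedron_halfplanes: "polyhedron (halfplanes C)"
proof (induction C)
  case Nil
  then show ?case by (simp add: halfplanes_def)
next
  case (Cons c C)
  obtain m n b where "c = (m, n, b)" by (cases c)
  then show ?case using Cons by (simp add: halfplanes_Cons polyhedron_Int polyhedron_halfspace_le)
qed

lemma interior_halfplanes:
  assumes "\<forall>(m, n, b)\<in>set C. m \<noteq> 0 \<or> n \<noteq> 0"
  shows "interior (halfplanes C) = {p. strictly_inside C (p $ 1) (p $ 2)}"
  using assms
proof (induction C)
  case Nil
  then show ?case by (simp add: halfplanes_def strictly_inside_def)
next
  case (Cons c C)
  obtain m n b where c: "c = (m, n, b)" by (cases c)
  have "(vector [m, n] :: real^2) \<noteq> 0" using Cons.prems c by (auto simp: vec2_eq_iff)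
  then have "interior (halfplanes (c # C)) = {p. (vector [m, n] :: real^2) \<bullet> p < b} \<inter> interior (halfplanes C)"
    by (simp add: c halfplanes_Cons interior_halfspace_le)
  then show ?case using Cons by (auto simp: c strictly_inside_def inner_vec_def sum_2)
qed

text \<open>A face is given by an index \<open>(i, j, t)\<close>, where \<open>(i, j)\<close> is its position and \<open>t\<close> its shape.\<close>

locale lattice_tiling =
  fixes Y Nb :: "(int \<times> int) set" and \<Phi> :: "(int \<times> int \<times> nat) set"
    and C :: "int \<times> int \<times> nat \<Rightarrow> (real \<times> real \<times> real) list" and m :: nat
  assumes moves: "\<And>v. v \<in> Nb \<Longrightarrow> king v"
    and no_cross: "\<And>i j. \<not> ((i, j) \<in> Y \<and> (i + 1, j) \<in> Y \<and> (i, j + 1) \<in> Y \<and> (i + 1, j + 1) \<in> Y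
      \<and> ((1, 1) \<in> Nb \<or> (-1, -1) \<in> Nb) \<and> ((1, -1) \<in> Nb \<or> (-1, 1) \<in> Nb))"
    and has_neighbour: "\<And>a. a \<in> Y \<Longrightarrow> \<exists>b\<in>Y. b - a \<in> Nb"
    and shapes: "\<And>i j t. (i, j, t) \<in> \<Phi> \<Longrightarrow> t < m"
    and normals: "\<And>\<phi>. \<phi> \<in> \<Phi> \<Longrightarrow> \<forall>(m, n, b)\<in>set (C \<phi>). m \<noteq> 0 \<or> n \<noteq> 0"
    and near: "\<And>i j t x y. (i, j, t) \<in> \<Phi> \<Longrightarrow> inside (C (i, j, t)) x y \<Longrightarrow> \<bar>x - i\<bar> \<le> 3 \<and> \<bar>y - j\<bar> \<le> 3"
    and inner_point: "\<And>\<phi>. \<phi> \<in> \<Phi> \<Longrightarrow> \<exists>x y. strictly_inside (C \<phi>) x y"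
    and cover: "\<And>x y. \<exists>\<phi>\<in>\<Phi>. inside (C \<phi>) x y"
    and disjoint: "\<And>\<phi> \<psi> x y. \<phi> \<in> \<Phi> \<Longrightarrow> \<psi> \<in> \<Phi> \<Longrightarrow> strictly_inside (C \<phi>) x y \<Longrightarrow> strictly_inside (C \<psi>) x y \<Longrightarrow> \<phi> = \<psi>"
    and boundary_edge: "\<And>\<phi> x y. \<phi> \<in> \<Phi> \<Longrightarrow> inside (C \<phi>) x y \<Longrightarrow> \<not> strictly_inside (C \<phi>) x y \<Longrightarrow>
      \<exists>a\<in>Y. \<exists>b\<in>Y. b - a \<in> Nb \<and> on_seg a b x y"
    and edge_boundary: "\<And>a b x y. a \<in> Y \<Longrightarrow> b \<in> Y \<Longrightarrow> b - a \<in> Nb \<Longrightarrow> on_seg a b x y \<Longrightarrow>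
      \<exists>\<phi>\<in>\<Phi>. inside (C \<phi>) x y \<and> \<not> strictly_inside (C \<phi>) x y"
    and corners: "\<And>\<phi>. \<phi> \<in> \<Phi> \<Longrightarrow> \<exists>A. finite A \<and> card A \<le> 6 \<and> {a \<in> Y. inside (C \<phi>) (fst a) (snd a)} \<subseteq> A"
begin

definition edges :: "(real^2) set set" where
  "edges = {closed_segment (pt a) (pt b) | a b. a \<in> Y \<and> b \<in> Y \<and> b - a \<in> Nb}"

definition faces :: "(real^2) set set" where
  "faces = (\<lambda>\<phi>. halfplanes (C \<phi>)) ` \<Phi>"

lemma face_interior: "\<phi> \<in> \<Phi> \<Longrightarrow> interior (halfplanes (C \<phi>)) = {p. strictly_inside (C \<phi>) (p $ 1) (p $ 2)}"
  by (rule interior_halfplanes[OF normals])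

lemma face_frontier:
  "\<phi> \<in> \<Phi> \<Longrightarrow> p \<in> frontier (halfplanes (C \<phi>)) \<longleftrightarrow>
    inside (C \<phi>) (p $ 1) (p $ 2) \<and> \<not> strictly_inside (C \<phi>) (p $ 1) (p $ 2)"
  using polyhedron_imp_closed[OF polyhedron_halfplanes]
  by (auto simp: frontier_def face_interior in_halfplanes)

lemma face_bounded: "\<phi> \<in> \<Phi> \<Longrightarrow> bounded (halfplanes (C \<phi>))"
proof -
  assume \<phi>: "\<phi> \<in> \<Phi>"
  obtain i j t where ijt: "\<phi> = (i, j, t)" by (cases \<phi>)
  have "halfplanes (C \<phi>) \<subseteq> cball (pt (i, j)) 6"
  proof
    fix p assume "p \<in> halfplanes (C \<phi>)"
    then have "\<bar>p $ 1 - i\<bar> \<le> 3" "\<bar>p $ 2 - j\<bar> \<le> 3" using near \<phi> ijt in_halfplanes by blast+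
    then have "norm (p - pt (i, j)) \<le> 6"
      using norm_le_l1_cart[of "p - pt (i, j)"] by (simp add: sum_2)
    then show "p \<in> cball (pt (i, j)) 6" by (simp add: dist_norm norm_minus_commute)
  qed
  then show ?thesis using bounded_cball bounded_subset by blast
qed

lemma finite_near:
  fixes x y r :: real
  shows "finite {(i, j, t). (i, j, t) \<in> \<Phi> \<and> \<bar>real_of_int i - x\<bar> \<le> r \<and> \<bar>real_of_int j - y\<bar> \<le> r}"
proof (rule finite_subset)
  have *: "\<lfloor>x - r\<rfloor> \<le> i \<and> i \<le> \<lceil>x + r\<rceil>" if "\<bar>real_of_int i - x\<bar> \<le> r" for i :: int and x :: real
    using that by linarith
  show "{(i, j, t). (i, j, t) \<in> \<Phi> \<and> \<bar>real_of_int i - x\<bar> \<le> r \<and> \<bar>real_of_int j - y\<bar> \<le> r}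
      \<subseteq> {\<lfloor>x - r\<rfloor>..\<lceil>x + r\<rceil>} \<times> {\<lfloor>y - r\<rfloor>..\<lceil>y + r\<rceil>} \<times> {..<m}"
  proof
    fix z assume z: "z \<in> {(i, j, t). (i, j, t) \<in> \<Phi> \<and> \<bar>real_of_int i - x\<bar> \<le> r \<and> \<bar>real_of_int j - y\<bar> \<le> r}"
    obtain i j t where ijt: "z = (i, j, t)" by (cases z)
    then show "z \<in> {\<lfloor>x - r\<rfloor>..\<lceil>x + r\<rceil>} \<times> {\<lfloor>y - r\<rfloor>..\<lceil>y + r\<rceil>} \<times> {..<m}"
      using z shapes[of i j t] *[of i x] *[of j y] by simp
  qed
qed simp

text \<open>A lattice point has equal floors and ceilings, so by \<open>king_segment_point\<close>
  it cannot be an inner point.\<close>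

lemma lattice_segment_vertices:
  assumes "a \<in> Y" "b \<in> Y" "b - a \<in> Nb"
  shows "closed_segment (pt a) (pt b) \<inter> pt ` Y = {pt a, pt b}"
proof
  show "closed_segment (pt a) (pt b) \<inter> pt ` Y \<subseteq> {pt a, pt b}"
  proof
    fix p assume p: "p \<in> closed_segment (pt a) (pt b) \<inter> pt ` Y"
    then obtain d where d: "p = pt d" "d \<in> Y" by blast
    then have s: "on_seg a b (fst d) (snd d)" using p in_lattice_segment[of p a b] by simp
    show "p \<in> {pt a, pt b}"
    proof (rule ccontr)
      assume "p \<notin> {pt a, pt b}"
      then have "d \<noteq> a" "d \<noteq> b" using d by auto
      then have "{a, b} = {d}"
        using king_segment_point[OF moves[OF assms(3)] s] by (auto simp: prod_eq_iff[of d])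
      then show False using \<open>d \<noteq> a\<close> by auto
    qed
  qed
qed (use assms in auto)

text \<open>By \<open>king_segment_point\<close> two edges through \<open>p\<close> either have the
  same ends or are the two diagonals of a unit cell, which \<open>no_cross\<close> forbids.\<close>

lemma edges_meet_in_vertices:
  assumes ab: "a \<in> Y" "b \<in> Y" "b - a \<in> Nb" and ab': "a' \<in> Y" "b' \<in> Y" "b' - a' \<in> Nb"
    and p: "p \<in> closed_segment (pt a) (pt b)" "p \<in> closed_segment (pt a') (pt b')" "p \<notin> pt ` Y"
  shows "{a, b} = {a', b'}"
proof -
  define x y where "x = p $ 1" and "y = p $ 2"
  have n: "(x, y) \<noteq> (real_of_int (fst d), real_of_int (snd d))" if "d \<in> Y" for d :: "int \<times> int"
    using p(3) that by (auto simp: x_def y_def vec2_eq_iff image_iff)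
  note k = king_segment_point[OF moves[OF ab(3)] _ n[OF ab(1)] n[OF ab(2)]]
  note k' = king_segment_point[OF moves[OF ab'(3)] _ n[OF ab'(1)] n[OF ab'(2)]]
  have s: "on_seg a b x y" "on_seg a' b' x y" using p in_lattice_segment by (auto simp: x_def y_def)
  define d1 where "d1 = {(\<lfloor>x\<rfloor>, \<lfloor>y\<rfloor>), (\<lceil>x\<rceil>, \<lceil>y\<rceil>)}"
  define d2 where "d2 = {(\<lfloor>x\<rfloor>, \<lceil>y\<rceil>), (\<lceil>x\<rceil>, \<lfloor>y\<rfloor>)}"
  have K: "{a, b} = d1 \<or> {a, b} = d2" "{a', b'} = d1 \<or> {a', b'} = d2"
    using k[OF s(1)] k'[OF s(2)] by (auto simp: d1_def d2_def)
  show ?thesis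
  proof (rule ccontr)
    assume ne: "{a, b} \<noteq> {a', b'}"
    have "(A = d1 \<and> B = d2) \<or> (A = d2 \<and> B = d1)" if "A = d1 \<or> A = d2" "B = d1 \<or> B = d2" "A \<noteq> B" for A B
      using that by blast
    from this[OF K ne]
    have dd: "({a, b} = d1 \<and> {a', b'} = d2) \<or> ({a, b} = d2 \<and> {a', b'} = d1)" .
    then have "d1 \<noteq> d2" using ne by auto
    then have "\<lfloor>x\<rfloor> \<noteq> \<lceil>x\<rceil>" "\<lfloor>y\<rfloor> \<noteq> \<lceil>y\<rceil>" by (auto simp: d1_def d2_def)
    then have cf: "\<lceil>x\<rceil> = \<lfloor>x\<rfloor> + 1" "\<lceil>y\<rceil> = \<lfloor>y\<rfloor> + 1" by linarith+
    have "d1 \<union> d2 \<subseteq> Y" using dd ab ab' by blast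
    moreover have "(1, 1) \<in> Nb \<or> (-1, -1) \<in> Nb"
      using dd ab(3) ab'(3) by (auto simp: d1_def cf doubleton_eq_iff)
    moreover have "(1, -1) \<in> Nb \<or> (-1, 1) \<in> Nb"
      using dd ab(3) ab'(3) by (auto simp: d2_def cf doubleton_eq_iff)
    ultimately show False using no_cross[of "\<lfloor>x\<rfloor>" "\<lfloor>y\<rfloor>"] by (auto simp: d1_def d2_def cf)
  qed
qed

lemma subdivision: "polygonal_subdivision (pt ` Y) edges faces"
proof -
  have 1: "\<forall>f\<in>faces. convex_polygon f"
  proof
    fix f assume "f \<in> faces"
    then obtain \<phi> where \<phi>: "\<phi> \<in> \<Phi>" "f = halfplanes (C \<phi>)" by (auto simp: faces_def)
    obtain x y where "strictly_inside (C \<phi>) x y" using inner_point[OF \<phi>(1)] by blast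
    then have "(vector [x, y] :: real^2) \<in> interior f" by (simp add: \<phi> face_interior)
    then show "convex_polygon f"
      using polyhedron_halfplanes face_bounded[OF \<phi>(1)]
      by (auto simp: \<phi>(2) convex_polygon_def polytope_eq_bounded_polyhedron)
  qed
  have 2: "\<Union>faces = UNIV"
    using cover in_halfplanes by (fastforce simp: faces_def)
  have 3: "pairwise (\<lambda>f g. interior f \<inter> interior g = {}) faces"
    unfolding faces_def by (rule pairwise_imageI) (use disjoint face_interior in fastforce)
  have 4: "locally_finite_in euclidean faces"
    unfolding locally_finite_in_def
  proof (intro conjI ballI)
    fix p :: "real^2"
    let ?I = "{(i, j, t). (i, j, t) \<in> \<Phi> \<and> \<bar>i - p $ 1\<bar> \<le> 4 \<and> \<bar>j - p $ 2\<bar> \<le> 4}"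
    have "{f \<in> faces. f \<inter> ball p 1 \<noteq> {}} \<subseteq> (\<lambda>\<phi>. halfplanes (C \<phi>)) ` ?I"
    proof
      fix f assume "f \<in> {f \<in> faces. f \<inter> ball p 1 \<noteq> {}}"
      then obtain \<phi> q where q': "f = halfplanes (C \<phi>)" "\<phi> \<in> \<Phi>" "q \<in> f" "q \<in> ball p 1"
        unfolding faces_def by blast
      obtain i j t where "\<phi> = (i, j, t)" by (cases \<phi>)
      note q = q'[unfolded this]
      have "\<bar>q $ 1 - i\<bar> \<le> 3" "\<bar>q $ 2 - j\<bar> \<le> 3" using near q in_halfplanes by blast+
      moreover have "\<bar>(p - q) $ 1\<bar> < 1" "\<bar>(p - q) $ 2\<bar> < 1"
        using q(4) component_le_norm_cart[of "p - q" 1] component_le_norm_cart[of "p - q" 2]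
        by (auto simp: dist_norm)
      ultimately have "(i, j, t) \<in> ?I" using q(2) by auto
      then show "f \<in> (\<lambda>\<phi>. halfplanes (C \<phi>)) ` ?I" using q(1) by blast
    qed
    then have "finite {f \<in> faces. f \<inter> ball p 1 \<noteq> {}}" by (rule finite_surj[OF finite_near])
    then show "\<exists>V. openin euclidean V \<and> p \<in> V \<and> finite {f \<in> faces. f \<inter> V \<noteq> {}}"
      by (intro exI[of _ "ball p 1"]) auto
  qed simp
  have 5: "\<forall>e\<in>edges. \<exists>x y. x \<noteq> y \<and> e = closed_segment x y \<and> e \<inter> pt ` Y = {x, y}"
  proof
    fix e assume "e \<in> edges"
    then obtain a b where ab: "e = closed_segment (pt a) (pt b)" "a \<in> Y" "b \<in> Y" "b - a \<in> Nb"
      unfolding edges_def by blast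
    have "a \<noteq> b" using moves[OF ab(4)] by (auto simp: king_def zero_prod_def)
    then show "\<exists>x y. x \<noteq> y \<and> e = closed_segment x y \<and> e \<inter> pt ` Y = {x, y}"
      using ab lattice_segment_vertices[OF ab(2-4)] pt_eq_iff by metis
  qed
  have 6: "pairwise (\<lambda>e e'. e \<inter> e' \<subseteq> pt ` Y) edges"
  proof (rule pairwiseI, rule subsetI, rule ccontr)
    fix e e' p assume e: "e \<in> edges" "e' \<in> edges" "e \<noteq> e'" and p: "p \<in> e \<inter> e'" "p \<notin> pt ` Y"
    obtain a b where ab: "e = closed_segment (pt a) (pt b)" "a \<in> Y" "b \<in> Y" "b - a \<in> Nb"
      using e(1) unfolding edges_def by blast
    obtain a' b' where ab': "e' = closed_segment (pt a') (pt b')" "a' \<in> Y" "b' \<in> Y" "b' - a' \<in> Nb"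
      using e(2) unfolding edges_def by blast
    have "{a, b} = {a', b'}" by (rule edges_meet_in_vertices[of _ _ _ _ p]) (use ab ab' p in auto)
    then show False using e(3) ab(1) ab'(1) by (auto simp: doubleton_eq_iff closed_segment_commute)
  qed
  have 7: "pt ` Y \<subseteq> \<Union>edges"
  proof
    fix p assume "p \<in> pt ` Y"
    then obtain a where a: "p = pt a" "a \<in> Y" by blast
    obtain b where "b \<in> Y" "b - a \<in> Nb" using has_neighbour[OF a(2)] by blast
    then have "closed_segment (pt a) (pt b) \<in> edges" using a unfolding edges_def by blast
    then show "p \<in> \<Union>edges" using a(1) ends_in_segment(1) by blast
  qed
  have 8: "\<Union>edges = (\<Union>f\<in>faces. frontier f)"
  proof
    show "\<Union>edges \<subseteq> (\<Union>f\<in>faces. frontier f)"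
    proof
      fix p assume "p \<in> \<Union>edges"
      then obtain a b where "a \<in> Y" "b \<in> Y" "b - a \<in> Nb" "on_seg a b (p $ 1) (p $ 2)"
        unfolding edges_def using in_lattice_segment by blast
      then obtain \<phi> where "\<phi> \<in> \<Phi>" "inside (C \<phi>) (p $ 1) (p $ 2)" "\<not> strictly_inside (C \<phi>) (p $ 1) (p $ 2)"
        using edge_boundary by blast
      then show "p \<in> (\<Union>f\<in>faces. frontier f)" using face_frontier by (auto simp: faces_def)
    qed
    show "(\<Union>f\<in>faces. frontier f) \<subseteq> \<Union>edges"
    proof
      fix p assume "p \<in> (\<Union>f\<in>faces. frontier f)"
      then obtain \<phi> where "\<phi> \<in> \<Phi>" "p \<in> frontier (halfplanes (C \<phi>))" by (auto simp: faces_def)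
      then obtain a b where "a \<in> Y" "b \<in> Y" "b - a \<in> Nb" "p \<in> closed_segment (pt a) (pt b)"
        using boundary_edge face_frontier in_lattice_segment by meson
      then show "p \<in> \<Union>edges" unfolding edges_def by blast
    qed
  qed
  show ?thesis unfolding polygonal_subdivision_def using 1 2 3 4 5 6 7 8 by (intro conjI)
qed

lemma finite_lattice_edges: "finite {e \<in> edges. e \<inter> cball 0 r \<noteq> {}}"
proof (rule finite_subset)
  let ?I = "{\<lfloor>- r - 1\<rfloor>..\<lceil>r + 1\<rceil>} \<times> {\<lfloor>- r - 1\<rfloor>..\<lceil>r + 1\<rceil>}"
  show "finite ((\<lambda>(a, b). closed_segment (pt a) (pt b)) ` (?I \<times> ?I))" by simp
  show "{e \<in> edges. e \<inter> cball 0 r \<noteq> {}} \<subseteq> (\<lambda>(a, b). closed_segment (pt a) (pt b)) ` (?I \<times> ?I)"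
  proof
    fix e assume "e \<in> {e \<in> edges. e \<inter> cball 0 r \<noteq> {}}"
    then obtain a b where ab0: "e = closed_segment (pt a) (pt b)" "b - a \<in> Nb" "e \<inter> cball 0 r \<noteq> {}"
      unfolding edges_def by blast
    then obtain p where "p \<in> e" "norm p \<le> r" by auto
    note ab = ab0(1,2) this
    have k: "\<bar>fst b - fst a\<bar> \<le> 1" "\<bar>snd b - snd a\<bar> \<le> 1" using moves[OF ab(2)] by (auto simp: king_def)
    have near: "\<bar>p $ 1\<bar> \<le> r" "\<bar>p $ 2\<bar> \<le> r"
      using component_le_norm_cart[of p 1] component_le_norm_cart[of p 2] ab(4) by auto
    have I: "d \<in> ?I" if s: "on_seg d d' (p $ 1) (p $ 2)" "\<bar>fst d' - fst d\<bar> \<le> 1" "\<bar>snd d' - snd d\<bar> \<le> 1" for d d'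
    proof -
      obtain t :: real where t: "0 \<le> t" "t \<le> 1" "p $ 1 = real_of_int (fst d) + t * real_of_int (fst d' - fst d)"
        "p $ 2 = real_of_int (snd d) + t * real_of_int (snd d' - snd d)"
        using s(1) unfolding on_seg_def by blast
      have "\<bar>t * real_of_int (fst d' - fst d)\<bar> \<le> 1" "\<bar>t * real_of_int (snd d' - snd d)\<bar> \<le> 1"
        unfolding abs_mult using t(1,2) s(2,3) by (auto intro!: mult_le_one)
      then have "\<bar>real_of_int (fst d)\<bar> \<le> r + 1" "\<bar>real_of_int (snd d)\<bar> \<le> r + 1"
        using near unfolding t(3,4) by auto
      then have "\<lfloor>- r - 1\<rfloor> \<le> fst d" "fst d \<le> \<lceil>r + 1\<rceil>" "\<lfloor>- r - 1\<rfloor> \<le> snd d" "snd d \<le> \<lceil>r + 1\<rceil>" by linarith+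
      then show ?thesis by (cases d) simp
    qed
    have s: "on_seg a b (p $ 1) (p $ 2)" using ab in_lattice_segment by blast
    have "a \<in> ?I" by (rule I[OF s k])
    moreover have "b \<in> ?I"
      by (rule I[OF s[unfolded on_seg_commute[of a b]]]) (use k in auto)
    ultimately show "e \<in> (\<lambda>(a, b). closed_segment (pt a) (pt b)) ` (?I \<times> ?I)"
      using ab(1) by (intro image_eqI[of _ _ "(a, b)"]) auto
  qed
qed

text \<open>A face has as many sides as vertices by \<open>card_W\<close>, so it suffices to count
  the points of \<open>Y\<close> in it, which \<open>corners\<close> does.\<close>

lemma face_sides: "f \<in> faces \<Longrightarrow> finite (sides edges f) \<and> card (sides edges f) \<le> 6"
proof -
  assume f: "f \<in> faces"
  interpret plane_subdivision "pt ` Y" edges faces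
    by unfold_locales (rule subdivision, rule finite_lattice_edges)
  obtain \<phi> where \<phi>: "\<phi> \<in> \<Phi>" "f = halfplanes (C \<phi>)" using f by (auto simp: faces_def)
  obtain c where c: "c \<in> interior f" using face_interior[OF f] by blast
  interpret subdivision_face "pt ` Y" edges faces f c by unfold_locales (rule f, rule c)
  obtain A where A: "finite A" "card A \<le> 6" "{a \<in> Y. inside (C \<phi>) (fst a) (snd a)} \<subseteq> A" using corners[OF \<phi>(1)] by blast
  have "pt ` Y \<inter> f \<subseteq> pt ` A" using A(3) by (auto simp: \<phi>(2) in_halfplanes)
  then have "card (pt ` Y \<inter> f) \<le> card (pt ` A)" using A(1) by (intro card_mono) auto
  also have "\<dots> \<le> 6" using card_image_le[OF A(1), of pt] A(2) by simp
  finally show ?thesis using card_W sides_finite[OF f] by simp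
qed

end

text \<open>A common point \<open>x + d = y + d'\<close> makes half the difference the midpoint of
  \<open>d\<close> and \<open>- d'\<close>. Conversely the midpoint of \<open>x\<close> and
  \<open>y\<close> is a common point.\<close>

lemma (in symmetric_domain) neighbours_eq:
  "neighbours K X x = {y \<in> X. y \<noteq> x \<and> (1/2) *\<^sub>R (y - x) \<in> K}"
proof -
  have "((+) x ` K) \<inter> ((+) y ` K) \<noteq> {} \<longleftrightarrow> (1/2) *\<^sub>R (y - x) \<in> K" for y
  proof
    assume "((+) x ` K) \<inter> ((+) y ` K) \<noteq> {}"
    then obtain d d' where d: "d \<in> K" "d' \<in> K" "x + d = y + d'" by auto
    have "y - x = d + (- d')" using d(3) by (simp add: algebra_simps)
    then have "(1/2) *\<^sub>R (y - x) = (1/2) *\<^sub>R d + (1/2) *\<^sub>R (- d')" by (simp only: scaleR_right_distrib)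
    also have "\<dots> \<in> K" by (rule convexD[OF convex d(1) sym[OF d(2)]]) auto
    finally show "(1/2) *\<^sub>R (y - x) \<in> K" .
  next
    assume k: "(1/2) *\<^sub>R (y - x) \<in> K"
    have "x + (1/2) *\<^sub>R (y - x) = y + - ((1/2) *\<^sub>R (y - x))" by (simp add: vec2_eq_iff field_simps)
    then show "((+) x ` K) \<inter> ((+) y ` K) \<noteq> {}" using k sym[OF k] by blast
  qed
  then show ?thesis by (simp add: neighbours_def)
qed

text \<open>A criterion that does not mention the interior of \<open>K\<close>: overlapping
  interiors put half the difference into the interior, where it could be stretched by a factor above
  1.\<close>

lemma (in symmetric_domain) translate_packingI:
  assumes "\<And>x y t. x \<in> X \<Longrightarrow> y \<in> X \<Longrightarrow> x \<noteq> y \<Longrightarrow> 1 < t \<Longrightarrow> t *\<^sub>R ((1/2) *\<^sub>R (y - x)) \<notin> K"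
  shows "translate_packing K X"
  unfolding translate_packing_def
proof (rule pairwiseI, rule ccontr)
  fix x y assume xy: "x \<in> X" "y \<in> X" "x \<noteq> y" and "interior ((+) x ` K) \<inter> interior ((+) y ` K) \<noteq> {}"
  then obtain d d' where d: "d \<in> interior K" "d' \<in> interior K" "x + d = y + d'"
    by (auto simp: interior_translation)
  define w where "w = (1/2) *\<^sub>R (y - x)"
  have "uminus ` K = K" using sym by (force simp: image_iff)
  then have d'': "- d' \<in> interior K" using d(2) by (metis imageI interior_negations)
  have "y - x = d + (- d')" using d(3) by (simp add: algebra_simps)
  then have "w = (1/2) *\<^sub>R d + (1/2) *\<^sub>R (- d')" by (simp only: w_def scaleR_right_distrib)
  also have "\<dots> \<in> interior K" by (rule convexD[OF convex_interior[OF convex] d(1) d'']) auto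
  finally have w: "w \<in> interior K" .
  then obtain \<epsilon> where e: "0 < \<epsilon>" "ball w \<epsilon> \<subseteq> K" by (meson mem_interior)
  have "w \<noteq> 0" using xy by (simp add: w_def)
  define t where "t = 1 + \<epsilon> / (2 * norm w)"
  have "1 < t" using e \<open>w \<noteq> 0\<close> by (simp add: t_def)
  have "w - t *\<^sub>R w = - ((\<epsilon> / (2 * norm w)) *\<^sub>R w)" by (simp add: t_def algebra_simps)
  then have "dist w (t *\<^sub>R w) = \<epsilon> / 2" using e \<open>w \<noteq> 0\<close> by (simp add: dist_norm)
  then have "t *\<^sub>R w \<in> K" using e by auto
  then show False using assms[OF xy \<open>1 < t\<close>] by (simp add: w_def)
qed

lemma on_seg_horizontal: "on_seg (i, j) (i + 1, j) x y \<longleftrightarrow> y = real_of_int j \<and> i \<le> x \<and> x \<le> i + 1"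
  by (auto simp: on_seg_def intro!: exI[of _ "x - i"])

lemma on_seg_vertical: "on_seg (i, j) (i, j + 1) x y \<longleftrightarrow> x = real_of_int i \<and> j \<le> y \<and> y \<le> j + 1"
  by (auto simp: on_seg_def intro!: exI[of _ "y - j"])

lemma on_seg_diagonal: "on_seg (i, j) (i + 1, j + 1) x y \<longleftrightarrow> x - real_of_int i = y - real_of_int j \<and> i \<le> x \<and> x \<le> i + 1"
  by (auto simp: on_seg_def intro!: exI[of _ "x - i"])

lemma on_seg_antidiagonal:
  "on_seg (i + 1, j) (i, j + 1) x y \<longleftrightarrow> x + y = real_of_int i + real_of_int j + 1 \<and> i \<le> x \<and> x \<le> i + 1"
  by (auto simp: on_seg_def intro!: exI[of _ "i + 1 - x"])

text \<open>Up to orientation an edge has one of four directions; \<open>(i, j)\<close> is the lower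
  left corner of its bounding box.\<close>

lemma king_edge_cases:
  assumes "king (b - a)"
  obtains i j where "(a = (i, j) \<and> b = (i + 1, j)) \<or> (b = (i, j) \<and> a = (i + 1, j))"
  | i j where "(a = (i, j) \<and> b = (i, j + 1)) \<or> (b = (i, j) \<and> a = (i, j + 1))"
  | i j where "(a = (i, j) \<and> b = (i + 1, j + 1)) \<or> (b = (i, j) \<and> a = (i + 1, j + 1))"
  | i j where "(a = (i + 1, j) \<and> b = (i, j + 1)) \<or> (b = (i + 1, j) \<and> a = (i, j + 1))"
proof -
  obtain i j k l where ab: "a = (i, j)" "b = (k, l)" by (metis surj_pair)
  have "\<bar>k - i\<bar> \<le> 1" "\<bar>l - j\<bar> \<le> 1" and ne: "\<not> (k = i \<and> l = j)"
    using assms by (auto simp: king_def ab)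
  then have "k = i \<or> k = i + 1 \<or> k = i - 1" "l = j \<or> l = j + 1 \<or> l = j - 1" by linarith+
  then consider "k = i + 1" "l = j" | "k = i" "l = j + 1" | "k = i + 1" "l = j + 1" | "k = i - 1" "l = j"
    | "k = i" "l = j - 1" | "k = i - 1" "l = j - 1" | "k = i + 1" "l = j - 1" | "k = i - 1" "l = j + 1"
    using ne by (elim disjE) blast+
  then show ?thesis
  proof cases
    case 1 then show ?thesis using that(1)[of i j] ab by simp
  next
    case 2 then show ?thesis using that(2)[of i j] ab by simp
  next
    case 3 then show ?thesis using that(3)[of i j] ab by simp
  next
    case 4 then show ?thesis using that(1)[of k j] ab by simp
  next
    case 5 then show ?thesis using that(2)[of i l] ab by simp
  next
    case 6 then show ?thesis using that(3)[of k l] ab by simp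
  next
    case 7 then show ?thesis using that(4)[of i l] ab by simp
  next
    case 8 then show ?thesis using that(4)[of k j] ab by simp
  qed
qed

lemma corners_list:
  assumes "\<And>k l. (k, l) \<in> Y \<Longrightarrow> inside C (real_of_int k) (real_of_int l) \<Longrightarrow> (k, l) \<in> set xs" "length xs \<le> 6"
  shows "\<exists>A. finite A \<and> card A \<le> 6 \<and> {a \<in> Y. inside C (fst a) (snd a)} \<subseteq> A"
  using assms order_trans[OF card_length assms(2)] by (intro exI[of _ "set xs"]) auto

locale sparse_rows =
  fixes J :: "int set"
  assumes sparse: "\<And>j. j \<in> J \<Longrightarrow> j + 1 \<notin> J"

section \<open>Triangular lattice with points removed\<close>

context sparse_rows
begin

text \<open>Two removed points are never a king move apart, so the six triangles around each of them
  merge into a separate hexagon.\<close>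

definition removed :: "(int \<times> int) set" where
  "removed = {(i, j). even i \<and> j \<in> J}"

abbreviation "kept \<equiv> - removed"

text \<open>The six shortest vectors of the triangular lattice in oblique coordinates.\<close>

definition hex_moves :: "(int \<times> int) set" where
  "hex_moves = {(1, 0), (-1, 0), (0, 1), (0, -1), (1, -1), (-1, 1)}"

text \<open>Shapes 0 and 1 are the triangles into which the antidiagonal divides the cell
  \<open>(i, j)\<close>; shape 2 is the hexagon around a removed point.\<close>

definition hex_faces :: "(int \<times> int \<times> nat) set" where
  "hex_faces = {(i, j, t). (t = 0 \<and> (i, j) \<in> kept \<and> (i + 1, j) \<in> kept \<and> (i, j + 1) \<in> kept)
    \<or> (t = 1 \<and> (i + 1, j + 1) \<in> kept \<and> (i + 1, j) \<in> kept \<and> (i, j + 1) \<in> kept)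
    \<or> (t = 2 \<and> (i, j) \<in> removed)}"

definition hex_shape :: "int \<times> int \<times> nat \<Rightarrow> (real \<times> real \<times> real) list" where
  "hex_shape = (\<lambda>(i, j, t). if t = 0 then [(-1, 0, - i), (0, -1, - j), (1, 1, i + j + 1)]
    else if t = 1 then [(1, 0, i + 1), (0, 1, j + 1), (-1, -1, - i - j - 1)]
    else [(1, 0, i + 1), (-1, 0, 1 - i), (0, 1, j + 1), (0, -1, 1 - j), (1, 1, i + j + 1), (-1, -1, 1 - i - j)])"

lemma removed_independent:
  assumes "(i, j) \<in> removed" "(k, l) \<in> removed" "\<bar>k - i\<bar> \<le> 1" "\<bar>l - j\<bar> \<le> 1"
  shows "k = i \<and> l = j"
proof -
  have "l = j \<or> l = j + 1 \<or> j = l + 1" using assms(4) by linarith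
  then have "l = j" using assms(1,2) sparse[of j] sparse[of l] by (auto simp: removed_def)
  moreover have "even (k - i)" using assms(1,2) by (auto simp: removed_def)
  then have "k - i \<noteq> 1" "k - i \<noteq> -1" by presburger+
  then have "k = i" using assms(3) by linarith
  ultimately show ?thesis by simp
qed

lemma removed_neighbour_kept:
  assumes "(i, j) \<in> removed" "\<bar>k - i\<bar> \<le> 1" "\<bar>l - j\<bar> \<le> 1" "(k, l) \<noteq> (i, j)"
  shows "(k, l) \<in> kept"
  using removed_independent[OF assms(1) _ assms(2,3)] assms(4) by auto

lemma hex_inside:
  "inside (hex_shape (i, j, 0)) x y \<longleftrightarrow> i \<le> x \<and> j \<le> y \<and> x + y \<le> i + j + 1"
  "inside (hex_shape (i, j, Suc 0)) x y \<longleftrightarrow> x \<le> i + 1 \<and> y \<le> j + 1 \<and> i + j + 1 \<le> x + y"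
  "inside (hex_shape (i, j, 2)) x y \<longleftrightarrow> \<bar>x - i\<bar> \<le> 1 \<and> \<bar>y - j\<bar> \<le> 1 \<and> \<bar>x + y - i - j\<bar> \<le> 1"
  "strictly_inside (hex_shape (i, j, 0)) x y \<longleftrightarrow> i < x \<and> j < y \<and> x + y < i + j + 1"
  "strictly_inside (hex_shape (i, j, Suc 0)) x y \<longleftrightarrow> x < i + 1 \<and> y < j + 1 \<and> i + j + 1 < x + y"
  "strictly_inside (hex_shape (i, j, 2)) x y \<longleftrightarrow> \<bar>x - i\<bar> < 1 \<and> \<bar>y - j\<bar> < 1 \<and> \<bar>x + y - i - j\<bar> < 1"
  by (auto simp: inside_def strictly_inside_def hex_shape_def)

lemma hex_faces_cases:
  assumes "\<phi> \<in> hex_faces"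
  obtains i j where "\<phi> = (i, j, 0)" "(i, j) \<in> kept" "(i + 1, j) \<in> kept" "(i, j + 1) \<in> kept"
  | i j where "\<phi> = (i, j, Suc 0)" "(i + 1, j + 1) \<in> kept" "(i + 1, j) \<in> kept" "(i, j + 1) \<in> kept"
  | i j where "\<phi> = (i, j, 2)" "(i, j) \<in> removed"
  using assms unfolding hex_faces_def by auto

lemma hex_moves_king: "v \<in> hex_moves \<Longrightarrow> king v"
  by (auto simp: hex_moves_def king_def)

text \<open>The corners of a lattice triangle are king moves apart, so at most one of them is
  removed. If none is, the triangle is a face; otherwise it is a sixth of the hexagon around the
  removed corner.\<close>

lemma hex_tiling: "lattice_tiling kept hex_moves hex_faces hex_shape 3"
proof
  show "king v" if "v \<in> hex_moves" for v
    using that by (rule hex_moves_king)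
next
  fix i j
  show "\<not> ((i, j) \<in> kept \<and> (i + 1, j) \<in> kept \<and> (i, j + 1) \<in> kept \<and> (i + 1, j + 1) \<in> kept
      \<and> ((1, 1) \<in> hex_moves \<or> (-1, -1) \<in> hex_moves) \<and> ((1, -1) \<in> hex_moves \<or> (-1, 1) \<in> hex_moves))"
    by (simp add: hex_moves_def)
next
  fix a assume a: "a \<in> kept"
  obtain i j where ij: "a = (i, j)" by (cases a)
  have "(i, j + 1) \<in> kept \<or> (i + 1, j) \<in> kept"
    using sparse[of j] by (auto simp: removed_def)
  then show "\<exists>b\<in>kept. b - a \<in> hex_moves"
    by (elim disjE; intro bexI; auto simp: ij hex_moves_def)
next
  show "t < 3" if "(i, j, t) \<in> hex_faces" for i j t
    using that by (auto simp: hex_faces_def)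
next
  show "\<forall>(m, n, b)\<in>set (hex_shape \<phi>). m \<noteq> 0 \<or> n \<noteq> 0" for \<phi>
    by (cases \<phi>) (auto simp: hex_shape_def)
next
  fix i j t x y assume "(i, j, t) \<in> hex_faces" and *: "inside (hex_shape (i, j, t)) x y"
  then consider "t = 0" | "t = Suc 0" | "t = 2" by (auto simp: hex_faces_def)
  then show "\<bar>x - i\<bar> \<le> 3 \<and> \<bar>y - j\<bar> \<le> 3"
    by cases (use * in \<open>auto simp: hex_inside\<close>)
next
  fix \<phi> assume "\<phi> \<in> hex_faces"
  then show "\<exists>x y. strictly_inside (hex_shape \<phi>) x y"
  proof (cases rule: hex_faces_cases)
    case (1 i j)
    then show ?thesis by (intro exI[of _ "i + 1/4"] exI[of _ "j + 1/4"]) (auto simp: hex_inside)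
  next
    case (2 i j)
    then show ?thesis by (intro exI[of _ "i + 3/4"] exI[of _ "j + 3/4"]) (auto simp: hex_inside)
  next
    case (3 i j)
    then show ?thesis by (intro exI[of _ "real_of_int i"] exI[of _ "real_of_int j"]) (auto simp: hex_inside)
  qed
next
  fix x y :: real
  define i j where "i = \<lfloor>x\<rfloor>" and "j = \<lfloor>y\<rfloor>"
  have fl: "i \<le> x" "x < i + 1" "j \<le> y" "y < j + 1" by (auto simp: i_def j_def)
  have hx: "\<exists>\<phi>\<in>hex_faces. inside (hex_shape \<phi>) x y"
    if "(k, l) \<in> removed" "\<bar>x - k\<bar> \<le> 1" "\<bar>y - l\<bar> \<le> 1" "\<bar>x + y - k - l\<bar> \<le> 1" for k l
    using that by (intro bexI[of _ "(k, l, 2)"]) (auto simp: hex_inside hex_faces_def)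
  show "\<exists>\<phi>\<in>hex_faces. inside (hex_shape \<phi>) x y"
  proof (cases "x + y \<le> i + j + 1")
    case True
    show ?thesis
    proof (cases "(i, j) \<in> kept \<and> (i + 1, j) \<in> kept \<and> (i, j + 1) \<in> kept")
      case k: True
      then show ?thesis using fl True by (intro bexI[of _ "(i, j, 0)"]) (auto simp: hex_inside hex_faces_def)
    next
      case False
      then show ?thesis using hx[of i j] hx[of "i + 1" j] hx[of i "j + 1"] fl True by auto
    qed
  next
    case F: False
    show ?thesis
    proof (cases "(i + 1, j + 1) \<in> kept \<and> (i + 1, j) \<in> kept \<and> (i, j + 1) \<in> kept")
      case True
      then show ?thesis using fl F by (intro bexI[of _ "(i, j, Suc 0)"]) (auto simp: hex_inside hex_faces_def)
    next
      case False
      then show ?thesis using hx[of "i + 1" "j + 1"] hx[of "i + 1" j] hx[of i "j + 1"] fl F by auto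
    qed
  qed
next
  have low: "i = \<lfloor>x\<rfloor> \<and> j = \<lfloor>y\<rfloor> \<and> x + y < i + j + 1" if "strictly_inside (hex_shape (i, j, 0)) x y" for i j x y
    using that unfolding hex_inside by (auto intro!: floor_unique[symmetric])
  have high: "i = \<lfloor>x\<rfloor> \<and> j = \<lfloor>y\<rfloor> \<and> i + j + 1 < x + y" if "strictly_inside (hex_shape (i, j, Suc 0)) x y" for i j x y
    using that unfolding hex_inside by (auto intro!: floor_unique[symmetric])
  \<comment> \<open>The strict inequalities leave only the three kept corners of the triangle as
    possible centre of an overlapping hexagon; likewise in \<open>c12\<close>.\<close>
  have c02: False if "strictly_inside (hex_shape (i, j, 0)) x y" "strictly_inside (hex_shape (k, l, 2)) x y"
    "(i, j) \<in> kept" "(i + 1, j) \<in> kept" "(i, j + 1) \<in> kept" "(k, l) \<in> removed" for i j k l x y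
  proof -
    have "i \<le> k" "k \<le> i + 1" "j \<le> l" "l \<le> j + 1" "i + j \<le> k + l" "k + l \<le> i + j + 1"
      using that(1,2) unfolding hex_inside by linarith+
    then have "(k = i \<and> l = j) \<or> (k = i + 1 \<and> l = j) \<or> (k = i \<and> l = j + 1)" by linarith
    then show False using that by auto
  qed
  have c12: False if "strictly_inside (hex_shape (i, j, Suc 0)) x y" "strictly_inside (hex_shape (k, l, 2)) x y"
    "(i + 1, j + 1) \<in> kept" "(i + 1, j) \<in> kept" "(i, j + 1) \<in> kept" "(k, l) \<in> removed" for i j k l x y
  proof -
    have "i \<le> k" "k \<le> i + 1" "j \<le> l" "l \<le> j + 1" "i + j + 1 \<le> k + l" "k + l \<le> i + j + 2"
      using that(1,2) unfolding hex_inside by linarith+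
    then have "(k = i + 1 \<and> l = j + 1) \<or> (k = i + 1 \<and> l = j) \<or> (k = i \<and> l = j + 1)" by linarith
    then show False using that by auto
  qed
  have c22: "k = i \<and> l = j" if "strictly_inside (hex_shape (i, j, 2)) x y" "strictly_inside (hex_shape (k, l, 2)) x y"
    "(i, j) \<in> removed" "(k, l) \<in> removed" for i j k l x y
  proof -
    have "\<bar>k - i\<bar> \<le> 1" "\<bar>l - j\<bar> \<le> 1"
      using that(1,2) unfolding hex_inside by linarith+
    then show ?thesis using removed_independent that by blast
  qed
  fix \<phi> \<psi> x y
  assume \<phi>: "\<phi> \<in> hex_faces" and \<psi>: "\<psi> \<in> hex_faces"
    and s: "strictly_inside (hex_shape \<phi>) x y" "strictly_inside (hex_shape \<psi>) x y"
  from \<phi> show "\<phi> = \<psi>"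
  proof (cases rule: hex_faces_cases)
    case p: (1 i j)
    from \<psi> show ?thesis
    proof (cases rule: hex_faces_cases)
      case (1 k l)
      then show ?thesis using p s low[of i j x y] low[of k l x y] by simp
    next
      case (2 k l)
      then show ?thesis using p s low[of i j x y] high[of k l x y] by simp
    next
      case (3 k l)
      then show ?thesis using p s c02 by blast
    qed
  next
    case p: (2 i j)
    from \<psi> show ?thesis
    proof (cases rule: hex_faces_cases)
      case (1 k l)
      then show ?thesis using p s high[of i j x y] low[of k l x y] by simp
    next
      case (2 k l)
      then show ?thesis using p s high[of i j x y] high[of k l x y] by simp
    next
      case (3 k l)
      then show ?thesis using p s c12 by blast
    qed
  next
    case p: (3 i j)
    from \<psi> show ?thesis
    proof (cases rule: hex_faces_cases)
      case (1 k l)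
      then show ?thesis using p s c02 by blast
    next
      case (2 k l)
      then show ?thesis using p s c12 by blast
    next
      case (3 k l)
      then show ?thesis using p s c22[of i j x y k l] by simp
    qed
  qed
next
  fix \<phi> x y assume \<phi>: "\<phi> \<in> hex_faces" and i: "inside (hex_shape \<phi>) x y" and n: "\<not> strictly_inside (hex_shape \<phi>) x y"
  have ex: "\<exists>a\<in>kept. \<exists>b\<in>kept. b - a \<in> hex_moves \<and> on_seg a b x y"
    if "a \<in> kept" "b \<in> kept" "b - a \<in> hex_moves" "on_seg a b x y" for a b using that by blast
  from \<phi> show "\<exists>a\<in>kept. \<exists>b\<in>kept. b - a \<in> hex_moves \<and> on_seg a b x y"
  proof (cases rule: hex_faces_cases)
    case (1 i j)
    then consider "x = i" | "y = j" | "x + y = i + j + 1" using i n unfolding 1 hex_inside by linarith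
    then show ?thesis
    proof cases
      case a: 1
      then show ?thesis using 1 i unfolding 1 hex_inside
        by (intro ex[of "(i, j)" "(i, j + 1)"]) (auto simp: hex_moves_def on_seg_vertical)
    next
      case a: 2
      then show ?thesis using 1 i unfolding 1 hex_inside
        by (intro ex[of "(i, j)" "(i + 1, j)"]) (auto simp: hex_moves_def on_seg_horizontal)
    next
      case a: 3
      then show ?thesis using 1 i unfolding 1 hex_inside
        by (intro ex[of "(i + 1, j)" "(i, j + 1)"]) (auto simp: hex_moves_def on_seg_antidiagonal)
    qed
  next
    case (2 i j)
    then consider "x = i + 1" | "y = j + 1" | "x + y = i + j + 1" using i n unfolding 2 hex_inside by linarith
    then show ?thesis
    proof cases
      case a: 1
      then show ?thesis using 2 i unfolding 2 hex_inside
        by (intro ex[of "(i + 1, j)" "(i + 1, j + 1)"]) (auto simp: hex_moves_def on_seg_vertical)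
    next
      case a: 2
      then show ?thesis using 2 i unfolding 2 hex_inside
        by (intro ex[of "(i, j + 1)" "(i + 1, j + 1)"]) (auto simp: hex_moves_def on_seg_horizontal)
    next
      case a: 3
      then show ?thesis using 2 i unfolding 2 hex_inside
        by (intro ex[of "(i + 1, j)" "(i, j + 1)"]) (auto simp: hex_moves_def on_seg_antidiagonal)
    qed
  next
    case (3 i j)
    note K = removed_neighbour_kept[OF 3(2)]
    consider "x - i = 1" | "x - i = -1" | "y - j = 1" | "y - j = -1" | "x + y - i - j = 1" | "x + y - i - j = -1"
      using i n unfolding 3 hex_inside by linarith
    then show ?thesis
    proof cases
      case a: 1
      then show ?thesis using i K[of "i + 1" "j - 1"] K[of "i + 1" j] on_seg_vertical[of "i + 1" "j - 1" x y] unfolding 3 hex_inside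
        by (intro ex[of "(i + 1, j - 1)" "(i + 1, j)"]) (auto simp: hex_moves_def)
    next
      case a: 2
      then show ?thesis using i K[of "i - 1" "j + 1"] K[of "i - 1" j] on_seg_vertical[of "i - 1" j x y] unfolding 3 hex_inside
        by (intro ex[of "(i - 1, j)" "(i - 1, j + 1)"]) (auto simp: hex_moves_def)
    next
      case a: 3
      then show ?thesis using i K[of "i - 1" "j + 1"] K[of i "j + 1"] on_seg_horizontal[of "i - 1" "j + 1" x y] unfolding 3 hex_inside
        by (intro ex[of "(i - 1, j + 1)" "(i, j + 1)"]) (auto simp: hex_moves_def)
    next
      case a: 4
      then show ?thesis using i K[of "i + 1" "j - 1"] K[of i "j - 1"] on_seg_horizontal[of i "j - 1" x y] unfolding 3 hex_inside
        by (intro ex[of "(i, j - 1)" "(i + 1, j - 1)"]) (auto simp: hex_moves_def)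
    next
      case a: 5
      then show ?thesis using i K[of "i + 1" j] K[of i "j + 1"] on_seg_antidiagonal[of i j x y] unfolding 3 hex_inside
        by (intro ex[of "(i + 1, j)" "(i, j + 1)"]) (auto simp: hex_moves_def)
    next
      case a: 6
      then show ?thesis using i K[of "i - 1" j] K[of i "j - 1"] on_seg_antidiagonal[of "i - 1" "j - 1" x y] unfolding 3 hex_inside
        by (intro ex[of "(i, j - 1)" "(i - 1, j)"]) (auto simp: hex_moves_def)
    qed
  qed
next
  fix a b x y assume ab: "a \<in> kept" "b \<in> kept" "b - a \<in> hex_moves" and s: "on_seg a b x y"
  have ex: "\<exists>\<phi>\<in>hex_faces. inside (hex_shape \<phi>) x y \<and> \<not> strictly_inside (hex_shape \<phi>) x y"
    if "\<phi> \<in> hex_faces" "inside (hex_shape \<phi>) x y" "\<not> strictly_inside (hex_shape \<phi>) x y" for \<phi> using that by blast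
  have "king (b - a)" using ab(3) by (rule hex_moves_king)
  then show "\<exists>\<phi>\<in>hex_faces. inside (hex_shape \<phi>) x y \<and> \<not> strictly_inside (hex_shape \<phi>) x y"
  proof (cases rule: king_edge_cases)
    case (1 i j)
    then have k: "(i, j) \<in> kept" "(i + 1, j) \<in> kept" "y = j" "i \<le> x" "x \<le> i + 1"
      using ab s on_seg_commute on_seg_horizontal by metis+
    show ?thesis
    proof (cases "(i, j + 1) \<in> kept")
      case True
      then show ?thesis using k by (intro ex[of "(i, j, 0)"]) (auto simp: hex_faces_def hex_inside)
    next
      case False
      then show ?thesis using k by (intro ex[of "(i, j + 1, 2)"]) (auto simp: hex_faces_def hex_inside)
    qed
  next
    case (2 i j)
    then have k: "(i, j) \<in> kept" "(i, j + 1) \<in> kept" "x = i" "j \<le> y" "y \<le> j + 1"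
      using ab s on_seg_commute on_seg_vertical by metis+
    show ?thesis
    proof (cases "(i + 1, j) \<in> kept")
      case True
      then show ?thesis using k by (intro ex[of "(i, j, 0)"]) (auto simp: hex_faces_def hex_inside)
    next
      case False
      then show ?thesis using k by (intro ex[of "(i + 1, j, 2)"]) (auto simp: hex_faces_def hex_inside)
    qed
  next
    case (3 i j)
    then show ?thesis using ab(3) by (auto simp: hex_moves_def)
  next
    case (4 i j)
    then have k: "(i + 1, j) \<in> kept" "(i, j + 1) \<in> kept" "x + y = real_of_int i + real_of_int j + 1" "i \<le> x" "x \<le> i + 1"
      using ab s on_seg_commute on_seg_antidiagonal by metis+
    show ?thesis
    proof (cases "(i, j) \<in> kept")
      case True
      then show ?thesis using k by (intro ex[of "(i, j, 0)"]) (auto simp: hex_faces_def hex_inside)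
    next
      case False
      then show ?thesis using k by (intro ex[of "(i, j, 2)"]) (auto simp: hex_faces_def hex_inside)
    qed
  qed
next
  fix \<phi> assume "\<phi> \<in> hex_faces"
  then show "\<exists>A. finite A \<and> card A \<le> 6 \<and> {a \<in> kept. inside (hex_shape \<phi>) (fst a) (snd a)} \<subseteq> A"
  proof (cases rule: hex_faces_cases)
    case (1 i j)
    show ?thesis
    proof (rule corners_list[of _ _ "[(i, j), (i + 1, j), (i, j + 1)]"])
      fix k l :: int assume "inside (hex_shape \<phi>) k l"
      then have "(k = i \<and> l = j) \<or> (k = i + 1 \<and> l = j) \<or> (k = i \<and> l = j + 1)"
        unfolding 1 hex_inside by linarith
      then show "(k, l) \<in> set [(i, j), (i + 1, j), (i, j + 1)]" by auto
    qed simp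
  next
    case (2 i j)
    show ?thesis
    proof (rule corners_list[of _ _ "[(i + 1, j + 1), (i + 1, j), (i, j + 1)]"])
      fix k l :: int assume "inside (hex_shape \<phi>) k l"
      then have "(k = i + 1 \<and> l = j + 1) \<or> (k = i + 1 \<and> l = j) \<or> (k = i \<and> l = j + 1)"
        unfolding 2 hex_inside by linarith
      then show "(k, l) \<in> set [(i + 1, j + 1), (i + 1, j), (i, j + 1)]" by auto
    qed simp
  next
    case (3 i j)
    show ?thesis
    proof (rule corners_list[of _ _ "[(i + 1, j), (i - 1, j), (i, j + 1), (i, j - 1), (i + 1, j - 1), (i - 1, j + 1)]"])
      fix k l :: int assume kl: "(k, l) \<in> kept" "inside (hex_shape \<phi>) k l"
      have "\<bar>k - i\<bar> \<le> 1" "\<bar>l - j\<bar> \<le> 1" "\<bar>k + l - i - j\<bar> \<le> 1"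
        using kl(2) unfolding 3 hex_inside by linarith+
      moreover have "\<not> (k = i \<and> l = j)" using kl(1) 3(2) by auto
      moreover from calculation have "k = i - 1 \<or> k = i \<or> k = i + 1" "l = j - 1 \<or> l = j \<or> l = j + 1" by linarith+
      ultimately show "(k, l) \<in> set [(i + 1, j), (i - 1, j), (i, j + 1), (i, j - 1), (i + 1, j - 1), (i - 1, j + 1)]" by auto
    qed simp
  qed
qed

end

section \<open>Diamonds and hexagons with filled rows\<close>

text \<open>Row \<open>h\<close> contains the points \<open>x\<close> with \<open>x + off h\<close> even, and all integer points if
  \<open>h \<in> B\<close>. Rows \<open>h \<in> A\<close> are joined to the next row by vertical edges, other rows by a zigzag. Every
  other integer point \<open>(c, h)\<close> with \<open>h - 1 \<notin> A\<close> is the centre of a diamond, of the lower half of a hexagon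
  (\<open>h \<in> A\<close>), or of a diamond cut into four triangles (\<open>h \<in> B\<close>).\<close>

locale zigzag_rows =
  fixes A B :: "int set" and off :: "int \<Rightarrow> int"
  assumes off: "\<And>h. even (off (h + 1)) \<longleftrightarrow> (even (off h) \<longleftrightarrow> h \<in> A)"
    and A_sparse: "\<And>h. h \<in> A \<Longrightarrow> h + 1 \<notin> A"
    and B_sparse: "\<And>h. h \<in> B \<Longrightarrow> h + 1 \<notin> B"
    and B_A: "\<And>h. h \<in> B \<Longrightarrow> h \<notin> A \<and> h - 1 \<notin> A"
begin

definition on_row :: "int \<Rightarrow> int \<Rightarrow> bool" where "on_row i h \<longleftrightarrow> even (i + off h)"

definition points :: "(int \<times> int) set" where
  "points = {(i, h). on_row i h \<or> h \<in> B}"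

definition king_moves :: "(int \<times> int) set" where
  "king_moves = {v. king v}"

text \<open>Positions with \<open>h - 1 \<in> A\<close> do not occur as centres: they lie inside the
  hexagon centred at \<open>(i, h - 1)\<close>. Shapes 1 to 4 are the quarters of a cut
  diamond.\<close>

definition sq_faces :: "(int \<times> int \<times> nat) set" where
  "sq_faces = {(i, h, t). \<not> on_row i h \<and> ((t = 0 \<and> h - 1 \<notin> A \<and> h \<notin> B) \<or> (t \<in> {1, 2, 3, 4} \<and> h \<in> B))}"

text \<open>The height by which a diamond is stretched upwards to become a hexagon.\<close>

definition bump :: "int \<Rightarrow> real" where "bump h = (if h \<in> A then 1 else 0)"

text \<open>\<open>sx\<close> and \<open>sy\<close> name the quadrant, relative to the centre, that
  contains the triangle of shape \<open>t\<close>.\<close>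

definition sx :: "nat \<Rightarrow> real" where "sx t = (if t = 1 \<or> t = 2 then 1 else -1)"

definition sy :: "nat \<Rightarrow> real" where "sy t = (if t = 1 \<or> t = 3 then 1 else -1)"

text \<open>The first two inequalities are the vertical sides of a hexagon; a diamond touches these
  lines only in its left and right corner.\<close>

definition sq_shape :: "int \<times> int \<times> nat \<Rightarrow> (real \<times> real \<times> real) list" where
  "sq_shape = (\<lambda>(i, h, t). if t = 0 then [(1, 0, i + 1), (-1, 0, 1 - i), (1, -1, 1 + i - h), (-1, -1, 1 - i - h),
      (1, 1, 1 + bump h + i + h), (-1, 1, 1 + bump h - i + h)]
    else [(- sx t, 0, - (sx t * i)), (0, - sy t, - (sy t * h)), (sx t, sy t, sx t * i + sy t * h + 1)])"

lemma on_row_Suc: "on_row (i + 1) h \<longleftrightarrow> \<not> on_row i h" "on_row (i - 1) h \<longleftrightarrow> \<not> on_row i h"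
  by (auto simp: on_row_def)

lemma on_row_up: "on_row i (h + 1) \<longleftrightarrow> (on_row i h \<longleftrightarrow> h \<in> A)"
  using off[of h] by (auto simp: on_row_def)

lemma on_row_down: "on_row i (h - 1) \<longleftrightarrow> (on_row i h \<longleftrightarrow> h - 1 \<in> A)"
  using on_row_up[of i "h - 1"] by auto

lemma sq_inside:
  "inside (sq_shape (i, h, 0)) x y \<longleftrightarrow> \<bar>x - i\<bar> \<le> 1 \<and> \<bar>x - i\<bar> - 1 \<le> y - h \<and> y - h \<le> 1 - \<bar>x - i\<bar> + bump h"
  "strictly_inside (sq_shape (i, h, 0)) x y \<longleftrightarrow> \<bar>x - i\<bar> < 1 \<and> \<bar>x - i\<bar> - 1 < y - h \<and> y - h < 1 - \<bar>x - i\<bar> + bump h"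
  by (auto simp: inside_def strictly_inside_def sq_shape_def)

lemma tri_inside:
  assumes "t \<noteq> 0"
  shows "inside (sq_shape (i, h, t)) x y \<longleftrightarrow> 0 \<le> sx t * (x - i) \<and> 0 \<le> sy t * (y - h) \<and> sx t * (x - i) + sy t * (y - h) \<le> 1"
    "strictly_inside (sq_shape (i, h, t)) x y \<longleftrightarrow> 0 < sx t * (x - i) \<and> 0 < sy t * (y - h) \<and> sx t * (x - i) + sy t * (y - h) < 1"
  using assms by (auto simp: inside_def strictly_inside_def sq_shape_def algebra_simps)

lemma sign_index:
  assumes "s = 1 \<or> s = -1" "s' = 1 \<or> s' = -1"
  obtains t where "t \<in> {1, 2, 3, 4}" "sx t = s" "sy t = s'"
  using assms that[of 1] that[of 2] that[of 3] that[of 4] by (auto simp: sx_def sy_def)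

lemma signs: "sx t = 1 \<or> sx t = -1" "sy t = 1 \<or> sy t = -1"
  by (auto simp: sx_def sy_def)

lemma sign_index_unique: "t \<in> {1, 2, 3, 4} \<Longrightarrow> t' \<in> {1, 2, 3, 4} \<Longrightarrow> sx t = sx t' \<Longrightarrow> sy t = sy t' \<Longrightarrow> t = t'"
  by (auto simp: sx_def sy_def split: if_splits)

lemma bump_cases: "h \<in> A \<Longrightarrow> bump h = 1" "h \<notin> A \<Longrightarrow> bump h = 0"
  by (auto simp: bump_def)

lemma triangle_in_diamond:
  assumes "strictly_inside (sq_shape (i, h, t)) x y" "t \<in> {1, 2, 3, 4}" "h \<in> B"
  shows "strictly_inside (sq_shape (i, h, 0)) x y"
proof -
  have t: "t \<noteq> 0" using assms(2) by auto
  have "0 < sx t * (x - i)" "0 < sy t * (y - h)" "sx t * (x - i) + sy t * (y - h) < 1"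
    using assms(1) unfolding tri_inside(2)[OF t] by auto
  moreover have "bump h = 0" using B_A[OF assms(3)] bump_cases by auto
  ultimately show ?thesis unfolding sq_inside using signs[of t] by auto
qed

text \<open>In different rows, \<open>lt\<close> leaves only l = h + 2 if \<open>h \<in> A\<close>
  and l = h + 1 otherwise. In both cases the parity of the rows makes \<open>k - i\<close> odd, so
  the horizontal distances of \<open>x\<close> to the two centres add up to at least 1, against
  \<open>lt\<close>.\<close>

lemma centres_unique_le:
  assumes c: "\<not> on_row i h" "h - 1 \<notin> A" "\<not> on_row k l" "l - 1 \<notin> A"
    and s: "strictly_inside (sq_shape (i, h, 0)) x y" "strictly_inside (sq_shape (k, l, 0)) x y" and "h \<le> l"
  shows "k = i \<and> l = h"
proof -
  have b: "bump h \<le> 1" by (simp add: bump_def)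
  have odd_ge: "1 \<le> \<bar>x - i\<bar> + \<bar>x - k\<bar>" if "odd (k - i)"
  proof -
    have "k - i \<noteq> 0" using that by auto
    then have "1 \<le> \<bar>k - i\<bar>" by linarith
    then have "1 \<le> \<bar>real_of_int k - real_of_int i\<bar>" by linarith
    then show ?thesis by linarith
  qed
  have lt: "real_of_int l - h < 2 - \<bar>x - i\<bar> - \<bar>x - k\<bar> + bump h"
    using s unfolding sq_inside by linarith
  show ?thesis
  proof (cases "l = h")
    case True
    have "even (k - i)" using c(1,3) True by (simp add: on_row_def)
    moreover have "\<bar>k - i\<bar> < 2" using s unfolding sq_inside by linarith
    ultimately have "k = i" by presburger
    then show ?thesis using True by simp
  next
    case False
    show ?thesis
    proof (cases "h \<in> A")
      case hA: True
      then have "l \<noteq> h + 1" using c(4) by auto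
      moreover have "l < h + 3" using lt b by linarith
      ultimately have l: "l = h + 2" using False \<open>h \<le> l\<close> by linarith
      have "on_row k (h + 1) \<longleftrightarrow> on_row k h" using on_row_up hA by blast
      moreover have "on_row k (h + 1 + 1) \<longleftrightarrow> \<not> on_row k (h + 1)" using on_row_up A_sparse[OF hA] by blast
      ultimately have "on_row k h" using c(3) l by (simp add: add.assoc)
      then have "odd (k - i)" using c(1) by (auto simp: on_row_def)
      then show ?thesis using odd_ge lt b l by auto
    next
      case hA: False
      then have "bump h = 0" by (simp add: bump_cases)
      then have "l < h + 2" using lt by linarith
      then have l: "l = h + 1" using False \<open>h \<le> l\<close> by linarith
      then have "on_row k h" using c(3) on_row_up hA by blast
      then have "odd (k - i)" using c(1) by (auto simp: on_row_def)
      then show ?thesis using odd_ge lt \<open>bump h = 0\<close> l by auto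
    qed
  qed
qed

lemma centres_unique:
  assumes c: "\<not> on_row i h" "h - 1 \<notin> A" "\<not> on_row k l" "l - 1 \<notin> A"
    and s: "strictly_inside (sq_shape (i, h, 0)) x y" "strictly_inside (sq_shape (k, l, 0)) x y"
  shows "k = i \<and> l = h"
proof (cases "h \<le> l")
  case False
  then show ?thesis using centres_unique_le[OF c(3,4,1,2) s(2,1)] by auto
qed (rule centres_unique_le[OF c s])

lemma odd_near:
  fixes x :: real
  obtains i where "\<not> on_row i h" "\<bar>x - real_of_int i\<bar> \<le> 1"
proof (cases "on_row \<lfloor>x\<rfloor> h")
  case True
  have "\<bar>x - real_of_int (\<lfloor>x\<rfloor> + 1)\<bar> \<le> 1" by linarith
  then show ?thesis using that[of "\<lfloor>x\<rfloor> + 1"] on_row_Suc(1)[of "\<lfloor>x\<rfloor>" h] True by blast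
next
  case False
  have "\<bar>x - real_of_int \<lfloor>x\<rfloor>\<bar> \<le> 1" by linarith
  then show ?thesis using that[of "\<lfloor>x\<rfloor>"] False by blast
qed

text \<open>Take the row below the point and an off-row position \<open>c\<close> near
  \<open>x\<close>. Below the zigzag the region belongs to \<open>c\<close> in this row, or in the
  row underneath if that one is aligned with it. Above the zigzag it belongs to the next row, at the
  position \<open>c'\<close> on the other side of \<open>x\<close>.\<close>

lemma centre_exists:
  obtains i h where "\<not> on_row i h" "h - 1 \<notin> A" "inside (sq_shape (i, h, 0)) x y"
proof -
  define k where "k = \<lfloor>y\<rfloor>"
  have y: "k \<le> y" "y < k + 1" by (auto simp: k_def)
  obtain c where c: "\<not> on_row c k" "\<bar>x - c\<bar> \<le> 1" by (rule odd_near)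
  show ?thesis
  proof (cases "k \<in> A")
    case True
    then have "k - 1 \<notin> A" using A_sparse[of "k - 1"] by auto
    then show ?thesis using that[of c k] c y True by (auto simp: sq_inside bump_cases)
  next
    case kA: False
    show ?thesis
    proof (cases "y - k \<le> 1 - \<bar>x - c\<bar>")
      case low: True
      show ?thesis
      proof (cases "k - 1 \<in> A")
        case True
        then have "k - 1 - 1 \<notin> A" using A_sparse[of "k - 1 - 1"] by auto
        moreover have "\<not> on_row c (k - 1)" using c(1) on_row_down True by blast
        ultimately show ?thesis using that[of c "k - 1"] c y low True by (auto simp: sq_inside bump_cases)
      next
        case False
        then show ?thesis using that[of c k] c y low kA by (auto simp: sq_inside bump_cases)
      qed
    next
      case high: False
      define c' where "c' = (if c \<le> x then c + 1 else c - 1)"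
      have "\<bar>x - c'\<bar> = 1 - \<bar>x - c\<bar>" using c(2) by (auto simp: c'_def)
      moreover have "on_row c' k" using c(1) on_row_Suc by (auto simp: c'_def)
      then have "\<not> on_row c' (k + 1)" using on_row_up kA by blast
      moreover have "0 \<le> bump (k + 1)" by (simp add: bump_def)
      ultimately show ?thesis using that[of c' "k + 1"] c y high kA by (auto simp: sq_inside)
    qed
  qed
qed

lemma sq_faces_cases:
  assumes "\<phi> \<in> sq_faces"
  obtains i h where "\<phi> = (i, h, 0)" "\<not> on_row i h" "h - 1 \<notin> A" "h \<notin> B"
  | i h t where "\<phi> = (i, h, t)" "\<not> on_row i h" "h \<in> B" "t \<in> {1, 2, 3, 4}" "t \<noteq> 0" "h \<notin> A" "h - 1 \<notin> A"
proof -
  obtain i h t where \<phi>: "\<phi> = (i, h, t)" by (cases \<phi>)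
  show ?thesis
  proof (cases "t = 0")
    case True
    then show ?thesis using assms that(1)[of i h] by (auto simp: \<phi> sq_faces_def)
  next
    case False
    then show ?thesis using assms that(2)[of i h t] B_A[of h] by (auto simp: \<phi> sq_faces_def)
  qed
qed

lemma filled_corners:
  assumes "h \<in> B" "\<not> on_row i h"
  shows "(i, h) \<in> points" "(i + 1, h) \<in> points" "(i - 1, h) \<in> points" "(i, h + 1) \<in> points" "(i, h - 1) \<in> points"
  using assms B_A[OF assms(1)] on_row_up[of i h] on_row_down[of i h] by (auto simp: points_def)

lemma king_moves_iff: "v \<in> king_moves \<longleftrightarrow> king v"
  by (simp add: king_moves_def)

text \<open>Covering and disjointness are settled for undivided diamonds and hexagons by
  \<open>centre_exists\<close> and \<open>centres_unique\<close>; a cut diamond is then resolved by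
  the signs of the coordinates relative to its centre.\<close>

lemma sq_tiling: "lattice_tiling points king_moves sq_faces sq_shape 5"
proof
  show "king v" if "v \<in> king_moves" for v using that by (simp add: king_moves_iff)
next
  fix i j
  show "\<not> ((i, j) \<in> points \<and> (i + 1, j) \<in> points \<and> (i, j + 1) \<in> points \<and> (i + 1, j + 1) \<in> points
      \<and> ((1, 1) \<in> king_moves \<or> (-1, -1) \<in> king_moves) \<and> ((1, -1) \<in> king_moves \<or> (-1, 1) \<in> king_moves))"
    using on_row_Suc(1)[of i j] on_row_Suc(1)[of i "j + 1"] B_sparse[of j] by (auto simp: points_def)
next
  fix a assume a: "a \<in> points"
  obtain i j where ij: "a = (i, j)" by (cases a)
  have ex: "\<exists>b\<in>points. b - a \<in> king_moves" if "(k, l) \<in> points" "king (k - i, l - j)" for k l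
    using that by (intro bexI[of _ "(k, l)"]) (auto simp: ij king_moves_iff)
  show "\<exists>b\<in>points. b - a \<in> king_moves"
  proof (cases "on_row i j")
    case True
    then have "(i, j + 1) \<in> points \<or> (i + 1, j + 1) \<in> points"
      using on_row_up[of i j] on_row_Suc(1)[of i "j + 1"] by (auto simp: points_def)
    then show ?thesis using ex[of i "j + 1"] ex[of "i + 1" "j + 1"] by (auto simp: king_def)
  next
    case False
    then show ?thesis using ex[of "i + 1" j] on_row_Suc(1)[of i j] by (auto simp: points_def king_def)
  qed
next
  show "t < 5" if "(i, j, t) \<in> sq_faces" for i j t
    using that by (auto simp: sq_faces_def)
next
  show "\<forall>(m, n, b)\<in>set (sq_shape \<phi>). m \<noteq> 0 \<or> n \<noteq> 0" for \<phi>
    by (cases \<phi>) (auto simp: sq_shape_def sx_def sy_def)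
next
  fix i j t x y assume \<phi>: "(i, j, t) \<in> sq_faces" and *: "inside (sq_shape (i, j, t)) x y"
  show "\<bar>x - i\<bar> \<le> 3 \<and> \<bar>y - j\<bar> \<le> 3"
  proof (cases "t = 0")
    case True
    then show ?thesis using * by (auto simp: sq_inside bump_def split: if_splits)
  next
    case False
    then show ?thesis using * signs[of t] by (auto simp: tri_inside)
  qed
next
  fix \<phi> assume "\<phi> \<in> sq_faces"
  then show "\<exists>x y. strictly_inside (sq_shape \<phi>) x y"
  proof (cases rule: sq_faces_cases)
    case (1 i h)
    then show ?thesis by (intro exI[of _ "real_of_int i"] exI[of _ "real_of_int h"]) (auto simp: sq_inside bump_def)
  next
    case (2 i h t)
    then show ?thesis using signs[of t]
      by (intro exI[of _ "i + sx t / 4"] exI[of _ "h + sy t / 4"]) (auto simp: tri_inside)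
  qed
next
  fix x y :: real
  obtain i h where ih: "\<not> on_row i h" "h - 1 \<notin> A" "inside (sq_shape (i, h, 0)) x y" by (rule centre_exists)
  show "\<exists>\<phi>\<in>sq_faces. inside (sq_shape \<phi>) x y"
  proof (cases "h \<in> B")
    case True
    define s where "s = (if i \<le> x then 1 else -1 :: real)"
    define s' where "s' = (if h \<le> y then 1 else -1 :: real)"
    have "s = 1 \<or> s = -1" "s' = 1 \<or> s' = -1" by (auto simp: s_def s'_def)
    then obtain t where t: "t \<in> {1, 2, 3, 4}" "sx t = s" "sy t = s'" by (rule sign_index)
    have "bump h = 0" using True B_A bump_cases by auto
    then have "inside (sq_shape (i, h, t)) x y"
      using ih(3) t by (subst tri_inside) (auto simp: sq_inside s_def s'_def)
    moreover have "(i, h, t) \<in> sq_faces" using ih True t by (auto simp: sq_faces_def)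
    ultimately show ?thesis by blast
  next
    case False
    then have "(i, h, 0) \<in> sq_faces" using ih by (simp add: sq_faces_def)
    then show ?thesis using ih(3) by blast
  qed
next
  fix \<phi> \<psi> x y
  assume \<phi>: "\<phi> \<in> sq_faces" and \<psi>: "\<psi> \<in> sq_faces"
    and s: "strictly_inside (sq_shape \<phi>) x y" "strictly_inside (sq_shape \<psi>) x y"
  obtain i h t k l t' where e: "\<phi> = (i, h, t)" "\<psi> = (k, l, t')" by (metis surj_pair)
  have base: "\<not> on_row i h \<and> h - 1 \<notin> A \<and> strictly_inside (sq_shape (i, h, 0)) x y"
    if f: "(i, h, t) \<in> sq_faces" and st: "strictly_inside (sq_shape (i, h, t)) x y" for i h t
  proof (cases "t = 0")
    case True
    then show ?thesis using f st by (auto simp: sq_faces_def)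
  next
    case False
    then show ?thesis using f triangle_in_diamond[OF st] B_A[of h] by (auto simp: sq_faces_def)
  qed
  have kl: "k = i" "l = h"
    using centres_unique[of i h k l x y] base[of i h t] base[of k l t'] \<phi> \<psi> s e by auto
  have "t = t'"
  proof (cases "h \<in> B")
    case True
    then have t: "t \<in> {1, 2, 3, 4}" "t' \<in> {1, 2, 3, 4}" "t \<noteq> 0" "t' \<noteq> 0"
      using \<phi> \<psi> e kl by (auto simp: sq_faces_def)
    have "0 < sx t * (x - i)" "0 < sx t' * (x - i)" "0 < sy t * (y - h)" "0 < sy t' * (y - h)"
      using s e kl t(3,4) by (auto simp: tri_inside)
    then have "sx t = sx t'" "sy t = sy t'" using signs[of t] signs[of t'] by auto
    then show ?thesis using sign_index_unique t by blast
  next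
    case False
    then show ?thesis using \<phi> \<psi> e kl by (auto simp: sq_faces_def)
  qed
  then show "\<phi> = \<psi>" using e kl by simp
next
  fix \<phi> x y assume \<phi>: "\<phi> \<in> sq_faces" and i: "inside (sq_shape \<phi>) x y" and n: "\<not> strictly_inside (sq_shape \<phi>) x y"
  have ex: "\<exists>a\<in>points. \<exists>b\<in>points. b - a \<in> king_moves \<and> on_seg a b x y"
    if "a \<in> points" "b \<in> points" "king (b - a)" "on_seg a b x y" for a b using that king_moves_iff by blast
  have H: "\<exists>a\<in>points. \<exists>b\<in>points. b - a \<in> king_moves \<and> on_seg a b x y"
    if "(k, l) \<in> points" "(k + 1, l) \<in> points" "y = real_of_int l" "k \<le> x" "x \<le> k + 1" for k l
    by (rule ex[OF that(1,2)]) (use that in \<open>auto simp: king_def on_seg_horizontal\<close>)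
  have V: "\<exists>a\<in>points. \<exists>b\<in>points. b - a \<in> king_moves \<and> on_seg a b x y"
    if "(k, l) \<in> points" "(k, l + 1) \<in> points" "x = real_of_int k" "l \<le> y" "y \<le> l + 1" for k l
    by (rule ex[OF that(1,2)]) (use that in \<open>auto simp: king_def on_seg_vertical\<close>)
  have D: "\<exists>a\<in>points. \<exists>b\<in>points. b - a \<in> king_moves \<and> on_seg a b x y"
    if "(k, l) \<in> points" "(k + 1, l + 1) \<in> points" "x - real_of_int k = y - real_of_int l" "k \<le> x" "x \<le> k + 1" for k l
    by (rule ex[OF that(1,2)]) (use that in \<open>auto simp: king_def on_seg_diagonal\<close>)
  have X: "\<exists>a\<in>points. \<exists>b\<in>points. b - a \<in> king_moves \<and> on_seg a b x y"
    if "(k + 1, l) \<in> points" "(k, l + 1) \<in> points" "x + y = real_of_int k + real_of_int l + 1" "k \<le> x" "x \<le> k + 1" for k l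
    by (rule ex[OF that(1,2)]) (use that in \<open>auto simp: king_def on_seg_antidiagonal\<close>)
  from \<phi> show "\<exists>a\<in>points. \<exists>b\<in>points. b - a \<in> king_moves \<and> on_seg a b x y"
  proof (cases rule: sq_faces_cases)
    case (1 c h)
    have P: "(c, h - 1) \<in> points" "(c + 1, h) \<in> points" "(c - 1, h) \<in> points"
      using 1 on_row_down[of c h] on_row_Suc by (auto simp: points_def)
    \<comment> \<open>The integer form of \<open>bump h\<close>: the upper vertices are (c
      \<plusminus> 1, h + b) and (c, h + b + 1).\<close>
    define b where "b = (if h \<in> A then 1 else 0 :: int)"
    have b: "bump h = b" by (simp add: bump_def b_def)
    have Q: "(c + 1, h + b) \<in> points" "(c - 1, h + b) \<in> points" "(c, h + b + 1) \<in> points"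
    proof -
      show "(c + 1, h + b) \<in> points" "(c - 1, h + b) \<in> points"
        using P 1 on_row_up[of "c + 1" h] on_row_up[of "c - 1" h] on_row_Suc by (auto simp: b_def points_def)
      show "(c, h + b + 1) \<in> points"
      proof (cases "h \<in> A")
        case True
        then have "\<not> on_row c (h + 1)" using 1 on_row_up by blast
        then have "on_row c (h + 1 + 1)" using on_row_up A_sparse[OF True] by blast
        then show ?thesis using True by (simp add: b_def points_def)
      next
        case False
        then show ?thesis using 1 on_row_up by (simp add: b_def points_def)
      qed
    qed
    have u: "\<bar>x - c\<bar> \<le> 1" "\<bar>x - c\<bar> - 1 \<le> y - h" "y - h \<le> 1 - \<bar>x - c\<bar> + b"
      using i unfolding 1 sq_inside b by auto
    have "\<bar>x - c\<bar> = 1 \<or> y - h = \<bar>x - c\<bar> - 1 \<or> y - h = 1 - \<bar>x - c\<bar> + b"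
      using i n unfolding 1 sq_inside b by linarith
    then consider "x - c = 1" "h \<in> A" | "x - c = -1" "h \<in> A" | "y - h = x - c - 1" "0 \<le> x - c"
      | "y - h = - (x - c) - 1" "x - c \<le> 0" | "y - h = 1 - (x - c) + b" "0 \<le> x - c" | "y - h = 1 + (x - c) + b" "x - c \<le> 0"
      using u by (cases "h \<in> A") (auto simp: b_def abs_if split: if_splits)
    then show ?thesis
    proof cases
      case a: 1
      then show ?thesis using V[of "c + 1" h] P Q u by (auto simp: b_def)
    next
      case a: 2
      then show ?thesis using V[of "c - 1" h] P Q u by (auto simp: b_def)
    next
      case a: 3
      then show ?thesis using D[of c "h - 1"] P u by auto
    next
      case a: 4
      then show ?thesis using X[of "c - 1" "h - 1"] P u by auto
    next
      case a: 5
      then show ?thesis using X[of c "h + b"] Q u by auto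
    next
      case a: 6
      then show ?thesis using D[of "c - 1" "h + b"] Q u by auto
    qed
  next
    case (2 c h t)
    note P = filled_corners[OF 2(3,2)]
    have u: "0 \<le> sx t * (x - c)" "0 \<le> sy t * (y - h)" "sx t * (x - c) + sy t * (y - h) \<le> 1"
      using i unfolding 2(1) tri_inside[OF 2(5)] by auto
    have "x = c \<or> y = h \<or> sx t * (x - c) + sy t * (y - h) = 1"
      using i n signs[of t] unfolding 2(1) tri_inside[OF 2(5)] by auto
    then consider "x = c" | "y = h" | "sx t * (x - c) + sy t * (y - h) = 1" by blast
    then show ?thesis
    proof cases
      case a: 1
      then show ?thesis using V[of c h] V[of c "h - 1"] P u signs(2)[of t] by auto
    next
      case a: 2
      then show ?thesis using H[of c h] H[of "c - 1" h] P u signs(1)[of t] by auto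
    next
      case a: 3
      consider "sx t = 1" "sy t = 1" | "sx t = 1" "sy t = -1" | "sx t = -1" "sy t = 1" | "sx t = -1" "sy t = -1"
        using signs[of t] by blast
      then show ?thesis
      proof cases
        case b: 1
        then show ?thesis using X[of c h] P u a by auto
      next
        case b: 2
        then show ?thesis using D[of c "h - 1"] P u a by auto
      next
        case b: 3
        then show ?thesis using D[of "c - 1" h] P u a by auto
      next
        case b: 4
        then show ?thesis using X[of "c - 1" "h - 1"] P u a by auto
      qed
    qed
  qed
next
  fix a b x y assume ab: "a \<in> points" "b \<in> points" "b - a \<in> king_moves" and s: "on_seg a b x y"
  have base: "\<exists>\<phi>\<in>sq_faces. inside (sq_shape \<phi>) x y \<and> \<not> strictly_inside (sq_shape \<phi>) x y"
    if "\<not> on_row c h" "h - 1 \<notin> A" "h \<notin> B" "inside (sq_shape (c, h, 0)) x y" "\<not> strictly_inside (sq_shape (c, h, 0)) x y" for c h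
    using that by (intro bexI[of _ "(c, h, 0)"]) (auto simp: sq_faces_def)
  have tri: "\<exists>\<phi>\<in>sq_faces. inside (sq_shape \<phi>) x y \<and> \<not> strictly_inside (sq_shape \<phi>) x y"
    if c: "\<not> on_row c h" "h \<in> B" "s = 1 \<or> s = -1" "s' = 1 \<or> s' = -1"
      "0 \<le> s * (x - c)" "0 \<le> s' * (y - h)" "s * (x - c) + s' * (y - h) \<le> 1"
      "s * (x - c) = 0 \<or> s' * (y - h) = 0 \<or> s * (x - c) + s' * (y - h) = 1" for c h and s s' :: real
  proof -
    obtain t where t: "t \<in> {1, 2, 3, 4}" "sx t = s" "sy t = s'" using sign_index c(3,4) by blast
    then have "t \<noteq> 0" by auto
    moreover have "(c, h, t) \<in> sq_faces" using c(1,2) t by (auto simp: sq_faces_def)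
    ultimately show ?thesis using c(5-8) t by (intro bexI[of _ "(c, h, t)"]) (auto simp: tri_inside)
  qed
  from ab(3) have "king (b - a)" by (simp add: king_moves_iff)
  then show "\<exists>\<phi>\<in>sq_faces. inside (sq_shape \<phi>) x y \<and> \<not> strictly_inside (sq_shape \<phi>) x y"
  proof (cases rule: king_edge_cases)
    case (1 i j)
    then have k: "(i, j) \<in> points" "(i + 1, j) \<in> points" "y = j" "i \<le> x" "x \<le> i + 1"
      using ab s on_seg_commute on_seg_horizontal by metis+
    then have "j \<in> B" using on_row_Suc(1)[of i j] by (auto simp: points_def)
    then show ?thesis
      using tri[of i j 1 1] tri[of "i + 1" j "-1" 1] on_row_Suc(1)[of i j] k by auto
  next
    case (2 i j)
    then have k: "(i, j) \<in> points" "(i, j + 1) \<in> points" "x = i" "j \<le> y" "y \<le> j + 1"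
      using ab s on_seg_commute on_seg_vertical by metis+
    show ?thesis
    proof (cases "on_row i j \<and> on_row i (j + 1)")
      case True
      then have jA: "j \<in> A" using on_row_up[of i j] by blast
      then have "j - 1 \<notin> A" using A_sparse[of "j - 1"] by auto
      moreover have "j \<notin> B" using B_A jA by blast
      moreover have "\<not> on_row (i + 1) j" using True on_row_Suc by blast
      ultimately show ?thesis using base[of "i + 1" j] k jA by (auto simp: sq_inside bump_cases)
    next
      case False
      then show ?thesis
        using tri[of i j 1 1] tri[of i "j + 1" 1 "-1"] k by (auto simp: points_def)
    qed
  next
    case (3 i j)
    then have k: "(i, j) \<in> points" "(i + 1, j + 1) \<in> points" "x - real_of_int i = y - real_of_int j" "i \<le> x" "x \<le> i + 1"
      using ab s on_seg_commute on_seg_diagonal by metis+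
    \<comment> \<open>If \<open>(i, j)\<close> were an extra point of a filled row,
      \<open>(i + 1, j + 1)\<close> would be off its row as well and two consecutive rows would be
      filled. Alignment of the two rows would put \<open>(i + 1, j + 1)\<close> off its row too,
      next to a row of \<open>A\<close>, which \<open>B_A\<close> excludes.\<close>
    have r: "on_row i j" "j \<notin> A"
      using k(1,2) B_sparse[of j] B_A[of j] B_A[of "j + 1"] on_row_up[of i j] on_row_Suc(1)[of i "j + 1"]
      by (auto simp: points_def)
    then have "\<not> on_row i (j + 1)" using on_row_up by blast
    then show ?thesis
      using tri[of i "j + 1" 1 "-1"] base[of i "j + 1"] r k
      by (cases "j + 1 \<in> B") (auto simp: sq_inside bump_def)
  next
    case (4 i j)
    then have k: "(i + 1, j) \<in> points" "(i, j + 1) \<in> points" "x + y = real_of_int i + real_of_int j + 1" "i \<le> x" "x \<le> i + 1"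
      using ab s on_seg_commute on_seg_antidiagonal by metis+
    have r: "on_row (i + 1) j" "j \<notin> A"
      using k(1,2) B_sparse[of j] B_A[of j] B_A[of "j + 1"] on_row_up[of i j] on_row_Suc(1)[of i j]
      by (auto simp: points_def)
    then have "\<not> on_row (i + 1) (j + 1)" using on_row_up by blast
    then show ?thesis
      using tri[of "i + 1" "j + 1" "-1" "-1"] base[of "i + 1" "j + 1"] r k
      by (cases "j + 1 \<in> B") (auto simp: sq_inside bump_def)
  qed
next
  fix \<phi> assume "\<phi> \<in> sq_faces"
  then show "\<exists>A. finite A \<and> card A \<le> 6 \<and> {a \<in> points. inside (sq_shape \<phi>) (fst a) (snd a)} \<subseteq> A"
  proof (cases rule: sq_faces_cases)
    case (1 c h)
    show ?thesis
    proof (cases "h \<in> A")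
      case hA: True
      have "\<not> on_row c (h + 1)" "h + 1 \<notin> B" using 1 on_row_up hA B_A[of "h + 1"] by auto
      then have n: "(c, h) \<notin> points" "(c, h + 1) \<notin> points" using 1 by (auto simp: points_def)
      show ?thesis
      proof (rule corners_list[of _ _ "[(c, h - 1), (c + 1, h), (c - 1, h), (c + 1, h + 1), (c - 1, h + 1), (c, h + 2)]"])
        fix k l :: int assume kl: "(k, l) \<in> points" "inside (sq_shape \<phi>) k l"
        have "\<bar>k - c\<bar> \<le> 1" "\<bar>k - c\<bar> - 1 \<le> l - h" "l - h \<le> 2 - \<bar>k - c\<bar>"
          using kl(2) hA unfolding 1 sq_inside bump_cases(1)[OF hA] by linarith+
        then have "(k = c \<and> (l = h - 1 \<or> l = h \<or> l = h + 1 \<or> l = h + 2)) \<or> ((k = c + 1 \<or> k = c - 1) \<and> (l = h \<or> l = h + 1))"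
          by (cases "k = c") (auto simp: abs_if split: if_splits)
        then show "(k, l) \<in> set [(c, h - 1), (c + 1, h), (c - 1, h), (c + 1, h + 1), (c - 1, h + 1), (c, h + 2)]"
          using n kl(1) by auto
      qed simp
    next
      case hA: False
      have n: "(c, h) \<notin> points" using 1 by (auto simp: points_def)
      show ?thesis
      proof (rule corners_list[of _ _ "[(c, h - 1), (c + 1, h), (c - 1, h), (c, h + 1)]"])
        fix k l :: int assume kl: "(k, l) \<in> points" "inside (sq_shape \<phi>) k l"
        have "\<bar>k - c\<bar> \<le> 1" "\<bar>k - c\<bar> - 1 \<le> l - h" "l - h \<le> 1 - \<bar>k - c\<bar>"
          using kl(2) hA unfolding 1 sq_inside bump_cases(2)[OF hA] by linarith+
        then have "(k = c \<and> (l = h - 1 \<or> l = h \<or> l = h + 1)) \<or> ((k = c + 1 \<or> k = c - 1) \<and> l = h)"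
          by (cases "k = c") (auto simp: abs_if split: if_splits)
        then show "(k, l) \<in> set [(c, h - 1), (c + 1, h), (c - 1, h), (c, h + 1)]"
          using n kl(1) by auto
      qed simp
    qed
  next
    case (2 c h t)
    define s s' where "s = (if sx t = 1 then 1 else -1 :: int)" and "s' = (if sy t = 1 then 1 else -1 :: int)"
    have ss: "sx t = s" "sy t = s'" using signs[of t] by (auto simp: s_def s'_def)
    show ?thesis
    proof (rule corners_list[of _ _ "[(c, h), (c + s, h), (c, h + s')]"])
      fix k l :: int assume kl: "(k, l) \<in> points" "inside (sq_shape \<phi>) k l"
      have "0 \<le> s * (k - c)" "0 \<le> s' * (l - h)" "s * (k - c) + s' * (l - h) \<le> 1"
        using kl(2) signs[of t] unfolding 2(1) tri_inside[OF 2(5)] by (auto simp: s_def s'_def)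
      then show "(k, l) \<in> set [(c, h), (c + s, h), (c, h + s')]"
        by (auto simp: s_def s'_def split: if_splits)
    qed simp
  qed
qed

end

section \<open>Counting lattice points in discs\<close>

definition lin2 :: "real^2 \<Rightarrow> real^2 \<Rightarrow> real^2 \<Rightarrow> real^2" where
  "lin2 a b p = p $ 1 *\<^sub>R a + p $ 2 *\<^sub>R b"

lemma linear_lin2: "linear (lin2 a b)"
  by (rule linearI) (simp_all add: lin2_def algebra_simps)

lemma inj_lin2:
  assumes "cross2 a b \<noteq> 0"
  shows "inj (lin2 a b)"
proof (rule injI)
  fix p q assume e: "lin2 a b p = lin2 a b q"
  have "cross2 (lin2 a b p) b = p $ 1 * cross2 a b" "cross2 a (lin2 a b p) = p $ 2 * cross2 a b" for p
    by (simp_all add: lin2_def cross2_add)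
  then show "p = q" using e assms by (metis mult_cancel_right vec2_eq_iff)
qed

lemma lin2_bijection: "cross2 a b \<noteq> 0 \<Longrightarrow> linear_bijection (lin2 a b)"
  unfolding linear_bijection_def using linear_lin2 inj_lin2 by blast

lemma det_lin2: "det (matrix (lin2 a b)) = cross2 a b"
  by (simp add: det_2 matrix_def lin2_def cross2_def axis_def algebra_simps)

lemma measure_lin2_image: "S \<in> lmeasurable \<Longrightarrow> measure lebesgue (lin2 a b ` S) = \<bar>cross2 a b\<bar> * measure lebesgue S"
  using measure_linear_image[OF linear_lin2, of S a b] by (simp add: det_lin2)

lemma lmeasurable_lin2_image: "S \<in> lmeasurable \<Longrightarrow> lin2 a b ` S \<in> lmeasurable"
  using measurable_linear_image[OF linear_lin2] .

definition cell :: "real^2 \<Rightarrow> real^2 \<Rightarrow> int \<times> int \<Rightarrow> (real^2) set" where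
  "cell a b = (\<lambda>(i, k). (+) (lin2 a b (pt (i, k))) ` lin2 a b ` cbox 0 1)"

lemma cell_lmeasurable: "cell a b z \<in> lmeasurable"
  unfolding cell_def by (cases z) (simp add: measurable_translation lmeasurable_lin2_image)

lemma measure_cell: "measure lebesgue (cell a b z) = \<bar>cross2 a b\<bar>"
proof -
  have "measure lebesgue (cbox 0 1 :: (real^2) set) = 1"
  proof -
    have "0 \<in> (cbox 0 1 :: (real^2) set)" by (simp add: mem_box_cart)
    then have "cbox 0 1 \<noteq> ({} :: (real^2) set)" by blast
    then show ?thesis by (simp add: content_cbox_cart)
  qed
  then show ?thesis
    unfolding cell_def by (cases z) (simp add: measure_translation measure_lin2_image)
qed

lemma in_cell:
  "p \<in> cell a b (i, k) \<longleftrightarrow> (\<exists>s u. real_of_int i \<le> s \<and> s \<le> real_of_int i + 1 \<and> real_of_int k \<le> u \<and> u \<le> real_of_int k + 1 \<and> p = s *\<^sub>R a + u *\<^sub>R b)"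
proof
  assume "p \<in> cell a b (i, k)"
  then obtain q :: "real^2" where q: "q \<in> cbox 0 1" "p = lin2 a b (pt (i, k)) + lin2 a b q" by (auto simp: cell_def)
  have "0 \<le> q $ 1" "q $ 1 \<le> 1" "0 \<le> q $ 2" "q $ 2 \<le> 1" using q(1) by (auto simp: mem_box_cart)
  then show "\<exists>s u. real_of_int i \<le> s \<and> s \<le> real_of_int i + 1 \<and> real_of_int k \<le> u \<and> u \<le> real_of_int k + 1 \<and> p = s *\<^sub>R a + u *\<^sub>R b"
    using q(2) by (intro exI[of _ "i + q $ 1"] exI[of _ "k + q $ 2"]) (auto simp: lin2_def algebra_simps)
next
  assume "\<exists>s u. real_of_int i \<le> s \<and> s \<le> real_of_int i + 1 \<and> real_of_int k \<le> u \<and> u \<le> real_of_int k + 1 \<and> p = s *\<^sub>R a + u *\<^sub>R b"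
  then obtain s u where su: "real_of_int i \<le> s" "s \<le> real_of_int i + 1" "real_of_int k \<le> u" "u \<le> real_of_int k + 1" "p = s *\<^sub>R a + u *\<^sub>R b" by blast
  define q :: "real^2" where "q = vector [s - i, u - k]"
  have "q \<in> cbox 0 1" using su by (simp add: mem_box_cart q_def forall_2)
  moreover have "p = lin2 a b (pt (i, k)) + lin2 a b q" by (simp add: su q_def lin2_def algebra_simps)
  ultimately show "p \<in> cell a b (i, k)" by (auto simp: cell_def)
qed

lemma cells_negligible:
  assumes "cross2 a b \<noteq> 0" "z \<noteq> z'"
  shows "negligible (cell a b z \<inter> cell a b z')"
proof -
  have ne: "a \<noteq> 0" "b \<noteq> 0" using assms(1) by auto
  have fst_less: "negligible (cell a b (i, k) \<inter> cell a b (i', k'))" if "i < i'" for i i' k k'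
  proof (rule negligible_subset[OF negligible_cross2[OF ne(2), of "i' *\<^sub>R a"]], rule subsetI)
    fix p assume "p \<in> cell a b (i, k) \<inter> cell a b (i', k')"
    then have "p \<in> cell a b (i, k)" "p \<in> cell a b (i', k')" by simp_all
    then obtain s u s' u' :: real where su: "s \<le> real_of_int i + 1" "p = s *\<^sub>R a + u *\<^sub>R b"
        "real_of_int i' \<le> s'" "p = s' *\<^sub>R a + u' *\<^sub>R b"
      unfolding in_cell by blast
    have "cross2 p b = s * cross2 a b" "cross2 p b = s' * cross2 a b" by (subst su(2), simp add: cross2_add, subst su(4), simp add: cross2_add)
    then have "s = s'" using assms(1) by simp
    then have "s = i'" using su(1,3) that by linarith
    then show "p \<in> {q. cross2 b (q - i' *\<^sub>R a) = 0}" using su(2) by (simp add: cross2_add)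
  qed
  have snd_less: "negligible (cell a b (i, k) \<inter> cell a b (i', k'))" if "k < k'" for i i' k k'
  proof (rule negligible_subset[OF negligible_cross2[OF ne(1), of "k' *\<^sub>R b"]], rule subsetI)
    fix p assume "p \<in> cell a b (i, k) \<inter> cell a b (i', k')"
    then have "p \<in> cell a b (i, k)" "p \<in> cell a b (i', k')" by simp_all
    then obtain s u s' u' :: real where su: "u \<le> real_of_int k + 1" "p = s *\<^sub>R a + u *\<^sub>R b"
        "real_of_int k' \<le> u'" "p = s' *\<^sub>R a + u' *\<^sub>R b"
      unfolding in_cell by blast
    have "cross2 a p = u * cross2 a b" "cross2 a p = u' * cross2 a b" by (subst su(2), simp add: cross2_add, subst su(4), simp add: cross2_add)
    then have "u = u'" using assms(1) by simp
    then have "u = k'" using su(1,3) that by linarith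
    then show "p \<in> {q. cross2 a (q - k' *\<^sub>R b) = 0}" using su(2) by (simp add: cross2_add)
  qed
  obtain i k i' k' where z: "z = (i, k)" "z' = (i', k')" by (metis surj_pair)
  consider "i < i'" | "i' < i" | "k < k'" | "k' < k" using assms(2) z by fastforce
  then show ?thesis unfolding z
    by cases (use fst_less[of i i' k k'] fst_less[of i' i k' k] snd_less[of k k' i i'] snd_less[of k' k i' i] in \<open>auto simp: Int_commute\<close>)
qed

lemma finite_near_lattice:
  assumes "cross2 a b \<noteq> 0"
  shows "finite {(i, k). norm (real_of_int i *\<^sub>R a + real_of_int k *\<^sub>R b) \<le> r}"
proof (rule finite_subset)
  define M where "M = nat \<lceil>r * (norm a + norm b) / \<bar>cross2 a b\<bar>\<rceil>"
  show "{(i, k). norm (real_of_int i *\<^sub>R a + real_of_int k *\<^sub>R b) \<le> r} \<subseteq> {- int M..int M} \<times> {- int M..int M}"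
  proof
    fix z assume "z \<in> {(i, k). norm (real_of_int i *\<^sub>R a + real_of_int k *\<^sub>R b) \<le> r}"
    then obtain i k where z: "z = (i, k)" and n: "norm (real_of_int i *\<^sub>R a + real_of_int k *\<^sub>R b) \<le> r" (is "norm ?v \<le> r")
      by blast
    have "0 \<le> r" using n norm_ge_zero order_trans by blast
    have pos: "0 < \<bar>cross2 a b\<bar>" using assms by simp
    have "\<bar>real_of_int i\<bar> * \<bar>cross2 a b\<bar> = \<bar>cross2 ?v b\<bar>" by (simp add: cross2_add abs_mult)
    also have "\<dots> \<le> norm ?v * norm b" by (rule abs_cross2_le)
    also have "\<dots> \<le> r * (norm a + norm b)" using n \<open>0 \<le> r\<close> by (intro mult_mono) auto
    finally have 1: "\<bar>real_of_int i\<bar> \<le> r * (norm a + norm b) / \<bar>cross2 a b\<bar>" using pos by (simp add: field_simps)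
    have "\<bar>real_of_int k\<bar> * \<bar>cross2 a b\<bar> = \<bar>cross2 a ?v\<bar>" by (simp add: cross2_add abs_mult)
    also have "\<dots> \<le> norm a * norm ?v" by (rule abs_cross2_le)
    also have "\<dots> \<le> (norm a + norm b) * r" using n \<open>0 \<le> r\<close> by (intro mult_mono) auto
    finally have 2: "\<bar>real_of_int k\<bar> \<le> r * (norm a + norm b) / \<bar>cross2 a b\<bar>" using pos by (simp add: field_simps)
    have "\<bar>real_of_int i\<bar> \<le> real M" "\<bar>real_of_int k\<bar> \<le> real M" using 1 2 unfolding M_def by linarith+
    then have "- int M \<le> i" "i \<le> int M" "- int M \<le> k" "k \<le> int M" by linarith+
    then show "z \<in> {- int M..int M} \<times> {- int M..int M}" unfolding z by simp
  qed
qed simp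

text \<open>If a family of points stays at bounded distance from the lattice spanned by \<open>a\<close> and \<open>b\<close>, it has
  the density of that lattice: assign to each point the cell of its lattice point.\<close>

lemma perturbed_lattice_count:
  fixes y :: "int \<times> int \<Rightarrow> real^2"
  assumes ab: "cross2 a b \<noteq> 0" and C: "\<And>i k. norm (y (i, k) - (real_of_int i *\<^sub>R a + real_of_int k *\<^sub>R b)) \<le> C"
  shows "((\<lambda>R. real (card {z. norm (y z) \<le> R}) / R\<^sup>2) \<longlongrightarrow> pi / \<bar>cross2 a b\<bar>) at_top"
proof -
  define I where "I = (\<lambda>R. {z. norm (y z) \<le> R})"
  \<comment> \<open>Exceeds the distance of \<open>y z\<close> from every point of the cell assigned
    to it.\<close>
  define E where "E = C + norm a + norm b + 1"
  have C0: "0 \<le> C" using C[of 0 0] norm_ge_zero order_trans by blast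
  have E: "0 < E" using C0 by (simp add: E_def add_nonneg_pos)
  have fin: "finite (I R)" for R
  proof (rule finite_subset[OF _ finite_near_lattice[OF ab, of "R + C"]], clarify)
    fix i k assume "(i, k) \<in> I R"
    then show "norm (real_of_int i *\<^sub>R a + real_of_int k *\<^sub>R b) \<le> R + C"
      using C[of i k] norm_triangle_sub[of "real_of_int i *\<^sub>R a + real_of_int k *\<^sub>R b" "y (i, k)"]
      by (simp add: I_def norm_minus_commute)
  qed
  have dist: "norm (p - y z) < E" if pz: "p \<in> cell a b z" for p z
  proof -
    obtain i k where z: "z = (i, k)" by (cases z)
    then obtain s u where su: "real_of_int i \<le> s" "s \<le> real_of_int i + 1" "real_of_int k \<le> u" "u \<le> real_of_int k + 1" "p = s *\<^sub>R a + u *\<^sub>R b"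
      using pz unfolding z in_cell by blast
    let ?l = "real_of_int i *\<^sub>R a + real_of_int k *\<^sub>R b"
    have "p - ?l = (s - i) *\<^sub>R a + (u - k) *\<^sub>R b" by (simp add: su algebra_simps)
    then have "norm (p - ?l) \<le> \<bar>s - i\<bar> * norm a + \<bar>u - k\<bar> * norm b" using norm_triangle_ineq by (metis norm_scaleR)
    also have "\<dots> \<le> 1 * norm a + 1 * norm b" using su by (intro add_mono mult_right_mono) auto
    finally have "norm (p - ?l) \<le> norm a + norm b" by simp
    moreover have "norm (p - y z) \<le> norm (p - ?l) + norm (?l - y z)" using norm_triangle_ineq[of "p - ?l" "?l - y z"] by simp
    ultimately show ?thesis using C[of i k] by (simp add: E_def z norm_minus_commute)
  qed
  have sum: "card (I R) * \<bar>cross2 a b\<bar> = measure lebesgue (\<Union>z\<in>I R. cell a b z)" for R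
  proof -
    have "measure lebesgue (\<Union>z\<in>I R. cell a b z) = (\<Sum>z\<in>I R. measure lebesgue (cell a b z))"
      by (rule measure_negligible_finite_Union_image[OF fin cell_lmeasurable])
         (simp add: pairwise_def cells_negligible[OF ab])
    then show ?thesis by (simp add: measure_cell)
  qed
  have Um: "(\<Union>z\<in>I R. cell a b z) \<in> lmeasurable" for R
    using fin cell_lmeasurable by (intro fmeasurable.finite_UN) auto
  have up: "card (I R) * \<bar>cross2 a b\<bar> \<le> pi * (R + E)\<^sup>2" if "0 \<le> R" for R
  proof -
    have "(\<Union>z\<in>I R. cell a b z) \<subseteq> ball 0 (R + E)"
    proof
      fix p assume "p \<in> (\<Union>z\<in>I R. cell a b z)"
      then obtain z where "norm (y z) \<le> R" "p \<in> cell a b z" by (auto simp: I_def)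
      then show "p \<in> ball 0 (R + E)" using dist[of p z] norm_triangle_sub[of p "y z"] by simp
    qed
    then have "measure lebesgue (\<Union>z\<in>I R. cell a b z) \<le> measure lebesgue (ball 0 (R + E) :: (real^2) set)"
      using Um by (intro measure_mono_fmeasurable) (auto simp: fmeasurableD)
    then show ?thesis unfolding sum using measure_disc[of "R + E" 0] that E by simp
  qed
  have low: "pi * (R - E)\<^sup>2 \<le> card (I R) * \<bar>cross2 a b\<bar>" if "E \<le> R" for R
  proof -
    have "ball 0 (R - E) \<subseteq> (\<Union>z\<in>I R. cell a b z)"
    proof
      fix p :: "real^2" assume p: "p \<in> ball 0 (R - E)"
      define s where "s = cross2 p b / cross2 a b"
      define u where "u = cross2 a p / cross2 a b"
      have "cross2 a b *\<^sub>R p = cross2 a b *\<^sub>R (s *\<^sub>R a + u *\<^sub>R b)"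
        using ab cross2_expansion[of a b p] by (simp add: s_def u_def scaleR_right_distrib)
      then have "p = s *\<^sub>R a + u *\<^sub>R b" using ab by simp
      then have "p \<in> cell a b (\<lfloor>s\<rfloor>, \<lfloor>u\<rfloor>)"
        unfolding in_cell by (intro exI[of _ s] exI[of _ u]) (auto simp: less_imp_le)
      moreover have "(\<lfloor>s\<rfloor>, \<lfloor>u\<rfloor>) \<in> I R"
        using dist[OF calculation] p norm_triangle_sub[of "y (\<lfloor>s\<rfloor>, \<lfloor>u\<rfloor>)" p] by (simp add: I_def norm_minus_commute)
      ultimately show "p \<in> (\<Union>z\<in>I R. cell a b z)" by blast
    qed
    then have "measure lebesgue (ball 0 (R - E) :: (real^2) set) \<le> measure lebesgue (\<Union>z\<in>I R. cell a b z)"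
      using Um by (intro measure_mono_fmeasurable) auto
    then show ?thesis unfolding sum using measure_disc[of "R - E" 0] that by simp
  qed
  have c: "0 < \<bar>cross2 a b\<bar>" using ab by simp
  have inv: "((\<lambda>R. E / R) \<longlongrightarrow> 0) at_top"
    by (rule real_tendsto_divide_at_top[OF tendsto_const filterlim_ident])
  have "((\<lambda>R. real (card (I R)) / R\<^sup>2) \<longlongrightarrow> pi / \<bar>cross2 a b\<bar>) at_top"
  proof (rule tendsto_sandwich[of "\<lambda>R. pi / \<bar>cross2 a b\<bar> * (1 - E / R)\<^sup>2" _ _ "\<lambda>R. pi / \<bar>cross2 a b\<bar> * (1 + E / R)\<^sup>2"])
    have "((\<lambda>R. pi / \<bar>cross2 a b\<bar> * (1 - E / R)\<^sup>2) \<longlongrightarrow> pi / \<bar>cross2 a b\<bar> * (1 - 0)\<^sup>2) at_top"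
      by (intro tendsto_intros inv)
    then show "((\<lambda>R. pi / \<bar>cross2 a b\<bar> * (1 - E / R)\<^sup>2) \<longlongrightarrow> pi / \<bar>cross2 a b\<bar>) at_top" by simp
    have "((\<lambda>R. pi / \<bar>cross2 a b\<bar> * (1 + E / R)\<^sup>2) \<longlongrightarrow> pi / \<bar>cross2 a b\<bar> * (1 + 0)\<^sup>2) at_top"
      by (intro tendsto_intros inv)
    then show "((\<lambda>R. pi / \<bar>cross2 a b\<bar> * (1 + E / R)\<^sup>2) \<longlongrightarrow> pi / \<bar>cross2 a b\<bar>) at_top" by simp
    have ev: "\<forall>\<^sub>F R in at_top. E \<le> R" by (rule eventually_ge_at_top)
    show "\<forall>\<^sub>F R in at_top. pi / \<bar>cross2 a b\<bar> * (1 - E / R)\<^sup>2 \<le> card (I R) / R\<^sup>2"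
      using ev
    proof eventually_elim
      case (elim R)
      then have R: "0 < R" using E by simp
      then have "pi / \<bar>cross2 a b\<bar> * (1 - E / R)\<^sup>2 = pi * (R - E)\<^sup>2 / (\<bar>cross2 a b\<bar> * R\<^sup>2)"
        by (simp add: field_simps power2_eq_square)
      also have "\<dots> \<le> card (I R) * \<bar>cross2 a b\<bar> / (\<bar>cross2 a b\<bar> * R\<^sup>2)"
        using low[OF elim] c R by (intro divide_right_mono) auto
      finally show ?case using c by simp
    qed
    show "\<forall>\<^sub>F R in at_top. card (I R) / R\<^sup>2 \<le> pi / \<bar>cross2 a b\<bar> * (1 + E / R)\<^sup>2"
      using ev
    proof eventually_elim
      case (elim R)
      then have R: "0 < R" using E by simp
      have "card (I R) / R\<^sup>2 = card (I R) * \<bar>cross2 a b\<bar> / (\<bar>cross2 a b\<bar> * R\<^sup>2)" using c by simp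
      also have "\<dots> \<le> pi * (R + E)\<^sup>2 / (\<bar>cross2 a b\<bar> * R\<^sup>2)"
        using up[of R] c R by (intro divide_right_mono) auto
      also have "\<dots> = pi / \<bar>cross2 a b\<bar> * (1 + E / R)\<^sup>2"
        using R by (simp add: field_simps power2_eq_square)
      finally show ?case .
    qed
  qed
  then show ?thesis unfolding I_def .
qed

section \<open>Densities of sets of lattice points\<close>

locale lattice_map =
  fixes a b :: "real^2"
  assumes ab: "cross2 a b \<noteq> 0"
begin

sublocale linear_bijection "lin2 a b"
  by (rule lin2_bijection[OF ab])

definition disc :: "real \<Rightarrow> (int \<times> int) set" where
  "disc R = {z. norm (lin2 a b (pt z)) \<le> R}"

text \<open>Normalised so that the whole lattice has density 1: its image under
  \<open>lin2 a b\<close> has about \<open>pi * R\<^sup>2 / \<bar>cross2 a b\<bar>\<close> points in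
  the disc.\<close>

definition dens :: "(int \<times> int) set \<Rightarrow> real \<Rightarrow> bool" where
  "dens S d \<longleftrightarrow> ((\<lambda>R. real (card (S \<inter> disc R)) / R\<^sup>2) \<longlongrightarrow> d * pi / \<bar>cross2 a b\<bar>) at_top"

lemma finite_disc: "finite (disc R)"
  using finite_near_lattice[OF ab, of R] by (rule finite_subset[rotated]) (auto simp: disc_def lin2_def)

text \<open>\<open>q\<close> is the mean distance of the rows and \<open>s\<close> the step within a
  row. Rounding the row numbers and shifting the rows moves points by a bounded amount, so
  \<open>perturbed_lattice_count\<close> applies.\<close>

lemma dens_rows:
  fixes r off :: "int \<Rightarrow> int"
  assumes s: "0 < s" and q: "0 < q" and r: "inj r" "\<And>k. \<bar>real_of_int (r k) - k * q\<bar> \<le> 1" and off: "\<And>k. \<bar>off k\<bar> \<le> 2"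
  shows "dens {(s * i + off k, r k) | i k. True} (1 / (s * q))"
proof -
  define z where "z = (\<lambda>(i, k). (s * i + off k, r k))"
  define y where "y = (\<lambda>x. lin2 a b (pt (z x)))"
  have injz: "inj z"
  proof (rule injI)
    fix x x' assume e: "z x = z x'"
    obtain i k i' k' where x: "x = (i, k)" "x' = (i', k')" by (metis surj_pair)
    have "r k = r k'" using e by (simp add: z_def x)
    then have k: "k = k'" using r(1) by (simp add: inj_eq)
    have "s * i = s * i'" using e by (simp add: z_def x k)
    then show "x = x'" using s by (simp add: x k)
  qed
  have "norm (y (i, k) - (real_of_int i *\<^sub>R (s *\<^sub>R a) + real_of_int k *\<^sub>R (q *\<^sub>R b))) \<le> 2 * norm a + norm b" for i k
  proof -
    have "y (i, k) - (real_of_int i *\<^sub>R (s *\<^sub>R a) + real_of_int k *\<^sub>R (q *\<^sub>R b))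
        = real_of_int (off k) *\<^sub>R a + (r k - k * q) *\<^sub>R b"
      by (simp add: y_def z_def lin2_def algebra_simps)
    also have "norm \<dots> \<le> \<bar>real_of_int (off k)\<bar> * norm a + \<bar>r k - k * q\<bar> * norm b"
      using norm_triangle_ineq by (metis norm_scaleR)
    also have "\<dots> \<le> 2 * norm a + 1 * norm b"
      using off[of k] r(2)[of k] by (intro add_mono mult_right_mono norm_ge_zero) linarith+
    finally show ?thesis by simp
  qed
  moreover have "cross2 (s *\<^sub>R a) (q *\<^sub>R b) \<noteq> 0" using ab s q by simp
  ultimately have "((\<lambda>R. real (card {x. norm (y x) \<le> R}) / R\<^sup>2) \<longlongrightarrow> pi / \<bar>cross2 (s *\<^sub>R a) (q *\<^sub>R b)\<bar>) at_top"
    by (intro perturbed_lattice_count)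
  moreover have "card {x. norm (y x) \<le> R} = card ({(s * i + off k, r k) | i k. True} \<inter> disc R)" for R
  proof -
    have "{(s * i + off k, r k) | i k. True} \<inter> disc R = z ` {x. norm (y x) \<le> R}"
      by (auto simp: z_def y_def disc_def image_iff) 
    then show ?thesis using card_image[OF inj_on_subset[OF injz]] by simp
  qed
  moreover have "pi / \<bar>cross2 (s *\<^sub>R a) (q *\<^sub>R b)\<bar> = 1 / (s * q) * pi / \<bar>cross2 a b\<bar>"
    using s q by (simp add: abs_mult)
  ultimately show ?thesis unfolding dens_def by simp
qed

lemma dens_empty: "dens {} 0"
  by (simp add: dens_def)

lemma dens_Un:
  assumes "dens S d" "dens T e" "S \<inter> T = {}"
  shows "dens (S \<union> T) (d + e)"
proof -
  have "card ((S \<union> T) \<inter> disc R) = card (S \<inter> disc R) + card (T \<inter> disc R)" for R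
    unfolding Int_Un_distrib2 by (rule card_Un_disjoint) (use finite_disc assms(3) in auto)
  then show ?thesis
    using tendsto_add[OF assms(1,2)[unfolded dens_def]] unfolding dens_def by (simp add: add_divide_distrib distrib_right)
qed

lemma dens_Diff:
  assumes "dens S d" "dens T e" "T \<subseteq> S"
  shows "dens (S - T) (d - e)"
proof -
  have "real (card ((S - T) \<inter> disc R)) = real (card (S \<inter> disc R)) - real (card (T \<inter> disc R))" for R
  proof -
    have "(S - T) \<inter> disc R = (S \<inter> disc R) - (T \<inter> disc R)" by blast
    moreover have "card ((S \<inter> disc R) - (T \<inter> disc R)) = card (S \<inter> disc R) - card (T \<inter> disc R)"
      by (rule card_Diff_subset) (use finite_disc assms(3) in auto)
    moreover have "card (T \<inter> disc R) \<le> card (S \<inter> disc R)"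
      by (rule card_mono) (use finite_disc assms(3) in auto)
    ultimately show ?thesis by (simp add: of_nat_diff)
  qed
  then show ?thesis
    using tendsto_diff[OF assms(1,2)[unfolded dens_def]] unfolding dens_def by (simp add: diff_divide_distrib left_diff_distrib)
qed

text \<open>A shift by \<open>n\<close> moves images by \<open>C\<close>, so the count lies between
  those for the radii R - C and R + C, and (R \<plusminus> C) / R tends to 1.\<close>

lemma dens_shift:
  assumes "dens S d"
  shows "dens {z. z + n \<in> S} d"
proof -
  define C where "C = norm (lin2 a b (pt n))"
  have add: "lin2 a b (pt (z + n)) = lin2 a b (pt z) + lin2 a b (pt n)" for z
    by (simp add: lin2_def algebra_simps)
  have inj: "inj_on (\<lambda>z. z + n) A" for A by (simp add: inj_on_def)
  have C0: "0 \<le> C" by (simp add: C_def)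
  have up: "card ({z. z + n \<in> S} \<inter> disc R) \<le> card (S \<inter> disc (R + C))" for R
  proof (rule card_inj_on_le[OF inj])
    show "(\<lambda>z. z + n) ` ({z. z + n \<in> S} \<inter> disc R) \<subseteq> S \<inter> disc (R + C)"
    proof
      fix w assume "w \<in> (\<lambda>z. z + n) ` ({z. z + n \<in> S} \<inter> disc R)"
      then obtain z where z: "z \<in> disc R" "z + n \<in> S" "w = z + n" by blast
      have "norm (lin2 a b (pt (z + n))) \<le> R + C"
        unfolding add C_def using z(1) norm_triangle_ineq[of "lin2 a b (pt z)" "lin2 a b (pt n)"] by (simp add: disc_def)
      then show "w \<in> S \<inter> disc (R + C)" using z(2,3) by (simp add: disc_def)
    qed
  qed (use finite_disc in auto)
  have low: "card (S \<inter> disc (R - C)) \<le> card ({z. z + n \<in> S} \<inter> disc R)" for R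
  proof (rule card_inj_on_le[of "\<lambda>z. z - n"])
    show "inj_on (\<lambda>z. z - n) (S \<inter> disc (R - C))" by (simp add: inj_on_def)
    show "(\<lambda>z. z - n) ` (S \<inter> disc (R - C)) \<subseteq> {z. z + n \<in> S} \<inter> disc R"
    proof
      fix w assume "w \<in> (\<lambda>z. z - n) ` (S \<inter> disc (R - C))"
      then obtain z where z: "z \<in> S" "z \<in> disc (R - C)" "w = z - n" by blast
      then have zw: "z = w + n" by simp
      have "lin2 a b (pt w) = lin2 a b (pt z) - lin2 a b (pt n)" unfolding zw add by simp
      then have "norm (lin2 a b (pt w)) \<le> R"
        using z(2) norm_triangle_ineq4[of "lin2 a b (pt z)" "lin2 a b (pt n)"] by (simp add: disc_def C_def)
      then show "w \<in> {z. z + n \<in> S} \<inter> disc R" using z(1) zw by (simp add: disc_def)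
    qed
  qed (use finite_disc in auto)
  define g where "g = (\<lambda>R. real (card (S \<inter> disc R)) / R\<^sup>2)"
  have g: "(g \<longlongrightarrow> d * pi / \<bar>cross2 a b\<bar>) at_top" using assms by (simp add: dens_def g_def)
  have inv: "((\<lambda>R. D / R) \<longlongrightarrow> 0) at_top" for D :: real
    by (rule real_tendsto_divide_at_top[OF tendsto_const filterlim_ident])
  have sh: "((\<lambda>R. real (card (S \<inter> disc (R + D))) / R\<^sup>2) \<longlongrightarrow> d * pi / \<bar>cross2 a b\<bar>) at_top" for D
  proof -
    have "filterlim (\<lambda>R. R + D) at_top (at_top :: real filter)"
      by (subst add.commute) (rule filterlim_tendsto_add_at_top[OF tendsto_const filterlim_ident])
    then have "((\<lambda>R. g (R + D)) \<longlongrightarrow> d * pi / \<bar>cross2 a b\<bar>) at_top" by (rule filterlim_compose[OF g])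
    moreover have "((\<lambda>R. (1 + D / R)\<^sup>2) \<longlongrightarrow> (1 + 0)\<^sup>2) at_top" by (intro tendsto_intros inv)
    ultimately have "((\<lambda>R. g (R + D) * (1 + D / R)\<^sup>2) \<longlongrightarrow> d * pi / \<bar>cross2 a b\<bar> * (1 + 0)\<^sup>2) at_top"
      by (rule tendsto_mult)
    then have lim: "((\<lambda>R. g (R + D) * (1 + D / R)\<^sup>2) \<longlongrightarrow> d * pi / \<bar>cross2 a b\<bar>) at_top" by simp
    have "\<forall>\<^sub>F R in at_top. \<bar>D\<bar> + 1 \<le> R" by (rule eventually_ge_at_top)
    then have "\<forall>\<^sub>F R in at_top. g (R + D) * (1 + D / R)\<^sup>2 = real (card (S \<inter> disc (R + D))) / R\<^sup>2"
    proof eventually_elim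
      case (elim R)
      then have "R \<noteq> 0" "R + D \<noteq> 0" by linarith+
      then have "(1 + D / R)\<^sup>2 = (R + D)\<^sup>2 / R\<^sup>2" by (simp add: field_simps power2_eq_square)
      then show ?case using \<open>R + D \<noteq> 0\<close> by (simp add: g_def)
    qed
    then show ?thesis using lim tendsto_cong by fast
  qed
  show ?thesis unfolding dens_def
  proof (rule tendsto_sandwich[OF _ _ sh[of "- C"] sh[of C]])
    show "\<forall>\<^sub>F R in at_top. real (card (S \<inter> disc (R + - C))) / R\<^sup>2 \<le> real (card ({z. z + n \<in> S} \<inter> disc R)) / R\<^sup>2"
      using low by (intro always_eventually allI divide_right_mono) auto
    show "\<forall>\<^sub>F R in at_top. real (card ({z. z + n \<in> S} \<inter> disc R)) / R\<^sup>2 \<le> real (card (S \<inter> disc (R + C))) / R\<^sup>2"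
      using up by (intro always_eventually allI divide_right_mono) auto
  qed
qed

text \<open>Degrees are summed direction by direction: \<open>e n\<close> is the density of the
  points that have a neighbour in direction \<open>n\<close>. The map scales \<open>K\<close> and
  the lattice cell by the same factor, so it cancels in the packing density.\<close>

lemma equality_from_densities:
  assumes adm: "admissible_packing K (pt ` Y)" and K: "K \<in> lmeasurable"
    and nb: "\<And>z. z \<in> Y \<Longrightarrow> neighbours K (pt ` Y) (pt z) = pt ` {w \<in> Y. w - z \<in> Nb}"
    and fin: "finite Nb" and Y: "dens Y d" "0 < d" and pairs: "\<And>n. n \<in> Nb \<Longrightarrow> dens {z \<in> Y. z + n \<in> Y} (e n)"
  shows "equality_attained ((\<lambda>x. c + lin2 a b x) ` K) ((\<Sum>n\<in>Nb. e n) / d) (d * measure lebesgue K)"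
proof -
  let ?L = "lin2 a b"
  let ?D = "(\<lambda>x. c + ?L x) ` K"
  let ?X = "?L ` pt ` Y"
  have injLp: "inj_on (\<lambda>z. ?L (pt z)) A" for A
    by (rule inj_onI) (simp add: inj_eq[OF inj])
  have ball: "?X \<inter> cball 0 R = (\<lambda>z. ?L (pt z)) ` (Y \<inter> disc R)" for R
    by (auto simp: disc_def)
  have cardX: "card (?X \<inter> cball 0 R) = card (Y \<inter> disc R)" for R
    unfolding ball by (rule card_image[OF injLp])
  have deg: "card (neighbours ?D ?X (?L (pt z))) = (\<Sum>n\<in>Nb. if z + n \<in> Y then 1 else 0)" if z: "z \<in> Y" for z
  proof -
    have "neighbours ?D ?X (?L (pt z)) = (\<lambda>w. ?L (pt w)) ` {w \<in> Y. w - z \<in> Nb}"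
      using neighbours_image[of "pt z" "pt ` Y" c K] nb[OF z] z by (simp add: image_image)
    then have "card (neighbours ?D ?X (?L (pt z))) = card {w \<in> Y. w - z \<in> Nb}"
      by (simp add: card_image[OF injLp])
    also have "{w \<in> Y. w - z \<in> Nb} = (\<lambda>n. z + n) ` {n \<in> Nb. z + n \<in> Y}"
    proof (intro set_eqI iffI)
      fix w assume "w \<in> {w \<in> Y. w - z \<in> Nb}"
      then show "w \<in> (\<lambda>n. z + n) ` {n \<in> Nb. z + n \<in> Y}" by (intro image_eqI[of _ _ "w - z"]) auto
    qed auto
    also have "card \<dots> = card {n \<in> Nb. z + n \<in> Y}" by (rule card_image) (simp add: inj_on_def)
    finally show ?thesis using fin by (simp add: sum.If_cases Int_def)
  qed
  have degsum: "(\<Sum>x\<in>?X \<inter> cball 0 R. card (neighbours ?D ?X x)) = (\<Sum>n\<in>Nb. card ({z \<in> Y. z + n \<in> Y} \<inter> disc R))" for R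
  proof -
    have "(\<Sum>x\<in>?X \<inter> cball 0 R. card (neighbours ?D ?X x)) = (\<Sum>z\<in>Y \<inter> disc R. card (neighbours ?D ?X (?L (pt z))))"
      unfolding ball by (subst sum.reindex[OF injLp]) simp
    also have "\<dots> = (\<Sum>z\<in>Y \<inter> disc R. \<Sum>n\<in>Nb. if z + n \<in> Y then 1 else 0)"
      by (rule sum.cong[OF refl]) (use deg in auto)
    also have "\<dots> = (\<Sum>n\<in>Nb. \<Sum>z\<in>Y \<inter> disc R. if z + n \<in> Y then 1 else 0)" by (rule sum.swap)
    also have "\<dots> = (\<Sum>n\<in>Nb. card ({z \<in> Y. z + n \<in> Y} \<inter> disc R))"
    proof (rule sum.cong[OF refl])
      fix n
      have "finite (Y \<inter> disc R)" using finite_disc by simp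
      moreover have "{z \<in> Y. z + n \<in> Y} \<inter> disc R = {z \<in> Y \<inter> disc R. z + n \<in> Y}" by blast
      ultimately show "(\<Sum>z\<in>Y \<inter> disc R. if z + n \<in> Y then 1 else 0) = card ({z \<in> Y. z + n \<in> Y} \<inter> disc R)"
        by (simp add: sum.If_cases Int_def)
    qed
    finally show ?thesis .
  qed
  define \<kappa> where "\<kappa> = pi / \<bar>cross2 a b\<bar>"
  have k: "0 < \<kappa>" using ab by (simp add: \<kappa>_def)
  have limY: "((\<lambda>R. real (card (Y \<inter> disc R)) / R\<^sup>2) \<longlongrightarrow> d * \<kappa>) at_top"
    using Y(1) by (simp add: dens_def \<kappa>_def)
  have limE: "((\<lambda>R. (\<Sum>n\<in>Nb. real (card ({z \<in> Y. z + n \<in> Y} \<inter> disc R)) / R\<^sup>2)) \<longlongrightarrow> (\<Sum>n\<in>Nb. e n * \<kappa>)) at_top"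
    by (rule tendsto_sum) (use pairs in \<open>simp add: dens_def \<kappa>_def\<close>)
  have "((\<lambda>R. (\<Sum>n\<in>Nb. real (card ({z \<in> Y. z + n \<in> Y} \<inter> disc R)) / R\<^sup>2) / (real (card (Y \<inter> disc R)) / R\<^sup>2))
      \<longlongrightarrow> (\<Sum>n\<in>Nb. e n * \<kappa>) / (d * \<kappa>)) at_top"
    by (rule tendsto_divide[OF limE limY]) (use k Y(2) in auto)
  then have lim: "((\<lambda>R. (\<Sum>n\<in>Nb. real (card ({z \<in> Y. z + n \<in> Y} \<inter> disc R)) / R\<^sup>2) / (real (card (Y \<inter> disc R)) / R\<^sup>2))
      \<longlongrightarrow> (\<Sum>n\<in>Nb. e n) / d) at_top"
    using k by (simp flip: sum_distrib_right)
  have "\<forall>\<^sub>F R in at_top. (\<Sum>n\<in>Nb. real (card ({z \<in> Y. z + n \<in> Y} \<inter> disc R)) / R\<^sup>2) / (real (card (Y \<inter> disc R)) / R\<^sup>2)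
      = average_neighbours ?D ?X R"
    using eventually_gt_at_top[of "0 :: real"]
  proof eventually_elim
    case (elim R)
    have "(\<Sum>x\<in>?X \<inter> cball 0 R. real (card (neighbours ?D ?X x))) = real (\<Sum>x\<in>?X \<inter> cball 0 R. card (neighbours ?D ?X x))" by simp
    then show ?case unfolding average_neighbours_def degsum cardX using elim
      by (simp flip: sum_divide_distrib)
  qed
  with lim have avg: "(average_neighbours ?D ?X \<longlongrightarrow> (\<Sum>n\<in>Nb. e n) / d) at_top"
    by (rule Lim_transform_eventually)
  have "measure lebesgue ?D = \<bar>cross2 a b\<bar> * measure lebesgue K"
    unfolding affine_image measure_translation by (rule measure_lin2_image[OF K])
  then have area: "measure lebesgue ?D = pi / \<kappa> * measure lebesgue K" using ab by (simp add: \<kappa>_def)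
  have "((\<lambda>R. real (card (Y \<inter> disc R)) / R\<^sup>2 * (measure lebesgue ?D / pi)) \<longlongrightarrow> d * \<kappa> * (measure lebesgue ?D / pi)) at_top"
    by (intro tendsto_intros limY)
  moreover have "d * \<kappa> * (measure lebesgue ?D / pi) = d * measure lebesgue K" using k by (simp add: area)
  moreover have "packing_density ?D ?X = (\<lambda>R. real (card (Y \<inter> disc R)) / R\<^sup>2 * (measure lebesgue ?D / pi))"
    by (simp add: packing_density_def cardX fun_eq_iff)
  ultimately have "(packing_density ?D ?X \<longlongrightarrow> d * measure lebesgue K) at_top" by simp
  then show ?thesis unfolding equality_attained_def using admissible_image[OF adm] avg by blast
qed

end

section \<open>Touching translates of hexagons and squares\<close>

text \<open>One description of a body by triangles yields both its vertices, for the comparison with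
  regular polygons, and its area through \<open>measure_star\<close>.\<close>

lemma symmetric_star_body:
  fixes p :: "nat \<Rightarrow> real^2"
  assumes K: "convex K" "\<And>x. x \<in> K \<Longrightarrow> - x \<in> K" and m: "0 < m" and pK: "\<And>i. i < m \<Longrightarrow> p i \<in> K" and pm: "p m = - p 0"
    and star: "\<And>q. q \<in> K \<Longrightarrow> \<exists>i<m. \<exists>s\<in>{1, -1}. \<exists>\<alpha>\<ge>0. \<exists>\<beta>\<ge>0. \<alpha> + \<beta> \<le> 1 \<and> q = s *\<^sub>R (\<alpha> *\<^sub>R p i + \<beta> *\<^sub>R p (Suc i))"
  shows "convex hull (p ` {..<m} \<union> uminus ` p ` {..<m}) = K" "\<Union>(star_triangle p ` ({..<m} \<times> {1, -1})) = K"
proof -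
  let ?P = "p ` {..<m} \<union> uminus ` p ` {..<m}"
  have "convex hull ?P \<subseteq> K"
    by (rule hull_minimal) (use pK K in auto)
  moreover have "\<Union>(star_triangle p ` ({..<m} \<times> {1, -1})) \<subseteq> convex hull ?P"
  proof -
    have P: "s *\<^sub>R p i \<in> ?P" if i: "i \<le> m" and s: "s \<in> {1, -1 :: real}" for i s
    proof (cases "i < m")
      case True
      then show ?thesis using s by auto
    next
      case False
      then have "p i = - p 0" using i pm by simp
      then show ?thesis using s m by auto
    qed
    have "p 0 \<in> convex hull ?P" "- p 0 \<in> convex hull ?P" using m by (auto intro!: hull_inc)
    then have "(1/2) *\<^sub>R p 0 + (1/2) *\<^sub>R (- p 0) \<in> convex hull ?P"
      by (rule convexD[OF convex_convex_hull]) auto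
    then have 0: "0 \<in> convex hull ?P" by simp
    have "convex hull {0, s *\<^sub>R p i, s *\<^sub>R p (Suc i)} \<subseteq> convex hull ?P" if i: "i < m" and s: "s \<in> {1, -1 :: real}" for i s
    proof (rule hull_minimal)
      have "s *\<^sub>R p i \<in> convex hull ?P" by (rule hull_inc[OF P]) (use i s in auto)
      moreover have "s *\<^sub>R p (Suc i) \<in> convex hull ?P" by (rule hull_inc[OF P]) (use i s in auto)
      ultimately show "{0, s *\<^sub>R p i, s *\<^sub>R p (Suc i)} \<subseteq> convex hull ?P" using 0 by blast
    qed (rule convex_convex_hull)
    then show ?thesis unfolding star_triangle_def by fastforce
  qed
  moreover have "K \<subseteq> \<Union>(star_triangle p ` ({..<m} \<times> {1, -1}))"
  proof
    fix q assume "q \<in> K"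
    then obtain i s \<alpha> \<beta> where i: "i < m" and s: "s \<in> {1, -1 :: real}" and ab: "0 \<le> \<alpha>" "0 \<le> \<beta>" "\<alpha> + \<beta> \<le> 1"
      and q: "q = s *\<^sub>R (\<alpha> *\<^sub>R p i + \<beta> *\<^sub>R p (Suc i))" using star by meson
    have "q = 0 + \<alpha> *\<^sub>R (s *\<^sub>R p i - 0) + \<beta> *\<^sub>R (s *\<^sub>R p (Suc i) - 0)" by (simp add: q algebra_simps)
    then have "q \<in> star_triangle p (i, s)" unfolding star_triangle_def prod.case in_triangle using ab by blast
    then show "q \<in> \<Union>(star_triangle p ` ({..<m} \<times> {1, -1}))" using i s by blast
  qed
  ultimately show "convex hull ?P = K" "\<Union>(star_triangle p ` ({..<m} \<times> {1, -1})) = K" by auto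
qed

lemma box_interior:
  assumes "{p :: real^2. \<bar>p $ 1\<bar> \<le> 1/4 \<and> \<bar>p $ 2\<bar> \<le> 1/4} \<subseteq> K"
  shows "interior K \<noteq> {}"
proof -
  have "ball 0 (1/4) \<subseteq> K"
  proof
    fix p :: "real^2" assume "p \<in> ball 0 (1/4)"
    then show "p \<in> K" using assms component_le_norm_cart[of p 1] component_le_norm_cart[of p 2] by fastforce
  qed
  then show ?thesis using mem_interior[of 0 K] by fastforce
qed

text \<open>Its vertices are the halves of the vectors in \<open>hex_moves\<close>, so neighbouring
  translates touch in vertices, and the full lattice packing has density 3/4 and not 1.\<close>

definition hexagon :: "(real^2) set" where
  "hexagon = halfplanes [(1, 0, 1/2), (-1, 0, 1/2), (0, 1, 1/2), (0, -1, 1/2), (1, 1, 1/2), (-1, -1, 1/2)]"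

definition hexagon_vertex :: "nat \<Rightarrow> real^2" where
  "hexagon_vertex i = [vector [1/2, 0], vector [0, 1/2], vector [-1/2, 1/2], vector [-1/2, 0]] ! i"

text \<open>Translates by a king move share a side or a corner of the unit square.\<close>

definition square :: "(real^2) set" where
  "square = halfplanes [(1, 0, 1/2), (-1, 0, 1/2), (0, 1, 1/2), (0, -1, 1/2)]"

definition square_vertex :: "nat \<Rightarrow> real^2" where
  "square_vertex i = [vector [1/2, 1/2], vector [-1/2, 1/2], vector [-1/2, -1/2]] ! i"

lemma hexagon_vertex_simps [simp]:
  "hexagon_vertex 0 = vector [1/2, 0]" "hexagon_vertex (Suc 0) = vector [0, 1/2]"
  "hexagon_vertex 2 = vector [-1/2, 1/2]" "hexagon_vertex 3 = vector [-1/2, 0]"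
  by (simp_all add: hexagon_vertex_def numeral_eq_Suc)

lemma square_vertex_simps [simp]:
  "square_vertex 0 = vector [1/2, 1/2]" "square_vertex (Suc 0) = vector [-1/2, 1/2]" "square_vertex 2 = vector [-1/2, -1/2]"
  by (simp_all add: square_vertex_def numeral_eq_Suc)

lemma less_3_iff: "i < 3 \<longleftrightarrow> i = 0 \<or> i = Suc 0 \<or> i = 2" for i :: nat
  by auto

lemma less_2_iff: "i < 2 \<longleftrightarrow> i = 0 \<or> i = Suc 0" for i :: nat
  by auto

lemma in_hexagon:
  "p \<in> hexagon \<longleftrightarrow> - 1 \<le> 2 * p $ 1 \<and> 2 * p $ 1 \<le> 1 \<and> - 1 \<le> 2 * p $ 2 \<and> 2 * p $ 2 \<le> 1
    \<and> - 1 \<le> 2 * (p $ 1 + p $ 2) \<and> 2 * (p $ 1 + p $ 2) \<le> 1"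
  by (auto simp: hexagon_def in_halfplanes inside_def)

lemma in_square: "p \<in> square \<longleftrightarrow> - 1 \<le> 2 * p $ 1 \<and> 2 * p $ 1 \<le> 1 \<and> - 1 \<le> 2 * p $ 2 \<and> 2 * p $ 2 \<le> 1"
  by (auto simp: square_def in_halfplanes inside_def)

lemma convex_hexagon: "convex hexagon"
  unfolding hexagon_def by (rule polyhedron_imp_convex[OF polyhedron_halfplanes])

lemma convex_square: "convex square"
  unfolding square_def by (rule polyhedron_imp_convex[OF polyhedron_halfplanes])

lemma hexagon_star:
  "convex hull (hexagon_vertex ` {..<3} \<union> uminus ` hexagon_vertex ` {..<3}) = hexagon"
  "\<Union>(star_triangle hexagon_vertex ` ({..<3} \<times> {1, -1})) = hexagon"
proof -
  have pos: "\<exists>i<3. \<exists>\<alpha>\<ge>0. \<exists>\<beta>\<ge>0. \<alpha> + \<beta> \<le> 1 \<and> q = \<alpha> *\<^sub>R hexagon_vertex i + \<beta> *\<^sub>R hexagon_vertex (Suc i)"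
    if q: "q \<in> hexagon" and y: "0 \<le> q $ 2" "q $ 2 = 0 \<Longrightarrow> 0 \<le> q $ 1" for q
  proof -
    have witness: "\<exists>i<3. \<exists>\<alpha>\<ge>0. \<exists>\<beta>\<ge>0. \<alpha> + \<beta> \<le> 1 \<and> q = \<alpha> *\<^sub>R hexagon_vertex i + \<beta> *\<^sub>R hexagon_vertex (Suc i)"
      if "i < 3" "0 \<le> \<alpha>" "0 \<le> \<beta>" "\<alpha> + \<beta> \<le> 1" "q = \<alpha> *\<^sub>R hexagon_vertex i + \<beta> *\<^sub>R hexagon_vertex (Suc i)" for i \<alpha> \<beta>
      using that by blast
    consider "0 \<le> q $ 1" | "q $ 1 \<le> 0" "0 \<le> q $ 1 + q $ 2" | "q $ 1 + q $ 2 \<le> 0" by linarith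
    then show ?thesis
    proof cases
      case 1
      then show ?thesis using q y
        by (intro witness[of 0 "2 * q $ 1" "2 * q $ 2"]) (auto simp: in_hexagon vec2_eq_iff)
    next
      case 2
      then show ?thesis using q y
        by (intro witness[of 1 "2 * (q $ 1 + q $ 2)" "- 2 * q $ 1"])
           (auto simp: in_hexagon vec2_eq_iff field_simps simp flip: numeral_2_eq_2)
    next
      case 3
      then show ?thesis using q y
        by (intro witness[of 2 "2 * q $ 2" "- 2 * (q $ 1 + q $ 2)"])
           (auto simp: in_hexagon vec2_eq_iff field_simps simp flip: numeral_3_eq_3)
    qed
  qed
  have sym: "- q \<in> hexagon" if "q \<in> hexagon" for q using that by (auto simp: in_hexagon)
  have star: "\<exists>i<3. \<exists>s\<in>{1, -1}. \<exists>\<alpha>\<ge>0. \<exists>\<beta>\<ge>0. \<alpha> + \<beta> \<le> 1 \<and> q = s *\<^sub>R (\<alpha> *\<^sub>R hexagon_vertex i + \<beta> *\<^sub>R hexagon_vertex (Suc i))"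
    if q: "q \<in> hexagon" for q
  proof (cases "0 < q $ 2 \<or> (q $ 2 = 0 \<and> 0 \<le> q $ 1)")
    case True
    then have y: "0 \<le> q $ 2" "q $ 2 = 0 \<Longrightarrow> 0 \<le> q $ 1" by auto
    obtain i \<alpha> \<beta> where i: "i < 3" "0 \<le> \<alpha>" "0 \<le> \<beta>" "\<alpha> + \<beta> \<le> 1" and e: "q = \<alpha> *\<^sub>R hexagon_vertex i + \<beta> *\<^sub>R hexagon_vertex (Suc i)"
      using pos[OF q y] by blast
    have "q = 1 *\<^sub>R (\<alpha> *\<^sub>R hexagon_vertex i + \<beta> *\<^sub>R hexagon_vertex (Suc i))" by (simp flip: e)
    then show ?thesis using i by blast
  next
    case False
    then have y: "0 \<le> (- q) $ 2" "(- q) $ 2 = 0 \<Longrightarrow> 0 \<le> (- q) $ 1" by auto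
    obtain i \<alpha> \<beta> where i: "i < 3" "0 \<le> \<alpha>" "0 \<le> \<beta>" "\<alpha> + \<beta> \<le> 1" and e: "- q = \<alpha> *\<^sub>R hexagon_vertex i + \<beta> *\<^sub>R hexagon_vertex (Suc i)"
      using pos[OF sym[OF q] y] by blast
    have "q = (-1) *\<^sub>R (\<alpha> *\<^sub>R hexagon_vertex i + \<beta> *\<^sub>R hexagon_vertex (Suc i))" by (simp flip: e)
    then show ?thesis using i by blast
  qed
  have vK: "\<And>i. i < 3 \<Longrightarrow> hexagon_vertex i \<in> hexagon" and pm: "hexagon_vertex 3 = - hexagon_vertex 0"
    by (auto simp: less_3_iff in_hexagon vec2_eq_iff)
  note body = symmetric_star_body[OF convex_hexagon sym _ vK pm star]
  show "convex hull (hexagon_vertex ` {..<3} \<union> uminus ` hexagon_vertex ` {..<3}) = hexagon"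
    "\<Union>(star_triangle hexagon_vertex ` ({..<3} \<times> {1, -1})) = hexagon"
    by (rule body; simp)+
qed

lemma square_star:
  "convex hull (square_vertex ` {..<2} \<union> uminus ` square_vertex ` {..<2}) = square"
  "\<Union>(star_triangle square_vertex ` ({..<2} \<times> {1, -1})) = square"
proof -
  have pos: "\<exists>i<2. \<exists>\<alpha>\<ge>0. \<exists>\<beta>\<ge>0. \<alpha> + \<beta> \<le> 1 \<and> q = \<alpha> *\<^sub>R square_vertex i + \<beta> *\<^sub>R square_vertex (Suc i)"
    if q: "q \<in> square" and y: "0 \<le> q $ 2 - q $ 1" for q
  proof -
    have witness: "\<exists>i<2. \<exists>\<alpha>\<ge>0. \<exists>\<beta>\<ge>0. \<alpha> + \<beta> \<le> 1 \<and> q = \<alpha> *\<^sub>R square_vertex i + \<beta> *\<^sub>R square_vertex (Suc i)"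
      if "i < 2" "0 \<le> \<alpha>" "0 \<le> \<beta>" "\<alpha> + \<beta> \<le> 1" "q = \<alpha> *\<^sub>R square_vertex i + \<beta> *\<^sub>R square_vertex (Suc i)" for i \<alpha> \<beta>
      using that by blast
    show ?thesis
    proof (cases "0 \<le> q $ 1 + q $ 2")
      case True
      then show ?thesis using q y
        by (intro witness[of 0 "q $ 1 + q $ 2" "q $ 2 - q $ 1"]) (auto simp: in_square vec2_eq_iff field_simps)
    next
      case False
      then show ?thesis using q y
        by (intro witness[of 1 "q $ 2 - q $ 1" "- (q $ 1 + q $ 2)"])
           (auto simp: in_square vec2_eq_iff field_simps simp flip: numeral_2_eq_2)
    qed
  qed
  have sym: "- q \<in> square" if "q \<in> square" for q using that by (auto simp: in_square)
  have star: "\<exists>i<2. \<exists>s\<in>{1, -1}. \<exists>\<alpha>\<ge>0. \<exists>\<beta>\<ge>0. \<alpha> + \<beta> \<le> 1 \<and> q = s *\<^sub>R (\<alpha> *\<^sub>R square_vertex i + \<beta> *\<^sub>R square_vertex (Suc i))"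
    if q: "q \<in> square" for q
  proof (cases "0 \<le> q $ 2 - q $ 1")
    case True
    then obtain i \<alpha> \<beta> where i: "i < 2" "0 \<le> \<alpha>" "0 \<le> \<beta>" "\<alpha> + \<beta> \<le> 1" and e: "q = \<alpha> *\<^sub>R square_vertex i + \<beta> *\<^sub>R square_vertex (Suc i)"
      using pos[OF q] by blast
    have "q = 1 *\<^sub>R (\<alpha> *\<^sub>R square_vertex i + \<beta> *\<^sub>R square_vertex (Suc i))" by (simp flip: e)
    then show ?thesis using i by blast
  next
    case False
    then obtain i \<alpha> \<beta> where i: "i < 2" "0 \<le> \<alpha>" "0 \<le> \<beta>" "\<alpha> + \<beta> \<le> 1" and e: "- q = \<alpha> *\<^sub>R square_vertex i + \<beta> *\<^sub>R square_vertex (Suc i)"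
      using pos[OF sym[OF q]] by force
    have "q = (-1) *\<^sub>R (\<alpha> *\<^sub>R square_vertex i + \<beta> *\<^sub>R square_vertex (Suc i))" by (simp flip: e)
    then show ?thesis using i by blast
  qed
  have vK: "\<And>i. i < 2 \<Longrightarrow> square_vertex i \<in> square" and pm: "square_vertex 2 = - square_vertex 0"
    by (auto simp: less_2_iff in_square vec2_eq_iff)
  note body = symmetric_star_body[OF convex_square sym _ vK pm star]
  show "convex hull (square_vertex ` {..<2} \<union> uminus ` square_vertex ` {..<2}) = square"
    "\<Union>(star_triangle square_vertex ` ({..<2} \<times> {1, -1})) = square"
    by (rule body; simp)+
qed

lemma area_hexagon: "measure lebesgue hexagon = 3/4"
proof -
  have "measure lebesgue (\<Union>(star_triangle hexagon_vertex ` ({..<3} \<times> {1, -1}))) = (\<Sum>i<3. cross2 (hexagon_vertex i) (hexagon_vertex (Suc i)))"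
    by (rule measure_star) (auto simp: less_3_iff less_2_iff vec2_eq_iff cross2_def)
  also have "\<dots> = 3/4"
  proof -
    have "(\<Sum>i<3. f i) = f 0 + f (Suc 0) + f 2" for f :: "nat \<Rightarrow> real" by (simp add: numeral_eq_Suc)
    then show ?thesis by (simp add: cross2_def flip: numeral_2_eq_2)
  qed
  finally show ?thesis by (simp only: hexagon_star(2))
qed

lemma area_square: "measure lebesgue square = 1"
proof -
  have "measure lebesgue (\<Union>(star_triangle square_vertex ` ({..<2} \<times> {1, -1}))) = (\<Sum>i<2. cross2 (square_vertex i) (square_vertex (Suc i)))"
    by (rule measure_star) (auto simp: less_2_iff vec2_eq_iff cross2_def)
  also have "\<dots> = 1"
  proof -
    have "(\<Sum>i<2. f i) = f 0 + f (Suc 0)" for f :: "nat \<Rightarrow> real" by (simp add: numeral_eq_Suc)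
    then show ?thesis by (simp add: cross2_def flip: numeral_2_eq_2)
  qed
  finally show ?thesis by (simp only: square_star(2))
qed

lemma hexagon_domain: "symmetric_domain hexagon"
proof
  show "compact hexagon" unfolding hexagon_star(1)[symmetric] by (intro finite_imp_compact_convex_hull) auto
  show "interior hexagon \<noteq> {}" by (rule box_interior) (auto simp: in_hexagon)
qed (auto simp: convex_hexagon, auto simp: in_hexagon)

lemma square_domain: "symmetric_domain square"
proof
  show "compact square" unfolding square_star(1)[symmetric] by (intro finite_imp_compact_convex_hull) auto
  show "interior square \<noteq> {}" by (rule box_interior) (auto simp: in_square)
qed (auto simp: convex_square, auto simp: in_square)

context lattice_tiling
begin

lemma lattice_packing:
  assumes K: "symmetric_domain K" and touch: "\<And>v. v \<noteq> 0 \<Longrightarrow> (1/2) *\<^sub>R pt v \<in> K \<longleftrightarrow> v \<in> Nb"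
    and sep: "\<And>v t. v \<noteq> 0 \<Longrightarrow> 1 < t \<Longrightarrow> t *\<^sub>R ((1/2) *\<^sub>R pt v) \<notin> K"
  shows "neighbours K (pt ` Y) (pt z) = pt ` {w \<in> Y. w - z \<in> Nb}" "admissible_packing K (pt ` Y)"
proof -
  interpret symmetric_domain K by (rule K)
  have diff: "pt w - pt z = pt (w - z)" for w z by (simp add: vec2_eq_iff)
  have "(0, 0) \<notin> Nb" using moves[of "(0, 0)"] by (auto simp: king_def)
  then have n0: "w - z \<in> Nb \<Longrightarrow> w \<noteq> z" for w z by (auto simp: zero_prod_def)
  have nb: "neighbours K (pt ` Y) (pt z) = pt ` {w \<in> Y. w - z \<in> Nb}" for z
  proof -
    have "neighbours K (pt ` Y) (pt z) = pt ` {w \<in> Y. w \<noteq> z \<and> (1/2) *\<^sub>R pt (w - z) \<in> K}"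
      unfolding neighbours_eq by (auto simp: diff)
    also have "{w \<in> Y. w \<noteq> z \<and> (1/2) *\<^sub>R pt (w - z) \<in> K} = {w \<in> Y. w - z \<in> Nb}"
      using touch n0 by (metis (no_types, lifting) right_minus_eq)
    finally show ?thesis .
  qed
  then show "neighbours K (pt ` Y) (pt z) = pt ` {w \<in> Y. w - z \<in> Nb}" .
  have "touching_segments K (pt ` Y) = edges"
  proof (intro set_eqI iffI)
    fix e assume "e \<in> touching_segments K (pt ` Y)"
    then obtain a y where a: "a \<in> Y" "y \<in> neighbours K (pt ` Y) (pt a)" "e = closed_segment (pt a) y"
      unfolding touching_segments_def by blast
    then obtain b where "b \<in> Y" "b - a \<in> Nb" "y = pt b" unfolding nb by blast
    then show "e \<in> edges" using a unfolding edges_def by blast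
  next
    fix e assume "e \<in> edges"
    then obtain a b where a: "a \<in> Y" "b \<in> Y" "b - a \<in> Nb" "e = closed_segment (pt a) (pt b)" unfolding edges_def by blast
    then have "pt b \<in> neighbours K (pt ` Y) (pt a)" unfolding nb by blast
    then show "e \<in> touching_segments K (pt ` Y)" using a unfolding touching_segments_def by blast
  qed
  moreover have "translate_packing K (pt ` Y)"
  proof (rule translate_packingI)
    fix x y t assume "x \<in> pt ` Y" "y \<in> pt ` Y" and ne: "x \<noteq> y" and t: "(1::real) < t"
    then obtain z w where xy: "x = pt z" "y = pt w" by blast
    then have "w - z \<noteq> 0" using ne by auto
    then show "t *\<^sub>R ((1/2) *\<^sub>R (y - x)) \<notin> K" unfolding xy diff using t by (rule sep)
  qed
  ultimately show "admissible_packing K (pt ` Y)"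
    unfolding admissible_packing_def using subdivision face_sides by metis
qed

end

lemma one_less_scaled_int: "1 < t * \<bar>real_of_int k\<bar>" if "1 < t" "k \<noteq> 0"
proof -
  have "1 \<le> \<bar>real_of_int k\<bar>" using that(2) by linarith
  then have "t * 1 \<le> t * \<bar>real_of_int k\<bar>" using that(1) by (intro mult_left_mono) auto
  then show ?thesis using that(1) by linarith
qed

lemma square_separated:
  assumes "v \<noteq> 0" "1 < t"
  shows "t *\<^sub>R ((1/2) *\<^sub>R pt v) \<notin> square"
proof -
  have "fst v \<noteq> 0 \<or> snd v \<noteq> 0" using assms(1) by (auto simp: prod_eq_iff)
  then have "1 < t * \<bar>real_of_int (fst v)\<bar> \<or> 1 < t * \<bar>real_of_int (snd v)\<bar>" using one_less_scaled_int[OF assms(2)] by blast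
  then have "1 < \<bar>t * fst v\<bar> \<or> 1 < \<bar>t * snd v\<bar>" using assms(2) by (simp add: abs_mult)
  then show ?thesis by (auto simp: in_square)
qed

lemma hexagon_subset_square: "hexagon \<subseteq> square"
  by (auto simp: in_hexagon in_square)

lemma square_touch: "v \<noteq> 0 \<Longrightarrow> (1/2) *\<^sub>R pt v \<in> square \<longleftrightarrow> king v"
  by (cases v) (auto simp: in_square king_def zero_prod_def)

context sparse_rows
begin

lemma hexagon_touch:
  assumes "v \<noteq> 0"
  shows "(1/2) *\<^sub>R pt v \<in> hexagon \<longleftrightarrow> v \<in> hex_moves"
proof -
  obtain i j where v: "v = (i, j)" by (cases v)
  have "(1/2) *\<^sub>R pt v \<in> hexagon \<longleftrightarrow> \<bar>real_of_int i\<bar> \<le> 1 \<and> \<bar>real_of_int j\<bar> \<le> 1 \<and> \<bar>real_of_int i + real_of_int j\<bar> \<le> 1"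
    by (auto simp: in_hexagon v)
  also have "\<dots> \<longleftrightarrow> \<bar>i\<bar> \<le> 1 \<and> \<bar>j\<bar> \<le> 1 \<and> \<bar>i + j\<bar> \<le> 1" by linarith
  also have "\<dots> \<longleftrightarrow> v \<in> hex_moves"
  proof
    assume a: "\<bar>i\<bar> \<le> 1 \<and> \<bar>j\<bar> \<le> 1 \<and> \<bar>i + j\<bar> \<le> 1"
    then have "i = -1 \<or> i = 0 \<or> i = 1" "j = -1 \<or> j = 0 \<or> j = 1" by linarith+
    then show "v \<in> hex_moves" using a assms by (elim disjE) (simp_all add: hex_moves_def v zero_prod_def)
  qed (auto simp: hex_moves_def v)
  finally show ?thesis .
qed

lemma hex_packing:
  "neighbours hexagon (pt ` kept) (pt z) = pt ` {w \<in> kept. w - z \<in> hex_moves}" "admissible_packing hexagon (pt ` kept)"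
  using lattice_tiling.lattice_packing[OF hex_tiling hexagon_domain hexagon_touch]
    square_separated hexagon_subset_square by blast+

end

context zigzag_rows
begin

lemma sq_packing:
  "neighbours square (pt ` points) (pt z) = pt ` {w \<in> points. w - z \<in> king_moves}" "admissible_packing square (pt ` points)"
  using lattice_tiling.lattice_packing[OF sq_tiling square_domain] square_separated square_touch king_moves_iff by blast+

end

text \<open>A regular polygon with \<open>2 * m\<close> vertices is symmetric about
  \<open>c\<close>, so matching half of its vertices suffices.\<close>

lemma regular_polygon_as_image:
  fixes w :: "nat \<Rightarrow> real^2"
  assumes L: "\<And>i. i < m \<Longrightarrow> lin2 a b (p i) = w i" and w: "\<And>i. i < m \<Longrightarrow> w (i + m) = - w i"
  shows "convex hull ((\<lambda>k. c + w k) ` {..<2 * m}) = (\<lambda>x. c + lin2 a b x) ` (convex hull (p ` {..<m} \<union> uminus ` p ` {..<m}))"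
proof -
  have "{..<2 * m} = {..<m} \<union> (\<lambda>i. i + m) ` {..<m}"
  proof (intro set_eqI iffI)
    fix k assume "k \<in> {..<2 * m}"
    then show "k \<in> {..<m} \<union> (\<lambda>i. i + m) ` {..<m}" by (cases "k < m") (auto intro!: image_eqI[of _ _ "k - m"])
  qed auto
  then have "w ` {..<2 * m} = w ` {..<m} \<union> (\<lambda>i. - w i) ` {..<m}" using w by (simp add: image_Un image_image)
  moreover have "lin2 a b ` (p ` {..<m} \<union> uminus ` p ` {..<m}) = w ` {..<m} \<union> (\<lambda>i. - w i) ` {..<m}"
    using L by (simp add: image_Un image_image linear_neg[OF linear_lin2])
  ultimately have *: "w ` {..<2 * m} = lin2 a b ` (p ` {..<m} \<union> uminus ` p ` {..<m})" by simp
  have "convex hull ((\<lambda>k. c + w k) ` {..<2 * m}) = (+) c ` (convex hull (w ` {..<2 * m}))"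
    by (simp add: image_image flip: convex_hull_translation)
  also have "\<dots> = (+) c ` lin2 a b ` (convex hull (p ` {..<m} \<union> uminus ` p ` {..<m}))"
    unfolding * convex_hull_linear_image[OF linear_lin2] ..
  finally show ?thesis by (simp add: image_image)
qed

lemma regular_hexagon:
  assumes "regular_polygon 6 D"
  obtains a b c where "cross2 a b \<noteq> 0" "D = (\<lambda>x. c + lin2 a b x) ` hexagon"
proof -
  obtain c :: "real^2" and r t where r: "0 < r" and D: "D = convex hull ((\<lambda>k. c + r *\<^sub>R vector [cos (t + 2 * pi * real k / real 6), sin (t + 2 * pi * real k / real 6)]) ` {..<6})"
    using assms unfolding regular_polygon_def by auto
  define w :: "nat \<Rightarrow> real^2" where "w k = r *\<^sub>R vector [cos (t + 2 * pi * real k / real 6), sin (t + 2 * pi * real k / real 6)]" for k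
  have w3: "w (i + 3) = - w i" for i
  proof -
    have e: "t + 2 * pi * real (i + 3) / real 6 = (t + 2 * pi * real i / real 6) + pi" by (simp add: field_simps)
    show ?thesis unfolding w_def e cos_add sin_add by (simp add: vec2_eq_iff algebra_simps)
  qed
  have t1: "t + 2 * pi * real (Suc 0) / real 6 = t + pi / 3" and t2: "t + 2 * pi * real 2 / real 6 = (t + pi / 3) + pi / 3" by simp_all
  have w0: "w 0 = r *\<^sub>R vector [cos t, sin t]" by (simp add: w_def)
  have w1: "w (Suc 0) = r *\<^sub>R vector [cos t * (1/2) - sin t * (sqrt 3 / 2), sin t * (1/2) + cos t * (sqrt 3 / 2)]"
    unfolding w_def t1 by (simp add: cos_add sin_add cos_60 sin_60)
  have s3: "sqrt 3 * (sqrt 3 * x) = 3 * x" for x :: real by (simp flip: mult.assoc)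
  have "w 2 = r *\<^sub>R vector [(cos t * (1/2) - sin t * (sqrt 3 / 2)) * (1/2) - (sin t * (1/2) + cos t * (sqrt 3 / 2)) * (sqrt 3 / 2),
      (sin t * (1/2) + cos t * (sqrt 3 / 2)) * (1/2) + (cos t * (1/2) - sin t * (sqrt 3 / 2)) * (sqrt 3 / 2)]"
    unfolding w_def t2 cos_add[of "t + pi / 3"] sin_add[of "t + pi / 3"] by (simp add: cos_add sin_add cos_60 sin_60)
  \<comment> \<open>Consecutive vertices of a regular hexagon satisfy this relation, so a map that
    is right on the first two model vertices is right on the third.\<close>
  then have w2: "w 2 = w (Suc 0) - w 0" unfolding w0 w1 by (simp add: vec2_eq_iff algebra_simps s3)
  have "lin2 (2 *\<^sub>R w 0) (2 *\<^sub>R w (Suc 0)) (hexagon_vertex i) = w i" if "i < 3" for i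
    using that unfolding less_3_iff by (auto simp: lin2_def w2)
  then have "convex hull ((\<lambda>k. c + w k) ` {..<2 * 3}) = (\<lambda>x. c + lin2 (2 *\<^sub>R w 0) (2 *\<^sub>R w (Suc 0)) x) ` hexagon"
    unfolding hexagon_star(1)[symmetric] using w3 by (rule regular_polygon_as_image)
  moreover have cr: "cross2 (w 0) (w (Suc 0)) = r * r * (sqrt 3 / 2) * (cos t * cos t + sin t * sin t)"
    unfolding w0 w1 by (simp add: cross2_def algebra_simps del: sin_cos_squared_add3)
  have "0 < cross2 (w 0) (w (Suc 0))" unfolding cr using r by simp
  then have "cross2 (2 *\<^sub>R w 0) (2 *\<^sub>R w (Suc 0)) \<noteq> 0" by simp
  moreover have "D = convex hull ((\<lambda>k. c + w k) ` {..<2 * 3})" by (simp add: D w_def)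
  ultimately show ?thesis using that by metis
qed

lemma regular_square:
  assumes "regular_polygon 4 D"
  obtains a b c where "cross2 a b \<noteq> 0" "D = (\<lambda>x. c + lin2 a b x) ` square"
proof -
  obtain c :: "real^2" and r t where r: "0 < r" and D: "D = convex hull ((\<lambda>k. c + r *\<^sub>R vector [cos (t + 2 * pi * real k / real 4), sin (t + 2 * pi * real k / real 4)]) ` {..<4})"
    using assms unfolding regular_polygon_def by auto
  define w :: "nat \<Rightarrow> real^2" where "w k = r *\<^sub>R vector [cos (t + 2 * pi * real k / real 4), sin (t + 2 * pi * real k / real 4)]" for k
  have w2: "w (i + 2) = - w i" for i
  proof -
    have e: "t + 2 * pi * real (i + 2) / real 4 = (t + 2 * pi * real i / real 4) + pi" by (simp add: field_simps)
    show ?thesis unfolding w_def e cos_add sin_add by (simp add: vec2_eq_iff algebra_simps)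
  qed
  have t1: "t + 2 * pi * real (Suc 0) / real 4 = t + pi / 2" by simp
  have w0: "w 0 = r *\<^sub>R vector [cos t, sin t]" by (simp add: w_def)
  have w1: "w (Suc 0) = r *\<^sub>R vector [- sin t, cos t]"
    unfolding w_def t1 by (simp add: cos_add sin_add)
  \<comment> \<open>The columns are chosen such that (1/2, 1/2) and (-1/2, 1/2) are sent to
    \<open>w 0\<close> and \<open>w (Suc 0)\<close>.\<close>
  have "lin2 (w 0 - w (Suc 0)) (w 0 + w (Suc 0)) (square_vertex i) = w i" if "i < 2" for i
    using that unfolding less_2_iff by (auto simp: lin2_def vec2_eq_iff field_simps)
  then have "convex hull ((\<lambda>k. c + w k) ` {..<2 * 2}) = (\<lambda>x. c + lin2 (w 0 - w (Suc 0)) (w 0 + w (Suc 0)) x) ` square"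
    unfolding square_star(1)[symmetric] using w2 by (rule regular_polygon_as_image)
  moreover have "cross2 (w 0 - w (Suc 0)) (w 0 + w (Suc 0)) = 2 * r * r * (cos t * cos t + sin t * sin t)"
    unfolding w0 w1 by (simp add: cross2_def algebra_simps del: sin_cos_squared_add3)
  then have "cross2 (w 0 - w (Suc 0)) (w 0 + w (Suc 0)) \<noteq> 0" using r by simp
  moreover have "D = convex hull ((\<lambda>k. c + w k) ` {..<2 * 2})" by (simp add: D w_def)
  ultimately show ?thesis using that by metis
qed

section \<open>Rows of prescribed frequency\<close>

text \<open>A Beatty sequence of frequency \<open>p\<close>. The ceiling also counts its members
  between 0 and \<open>h\<close>, which is used for the parities of rows.\<close>

definition frequent :: "real \<Rightarrow> int set" where
  "frequent p = {h. \<lceil>real_of_int h * p\<rceil> < \<lceil>real_of_int (h + 1) * p\<rceil>}"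

lemma ceiling_Suc_mult: "\<lceil>real_of_int (h + 1) * p\<rceil> = \<lceil>real_of_int h * p + p\<rceil>"
  by (simp add: algebra_simps)

lemma frequent_step:
  assumes "0 \<le> p" "p \<le> 1"
  shows "\<lceil>real_of_int (h + 1) * p\<rceil> = \<lceil>real_of_int h * p\<rceil> + (if h \<in> frequent p then 1 else 0)"
  using assms unfolding frequent_def mem_Collect_eq ceiling_Suc_mult by (auto; linarith)

text \<open>Two steps of length at most 1/2 raise the ceiling by at most 1.\<close>

lemma frequent_sparse:
  assumes "0 \<le> p" "p \<le> 1/2"
  shows "sparse_rows (frequent p)"
proof
  fix h assume h: "h \<in> frequent p"
  have "\<lceil>real_of_int (h + 1 + 1) * p\<rceil> = \<lceil>real_of_int h * p + p + p\<rceil>" by (simp add: algebra_simps)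
  also have "\<dots> \<le> \<lceil>real_of_int h * p\<rceil> + 1" using assms by linarith
  also have "\<dots> = \<lceil>real_of_int (h + 1) * p\<rceil>" using frequent_step[of p h] assms h by simp
  finally show "h + 1 \<notin> frequent p" by (simp add: frequent_def)
qed

lemma frequent_0: "frequent 0 = {}"
  by (simp add: frequent_def)

lemma frequent_1: "frequent 1 = UNIV"
  by (simp add: frequent_def)

text \<open>Enumerates the rows with mean distance 1 / p, as \<open>dens_rows\<close> requires;
  \<open>k\<close> is the value of the ceiling before its jump.\<close>

lemma frequent_eq_range:
  assumes "0 < p"
  shows "frequent p = range (\<lambda>k::int. \<lfloor>real_of_int k / p\<rfloor>)"
proof -
  have fl: "h = \<lfloor>real_of_int k / p\<rfloor> \<longleftrightarrow> real_of_int h * p \<le> k \<and> k < real_of_int (h + 1) * p" for h k :: int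
  proof -
    have "h = \<lfloor>real_of_int k / p\<rfloor> \<longleftrightarrow> real_of_int h \<le> real_of_int k / p \<and> real_of_int k / p < real_of_int h + 1" by linarith
    then show ?thesis using assms by (simp add: field_simps)
  qed
  show ?thesis
  proof (intro set_eqI iffI)
    fix h assume "h \<in> frequent p"
    then have "real_of_int \<lceil>real_of_int h * p\<rceil> < real_of_int (h + 1) * p" unfolding frequent_def mem_Collect_eq by linarith
    moreover have "real_of_int h * p \<le> real_of_int \<lceil>real_of_int h * p\<rceil>" by linarith
    ultimately have "h = \<lfloor>\<lceil>real_of_int h * p\<rceil> / p\<rfloor>" using fl by blast
    then show "h \<in> range (\<lambda>k::int. \<lfloor>real_of_int k / p\<rfloor>)" by blast
  next
    fix h assume "h \<in> range (\<lambda>k::int. \<lfloor>real_of_int k / p\<rfloor>)"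
    then obtain k :: int where "h = \<lfloor>real_of_int k / p\<rfloor>" by blast
    then have "real_of_int h * p \<le> k" "k < real_of_int (h + 1) * p" using fl by blast+
    then have "\<lceil>real_of_int h * p\<rceil> \<le> k" "k < \<lceil>real_of_int (h + 1) * p\<rceil>" by (simp_all only: ceiling_le_iff less_ceiling_iff)
    then show "h \<in> frequent p" by (simp only: frequent_def mem_Collect_eq)
  qed
qed

context lattice_map
begin

lemma dens_frequent:
  fixes s :: int
  assumes s: "0 < s" "s \<le> 2" and p: "0 \<le> p" "p \<le> 1"
  shows "dens {(i, h). s dvd i + o' h \<and> h \<in> frequent p} (p / s)"
proof (cases "p = 0")
  case True
  then show ?thesis by (simp add: frequent_0 dens_empty)
next
  case False
  then have p0: "0 < p" using p by simp
  define r where "r = (\<lambda>k::int. \<lfloor>real_of_int k / p\<rfloor>)"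
  \<comment> \<open>The residue in {0, ..., s - 1} that makes \<open>off k + o' (r k)\<close>
    divisible by \<open>s\<close>; this keeps the shift bounded for any \<open>o'\<close>.\<close>
  define off where "off = (\<lambda>k. (- o' (r k)) mod s)"
  have "inj r"
  proof (rule injI)
    have less: "r k < r l" if "k < l" for k l
    proof -
      have "real_of_int (k + 1) / p \<le> real_of_int l / p" using that p0 by (intro divide_right_mono) auto
      moreover have "1 \<le> 1 / p" using p p0 by simp
      ultimately have "real_of_int k / p + 1 \<le> real_of_int l / p" by (simp add: add_divide_distrib)
      then show ?thesis unfolding r_def by linarith
    qed
    fix k l assume "r k = r l"
    then show "k = l" using less[of k l] less[of l k] by (cases k l rule: linorder_cases) auto
  qed
  moreover have "\<bar>real_of_int (r k) - k * (1 / p)\<bar> \<le> 1" for k unfolding r_def by (simp, linarith)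
  moreover have "\<bar>off k\<bar> \<le> 2" for k
    using s pos_mod_bound[OF s(1), of "- o' (r k)"] pos_mod_sign[OF s(1), of "- o' (r k)"] unfolding off_def by linarith
  ultimately have "dens {(s * i + off k, r k) | i k. True} (1 / (s * (1 / p)))"
    using s(1) p0 by (intro dens_rows) auto
  moreover have "{(s * i + off k, r k) | i k. True} = {(i, h). s dvd i + o' h \<and> h \<in> frequent p}"
  proof (intro set_eqI iffI)
    fix z assume "z \<in> {(s * i + off k, r k) | i k. True}"
    then obtain i k where z: "z = (s * i + off k, r k)" by blast
    have "s dvd off k + o' (r k)" unfolding off_def by (simp add: dvd_eq_mod_eq_0 mod_add_left_eq)
    then have "s dvd s * i + off k + o' (r k)" by (simp add: add.assoc)
    then show "z \<in> {(i, h). s dvd i + o' h \<and> h \<in> frequent p}"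
      by (simp add: z frequent_eq_range[OF p0] r_def)
  next
    fix z assume "z \<in> {(i, h). s dvd i + o' h \<and> h \<in> frequent p}"
    then obtain i h where z: "z = (i, h)" "s dvd i + o' h" "h \<in> frequent p" by blast
    then obtain k where k: "h = r k" by (auto simp: frequent_eq_range[OF p0] r_def)
    obtain j where "i + o' h = s * j" using z(2) by blast
    moreover have "off k = - o' h - s * ((- o' h) div s)" unfolding off_def k by (simp add: minus_mult_div_eq_mod)
    ultimately have "i = s * (j + (- o' h) div s) + off k" by (simp add: algebra_simps)
    then show "z \<in> {(s * i + off k, r k) | i k. True}" using z(1) k by blast
  qed
  ultimately show ?thesis by simp
qed

lemma dens_UNIV: "dens UNIV 1"
proof -
  have "{(i, h). (1::int) dvd i + 0 \<and> h \<in> frequent 1} = UNIV" by (auto simp: frequent_1)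
  then show ?thesis using dens_frequent[of 1 1 "\<lambda>_. 0"] by simp
qed

lemma hexagon_equality:
  assumes l: "24/5 \<le> l" "l \<le> 6"
  shows "equality_attained ((\<lambda>x. c + lin2 a b x) ` hexagon) l (3/4 * (2 / (- (1/3) * l + 4)))"
proof -
  \<comment> \<open>Solves 6 (1 - p) / (1 - p/2) = l; it runs from 0 at l = 6 to 1/3 at l =
    24/5.\<close>
  define p where "p = 2 * (6 - l) / (12 - l)"
  have p: "0 \<le> p" "p \<le> 1/2" "p < 1" using l by (auto simp: p_def field_simps)
  interpret sparse_rows "frequent p" by (rule frequent_sparse[OF p(1,2)])
  interpret K: symmetric_domain hexagon by (rule hexagon_domain)
  have rem: "dens removed (p / 2)"
    using dens_frequent[of 2 p "\<lambda>_. 0"] p by (simp add: removed_def)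
  have Y: "dens kept (1 - p / 2)"
    using dens_Diff[OF dens_UNIV rem] by (simp add: Compl_eq_Diff_UNIV)
  \<comment> \<open>A pair is lost when one of its ends is removed. Both ends never are, so the two
    losses of p/2 add up.\<close>
  have pairs: "dens {z \<in> kept. z + n \<in> kept} (1 - p)" if n: "n \<in> hex_moves" for n
  proof -
    have "removed \<inter> {z. z + n \<in> removed} = {}"
    proof (rule ccontr)
      assume "removed \<inter> {z. z + n \<in> removed} \<noteq> {}"
      then obtain i j where ij: "(i, j) \<in> removed" "(i, j) + n \<in> removed" by auto
      obtain k l where n': "n = (k, l)" by (cases n)
      have "\<bar>k\<bar> \<le> 1" "\<bar>l\<bar> \<le> 1" "n \<noteq> 0" using hex_moves_king[OF n] by (auto simp: n' king_def zero_prod_def)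
      then show False using removed_independent[of i j "i + k" "j + l"] ij by (simp add: n' zero_prod_def)
    qed
    from dens_Diff[OF dens_UNIV dens_Un[OF rem dens_shift[OF rem] this]]
    have "dens (UNIV - (removed \<union> {z. z + n \<in> removed})) (1 - p)" by simp
    moreover have "UNIV - (removed \<union> {z. z + n \<in> removed}) = {z \<in> kept. z + n \<in> kept}" by blast
    ultimately show ?thesis by simp
  qed
  have "equality_attained ((\<lambda>x. c + lin2 a b x) ` hexagon) ((\<Sum>n\<in>hex_moves. 1 - p) / (1 - p / 2)) ((1 - p / 2) * measure lebesgue hexagon)"
  proof (rule equality_from_densities[OF hex_packing(2) _ hex_packing(1) _ Y _ pairs])
    show "hexagon \<in> lmeasurable" by (rule lmeasurable_compact[OF K.compact])
    show "finite hex_moves" by (simp add: hex_moves_def)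
    show "0 < 1 - p / 2" using p by simp
  qed
  moreover have "(\<Sum>n\<in>hex_moves. 1 - p) = 6 * (1 - p)" by (simp add: hex_moves_def)
  moreover have "6 * (1 - p) / (1 - p / 2) = l"
  proof -
    have "1 - p = l / (12 - l)" "1 - p / 2 = 6 / (12 - l)" using l by (simp_all add: p_def field_simps)
    then show ?thesis using l by simp
  qed
  moreover have "(1 - p / 2) * measure lebesgue hexagon = 3/4 * (2 / (- (1/3) * l + 4))"
  proof -
    have "1 - p / 2 = 6 / (12 - l)" using l by (simp add: p_def field_simps)
    then show ?thesis using l by (simp add: area_hexagon field_simps)
  qed
  ultimately show ?thesis by simp
qed

end

lemma king_eq: "{v. king v} = {(1, 0), (-1, 0), (0, 1), (0, -1), (1, 1), (1, -1), (-1, 1), (-1, -1)}"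
proof (intro set_eqI iffI)
  fix v assume "v \<in> {v. king v}"
  moreover obtain i j where v: "v = (i, j)" by (cases v)
  ultimately have k: "\<bar>i\<bar> \<le> 1" "\<bar>j\<bar> \<le> 1" "(i, j) \<noteq> (0, 0)" by (auto simp: king_def)
  then have "i = -1 \<or> i = 0 \<or> i = 1" "j = -1 \<or> j = 0 \<or> j = 1" by linarith+
  then show "v \<in> {(1, 0), (-1, 0), (0, 1), (0, -1), (1, 1), (1, -1), (-1, 1), (-1, -1)}"
    using k(3) unfolding v by (elim disjE) simp_all
qed (auto simp: king_def)

context lattice_map
begin

lemma square_equality_dense:
  assumes l: "4 \<le> l" "l \<le> 24/5"
  shows "equality_attained ((\<lambda>x. c + lin2 a b x) ` square) l (2 / (8 - l))"
proof -
  \<comment> \<open>Solves (2 + 4 p) / ((1 + p) / 2) = l; it runs from 0 at l = 4 to 1/4 at l =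
    24/5.\<close>
  define p where "p = (l - 4) / (8 - l)"
  have p: "0 \<le> p" "p \<le> 1/2" using l by (auto simp: p_def field_simps)
  interpret J: sparse_rows "frequent p" by (rule frequent_sparse[OF p])
  interpret zigzag_rows "{}" "frequent p" "\<lambda>h. h"
    by unfold_locales (use J.sparse in auto)
  interpret K: symmetric_domain square by (rule square_domain)
  \<comment> \<open>\<open>S\<close> is the checkerboard, \<open>B\<close> consists of the points
    added in the filled rows.\<close>
  define S where "S = {(i, h). (2::int) dvd i + h \<and> h \<in> frequent 1}"
  define B where "B = {(i, h). (2::int) dvd i + (h + 1) \<and> h \<in> frequent p}"
  have S: "dens S (1 / 2)" unfolding S_def using dens_frequent[of 2 1 "\<lambda>h. h"] by simp
  have B: "dens B (p / 2)" unfolding B_def using dens_frequent[of 2 p "\<lambda>h. h + 1"] p by simp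
  have inO: "(i, h) \<in> S \<longleftrightarrow> even (i + h)" for i h by (simp add: S_def frequent_1)
  have inB: "(i, h) \<in> B \<longleftrightarrow> odd (i + h) \<and> h \<in> frequent p" for i h by (auto simp: B_def)
  have inY: "(i, h) \<in> points \<longleftrightarrow> even (i + h) \<or> h \<in> frequent p" for i h by (simp add: points_def on_row_def)
  have "S \<union> B = points" "S \<inter> B = {}" by (auto simp: inO inB inY)
  then have Y: "dens points ((1 + p) / 2)" using dens_Un[OF S B] by (simp add: add_divide_distrib)
  \<comment> \<open>Diagonal pairs are those of the checkerboard, since consecutive rows are never
    both filled. A horizontal or vertical pair has exactly one end in \<open>B\<close>, and
    \<open>B\<close> together with its shift has density \<open>p\<close>.\<close>
  define e where "e n = (if even (fst n + snd n) then 1/2 else p)" for n :: "int \<times> int"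
  have pairs: "dens {z \<in> points. z + n \<in> points} (e n)" if n: "n \<in> king_moves" for n
  proof -
    obtain k m where n': "n = (k, m)" by (cases n)
    have km: "\<bar>k\<bar> \<le> 1" "\<bar>m\<bar> \<le> 1" "(k, m) \<noteq> (0, 0)" using n by (auto simp: king_moves_iff n' king_def)
    show ?thesis
    proof (cases "even (k + m)")
      case True
      have "m \<noteq> 0"
      proof
        assume "m = 0"
        then have "k = 1 \<or> k = -1" using km by auto
        then show False using True \<open>m = 0\<close> by auto
      qed
      then have m: "m = 1 \<or> m = -1" using km(2) by linarith
      have nf: "h + m \<notin> frequent p" if "h \<in> frequent p" for h
        using m J.sparse[of h] J.sparse[of "h - 1"] that by auto
      have "{z \<in> points. z + n \<in> points} = S"
      proof (intro set_eqI iffI)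
        fix z assume z: "z \<in> {z \<in> points. z + n \<in> points}"
        obtain i h where ih: "z = (i, h)" by (cases z)
        have "even (i + h) \<longleftrightarrow> even (i + k + (h + m))" using True by presburger
        then show "z \<in> S" using z nf[of h] by (auto simp: ih n' inO inY)
      next
        fix z assume z: "z \<in> S"
        obtain i h where ih: "z = (i, h)" by (cases z)
        have "even (i + h) \<longleftrightarrow> even (i + k + (h + m))" using True by presburger
        then show "z \<in> {z \<in> points. z + n \<in> points}" using z by (simp add: ih n' inO inY)
      qed
      then show ?thesis using S True by (simp add: e_def n')
    next
      case False
      have par: "even (i + k + (h + m)) \<longleftrightarrow> odd (i + h)" for i h using False by presburger
      have one: "(z \<in> points \<and> z + n \<in> points \<longleftrightarrow> z \<in> B \<or> z + n \<in> B) \<and> \<not> (z \<in> B \<and> z + n \<in> B)" for z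
      proof -
        obtain i h where z: "z = (i, h)" by (cases z)
        have zn: "z + n = (i + k, h + m)" by (simp add: z n')
        show ?thesis unfolding zn unfolding z inY inB par by blast
      qed
      then have sets: "{z \<in> points. z + n \<in> points} = B \<union> {z. z + n \<in> B}" "B \<inter> {z. z + n \<in> B} = {}" by blast+
      have "dens (B \<union> {z. z + n \<in> B}) (p / 2 + p / 2)"
        by (rule dens_Un[OF B dens_shift[OF B] sets(2)])
      then show ?thesis using sets(1) False by (simp add: e_def n')
    qed
  qed
  have "equality_attained ((\<lambda>x. c + lin2 a b x) ` square) ((\<Sum>n\<in>king_moves. e n) / ((1 + p) / 2)) ((1 + p) / 2 * measure lebesgue square)"
  proof (rule equality_from_densities[OF sq_packing(2) _ sq_packing(1) _ Y _ pairs])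
    show "square \<in> lmeasurable" by (rule lmeasurable_compact[OF K.compact])
    show "finite king_moves" unfolding king_moves_def king_eq by simp
    show "0 < (1 + p) / 2" using p by simp
  qed
  moreover have "(\<Sum>n\<in>king_moves. e n) = 2 + 4 * p" unfolding king_moves_def king_eq by (simp add: e_def)
  moreover have p1: "1 + p = 4 / (8 - l)" and p2: "2 + 4 * p = 2 * l / (8 - l)" using l by (simp_all add: p_def field_simps)
  moreover have "(2 + 4 * p) / ((1 + p) / 2) = l" unfolding p1 p2 using l by (simp add: field_simps)
  moreover have "(1 + p) / 2 * measure lebesgue square = 2 / (8 - l)" unfolding p1 area_square using l by (simp add: field_simps)
  ultimately show ?thesis by metis
qed

lemma square_equality_sparse:
  assumes l: "3 \<le> l" "l \<le> 4"
  shows "equality_attained ((\<lambda>x. c + lin2 a b x) ` square) l (1/2)"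
proof -
  \<comment> \<open>Solves 4 - 2 p = l.\<close>
  define p where "p = (4 - l) / 2"
  have p: "0 \<le> p" "p \<le> 1/2" "p \<le> 1" using l by (auto simp: p_def)
  interpret J: sparse_rows "frequent p" by (rule frequent_sparse[OF p(1,2)])
  \<comment> \<open>The term \<open>h\<close> alone would alternate the parity of rows as in a
    checkerboard; the ceiling cancels this change after each row of \<open>frequent p\<close>, which
    aligns it with the next row.\<close>
  define off where "off h = h - \<lceil>real_of_int h * p\<rceil>" for h :: int
  have step: "off (h + 1) = off h + 1 - (if h \<in> frequent p then 1 else 0)" for h
    unfolding off_def using frequent_step[OF p(1,3), of h] by simp
  interpret zigzag_rows "frequent p" "{}" off
    by unfold_locales (use J.sparse step in auto)
  interpret K: symmetric_domain square by (rule square_domain)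
  have inY: "(i, h) \<in> points \<longleftrightarrow> even (i + off h)" for i h by (simp add: points_def on_row_def)
  have Y: "dens points (1 / 2)"
    using dens_frequent[of 2 1 off] by (simp add: points_def on_row_def frequent_1)
  define V :: "(int \<times> int) set" where "V = {(i, h). 2 dvd i + off h \<and> h \<in> frequent p}"
  have V: "dens V (p / 2)" unfolding V_def using dens_frequent[of 2 p off] p by simp
  have inV: "(i, h) \<in> V \<longleftrightarrow> even (i + off h) \<and> h \<in> frequent p" for i h by (simp add: V_def)
  define P where "P n = {z \<in> points. z + n \<in> points}" for n
  have P: "(i, h) \<in> P (k, m) \<longleftrightarrow> even (i + off h) \<and> even (i + k + off (h + m))" for i h k m by (simp add: P_def inY)
  have opposite: "dens (P n) d" if d: "dens (P (- n)) d" for n d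
  proof -
    have "P n = {z. z + n \<in> P (- n)}" by (auto simp: P_def)
    then show ?thesis using dens_shift[OF d] by simp
  qed
  have horizontal: "dens (P (k, 0)) 0" if "k = 1 \<or> k = -1" for k
  proof -
    have "P (k, 0) = {}" using that by (auto simp: P)
    then show ?thesis by (simp add: dens_empty)
  qed
  have vertical: "dens (P (0, 1)) (p / 2)"
  proof -
    have "P (0, 1) = V"
    proof (intro set_eqI)
      fix z :: "int \<times> int"
      obtain i h where z: "z = (i, h)" by (cases z)
      show "z \<in> P (0, 1) \<longleftrightarrow> z \<in> V" unfolding z P inV step by auto
    qed
    then show ?thesis using V by simp
  qed
  have diagonal: "dens (P (k, 1)) (1 / 2 - p / 2)" if k: "k = 1 \<or> k = -1" for k
  proof -
    have "P (k, 1) = points - V"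
    proof (intro set_eqI)
      fix z :: "int \<times> int"
      obtain i h where z: "z = (i, h)" by (cases z)
      show "z \<in> P (k, 1) \<longleftrightarrow> z \<in> points - V" unfolding z P Diff_iff inV inY step using k by auto
    qed
    moreover have "V \<subseteq> points" by (auto simp: inV inY)
    ultimately show ?thesis using dens_Diff[OF Y V] by simp
  qed
  define e where "e n = (if snd n = 0 then 0 else if fst n = 0 then p / 2 else 1 / 2 - p / 2)" for n :: "int \<times> int"
  have pairs: "dens {z \<in> points. z + n \<in> points} (e n)" if n: "n \<in> king_moves" for n
  proof -
    have "n \<in> {(1, 0), (-1, 0), (0, 1), (0, -1), (1, 1), (1, -1), (-1, 1), (-1, -1)}"
      using n unfolding king_moves_def king_eq .
    then have "dens (P n) (e n)"
      using horizontal[of 1] horizontal[of "-1"] vertical diagonal[of 1] diagonal[of "-1"]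
        opposite[of "(0, -1)"] opposite[of "(1, -1)"] opposite[of "(-1, -1)"]
      unfolding insert_iff empty_iff by (elim disjE) (simp_all add: e_def)
    then show ?thesis by (simp add: P_def)
  qed
  have "equality_attained ((\<lambda>x. c + lin2 a b x) ` square) ((\<Sum>n\<in>king_moves. e n) / (1 / 2)) (1 / 2 * measure lebesgue square)"
  proof (rule equality_from_densities[OF sq_packing(2) _ sq_packing(1) _ Y _ pairs])
    show "square \<in> lmeasurable" by (rule lmeasurable_compact[OF K.compact])
    show "finite king_moves" unfolding king_moves_def king_eq by simp
  qed simp
  moreover have "(\<Sum>n\<in>king_moves. e n) = 2 - p" unfolding king_moves_def king_eq by (simp add: e_def)
  moreover have "(2 - p) / (1 / 2) = l" by (simp add: p_def field_simps)
  ultimately show ?thesis by (simp add: area_square)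
qed

end

theorem corollary1:
  shows "(\<forall>(D :: (real^2) set) X (l :: real).
            convex_domain D \<and> centrosymmetric D \<and> admissible_packing D X \<longrightarrow>
              (24/5 \<le> l \<and> l \<le> 6 \<longrightarrow>
                 asymptotic_lower_bound D X l (3/4 * (2 / (- (1/3) * l + 4)))) \<and>
              (4 \<le> l \<and> l \<le> 24/5 \<longrightarrow>
                 asymptotic_lower_bound D X l (2 / (8 - l))) \<and>
              (3 \<le> l \<and> l \<le> 4 \<longrightarrow>
                 asymptotic_lower_bound D X l (1/2))) \<and>
         (\<forall>(D :: (real^2) set) (l :: real).
            regular_polygon 6 D \<and> 24/5 \<le> l \<and> l \<le> 6 \<longrightarrow>
              equality_attained D l (3/4 * (2 / (- (1/3) * l + 4)))) \<and>
         (\<forall>(D :: (real^2) set) (l :: real).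
            regular_polygon 4 D \<longrightarrow>
              (4 \<le> l \<and> l \<le> 24/5 \<longrightarrow> equality_attained D l (2 / (8 - l))) \<and>
              (3 \<le> l \<and> l \<le> 4 \<longrightarrow> equality_attained D l (1/2)))"
proof (intro conjI allI impI)
  fix D :: "(real^2) set" and l :: real assume D: "regular_polygon 6 D \<and> 24/5 \<le> l \<and> l \<le> 6"
  obtain a b c where D_eq: "cross2 a b \<noteq> 0" "D = (\<lambda>x. c + lin2 a b x) ` hexagon" using regular_hexagon D by blast
  interpret lattice_map a b by unfold_locales (rule D_eq(1))
  show "equality_attained D l (3/4 * (2 / (- (1/3) * l + 4)))" unfolding D_eq(2) by (rule hexagon_equality) (use D in auto)
next
  fix D :: "(real^2) set" and l :: real assume D: "regular_polygon 4 D" and l: "4 \<le> l \<and> l \<le> 24/5"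
  obtain a b c where D_eq: "cross2 a b \<noteq> 0" "D = (\<lambda>x. c + lin2 a b x) ` square" using regular_square D by blast
  interpret lattice_map a b by unfold_locales (rule D_eq(1))
  show "equality_attained D l (2 / (8 - l))" unfolding D_eq(2) by (rule square_equality_dense) (use l in auto)
next
  fix D :: "(real^2) set" and l :: real assume D: "regular_polygon 4 D" and l: "3 \<le> l \<and> l \<le> 4"
  obtain a b c where D_eq: "cross2 a b \<noteq> 0" "D = (\<lambda>x. c + lin2 a b x) ` square" using regular_square D by blast
  interpret lattice_map a b by unfold_locales (rule D_eq(1))
  show "equality_attained D l (1/2)" unfolding D_eq(2) by (rule square_equality_sparse) (use l in auto)
qed (use packing_lower_bounds in auto)

end
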